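(* Let $q>2$ and consider one of the known finite circle geometries of order $q$, that is, an ovoidal circle geometry of order $q$ or a Minkowski plane $\mathrm{CM}(2,q,\varphi)$. In case it is a Möbius plane, assume moreover that $q>3$. Then every intersecting family of largest possible size consists of all circles through a fixed point, or, in case of a Laguerre plane of even order, of all circles through a fixed point or of all circles through a fixed nucleus.
   Context: A circle geometry is an incidence structure $(\mathcal P,\mathcal B)$ (points and blocks, each block being a subset of $\mathcal P$; blocks are called circles) together with $\rho\in\{0,1,2\}$ parallel relations (partitions of $\mathcal P$ into parallel classes; two points are parallel if they lie in the same parallel class of some parallel relation) such that: (1) three distinct pairwise non-parallel points lie on a unique circle; (2) given a circle $c$, a point $P\in c$ and a point $Q\notin c$ not parallel with $P$, there is a unique circle through $P$ and $Q$ meeting $c$ only in $P$; (3) every circle contains a unique point of each parallel class; (4) two parallel classes from different parallel relations meet in a unique point; (5) each circle has at least three points, and there exist a circle and a point not on it. It is a Möbius, Laguerre or Minkowski plane if $\rho=0,1,2$ respectively. A finite one has order $q$ if every circle has $q+1$ points. Ovoidal circle geometries of order $q$. An oval is a set of $q+1$ points in $\mathrm{PG}(2,q)$, no three on a line. Let $\mathcal Q$ be one of the following sets in $\mathrm{PG}(3,q)$: an ovoid (a set of $q^2+1$ points, no three on a line; $q>2$); an oval cone (take an oval $\mathcal O$ in a plane and a point $R$, the vertex, not in this plane; the union of all lines through $R$ meeting $\mathcal O$); a hyperbolic quadric $\mathcal Q^+(3,q)$. A plane $\pi$ is an oval plane if $\pi\cap\mathcal Q$ is an oval in $\pi$. The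 points of the geometry are the points of $\mathcal Q$ (excluding the vertex for an oval cone), and the circles are the sets $\pi\cap\mathcal Q$ with $\pi$ an oval plane. These geometries are a Möbius, Laguerre, Minkowski plane respectively, and are called ovoidal. Nuclei. If $q$ is even, an oval in a plane has a nucleus: the point $N$ of the plane such that the tangent lines (lines meeting the oval in exactly one point) in that plane are exactly the lines through $N$. For an ovoidal Laguerre plane of even order, the nucleus of a circle $\pi\cap\mathcal Q$ is the nucleus of this oval in $\pi$; a circle goes through a nucleus $N$ if its nucleus is $N$. The planes $\mathrm{CM}(2,q,\varphi)$. Let $q$ be a prime power and $\varphi$ a field automorphism of $\mathbb F_q$. For $M\in\mathrm{PGL}(2,q)$ define $f_M$ on $\mathrm{PG}(1,q)$ by $f_M(x)=Mx$ if $M\in\mathrm{PSL}(2,q)$ and $f_M(x)=Mx^\varphi$ otherwise ($\varphi$ applied coordinatewise). The points of $\mathrm{CM}(2,q,\varphi)$ are $\mathrm{PG}(1,q)\times\mathrm{PG}(1,q)$ and the circles are the graphs $\{(x,f_M(x)) : x\in\mathrm{PG}(1,q)\}$, $M\in\mathrm{PGL}(2,q)$. An intersecting family is a set of circles any two of which have non-empty intersection. *)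

theory Defs
  imports "HOL-Analysis.Determinants"
begin

text \<open>
  \<open>PG(n-1,q)\<close> is modelled by the lattice of subspaces of \<open>'a ^ 'n\<close>, where \<open>'a\<close> is a finite field,
  \<open>q = CARD('a)\<close> and \<open>n = CARD('n)\<close>; projective dimension is linear dimension minus one, and
  incidence is inclusion.
\<close>

definition pg_points :: "('a::{field,finite} ^ 'n) set set" where
  "pg_points = {P. vec.subspace P \<and> vec.dim P = 1}"

definition pg_lines :: "('a::{field,finite} ^ 'n) set set" where
  "pg_lines = {L. vec.subspace L \<and> vec.dim L = 2}"

definition pg_planes :: "('a::{field,finite} ^ 'n) set set" where
  "pg_planes = {E. vec.subspace E \<and> vec.dim E = 3}"

definition no_three_on_a_line :: "('a::{field,finite} ^ 'n) set set \<Rightarrow> bool" where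
  "no_three_on_a_line S \<longleftrightarrow>
     (\<forall>X\<in>S. \<forall>Y\<in>S. \<forall>Z\<in>S. X \<noteq> Y \<and> X \<noteq> Z \<and> Y \<noteq> Z \<longrightarrow>
        \<not> (\<exists>L\<in>pg_lines. X \<subseteq> L \<and> Y \<subseteq> L \<and> Z \<subseteq> L))"

definition oval_in :: "('a::{field,finite} ^ 'n) set \<Rightarrow> ('a ^ 'n) set set \<Rightarrow> bool" where
  "oval_in E S \<longleftrightarrow>
     E \<in> pg_planes \<and> S \<subseteq> pg_points \<and> (\<forall>P\<in>S. P \<subseteq> E) \<and>
     card S = CARD('a) + 1 \<and> no_three_on_a_line S"

text \<open>The usual additional requirement \<open>q > 2\<close> is left to the theorems about ovoids.\<close>

definition ovoid :: "('a::{field,finite} ^ 4) set set \<Rightarrow> bool" where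
  "ovoid Q \<longleftrightarrow>
     Q \<subseteq> pg_points \<and> card Q = CARD('a) ^ 2 + 1 \<and> no_three_on_a_line Q"

definition oval_cone_with_vertex :: "('a::{field,finite} ^ 4) set \<Rightarrow> ('a ^ 4) set set \<Rightarrow> bool" where
  "oval_cone_with_vertex R Q \<longleftrightarrow>
     R \<in> pg_points \<and>
     (\<exists>E S. oval_in E S \<and> \<not> R \<subseteq> E \<and>
        Q = {P \<in> pg_points. \<exists>L\<in>pg_lines. R \<subseteq> L \<and> (\<exists>X\<in>S. X \<subseteq> L) \<and> P \<subseteq> L})"

text \<open>
  A quadric is hyperbolic if its equation is \<open>x\<^sub>1 x\<^sub>2 + x\<^sub>3 x\<^sub>4 = 0\<close> in suitable homogeneous
  coordinates; the invertible matrix \<open>A\<close> is the change of coordinates.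
\<close>

definition hyperbolic_quadric :: "('a::{field,finite} ^ 4) set set \<Rightarrow> bool" where
  "hyperbolic_quadric Q \<longleftrightarrow>
     (\<exists>A :: 'a ^ 4 ^ 4. invertible A \<and>
        Q = {P \<in> pg_points. \<forall>v\<in>P.
               (A *v v) $ 1 * (A *v v) $ 2 + (A *v v) $ 3 * (A *v v) $ 4 = 0})"


text \<open>An incidence structure is a pair of a point set and a set of blocks (circles).\<close>

type_synonym 'p incidence_structure = "'p set \<times> 'p set set"

definition section_by :: "('a::{field,finite} ^ 4) set set \<Rightarrow> ('a ^ 4) set \<Rightarrow> ('a ^ 4) set set" where
  "section_by Q E = {P \<in> Q. P \<subseteq> E}"

definition oval_plane :: "('a::{field,finite} ^ 4) set set \<Rightarrow> ('a ^ 4) set \<Rightarrow> bool" where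
  "oval_plane Q E \<longleftrightarrow> oval_in E (section_by Q E)"

definition oval_sections :: "('a::{field,finite} ^ 4) set set \<Rightarrow> ('a ^ 4) set set set" where
  "oval_sections Q = {section_by Q E | E. oval_plane Q E}"

definition ovoidal_moebius_plane :: "('a::{field,finite} ^ 4) set incidence_structure \<Rightarrow> bool" where
  "ovoidal_moebius_plane G \<longleftrightarrow> (\<exists>Q. ovoid Q \<and> G = (Q, oval_sections Q))"

definition ovoidal_laguerre_plane :: "('a::{field,finite} ^ 4) set incidence_structure \<Rightarrow> bool" where
  "ovoidal_laguerre_plane G \<longleftrightarrow>
     (\<exists>R Q. oval_cone_with_vertex R Q \<and> G = (Q - {R}, oval_sections Q))"

definition ovoidal_minkowski_plane :: "('a::{field,finite} ^ 4) set incidence_structure \<Rightarrow> bool" where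
  "ovoidal_minkowski_plane G \<longleftrightarrow> (\<exists>Q. hyperbolic_quadric Q \<and> G = (Q, oval_sections Q))"


definition nucleus_in :: "('a::{field,finite} ^ 'n) set \<Rightarrow> ('a ^ 'n) set set \<Rightarrow> ('a ^ 'n) set \<Rightarrow> bool" where
  "nucleus_in E S N \<longleftrightarrow>
     N \<in> pg_points \<and> N \<subseteq> E \<and>
     (\<forall>L\<in>pg_lines. L \<subseteq> E \<longrightarrow> (card {P \<in> S. P \<subseteq> L} = 1 \<longleftrightarrow> N \<subseteq> L))"

text \<open>
  In an ovoidal geometry a circle \<open>C\<close> is an oval of a plane \<open>E\<close>, which is the only plane
  containing \<open>C\<close>.
\<close>

definition circle_nucleus :: "('a::{field,finite} ^ 4) set set \<Rightarrow> ('a ^ 4) set \<Rightarrow> bool" where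
  "circle_nucleus C N \<longleftrightarrow> (\<exists>E. oval_in E C \<and> nucleus_in E C N)"

definition nuclei :: "('a::{field,finite} ^ 4) set incidence_structure \<Rightarrow> ('a ^ 4) set set" where
  "nuclei G = {N. \<exists>C\<in>snd G. circle_nucleus C N}"

definition circles_through_nucleus ::
    "('a::{field,finite} ^ 4) set incidence_structure \<Rightarrow> ('a ^ 4) set \<Rightarrow> ('a ^ 4) set set set" where
  "circles_through_nucleus G N = {C \<in> snd G. circle_nucleus C N}"


definition field_automorphism :: "('a::field \<Rightarrow> 'a) \<Rightarrow> bool" where
  "field_automorphism \<phi> \<longleftrightarrow>
     bij \<phi> \<and> (\<forall>x y. \<phi> (x + y) = \<phi> x + \<phi> y) \<and> (\<forall>x y. \<phi> (x * y) = \<phi> x * \<phi> y)"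

text \<open>
  An element of \<open>PGL(2,q)\<close> is given by an invertible matrix \<open>M\<close>, any nonzero multiple of \<open>M\<close>
  representing the same element; it lies in \<open>PSL(2,q)\<close> iff some multiple of \<open>M\<close> has
  determinant 1.
\<close>

definition in_PSL2 :: "'a::{field,finite} ^ 2 ^ 2 \<Rightarrow> bool" where
  "in_PSL2 M \<longleftrightarrow> (\<exists>c N. c \<noteq> 0 \<and> det N = 1 \<and> M = mat c ** N)"

definition CM_map ::
    "('a \<Rightarrow> 'a) \<Rightarrow> 'a ^ 2 ^ 2 \<Rightarrow> ('a ^ 2) set \<Rightarrow> ('a::{field,finite} ^ 2) set" where
  "CM_map \<phi> M x =
     (if in_PSL2 M then (\<lambda>v. M *v v) ` x else (\<lambda>v. M *v (\<chi> i. \<phi> (v $ i))) ` x)"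

definition CM_plane ::
    "('a::{field,finite} \<Rightarrow> 'a) \<Rightarrow> (('a ^ 2) set \<times> ('a ^ 2) set) incidence_structure" where
  "CM_plane \<phi> =
     (pg_points \<times> pg_points,
      {{(x, CM_map \<phi> M x) | x. x \<in> pg_points} | M. invertible M})"


definition intersecting_family :: "'p incidence_structure \<Rightarrow> 'p set set \<Rightarrow> bool" where
  "intersecting_family G F \<longleftrightarrow> F \<subseteq> snd G \<and> (\<forall>C\<in>F. \<forall>D\<in>F. C \<inter> D \<noteq> {})"

definition largest_intersecting_family :: "'p incidence_structure \<Rightarrow> 'p set set \<Rightarrow> bool" where
  "largest_intersecting_family G F \<longleftrightarrow>
     intersecting_family G F \<and> (\<forall>F'. intersecting_family G F' \<longrightarrow> card F' \<le> card F)"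

definition circles_through :: "'p incidence_structure \<Rightarrow> 'p \<Rightarrow> 'p set set" where
  "circles_through G P = {C \<in> snd G. P \<in> C}"

end

theory Submission
  imports Defs "HOL-Analysis.Convex"
begin

text \<open>
  Moebius and Minkowski planes. Let \<open>A\<close> be the adjacency operator of the tangency graph on the circles. The
  circles have poles with respect to a symmetric bilinear form: the polar form of the determinant on
  \<open>2 \<times> 2\<close> matrices for the Minkowski planes, and for an ovoid the form provided by Segre's lemma of tangents.
  Counting common tangent circles by means of this form shows that \<open>A\<^sup>2 + 2 A - (q\<^sup>2 - 1)\<close> vanishes on the functions
  whose sums over all pencils of circles vanish, also after multiplication by the quadratic character of the
  norms of the poles. Projecting the indicator function of an intersecting family \<open>F\<close> to this space yields
  \<open>card F \<le> q (q + 1 - \<rho>)\<close>, and in case of equality the projection is zero. Then the indicator is an affine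
  function of the sum over \<open>C\<close> of the degrees \<open>card {D \<in> F. P \<in> D}\<close>, and since it is idempotent, one of the
  degrees equals \<open>card F\<close>. The nonordinary planes \<open>CM(2, q, \<phi>)\<close> arise by exchanging one of the two classes of circles
  of the ordinary plane.

  Laguerre planes. If \<open>r\<close> spans the vertex of the cone, then the circles correspond to the functionals \<open>u\<close> with \<open>u r = 1\<close>.
  A line external to the oval yields a functional \<open>f\<close> for which the circles \<open>u + t f\<close> are pairwise disjoint, so a largest
  intersecting family \<open>F\<close> contains exactly one of them. Inverting a Radon transform, the indicator function of \<open>F\<close>
  becomes a sum of functions of \<open>u p\<close>, where \<open>p\<close> runs through the oval and its nucleus. These points are in general
  position, so the second moment of the indicator on the fibres \<open>u p = c\<close> can be computed, and it shows that some
  fibre is equal to \<open>F\<close>.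
\<close>

section \<open>Circle geometries\<close>

text \<open>In odd characteristic two circles have common tangents only if
  \<open>eps C * eps D = 1\<close>, so the square of the adjacency operator involves the incidence
  map together with its twist by \<open>eps\<close>. Both have to be projected away, and this is
  possible independently, because the pencils and the pencils multiplied by \<open>eps\<close> are
  orthogonal: all numbers \<open>sgn_inc P Q\<close> vanish. On the remaining functions the
  eigenvalues are \<open>q - 1\<close> and \<open>- q - 1\<close>. The twisted part of the
  projection enters the bound with the wrong sign; it is compensated by counting the intersections a
  second time with the weights \<open>eps\<close>. In a Moebius plane of odd order the estimate
  needs \<open>q >= 5\<close>, which is what \<open>q > 3\<close> provides.

  For even \<open>q\<close> neither an ovoid nor the oval of a cone has to be given by a quadratic
  equation. The form of an ovoid is therefore built from its tangent planes, for which all plane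
  sections must first be known to have \<open>1\<close> or \<open>q + 1\<close> points or to be
  empty, and the argument for Laguerre planes uses nothing but general position.\<close>

lemma three_elementsE:
  assumes "3 \<le> card C"
  obtains P Q R where "P \<in> C" "Q \<in> C" "R \<in> C" "P \<noteq> Q" "P \<noteq> R" "Q \<noteq> R"
proof -
  obtain S where "S \<subseteq> C" "card S = 3" using assms by (meson obtain_subset_with_card_n)
  thus ?thesis using that by (auto simp: card_3_iff)
qed

text \<open>Counting conditions replace the touching axiom, which is recovered in
  \<open>unique_tangent\<close>. The relation \<open>par\<close> is empty for an ovoid but reflexive
  for a product, so \<open>R \<noteq> P\<close> is always written out. The value
  \<open>\<rho> = 1\<close> is excluded, Laguerre planes being treated by linear functionals. The
  product form of \<open>card_pts\<close> covers \<open>q\<^sup>2 + 1\<close> and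
  \<open>(q + 1)\<^sup>2\<close> points at once.\<close>

locale circle_geometry =
  fixes pts :: "'p set" and circs :: "'p set set" and par :: "'p \<Rightarrow> 'p \<Rightarrow> bool" and q \<rho> :: nat
  assumes finite_pts: "finite pts"
    and circ_sub: "C \<in> circs \<Longrightarrow> C \<subseteq> pts"
    and card_circ: "C \<in> circs \<Longrightarrow> card C = q + 1"
    and q_ge_3: "q \<ge> 3" and rho: "\<rho> = 0 \<or> \<rho> = 2"
    and par_sym: "par P R \<Longrightarrow> par R P"
    and circ_not_par: "C \<in> circs \<Longrightarrow> P \<in> C \<Longrightarrow> R \<in> C \<Longrightarrow> P \<noteq> R \<Longrightarrow> \<not> par P R"
    and three: "\<lbrakk>P \<in> pts; Q \<in> pts; R \<in> pts; P \<noteq> Q; P \<noteq> R; Q \<noteq> R; \<not> par P Q; \<not> par P R; \<not> par Q R\<rbrakk>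
      \<Longrightarrow> \<exists>!C. C \<in> circs \<and> P \<in> C \<and> Q \<in> C \<and> R \<in> C"
    and card_par_circ: "P \<in> pts \<Longrightarrow> C \<in> circs \<Longrightarrow> P \<notin> C \<Longrightarrow> card {R\<in>C. par P R} = \<rho>"
    and card_not_par: "P \<in> pts \<Longrightarrow> card {R\<in>pts. R \<noteq> P \<and> \<not> par P R} = q\<^sup>2"
    and card_not_par2: "P \<in> pts \<Longrightarrow> Q \<in> pts \<Longrightarrow> P \<noteq> Q \<Longrightarrow> \<not> par P Q \<Longrightarrow>
      card {R\<in>pts. R \<noteq> P \<and> R \<noteq> Q \<and> \<not> par P R \<and> \<not> par Q R} = (q - 1) * (q + 1 - \<rho>)"
    and card_pts: "card pts * (q + 1 - \<rho>) = (q + 1) * (q\<^sup>2 + 1 - \<rho>)"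
begin

definition tan :: "'p set \<Rightarrow> 'p set \<Rightarrow> bool" where
  "tan C D \<longleftrightarrow> C \<noteq> D \<and> card (C \<inter> D) = 1"

lemma tan_sym: "tan C D \<longleftrightarrow> tan D C"
  by (auto simp: tan_def Int_commute)

lemma finite_circs: "finite circs"
  using finite_pts circ_sub by (metis (no_types, lifting) PowI finite_Pow_iff finite_subset subsetI)

lemma finite_circ: "C \<in> circs \<Longrightarrow> finite C"
  using circ_sub finite_pts finite_subset by blast

lemma circ_eqI:
  assumes "C \<in> circs" "D \<in> circs" "P \<in> C" "P \<in> D" "Q \<in> C" "Q \<in> D" "R \<in> C" "R \<in> D"
    "P \<noteq> Q" "P \<noteq> R" "Q \<noteq> R"
  shows "C = D"
proof -
  have "\<exists>!C. C \<in> circs \<and> P \<in> C \<and> Q \<in> C \<and> R \<in> C"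
    by (intro three) (use assms circ_sub circ_not_par in auto)
  thus ?thesis using assms by blast
qed

lemma card_Int_le: assumes "C \<in> circs" "D \<in> circs" "C \<noteq> D" shows "card (C \<inter> D) \<le> 2"
proof (rule ccontr)
  assume "\<not> card (C \<inter> D) \<le> 2"
  hence "3 \<le> card (C \<inter> D)" by simp
  then obtain x y z where "x \<in> C \<inter> D" "y \<in> C \<inter> D" "z \<in> C \<inter> D" "x \<noteq> y" "x \<noteq> z" "y \<noteq> z"
    by (rule three_elementsE)
  thus False using circ_eqI[of C D x y z] assms by blast
qed

lemma tanI: assumes "C \<in> circs" "D \<in> circs" "C \<inter> D = {P}" shows "tan C D"
proof -
  have "C \<noteq> D" using assms card_circ[of C] q_ge_3 by auto
  thus ?thesis using assms by (auto simp: tan_def)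
qed

lemma tan_iff: "C \<in> circs \<Longrightarrow> D \<in> circs \<Longrightarrow> tan C D \<longleftrightarrow> (\<exists>P. C \<inter> D = {P})"
  using tanI by (metis card_1_singletonE tan_def)

section \<open>Double counts of circles and tangent circles\<close>

lemma card_through2:
  assumes "P \<in> pts" "Q \<in> pts" "P \<noteq> Q" "\<not> par P Q"
  shows "card {C\<in>circs. P \<in> C \<and> Q \<in> C} = q + 1 - \<rho>"
proof -
  let ?A = "{R\<in>pts. R \<noteq> P \<and> R \<noteq> Q \<and> \<not> par P R \<and> \<not> par Q R}"
  let ?B = "{C\<in>circs. P \<in> C \<and> Q \<in> C}"
  have 1: "card {C\<in>?B. R \<in> C} = 1" if "R \<in> ?A" for R
  proof -
    have "\<exists>!C. C \<in> circs \<and> P \<in> C \<and> Q \<in> C \<and> R \<in> C"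
      by (rule three) (use that assms in auto)
    then obtain C where C: "C \<in> circs \<and> P \<in> C \<and> Q \<in> C \<and> R \<in> C"
      and u: "\<And>D. D \<in> circs \<and> P \<in> D \<and> Q \<in> D \<and> R \<in> D \<Longrightarrow> D = C"
      by blast
    hence "{C\<in>?B. R \<in> C} = {C}" by blast
    thus ?thesis by simp
  qed
  have 2: "card {R\<in>?A. R \<in> C} = q - 1" if "C \<in> ?B" for C
  proof -
    have "{R\<in>?A. R \<in> C} = C - {P,Q}" using that circ_sub circ_not_par by blast
    thus ?thesis using that assms card_circ[of C] finite_circ[of C] by (simp add: card_Diff_subset)
  qed
  have "(\<Sum>R\<in>?A. card {C\<in>?B. R \<in> C}) = (q - 1) * card ?B"
    by (rule sum_multicount) (use 2 finite_pts finite_circs in auto)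
  moreover have "(\<Sum>R\<in>?A. card {C\<in>?B. R \<in> C}) = card ?A" using 1 by simp
  ultimately show ?thesis using card_not_par2[OF assms] q_ge_3 by simp
qed

lemma card_through:
  assumes "P \<in> pts"
  shows "card {C\<in>circs. P \<in> C} = q * (q + 1 - \<rho>)"
proof -
  let ?A = "{R\<in>pts. R \<noteq> P \<and> \<not> par P R}"
  let ?B = "{C\<in>circs. P \<in> C}"
  have 1: "card {C\<in>?B. R \<in> C} = q + 1 - \<rho>" if "R \<in> ?A" for R
    using card_through2[of P R] that assms by auto
  have 2: "card {R\<in>?A. R \<in> C} = q" if "C \<in> ?B" for C
  proof -
    have "{R\<in>?A. R \<in> C} = C - {P}" using that circ_sub circ_not_par by blast
    thus ?thesis using that card_circ[of C] finite_circ[of C] by simp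
  qed
  have "(\<Sum>R\<in>?A. card {C\<in>?B. R \<in> C}) = q * card ?B"
    by (rule sum_multicount) (use 2 finite_pts finite_circs in auto)
  moreover have "(\<Sum>R\<in>?A. card {C\<in>?B. R \<in> C}) = card ?A * (q + 1 - \<rho>)" using 1 by simp
  ultimately show ?thesis using card_not_par[OF assms] q_ge_3 by (simp add: power2_eq_square)
qed

text \<open>Of the \<open>q + 1 - \<rho>\<close> circles through \<open>P\<close> and
  \<open>Q\<close>, those that do not touch \<open>C\<close> at \<open>P\<close> meet it in one more
  point. They correspond to the \<open>q - \<rho>\<close> points of \<open>C\<close> other than
  \<open>P\<close> that are not parallel to \<open>Q\<close>, so exactly one circle is left.\<close>

lemma unique_tangent:
  assumes C: "C \<in> circs" "P \<in> C" and Q: "Q \<in> pts" "Q \<notin> C" "\<not> par P Q"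
  shows "card {D\<in>circs. C \<inter> D = {P} \<and> Q \<in> D} = 1"
proof -
  have P: "P \<in> pts" "P \<noteq> Q" using C Q circ_sub by auto
  let ?B = "{D\<in>circs. P \<in> D \<and> Q \<in> D}"
  let ?T = "{D\<in>circs. C \<inter> D = {P} \<and> Q \<in> D}"
  let ?R = "{R\<in>C. R \<noteq> P \<and> \<not> par Q R}"
  have finB: "finite ?B" using finite_circs by simp
  have cR: "card ?R + 1 + \<rho> = q + 1"
  proof -
    have "C = ?R \<union> {P} \<union> {R\<in>C. par Q R}" using C by auto
    moreover have "card (?R \<union> {P} \<union> {R\<in>C. par Q R}) = card ?R + 1 + \<rho>"
    proof -
      have "card (?R \<union> {P}) = card ?R + 1" using finite_circ[OF C(1)] by simp
      moreover have "card ({R\<in>C. par Q R}) = \<rho>" using card_par_circ[OF Q(1) C(1) Q(2)] .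
      moreover have "(?R \<union> {P}) \<inter> {R\<in>C. par Q R} = {}" using Q par_sym by auto
      ultimately show ?thesis using finite_circ[OF C(1)] by (subst card_Un_disjoint) auto
    qed
    ultimately show ?thesis using card_circ[OF C(1)] by simp
  qed
  have "\<exists>g. \<forall>R\<in>?R. g R \<in> circs \<and> P \<in> g R \<and> Q \<in> g R \<and> R \<in> g R"
  proof (rule bchoice, intro ballI)
    fix R assume R: "R \<in> ?R"
    have "\<exists>!D. D \<in> circs \<and> P \<in> D \<and> Q \<in> D \<and> R \<in> D"
      by (rule three) (use P C Q R circ_sub circ_not_par in auto)
    thus "\<exists>D. D \<in> circs \<and> P \<in> D \<and> Q \<in> D \<and> R \<in> D" by blast
  qed
  then obtain g where g: "\<And>R. R \<in> ?R \<Longrightarrow> g R \<in> circs \<and> P \<in> g R \<and> Q \<in> g R \<and> R \<in> g R" by blast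
  have inj: "inj_on g ?R"
  proof (rule inj_onI)
    fix R R' assume a: "R \<in> ?R" "R' \<in> ?R" "g R = g R'"
    show "R = R'"
    proof (rule ccontr)
      assume "R \<noteq> R'"
      hence "g R = C" using a g[of R] g[of R'] C circ_eqI[of "g R" C P R R'] by auto
      thus False using g[of R] a Q by auto
    qed
  qed
  have im: "g ` ?R = ?B - ?T"
  proof
    show "g ` ?R \<subseteq> ?B - ?T" using g C by auto
    show "?B - ?T \<subseteq> g ` ?R"
    proof
      fix D assume D: "D \<in> ?B - ?T"
      then obtain R where R: "R \<in> C" "R \<in> D" "R \<noteq> P" using C by blast
      have "R \<noteq> Q" using R Q by auto
      have "R \<in> ?R" using R D circ_not_par[of D Q R] \<open>R \<noteq> Q\<close> by auto
      moreover have "g R = D" using g[OF \<open>R \<in> ?R\<close>] D R P \<open>R \<noteq> Q\<close> circ_eqI[of "g R" D P Q R] by auto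
      ultimately show "D \<in> g ` ?R" by blast
    qed
  qed
  have "card (?B - ?T) = card ?R" unfolding im[symmetric] by (rule card_image[OF inj])
  moreover have "?T \<subseteq> ?B" by blast
  hence "card (?B - ?T) = card ?B - card ?T" "card ?T \<le> card ?B" using finB
    by (auto intro: card_Diff_subset finite_subset card_mono)
  ultimately show ?thesis using cR card_through2[OF P(1) Q(1) P(2) Q(3)] by linarith
qed

text \<open>By \<open>unique_tangent\<close> the circles touching \<open>C\<close> at
  \<open>P\<close> partition the \<open>q\<^sup>2 - q\<close> points off \<open>C\<close> that are
  not parallel to \<open>P\<close> into sets of size \<open>q\<close>.\<close>

lemma card_tangent_at:
  assumes C: "C \<in> circs" "P \<in> C"
  shows "card {D\<in>circs. C \<inter> D = {P}} = q - 1"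
proof -
  have P: "P \<in> pts" using C circ_sub by auto
  let ?A = "{R\<in>pts. R \<noteq> P \<and> \<not> par P R} - C"
  let ?B = "{D\<in>circs. C \<inter> D = {P}}"
  have cA: "card ?A = q\<^sup>2 - q"
  proof -
    have "{R\<in>pts. R \<noteq> P \<and> \<not> par P R} \<inter> C = C - {P}" using circ_sub[OF C(1)] circ_not_par[OF C] by auto
    moreover have "card (C - {P}) = q" using card_circ[OF C(1)] C finite_circ[OF C(1)] by simp
    ultimately show ?thesis using card_not_par[OF P] finite_pts
      by (metis (no_types, lifting) card_Diff_subset_Int finite_Int finite_circ[OF C(1)])
  qed
  have 1: "card {D\<in>?B. R \<in> D} = 1" if "R \<in> ?A" for R
    using unique_tangent[OF C, of R] that by (simp add: conj_assoc)
  have 2: "card {R\<in>?A. R \<in> D} = q" if "D \<in> ?B" for D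
  proof -
    have D: "D \<in> circs" "P \<in> D" "C \<inter> D = {P}" using that by auto
    have "{R\<in>?A. R \<in> D} = D - {P}" using D circ_sub[OF D(1)] circ_not_par[OF D(1,2)] by auto
    thus ?thesis using D card_circ[OF D(1)] finite_circ[OF D(1)] by simp
  qed
  have "(\<Sum>R\<in>?A. card {C\<in>?B. R \<in> C}) = q * card ?B"
    by (rule sum_multicount) (use 2 finite_pts finite_circs in auto)
  moreover have "(\<Sum>R\<in>?A. card {C\<in>?B. R \<in> C}) = card ?A" using 1 by simp
  ultimately have "q * card ?B = q * (q - 1)" using cA by (simp add: power2_eq_square algebra_simps)
  thus ?thesis using q_ge_3 by simp
qed

lemma tangents_eq: "C \<in> circs \<Longrightarrow> {D\<in>circs. tan C D} = (\<Union>P\<in>C. {D\<in>circs. C \<inter> D = {P}})"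
  using tan_iff[of C] by blast

lemma card_tangent_through_in:
  assumes C: "C \<in> circs" "P \<in> C"
  shows "card {D\<in>circs. tan C D \<and> P \<in> D} = q - 1"
proof -
  have "{D\<in>circs. tan C D \<and> P \<in> D} = {D\<in>circs. C \<inter> D = {P}}"
  proof -
    have "tan C D \<and> P \<in> D \<longleftrightarrow> C \<inter> D = {P}" if D: "D \<in> circs" for D
    proof
      assume a: "tan C D \<and> P \<in> D"
      then obtain R where "C \<inter> D = {R}" using tan_iff[OF C(1) D] by blast
      thus "C \<inter> D = {P}" using C(2) a by auto
    qed (use C tanI[OF C(1) D] in auto)
    thus ?thesis by blast
  qed
  thus ?thesis using card_tangent_at[OF C] by simp
qed

text \<open>There is one tangent circle for each possible contact point, that is for each point of
  \<open>C\<close> not parallel to \<open>P\<close>.\<close>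

lemma card_tangent_through_out:
  assumes C: "C \<in> circs" "P \<in> pts" "P \<notin> C"
  shows "card {D\<in>circs. tan C D \<and> P \<in> D} = q + 1 - \<rho>"
proof -
  have "{D\<in>circs. tan C D \<and> P \<in> D} = (\<Union>R\<in>{R\<in>C. \<not> par P R}. {D\<in>circs. C \<inter> D = {R} \<and> P \<in> D})"
  proof -
    have "{D\<in>circs. tan C D \<and> P \<in> D} = (\<Union>R\<in>C. {D\<in>circs. C \<inter> D = {R} \<and> P \<in> D})"
      using tangents_eq[OF C(1)] by blast
    moreover have "{D\<in>circs. C \<inter> D = {R} \<and> P \<in> D} = {}" if "R \<in> C" "par P R" for R
      using circ_not_par[of _ P R] that C by blast
    ultimately show ?thesis by blast
  qed
  also have "card \<dots> = (\<Sum>R\<in>{R\<in>C. \<not> par P R}. card {D\<in>circs. C \<inter> D = {R} \<and> P \<in> D})"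
    by (rule card_UN_disjoint) (use finite_circ[OF C(1)] finite_circs in auto)
  also have "\<dots> = card {R\<in>C. \<not> par P R}"
  proof -
    have "card {D\<in>circs. C \<inter> D = {R} \<and> P \<in> D} = 1" if "R \<in> {R\<in>C. \<not> par P R}" for R
      using that unique_tangent[OF C(1), of R P] C par_sym by auto
    thus ?thesis by simp
  qed
  also have "{R\<in>C. \<not> par P R} = C - {R\<in>C. par P R}" by blast
  also have "card \<dots> = q + 1 - \<rho>"
    using card_par_circ[OF C(2) C(1) C(3)] card_circ[OF C(1)] finite_circ[OF C(1)]
    by (subst card_Diff_subset) auto
  finally show ?thesis .
qed

lemma card_tangents:
  assumes C: "C \<in> circs" shows "card {D\<in>circs. tan C D} = q\<^sup>2 - 1"
proof -
  have "card {D\<in>circs. tan C D} = (\<Sum>P\<in>C. card {D\<in>circs. C \<inter> D = {P}})"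
    unfolding tangents_eq[OF C]
    by (rule card_UN_disjoint) (use finite_circ[OF C(1)] finite_circs in auto)
  also have "\<dots> = (q + 1) * (q - 1)" using card_tangent_at[OF C] card_circ[OF C] by simp
  also have "\<dots> = q\<^sup>2 - 1" by (simp add: power2_eq_square algebra_simps)
  finally show ?thesis .
qed

text \<open>With \<open>b = q + 1 - \<rho>\<close> the sum is \<open>2 * q * b\<close> for
  \<open>P\<close> on \<open>C\<close> and \<open>b\<^sup>2\<close> for \<open>P\<close> off
  \<open>C\<close>. The identity \<open>2 * q * b = q\<^sup>2 - 1 + b\<^sup>2\<close>, valid for
  \<open>\<rho> = 0\<close> and for \<open>\<rho> = 2\<close>, brings the two cases into one
  formula.\<close>

lemma sum_through2_circ:
  assumes C: "C \<in> circs" and P: "P \<in> pts"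
  shows "(\<Sum>R\<in>C. real (card {D\<in>circs. P \<in> D \<and> R \<in> D})) =
    (real q^2 - 1) * (if P \<in> C then 1 else 0) + (real q + 1 - real \<rho>)^2"
proof (cases "P \<in> C")
  case True
  have "(\<Sum>R\<in>C. real (card {D\<in>circs. P \<in> D \<and> R \<in> D})) = real (card {D\<in>circs. P \<in> D \<and> P \<in> D}) +
     (\<Sum>R\<in>C-{P}. real (card {D\<in>circs. P \<in> D \<and> R \<in> D}))"
    using True finite_circ[OF C] by (subst sum.remove[of C P]) auto
  also have "(\<Sum>R\<in>C-{P}. real (card {D\<in>circs. P \<in> D \<and> R \<in> D})) = (\<Sum>R\<in>C-{P}. real (q + 1 - \<rho>))"
    by (rule sum.cong) (use card_through2 P circ_sub[OF C] circ_not_par[OF C True] in auto)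
  also have "\<dots> = real q * real (q + 1 - \<rho>)" using True card_circ[OF C] finite_circ[OF C] by simp
  finally have "(\<Sum>R\<in>C. real (card {D\<in>circs. P \<in> D \<and> R \<in> D})) = 2 * (real q * real (q + 1 - \<rho>))"
    using card_through[OF P] by (simp del: of_nat_diff)
  moreover have "real (q + 1 - \<rho>) = real q + 1 - real \<rho>" using rho q_ge_3 by auto
  ultimately show ?thesis using True rho by (auto simp: power2_eq_square algebra_simps)
next
  case False
  have z: "real (card {D\<in>circs. P \<in> D \<and> R \<in> D}) = (if par P R then 0 else real (q + 1 - \<rho>))" if "R \<in> C" for R
  proof (cases "par P R")
    case True
    hence "{D\<in>circs. P \<in> D \<and> R \<in> D} = {}" using circ_not_par[of _ P R] that False by auto
    hence "card {D\<in>circs. P \<in> D \<and> R \<in> D} = 0" by (simp only: card.empty)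
    thus ?thesis using True by simp
  next
    case f: False
    thus ?thesis using card_through2[of P R] that False P circ_sub[OF C] by auto
  qed
  have "(\<Sum>R\<in>C. real (card {D\<in>circs. P \<in> D \<and> R \<in> D})) = (\<Sum>R\<in>C. if par P R then 0 else real (q + 1 - \<rho>))"
    using z by simp
  also have "\<dots> = (\<Sum>R\<in>C - {R\<in>C. par P R}. real (q + 1 - \<rho>))"
    by (rule sum.mono_neutral_cong_right) (use finite_circ[OF C] in auto)
  also have "\<dots> = real (card (C - {R\<in>C. par P R})) * real (q + 1 - \<rho>)" by simp
  also have "card (C - {R\<in>C. par P R}) = q + 1 - \<rho>"
    using card_par_circ[OF P C False] card_circ[OF C] finite_circ[OF C] by (subst card_Diff_subset) auto
  finally show ?thesis using False rho q_ge_3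
    by (auto simp: of_nat_diff power2_eq_square algebra_simps)
qed

end

section \<open>The tangency graph\<close>

text \<open>The sign \<open>eps C\<close> is the quadratic character of the norm of the pole of \<open>C\<close>, see \<open>polar_circle_geometry\<close>;
  it is constantly \<open>0\<close> in even characteristic.\<close>

locale classed_circle_geometry = circle_geometry pts circs par q \<rho>
  for pts :: "'p set" and circs par q \<rho> +
  fixes eps :: "'p set \<Rightarrow> real"
  assumes eps_cases: "(\<forall>C\<in>circs. eps C = 0) \<or> (\<forall>C\<in>circs. eps C = 1 \<or> eps C = -1)"
    and eps_tan: "C \<in> circs \<Longrightarrow> D \<in> circs \<Longrightarrow> tan C D \<Longrightarrow> eps C = eps D"
    and common_tangents: "C \<in> circs \<Longrightarrow> D \<in> circs \<Longrightarrow> C \<noteq> D \<Longrightarrow>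
      real (card {E\<in>circs. tan C E \<and> tan E D}) + 2 * (if tan C D then 1 else 0) =
      (real q + 1 - real (card (C \<inter> D))) * (1 + eps C * eps D)"
begin

section \<open>Incidence sums and the adjacency operator\<close>

definition inc :: "('p set \<Rightarrow> real) \<Rightarrow> 'p \<Rightarrow> real" where
  "inc f P = (\<Sum>C\<in>{C\<in>circs. P \<in> C}. f C)"

definition adj :: "('p set \<Rightarrow> real) \<Rightarrow> 'p set \<Rightarrow> real" where
  "adj f C = (\<Sum>D\<in>{D\<in>circs. tan C D}. f D)"

abbreviation total :: "('p set \<Rightarrow> real) \<Rightarrow> real" where
  "total f \<equiv> sum f circs"

text \<open>\<open>b\<close> is the number of circles through two nonparallel points, and also the
  number of circles tangent to a given circle through a point off it. For a point on the circle the
  latter number is \<open>a + b = q - 1\<close>.\<close>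

definition b :: real where "b = real q + 1 - real \<rho>"
definition a :: real where "a = real \<rho> - 2"
text \<open>The scalar product of the pencil of \<open>P\<close> with the pencil of \<open>Q\<close>
  multiplied by \<open>eps\<close>.\<close>

definition sgn_inc :: "'p \<Rightarrow> 'p \<Rightarrow> real" where
  "sgn_inc P Q = (\<Sum>D\<in>{D\<in>circs. P \<in> D \<and> Q \<in> D}. eps D)"

lemma b_nat: "b = real (q + 1 - \<rho>)"
  using rho q_ge_3 by (auto simp: b_def)

lemma b_pos: "b > 0"
  using rho q_ge_3 by (auto simp: b_def)

lemma q_real: "real q \<ge> 3" using q_ge_3 by simp

lemma ab_cases: "(a = -2 \<and> b = real q + 1) \<or> (a = 0 \<and> b = real q - 1)"
  using rho by (auto simp: a_def b_def)

lemma swap_points: "(\<Sum>C\<in>circs. \<Sum>P\<in>C. g C P) = (\<Sum>P\<in>pts. \<Sum>C\<in>{C\<in>circs. P \<in> C}. (g C P :: real))"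
proof -
  have "(\<Sum>C\<in>circs. \<Sum>P\<in>C. g C P) = (\<Sum>C\<in>circs. \<Sum>P\<in>{P\<in>pts. P \<in> C}. g C P)"
    by (intro sum.cong refl) (use circ_sub in auto)
  also have "\<dots> = (\<Sum>P\<in>pts. \<Sum>C\<in>{C\<in>circs. P \<in> C}. g C P)"
    by (rule sum.swap_restrict) (use finite_circs finite_pts in auto)
  finally show ?thesis .
qed

lemma sum_inc: "(\<Sum>P\<in>pts. g P * inc f P) = (\<Sum>C\<in>circs. f C * (\<Sum>P\<in>C. g P))"
  by (simp add: sum_distrib_left inc_def swap_points mult.commute)

lemma sum_inc1: "(\<Sum>P\<in>pts. inc f P) = (real q + 1) * total f"
proof -
  have "(\<Sum>P\<in>pts. inc f P) = (\<Sum>C\<in>circs. f C * (\<Sum>P\<in>C. 1))" using sum_inc[of "\<lambda>_. 1" f] by simp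
  also have "\<dots> = (\<Sum>C\<in>circs. f C * (real q + 1))" by (intro sum.cong refl) (simp add: card_circ)
  finally show ?thesis by (simp add: sum_distrib_right[symmetric] mult.commute)
qed

lemma sum_Int_card:
  assumes "finite A" "\<And>D. D \<in> A \<Longrightarrow> D \<in> circs" "C \<in> circs"
  shows "(\<Sum>D\<in>A. f D * real (card (C \<inter> D))) = (\<Sum>P\<in>C. \<Sum>D\<in>{D\<in>A. P \<in> D}. f D)"
proof -
  have "(\<Sum>D\<in>A. f D * real (card (C \<inter> D))) = (\<Sum>D\<in>A. \<Sum>P\<in>{P\<in>C. P \<in> D}. f D)"
  proof (intro sum.cong refl)
    fix D
    have "{P\<in>C. P \<in> D} = C \<inter> D" by blast
    thus "f D * real (card (C \<inter> D)) = (\<Sum>P\<in>{P\<in>C. P \<in> D}. f D)" by simp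
  qed
  also have "\<dots> = (\<Sum>P\<in>C. \<Sum>D\<in>{D\<in>A. P \<in> D}. f D)"
    by (rule sum.swap_restrict) (use assms finite_circ in auto)
  finally show ?thesis .
qed

lemma sum_Int_total: "C \<in> circs \<Longrightarrow> (\<Sum>D\<in>circs. f D * real (card (C \<inter> D))) = (\<Sum>P\<in>C. inc f P)"
  unfolding inc_def by (rule sum_Int_card) (auto simp: finite_circs)

lemma sum_Int_through:
  assumes "C \<in> circs" "P \<in> pts"
  shows "(\<Sum>D\<in>{D\<in>circs. P \<in> D}. real (card (C \<inter> D))) = (real q^2 - 1) * of_bool (P \<in> C) + b\<^sup>2"
proof -
  have "(\<Sum>D\<in>{D\<in>circs. P \<in> D}. 1 * real (card (C \<inter> D))) = (\<Sum>R\<in>C. \<Sum>D\<in>{D\<in>{D\<in>circs. P \<in> D}. R \<in> D}. 1)"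
    by (rule sum_Int_card) (use assms finite_circs in auto)
  hence "(\<Sum>D\<in>{D\<in>circs. P \<in> D}. real (card (C \<inter> D))) = (\<Sum>R\<in>C. \<Sum>D\<in>{D\<in>{D\<in>circs. P \<in> D}. R \<in> D}. 1)"
    by (simp only: mult_1)
  also have "\<dots> = (\<Sum>R\<in>C. real (card {D\<in>circs. P \<in> D \<and> R \<in> D}))"
    by (intro sum.cong refl) (simp add: conj_ac)
  finally show ?thesis using sum_through2_circ[OF assms] by (simp add: b_def of_bool_def)
qed

text \<open>Summing point degrees over circles inverts \<open>inc\<close> up to the factor
  \<open>q\<^sup>2 - 1\<close> and a constant. The coefficients of the projection in
  \<open>intersecting_family_degree_one\<close> come from here.\<close>

lemma inc_point_sums:
  assumes "P \<in> pts"
  shows "inc (\<lambda>D. \<Sum>R\<in>D. inc g R) P = (real q^2 - 1) * inc g P + b\<^sup>2 * total g"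
proof -
  have "inc (\<lambda>D. \<Sum>R\<in>D. inc g R) P = (\<Sum>D\<in>{D\<in>circs. P \<in> D}. \<Sum>C\<in>circs. g C * real (card (D \<inter> C)))"
    unfolding inc_def[of "\<lambda>D. \<Sum>R\<in>D. inc g R"] by (intro sum.cong refl) (use sum_Int_total[of _ g] in auto)
  also have "\<dots> = (\<Sum>C\<in>circs. \<Sum>D\<in>{D\<in>circs. P \<in> D}. g C * real (card (D \<inter> C)))" by (rule sum.swap)
  also have "\<dots> = (\<Sum>C\<in>circs. g C * ((real q^2 - 1) * of_bool (P \<in> C) + b\<^sup>2))"
    by (intro sum.cong refl) (use sum_Int_through[OF _ assms] in \<open>simp add: sum_distrib_left[symmetric] Int_commute\<close>)
  also have "\<dots> = (real q^2 - 1) * (\<Sum>C\<in>circs. g C * of_bool (P \<in> C)) + b\<^sup>2 * total g"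
    unfolding sum_distrib_left sum.distrib[symmetric] by (intro sum.cong refl) (simp add: algebra_simps)
  also have "(\<Sum>C\<in>circs. g C * of_bool (P \<in> C)) = inc g P"
    unfolding inc_def using finite_circs by (simp add: sum.If_cases of_bool_def if_distrib Int_def cong: if_cong)
  finally show ?thesis .
qed

text \<open>The tangent circles of \<open>C\<close> pass \<open>b\<close> times through a point off
  \<open>C\<close> and \<open>a + b\<close> times through a point of \<open>C\<close>. Hence the
  functions given by sums over points, together with the constants, are invariant under
  \<open>adj\<close>.\<close>

lemma adj_point_sums:
  assumes C: "C \<in> circs"
  shows "adj (\<lambda>D. \<Sum>P\<in>D. g P) C = a * (\<Sum>P\<in>C. g P) + b * (\<Sum>P\<in>pts. g P)"
proof -
  have "adj (\<lambda>D. \<Sum>P\<in>D. g P) C = (\<Sum>D\<in>{D\<in>circs. tan C D}. \<Sum>P\<in>{P\<in>pts. P \<in> D}. g P)"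
    unfolding adj_def by (intro sum.cong refl) (use circ_sub in auto)
  also have "\<dots> = (\<Sum>P\<in>pts. \<Sum>D\<in>{D\<in>{D\<in>circs. tan C D}. P \<in> D}. g P)"
    by (rule sum.swap_restrict) (use finite_circs finite_pts in auto)
  also have "\<dots> = (\<Sum>P\<in>pts. g P * (b + a * of_bool (P \<in> C)))"
  proof (intro sum.cong refl)
    fix P assume P: "P \<in> pts"
    have "real (card {D\<in>circs. tan C D \<and> P \<in> D}) = b + a * of_bool (P \<in> C)"
      using card_tangent_through_in[OF C, of P] card_tangent_through_out[OF C P] q_ge_3 rho
      by (cases "P \<in> C") (auto simp: a_def b_def of_nat_diff)
    thus "(\<Sum>D\<in>{D\<in>{D\<in>circs. tan C D}. P \<in> D}. g P) = g P * (b + a * of_bool (P \<in> C))"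
      by (simp add: conj_assoc)
  qed
  also have "\<dots> = b * (\<Sum>P\<in>pts. g P) + a * (\<Sum>P\<in>pts. g P * of_bool (P \<in> C))"
    unfolding sum_distrib_left sum.distrib[symmetric] by (intro sum.cong refl) (simp add: algebra_simps)
  also have "(\<Sum>P\<in>pts. g P * of_bool (P \<in> C)) = (\<Sum>P\<in>C. g P)"
    using circ_sub[OF C] finite_pts
    by (simp add: sum.If_cases of_bool_def if_distrib Int_absorb1 cong: if_cong)
  finally show ?thesis by simp
qed

lemma adj_const: "C \<in> circs \<Longrightarrow> adj (\<lambda>_. x) C = (real q^2 - 1) * x"
  using card_tangents q_ge_3 by (simp add: adj_def of_nat_diff)

lemma adj_eps: "C \<in> circs \<Longrightarrow> adj (\<lambda>D. eps D * g D) C = eps C * adj g C"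
  unfolding adj_def sum_distrib_left by (intro sum.cong refl) (use eps_tan[of C] in auto)

lemma adj_sym: "(\<Sum>C\<in>circs. f C * adj g C) = (\<Sum>C\<in>circs. g C * adj f C)"
proof -
  have "(\<Sum>C\<in>circs. f C * adj g C) = (\<Sum>C\<in>circs. \<Sum>D\<in>{D\<in>circs. tan C D}. f C * g D)"
    by (simp add: adj_def sum_distrib_left)
  also have "\<dots> = (\<Sum>D\<in>circs. \<Sum>C\<in>{C\<in>circs. tan C D}. f C * g D)"
    by (rule sum.swap_restrict) (use finite_circs in auto)
  finally show ?thesis by (simp add: adj_def sum_distrib_left tan_sym mult.commute)
qed

lemma adj_linear: "adj (\<lambda>D. f D + g D) C = adj f C + adj g C" "adj (\<lambda>D. f D - g D) C = adj f C - adj g C"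
  "adj (\<lambda>D. x * f D) C = x * adj f C"
  by (simp_all add: adj_def sum.distrib sum_subtractf sum_distrib_left)

lemma inc_linear: "inc (\<lambda>D. f D + g D) C = inc f C + inc g C" "inc (\<lambda>D. f D - g D) C = inc f C - inc g C"
  "inc (\<lambda>D. x * f D) C = x * inc f C"
  by (simp_all add: inc_def sum.distrib sum_subtractf sum_distrib_left)

lemma inc_const: "P \<in> pts \<Longrightarrow> inc (\<lambda>_. x) P = real q * b * x"
  using card_through by (simp add: inc_def b_nat)

text \<open>Counts the paths \<open>C\<close>, \<open>E\<close>, \<open>D\<close> of tangent circles
  by \<open>common_tangents\<close>; the correction for tangent pairs in that formula produces the
  term \<open>- 2 * adj f C\<close>.\<close>

lemma adj_adj:
  assumes C: "C \<in> circs"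
  shows "adj (adj f) C = (real q^2 - 1) * f C - 2 * adj f C
     + (real q + 1) * (total f + eps C * total (\<lambda>D. eps D * f D))
     - (\<Sum>P\<in>C. inc f P) - eps C * (\<Sum>P\<in>C. inc (\<lambda>D. eps D * f D) P)"
proof -
  \<comment> \<open>For \<open>D = C\<close> this factor is zero, and the number of paths is the
    valency \<open>q\<^sup>2 - 1\<close>.\<close>
  define m where "m D = (real q + 1 - real (card (C \<inter> D))) * (1 + eps C * eps D)" for D
  have "adj (adj f) C = (\<Sum>E\<in>{E\<in>circs. tan C E}. \<Sum>D\<in>{D\<in>circs. tan E D}. f D)"
    by (simp add: adj_def)
  also have "\<dots> = (\<Sum>D\<in>circs. \<Sum>E\<in>{E\<in>{E\<in>circs. tan C E}. tan E D}. f D)"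
    by (rule sum.swap_restrict) (use finite_circs in auto)
  also have "\<dots> = (\<Sum>D\<in>circs. f D * ((real q^2 - 1) * of_bool (D = C) - 2 * of_bool (tan C D) + m D))"
  proof (intro sum.cong refl)
    fix D assume D: "D \<in> circs"
    have "real (card {E\<in>circs. tan C E \<and> tan E D}) = (real q^2 - 1) * of_bool (D = C) - 2 * of_bool (tan C D) + m D"
    proof (cases "C = D")
      case True
      have "{E\<in>circs. tan C E \<and> tan E D} = {E\<in>circs. tan C E}" using True tan_sym by blast
      thus ?thesis using True card_tangents[OF C] card_circ[OF C] q_ge_3
        by (simp add: m_def tan_def of_nat_diff)
    next
      case False
      thus ?thesis using common_tangents[OF C D] by (simp add: m_def of_bool_def)
    qed
    thus "(\<Sum>E\<in>{E\<in>{E\<in>circs. tan C E}. tan E D}. f D) =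
        f D * ((real q^2 - 1) * of_bool (D = C) - 2 * of_bool (tan C D) + m D)"
      by (simp add: conj_assoc)
  qed
  also have "\<dots> = (\<Sum>D\<in>circs. (real q^2 - 1) * (f D * of_bool (D = C))) - 2 * (\<Sum>D\<in>circs. f D * of_bool (tan C D))
      + (\<Sum>D\<in>circs. f D * m D)"
    by (simp add: sum.distrib sum_subtractf sum_distrib_left algebra_simps)
  also have "(\<Sum>D\<in>circs. (real q^2 - 1) * (f D * of_bool (D = C))) = (real q^2 - 1) * f C"
    using C finite_circs by (simp add: of_bool_def if_distrib cong: if_cong)
  also have "(\<Sum>D\<in>circs. f D * of_bool (tan C D)) = adj f C"
    unfolding adj_def using finite_circs by (simp add: sum.If_cases of_bool_def if_distrib Int_def cong: if_cong)
  also have "(\<Sum>D\<in>circs. f D * m D) = (real q + 1) * (total f + eps C * total (\<lambda>D. eps D * f D))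
     - (\<Sum>D\<in>circs. f D * real (card (C \<inter> D))) - eps C * (\<Sum>D\<in>circs. (eps D * f D) * real (card (C \<inter> D)))"
    by (simp add: m_def sum.distrib sum_subtractf sum_distrib_left algebra_simps)
  finally show ?thesis unfolding sum_Int_total[OF C] by simp
qed

text \<open>The indicator function \<open>f\<close> of the pencil of \<open>P\<close> satisfies
  \<open>adj f = a * f + b\<close>, so \<open>adj (adj f)\<close> is known in two ways. The unsigned
  terms of \<open>adj_adj\<close> cancel, and the signed ones give the claim after division by
  \<open>eps C\<close>.\<close>

lemma sgn_inc_circ:
  assumes C: "C \<in> circs" and P: "P \<in> pts" and nz: "eps C \<noteq> 0"
  shows "(\<Sum>R\<in>C. sgn_inc P R) = (real q + 1) * sgn_inc P P"
proof -
  let ?f = "\<lambda>D. of_bool (P \<in> D) :: real"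
  have f: "?f D = (\<Sum>R\<in>D. of_bool (R = P))" if "D \<in> circs" for D
    using finite_circ[OF that] by (simp add: of_bool_def)
  have adjf: "adj ?f D = a * ?f D + b" if "D \<in> circs" for D
  proof -
    have "adj ?f D = adj (\<lambda>D. \<Sum>R\<in>D. of_bool (R = P)) D"
      unfolding adj_def by (intro sum.cong refl f) auto
    also have "\<dots> = a * ?f D + b"
      using adj_point_sums[OF that, of "\<lambda>R. of_bool (R = P)"] f[OF that] P finite_pts
      by (simp add: of_bool_def)
    finally show ?thesis .
  qed
  have inc1: "inc (\<lambda>D. g D * ?f D) R = (\<Sum>D\<in>{D\<in>circs. P \<in> D \<and> R \<in> D}. g D)" for g R
  proof -
    have "inc (\<lambda>D. g D * ?f D) R = (\<Sum>D\<in>{D\<in>circs. R \<in> D}. if P \<in> D then g D else 0)"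
      unfolding inc_def by (intro sum.cong) auto
    also have "\<dots> = (\<Sum>D\<in>{D\<in>{D\<in>circs. R \<in> D}. P \<in> D}. g D)"
      by (subst sum.inter_filter) (use finite_circs in auto)
    also have "{D\<in>{D\<in>circs. R \<in> D}. P \<in> D} = {D\<in>circs. P \<in> D \<and> R \<in> D}" by blast
    finally show ?thesis .
  qed
  have "adj (adj ?f) C = adj (\<lambda>D. a * ?f D + b) C"
    unfolding adj_def[of "adj ?f"] adj_def[of "\<lambda>D. a * ?f D + b"] by (intro sum.cong refl adjf) auto
  also have "\<dots> = a * (a * ?f C + b) + (real q^2 - 1) * b"
    by (simp only: adj_linear adj_const[OF C] adjf[OF C])
  finally have 1: "adj (adj ?f) C = a * (a * ?f C + b) + (real q^2 - 1) * b" .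
  have tot: "total (\<lambda>D. g D * ?f D) = (\<Sum>D\<in>{D\<in>circs. P \<in> D \<and> P \<in> D}. g D)" for g
    using finite_circs by (simp add: of_bool_def if_distrib sum.If_cases Int_def cong: if_cong)
  have tf: "total ?f = real q * b"
    using tot[of "\<lambda>_. 1"] card_through[OF P] by (simp add: b_nat)
  have te: "total (\<lambda>D. eps D * ?f D) = sgn_inc P P"
    unfolding tot sgn_inc_def ..
  have if1: "(\<Sum>R\<in>C. inc ?f R) = (real q^2 - 1) * ?f C + b\<^sup>2"
    using inc1[of "\<lambda>_. 1"] sum_through2_circ[OF C P] by (simp add: b_def of_bool_def)
  have ie: "(\<Sum>R\<in>C. inc (\<lambda>D. eps D * ?f D) R) = (\<Sum>R\<in>C. sgn_inc P R)"
    unfolding inc1 sgn_inc_def ..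
  have "a * (a * ?f C + b) + (real q^2 - 1) * b = (real q^2 - 1) * ?f C - 2 * (a * ?f C + b)
     + (real q + 1) * (real q * b + eps C * sgn_inc P P)
     - ((real q^2 - 1) * ?f C + b\<^sup>2) - eps C * (\<Sum>R\<in>C. sgn_inc P R)"
    using adj_adj[OF C, of ?f] unfolding 1 adjf[OF C] tf te if1 ie .
  hence "eps C * (\<Sum>R\<in>C. sgn_inc P R) = eps C * ((real q + 1) * sgn_inc P P)"
    using ab_cases by (elim disjE) (auto simp: power2_eq_square algebra_simps)
  thus ?thesis using nz by simp
qed

text \<open>Summing \<open>sgn_inc_circ\<close> over the circles of a pencil gives \<open>sgn_inc P P = 0\<close>; then the same identity,
  weighted by \<open>eps\<close>, shows that the squares of the numbers \<open>sgn_inc P R\<close> add up to \<open>0\<close>.\<close>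

lemma sgn_inc_eq_0:
  assumes P: "P \<in> pts" and Q: "Q \<in> pts"
  shows "sgn_inc P Q = 0"
proof (cases "\<forall>C\<in>circs. eps C = 0")
  case True
  thus ?thesis by (simp add: sgn_inc_def)
next
  case False
  hence nz: "\<And>C. C \<in> circs \<Longrightarrow> eps C \<noteq> 0" using eps_cases by force
  let ?A = "{R\<in>pts. R \<noteq> P \<and> \<not> par P R}"
  have sum_rest: "(\<Sum>R\<in>C - {P}. sgn_inc P R) = real q * sgn_inc P P" if "C \<in> circs" "P \<in> C" for C
    using sgn_inc_circ[OF that(1) P nz[OF that(1)]] that(2) finite_circ[OF that(1)]
    by (simp add: sum.remove[of C P] algebra_simps)
  have AD: "{R\<in>?A. R \<in> D} = D - {P}" if "D \<in> circs" "P \<in> D" for D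
    using circ_sub[OF that(1)] circ_not_par[OF that] by auto
  have l2: "card {D\<in>circs. P \<in> D \<and> R \<in> D} = q + 1 - \<rho>" if "R \<in> ?A" for R
    by (rule card_through2) (use that P in auto)
  have sg: "sgn_inc P R = (\<Sum>D\<in>{D\<in>{D\<in>circs. P \<in> D}. R \<in> D}. eps D)" for R
    unfolding sgn_inc_def by (rule sum.cong) auto
  have "real q * b * (real q * sgn_inc P P) = (\<Sum>D\<in>{D\<in>circs. P \<in> D}. real q * sgn_inc P P)"
    by (rule inc_const[OF P, unfolded inc_def, symmetric])
  also have "\<dots> = (\<Sum>D\<in>{D\<in>circs. P \<in> D}. \<Sum>R\<in>{R\<in>?A. R \<in> D}. sgn_inc P R)"
  proof (intro sum.cong refl)
    fix D assume "D \<in> {D\<in>circs. P \<in> D}"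
    hence D: "D \<in> circs" "P \<in> D" by auto
    show "real q * sgn_inc P P = (\<Sum>R\<in>{R\<in>?A. R \<in> D}. sgn_inc P R)"
      unfolding AD[OF D] by (rule sum_rest[OF D, symmetric])
  qed
  also have "\<dots> = (\<Sum>R\<in>?A. \<Sum>D\<in>{D\<in>{D\<in>circs. P \<in> D}. R \<in> D}. sgn_inc P R)"
    by (rule sum.swap_restrict) (use finite_circs finite_pts in auto)
  also have "\<dots> = (\<Sum>R\<in>?A. b * sgn_inc P R)"
  proof (intro sum.cong refl)
    fix R assume "R \<in> ?A"
    hence "card {D\<in>{D\<in>circs. P \<in> D}. R \<in> D} = q + 1 - \<rho>" using l2[of R] by (simp add: conj_assoc)
    thus "(\<Sum>D\<in>{D\<in>{D\<in>circs. P \<in> D}. R \<in> D}. sgn_inc P R) = b * sgn_inc P R"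
      by (simp only: sum_constant b_nat)
  qed
  also have "\<dots> = b * (\<Sum>R\<in>?A. \<Sum>D\<in>{D\<in>{D\<in>circs. P \<in> D}. R \<in> D}. eps D)"
    by (simp only: sum_distrib_left[symmetric] sg[symmetric])
  also have "(\<Sum>R\<in>?A. \<Sum>D\<in>{D\<in>{D\<in>circs. P \<in> D}. R \<in> D}. eps D) = (\<Sum>D\<in>{D\<in>circs. P \<in> D}. \<Sum>R\<in>{R\<in>?A. R \<in> D}. eps D)"
    by (rule sum.swap_restrict[symmetric]) (use finite_circs finite_pts in auto)
  also have "\<dots> = (\<Sum>D\<in>{D\<in>circs. P \<in> D}. real q * eps D)"
  proof (intro sum.cong refl)
    fix D assume "D \<in> {D\<in>circs. P \<in> D}"
    hence D: "D \<in> circs" "P \<in> D" by auto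
    show "(\<Sum>R\<in>{R\<in>?A. R \<in> D}. eps D) = real q * eps D"
      unfolding AD[OF D] using D card_circ[OF D(1)] finite_circ[OF D(1)] by simp
  qed
  also have "\<dots> = real q * sgn_inc P P"
    unfolding sgn_inc_def by (simp only: sum_distrib_left[symmetric] conj_absorb)
  finally have "b * real q * ((real q - 1) * sgn_inc P P) = 0" by (simp add: algebra_simps)
  hence e0: "sgn_inc P P = 0" using b_pos q_real by auto
  have s1: "(\<Sum>R\<in>pts. (sgn_inc P R)\<^sup>2) = (\<Sum>R\<in>pts. \<Sum>D\<in>{D\<in>{D\<in>circs. P \<in> D}. R \<in> D}. sgn_inc P R * eps D)"
    by (simp only: power2_eq_square sum_distrib_left[symmetric] sg[symmetric])
  have s2: "(\<Sum>R\<in>pts. \<Sum>D\<in>{D\<in>{D\<in>circs. P \<in> D}. R \<in> D}. sgn_inc P R * eps D)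
     = (\<Sum>D\<in>{D\<in>circs. P \<in> D}. \<Sum>R\<in>{R\<in>pts. R \<in> D}. sgn_inc P R * eps D)"
    by (rule sum.swap_restrict[symmetric]) (use finite_circs finite_pts in auto)
  have "(\<Sum>R\<in>pts. (sgn_inc P R)\<^sup>2) = 0"
    unfolding s1 s2
  proof (rule sum.neutral, rule ballI)
    fix D assume "D \<in> {D\<in>circs. P \<in> D}"
    hence D: "D \<in> circs" by blast
    have E: "{R\<in>pts. R \<in> D} = D" using circ_sub[OF D] by blast
    show "(\<Sum>R\<in>{R\<in>pts. R \<in> D}. sgn_inc P R * eps D) = 0"
      unfolding E sum_distrib_right[symmetric] sgn_inc_circ[OF D P nz[OF D]] e0 by simp
  qed
  thus ?thesis using Q finite_pts by (simp add: sum_nonneg_eq_0_iff)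
qed

lemma inc_eps_point_sums: "P \<in> pts \<Longrightarrow> inc (\<lambda>D. eps D * (\<Sum>R\<in>D. g R)) P = 0"
proof -
  assume P: "P \<in> pts"
  have "inc (\<lambda>D. eps D * (\<Sum>R\<in>D. g R)) P = (\<Sum>D\<in>{D\<in>circs. P \<in> D}. \<Sum>R\<in>{R\<in>pts. R \<in> D}. g R * eps D)"
    unfolding inc_def
  proof (intro sum.cong refl)
    fix D assume "D \<in> {D\<in>circs. P \<in> D}"
    hence "{R\<in>pts. R \<in> D} = D" using circ_sub by blast
    thus "eps D * (\<Sum>R\<in>D. g R) = (\<Sum>R\<in>{R\<in>pts. R \<in> D}. g R * eps D)"
      by (simp add: sum_distrib_left mult.commute)
  qed
  also have "\<dots> = (\<Sum>R\<in>pts. \<Sum>D\<in>{D\<in>{D\<in>circs. P \<in> D}. R \<in> D}. g R * eps D)"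
    by (rule sum.swap_restrict) (use finite_circs finite_pts in auto)
  also have "\<dots> = (\<Sum>R\<in>pts. g R * sgn_inc P R)"
    unfolding sgn_inc_def
  proof (intro sum.cong refl)
    fix R
    have "{D\<in>{D\<in>circs. P \<in> D}. R \<in> D} = {D\<in>circs. P \<in> D \<and> R \<in> D}" by blast
    thus "(\<Sum>D\<in>{D\<in>{D\<in>circs. P \<in> D}. R \<in> D}. g R * eps D) = g R * (\<Sum>D\<in>{D\<in>circs. P \<in> D \<and> R \<in> D}. eps D)"
      by (simp only: sum_distrib_left)
  qed
  also have "\<dots> = 0" using sgn_inc_eq_0[OF P] by simp
  finally show ?thesis .
qed

lemma inc_eps: "P \<in> pts \<Longrightarrow> inc eps P = 0"
  using sgn_inc_eq_0[of P P] by (simp add: inc_def sgn_inc_def)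

text \<open>By \<open>adj_adj\<close> the only eigenvalues of \<open>adj\<close> on this space are \<open>q - 1\<close> and \<open>- q - 1\<close>.\<close>

lemma inc_psd:
  assumes h0: "\<And>P. P \<in> pts \<Longrightarrow> inc h P = 0" and h1: "\<And>P. P \<in> pts \<Longrightarrow> inc (\<lambda>D. eps D * h D) P = 0"
  shows "(\<Sum>C\<in>circs. h C * adj h C) \<le> (real q - 1) * (\<Sum>C\<in>circs. h C * h C)"
proof -
  define H where "H = (\<Sum>C\<in>circs. h C * h C)"
  define K where "K = (\<Sum>C\<in>circs. h C * adj h C)"
  have "(real q + 1) * total h = 0" "(real q + 1) * total (\<lambda>D. eps D * h D) = 0"
    using sum_inc1[of h] sum_inc1[of "\<lambda>D. eps D * h D"] h0 h1 by simp_all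
  hence t: "total h = 0" "total (\<lambda>D. eps D * h D) = 0" using q_real by auto
  have aa: "adj (adj h) C = (real q^2 - 1) * h C - 2 * adj h C" if C: "C \<in> circs" for C
  proof -
    have "(\<Sum>P\<in>C. inc h P) = 0" "(\<Sum>P\<in>C. inc (\<lambda>D. eps D * h D) P) = 0"
      using h0 h1 circ_sub[OF C] by (auto intro!: sum.neutral)
    thus ?thesis using adj_adj[OF C, of h] t by simp
  qed
  have "(\<Sum>C\<in>circs. adj h C * adj h C) = (\<Sum>C\<in>circs. h C * adj (adj h) C)"
    using adj_sym[of h "adj h"] by simp
  also have "\<dots> = (\<Sum>C\<in>circs. (real q^2 - 1) * (h C * h C) - 2 * (h C * adj h C))"
    by (intro sum.cong refl) (simp add: aa algebra_simps)
  also have "\<dots> = (real q^2 - 1) * H - 2 * K"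
    by (simp add: sum_subtractf sum_distrib_left H_def K_def)
  finally have A: "(\<Sum>C\<in>circs. adj h C * adj h C) = (real q^2 - 1) * H - 2 * K" .
  \<comment> \<open>Since the eigenvalues are \<open>q - 1\<close> and \<open>- q - 1\<close>, this
    sum of squares equals \<open>2 * q\<close> times the difference of the two sides of the
    claim.\<close>
  have "0 \<le> (\<Sum>C\<in>circs. ((real q - 1) * h C - adj h C)\<^sup>2)" by (intro sum_nonneg) simp
  also have "\<dots> = (\<Sum>C\<in>circs. (real q - 1)\<^sup>2 * (h C * h C) - 2 * (real q - 1) * (h C * adj h C) + adj h C * adj h C)"
    by (intro sum.cong refl) (simp add: power2_eq_square algebra_simps)
  also have "\<dots> = (real q - 1)\<^sup>2 * H - 2 * (real q - 1) * K + ((real q^2 - 1) * H - 2 * K)"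
    unfolding sum.distrib sum_subtractf A H_def K_def by (simp only: sum_distrib_left[symmetric])
  also have "\<dots> = 2 * real q * ((real q - 1) * H - K)" by (simp add: power2_eq_square algebra_simps)
  finally have "0 \<le> (real q - 1) * H - K" using q_real by (simp add: zero_le_mult_iff)
  thus ?thesis by (simp add: H_def K_def)
qed

end

text \<open>Here \<open>n\<close> and \<open>e\<close> are the sums of the indicator function and of its product with \<open>eps\<close>, \<open>S\<close> and \<open>S'\<close> are the sums
  of squares of the corresponding point degrees, and \<open>H\<close> and \<open>K\<close> are \<open>\<Sum> h\<^sup>2\<close> and \<open>\<Sum> h (adj h)\<close> for the projection \<open>h\<close>.\<close>

lemma ratio_bound_arith:
  fixes q a b n e S S' \<tau> H K t v :: real
  assumes q: "q \<ge> 3" and ab: "(a = -2 \<and> b = q + 1 \<and> v = q^2 + 1) \<or> (a = 0 \<and> b = q - 1 \<and> v = (q + 1)^2)"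
    and t: "(t = 0 \<and> e = 0 \<and> S' = 0) \<or> (t = 1/2 \<and> S' + \<tau> = 2 * e^2 + (q - 1) * n)"
    and large: "a = -2 \<Longrightarrow> q \<ge> 4" "a = -2 \<Longrightarrow> t = 1/2 \<Longrightarrow> q \<ge> 5"
    and i: "S + \<tau> = 2 * n^2 + (q - 1) * n"
    and H: "H = n - (S + S') / (q^2 - 1) + b / (q * (q^2 - 1)) * (n^2 + e^2)"
    and K: "K = \<tau> - (a * (S + S') + b * (q + 1) * (n^2 + e^2)) / (q^2 - 1) + b / q * (n^2 + e^2)"
    and psd: "K \<le> (q - 1) * H" and H0: "H \<ge> 0" and n: "n \<ge> q * b"
    and cs: "(q + 1)^2 * e^2 \<le> v * S'"
  shows "n = q * b \<and> H = 0 \<and> S' = 0"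
proof -
  define p where "p = q^2 - 1"
  have "3 * 3 \<le> q * q" using q by (intro mult_mono) auto
  hence p: "p > 0" "p = (q-1)*(q+1)" by (auto simp: p_def power2_eq_square algebra_simps)
  define T where "T = p * (n - H) + b / q * (n^2 + e^2)"
  have T: "S + S' = T"
  proof -
    have "H = n - (S + S') / p + b / (q * p) * (n^2 + e^2)" using H by (simp add: p_def)
    hence "p * H = p * (n - (S + S') / p + b / (q * p) * (n^2 + e^2))" by simp
    also have "\<dots> = p * n - (S + S') + b / q * (n^2 + e^2)"
    proof -
      have "p * ((S + S') / p) = S + S'" "p * (b / (q * p) * (n^2 + e^2)) = b / q * (n^2 + e^2)" using p(1) by simp_all
      thus ?thesis unfolding right_diff_distrib distrib_left by (simp add: algebra_simps)
    qed
    finally show ?thesis unfolding T_def by (simp add: algebra_simps)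
  qed
  have S'0: "0 \<le> S'"
  proof -
    have "0 \<le> v * S'" using cs by (rule order_trans[rotated]) simp
    moreover have "v > 0" using ab q by (auto intro: add_nonneg_pos)
    ultimately show ?thesis by (simp add: zero_le_mult_iff)
  qed
  \<comment> \<open>The counting identity for the indicator, plus \<open>t\<close> times the one for
    its product with \<open>eps\<close>, minus \<open>1 + t\<close> times the eigenvalue inequality.
    With these weights \<open>\<tau>\<close> cancels.\<close>
  have Z: "2 * n^2 + (q - 1) * n - S - \<tau> + t * (2 * e^2 + (q - 1) * n - S' - \<tau>) - (1 + t) * ((q - 1) * H - K) \<le> 0"
  proof -
    have "t * (2 * e^2 + (q - 1) * n - S' - \<tau>) = 0" using t by auto
    moreover have "(1 + t) * ((q - 1) * H - K) \<ge> 0" using t psd by auto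
    moreover have "2 * n^2 + (q - 1) * n - S - \<tau> = 0" using i by simp
    ultimately show ?thesis by linarith
  qed
  define L where "L = 2 * n^2 + 2 * t * e^2 + (1 + t) * (q - 1) * (n - H) + (1 - t) * S' - T
     + (1 + t) * (- a * T / p + (b / q - b * (q + 1) / p) * (n^2 + e^2))"
  have KK: "K = \<tau> - a * T / p - b * (q + 1) / p * (n^2 + e^2) + b / q * (n^2 + e^2)"
    using K unfolding T p_def[symmetric] by (simp add: add_divide_distrib)
  have "L = 2 * n^2 + (q - 1) * n - S - \<tau> + t * (2 * e^2 + (q - 1) * n - S' - \<tau>) - (1 + t) * ((q - 1) * H - K)"
  proof -
    have S: "S = T - S'" using T by simp
    show ?thesis unfolding L_def KK S by (simp add: algebra_simps)
  qed
  hence L: "L \<le> 0" using Z by simp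
  from ab show ?thesis
  proof
    assume A: "a = -2 \<and> b = q + 1 \<and> v = q^2 + 1"
    have T': "T / p = n - H + (n^2 + e^2) / (q * (q - 1))"
    proof -
      have "T / p = p * (n - H) / p + b / q * (n^2 + e^2) / p" unfolding T_def by (rule add_divide_distrib)
      also have "b / q * (n^2 + e^2) / p = (n^2 + e^2) / (q * (q - 1))"
        using A q unfolding p(2) by simp
      finally show ?thesis using p(1) by simp
    qed
    have c: "b / q - b * (q + 1) / p = - (q + 1) / (q * (q - 1))"
    proof -
      have h: "b * (q + 1) / p = (q + 1) / (q - 1)" using A q unfolding p(2) by simp
      have bq: "b = q + 1" using A by simp
      show ?thesis unfolding h unfolding bq using q by (simp add: field_simps)
    qed
    have TT: "T = p * (n - H) + (q + 1) / q * (n^2 + e^2)" using A by (simp add: T_def)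
    have "L = 2 * n^2 + 2 * t * e^2 + (1 + t) * (q - 1) * (n - H) + (1 - t) * S' - (p * (n - H) + (q + 1) / q * (n^2 + e^2))
      + (1 + t) * (2 * (n - H + (n^2 + e^2) / (q * (q - 1))) - (q + 1) / (q * (q - 1)) * (n^2 + e^2))"
    proof -
      have aT: "- a * T / p = 2 * (T / p)" using A by simp
      have m: "- (q + 1) / (q * (q - 1)) * (n^2 + e^2) = - ((q + 1) / (q * (q - 1)) * (n^2 + e^2))" by (simp only: minus_divide_left[symmetric] mult_minus_left)
      show ?thesis unfolding L_def c aT T' m unfolding TT by (simp only: diff_conv_add_uminus)
    qed
    \<comment> \<open>The first two terms are nonnegative because \<open>n >= q * b\<close> and
      \<open>H >= 0\<close>. The last two are bounded below by a positive multiple of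
      \<open>S'\<close> by means of the Cauchy-Schwarz inequality \<open>cs\<close>.\<close>
    also have "\<dots> = (q - 2 - t) / q * (n * (n - q * b)) + (q + 1) * (q - 2 - t) * H
        + (2 * t - (q + 2 + t) / q) * e^2 + (1 - t) * S'"
    proof -
      define u where "u = 1 / q"
      define Z where "Z = (n^2 + e^2) / (q * (q - 1))"
      have qu: "q * u = 1" using q by (simp add: u_def)
      have d: "(q + 1) / q * (n^2 + e^2) = (n^2 + e^2) + (n^2 + e^2) * u"
        "(q + 1) / (q * (q - 1)) * (n^2 + e^2) = (n^2 + e^2) * u + 2 * Z"
        "(q - 2 - t) / q = 1 - (2 + t) * u" "(q + 2 + t) / q = 1 + (2 + t) * u"
        using q by (simp_all add: u_def Z_def divide_simps) (simp_all add: algebra_simps)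
      have r: "(1 - (2 + t) * u) * (n * (n - q * b)) = n * (n - q * b) - (2 + t) * (n * n * u - n * b * (q * u))"
        by (simp add: algebra_simps)
      show ?thesis unfolding d p(2) Z_def[symmetric] r qu using A by (simp add: algebra_simps power2_eq_square)
    qed
    finally have L1: "(q - 2 - t) / q * (n * (n - q * b)) + (q + 1) * (q - 2 - t) * H
        + ((2 * t - (q + 2 + t) / q) * e^2 + (1 - t) * S') \<le> 0" using L by simp
    have pos: "q - 2 - t > 0" "q * b > 0" using t large A q by auto
    have e: "(2 * t - (q + 2 + t) / q) * e^2 + (1 - t) * S' \<ge> q / (q+1)^2 * S'"
    proof (cases "t = 0")
      case True thus ?thesis using t by auto
    next
      case False
      hence t2: "t = 1/2" "q \<ge> 5" using t large A by auto
      \<comment> \<open>The left side is \<open>- 5 / (2 * q)\<close>; this is where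
        \<open>q >= 5\<close> is needed.\<close>
      have c1: "2 * t - (q + 2 + t) / q \<ge> - (1/2)" using t2 q by (simp add: field_simps)
      have "e^2 \<le> (q^2 + 1) / (q + 1)^2 * S'" using cs A q by (simp add: field_simps)
      hence "- (1/2) * ((q^2 + 1) / (q + 1)^2 * S') \<le> - (1/2) * e^2" by simp
      also have "\<dots> \<le> (2 * t - (q + 2 + t) / q) * e^2" using c1 by (intro mult_right_mono) auto
      finally have "- (1/2) * ((q^2 + 1) / (q + 1)^2 * S') + 1/2 * S' \<le> (2 * t - (q + 2 + t) / q) * e^2 + (1 - t) * S'"
        by (simp add: t2(1))
      moreover have "- (1/2) * ((q^2 + 1) / (q + 1)^2 * S') + 1/2 * S' = q / (q+1)^2 * S'"
      proof -
        have "(q + 1)^2 \<noteq> 0" using q by simp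
        thus ?thesis by (simp add: divide_simps) (simp add: power2_eq_square algebra_simps)
      qed
      ultimately show ?thesis by simp
    qed
    have n0: "n * (n - q * b) \<ge> 0" using n pos by simp
    have t1: "(q - 2 - t) / q * (n * (n - q * b)) \<ge> 0" using n0 pos q by simp
    have t2: "(q + 1) * (q - 2 - t) * H \<ge> 0" using pos H0 q by simp
    have t3: "q / (q+1)^2 * S' \<ge> 0" using S'0 q by simp
    have "(q - 2 - t) / q * (n * (n - q * b)) = 0" "(q + 1) * (q - 2 - t) * H = 0" "q / (q+1)^2 * S' = 0"
      using L1 e t1 t2 t3 by linarith+
    thus ?thesis using pos q n by auto
  next
    assume A: "a = 0 \<and> b = q - 1 \<and> v = (q + 1)^2"
    have c: "b / q - b * (q + 1) / p = - 1 / q"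
    proof -
      have h: "b * (q + 1) / p = 1"
      proof -
        have "b = q - 1" using A by simp
        thus ?thesis using q unfolding p(2) by simp
      qed
      have bq: "b = q - 1" using A by simp
      show ?thesis unfolding h unfolding bq using q by (simp add: field_simps)
    qed
    have TT: "T = p * (n - H) + (q - 1) / q * (n^2 + e^2)" using A by (simp add: T_def)
    have "L = 2 * n^2 + 2 * t * e^2 + (1 + t) * (q - 1) * (n - H) + (1 - t) * S' - (p * (n - H) + (q - 1) / q * (n^2 + e^2))
      + (1 + t) * (- 1 / q * (n^2 + e^2))"
    proof -
      have aT: "- a * T / p = 0" using A by simp
      show ?thesis unfolding L_def c aT unfolding TT by (simp only: add_0_left)
    qed
    also have "\<dots> = (q - t) / q * (n * (n - q * b)) + (q - 1) * (q - t) * H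
        + (2 * t - (q + t) / q) * e^2 + (1 - t) * S'"
    proof -
      define u where "u = 1 / q"
      have qu: "q * u = 1" using q by (simp add: u_def)
      have d: "(q - 1) / q * (n^2 + e^2) = (n^2 + e^2) - (n^2 + e^2) * u" "- 1 / q = - u"
        "(q - t) / q = 1 - t * u" "(q + t) / q = 1 + t * u"
        using q by (simp_all add: u_def divide_simps) (simp_all add: algebra_simps)
      have r: "(1 - t * u) * (n * (n - q * b)) = n * (n - q * b) - t * (n * n * u - n * b * (q * u))"
        by (simp add: algebra_simps)
      have bq: "b = q - 1" using A by simp
      show ?thesis unfolding d p(2) r qu unfolding bq by (simp add: algebra_simps power2_eq_square)
    qed
    finally have L1: "(q - t) / q * (n * (n - q * b)) + (q - 1) * (q - t) * H
        + ((2 * t - (q + t) / q) * e^2 + (1 - t) * S') \<le> 0" using L by simp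
    have pos: "q - t > 0" "q * b > 0" using t A q by auto
    have e: "(2 * t - (q + t) / q) * e^2 + (1 - t) * S' \<ge> 1/4 * S'"
    proof (cases "t = 0")
      case True thus ?thesis using t by auto
    next
      case False
      hence t2: "t = 1/2" using t by auto
      have c1: "2 * t - (q + t) / q \<ge> - (1/4)" using t2 q by (simp add: field_simps)
      have "(q + 1)^2 * e^2 \<le> (q + 1)^2 * S'" using cs A by simp
      hence "e^2 \<le> S'" using q by (simp add: mult_le_cancel_left_pos)
      hence "- (1/4) * S' \<le> - (1/4) * e^2" by simp
      also have "\<dots> \<le> (2 * t - (q + t) / q) * e^2" using c1 by (intro mult_right_mono) auto
      finally have "- (1/4) * S' \<le> (2 * t - (q + t) / q) * e^2" .
      moreover have "(1 - t) * S' = 1/2 * S'" by (simp add: t2)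
      ultimately show ?thesis by linarith
    qed
    have n0: "n * (n - q * b) \<ge> 0" using n pos by simp
    have t1: "(q - t) / q * (n * (n - q * b)) \<ge> 0" using n0 pos q by simp
    have t2: "(q - 1) * (q - t) * H \<ge> 0" using pos H0 q by simp
    have "(q - t) / q * (n * (n - q * b)) = 0" "(q - 1) * (q - t) * H = 0" "1/4 * S' = 0"
      using L1 e t1 t2 S'0 by linarith+
    thus ?thesis using pos q n by auto
  qed
qed

section \<open>The ratio bound for intersecting families\<close>

context classed_circle_geometry begin

lemma sum_inc_sq:
  "(\<Sum>P\<in>pts. inc g P * inc g P) = (\<Sum>C\<in>circs. \<Sum>D\<in>circs. g C * g D * real (card (C \<inter> D)))"
proof -
  have "(\<Sum>P\<in>pts. inc g P * inc g P) = (\<Sum>C\<in>circs. g C * (\<Sum>P\<in>C. inc g P))" by (rule sum_inc)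
  also have "\<dots> = (\<Sum>C\<in>circs. \<Sum>D\<in>circs. g C * g D * real (card (C \<inter> D)))"
  proof (intro sum.cong refl)
    fix C assume C: "C \<in> circs"
    show "g C * (\<Sum>P\<in>C. inc g P) = (\<Sum>D\<in>circs. g C * g D * real (card (C \<inter> D)))"
      unfolding sum_Int_total[OF C, symmetric] sum_distrib_left by (simp only: mult.assoc)
  qed
  finally show ?thesis .
qed

text \<open>If two circles of the support meet, then \<open>card (C \<inter> D)\<close> is
  \<open>2\<close>, corrected by \<open>- 1\<close> for tangent circles and by \<open>q - 1\<close>
  for equal ones. The weights are arbitrary so that the count applies to the indicator function and
  to its product with \<open>eps\<close>.\<close>

lemma intersecting_count:
  assumes int: "\<And>C D. C \<in> circs \<Longrightarrow> D \<in> circs \<Longrightarrow> g C \<noteq> 0 \<Longrightarrow> g D \<noteq> 0 \<Longrightarrow> C \<inter> D \<noteq> {}"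
  shows "(\<Sum>P\<in>pts. inc g P * inc g P) + (\<Sum>C\<in>circs. g C * adj g C)
     = 2 * (total g)\<^sup>2 + (real q - 1) * (\<Sum>C\<in>circs. g C * g C)"
proof -
  have "(\<Sum>C\<in>circs. \<Sum>D\<in>circs. g C * g D * real (card (C \<inter> D)))
     = (\<Sum>C\<in>circs. 2 * g C * total g - g C * adj g C + (real q - 1) * (g C * g C))"
  proof (intro sum.cong refl)
    fix C assume C: "C \<in> circs"
    have "(\<Sum>D\<in>circs. g C * g D * real (card (C \<inter> D)))
      = (\<Sum>D\<in>circs. 2 * g C * g D - g C * (if tan C D then g D else 0) + (if D = C then (real q - 1) * (g C * g C) else 0))"
    proof (intro sum.cong refl)
      fix D assume D: "D \<in> circs"
      consider "g C = 0 \<or> g D = 0" | "C = D" | "C \<noteq> D" "tan C D" | "C \<noteq> D" "\<not> tan C D" "g C \<noteq> 0" "g D \<noteq> 0" by blast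
      thus "g C * g D * real (card (C \<inter> D)) = 2 * g C * g D - g C * (if tan C D then g D else 0) +
          (if D = C then (real q - 1) * (g C * g C) else 0)"
      proof cases
        case 2
        thus ?thesis using card_circ[OF C] by (simp add: tan_def algebra_simps)
      next
        case 3
        thus ?thesis by (simp add: tan_def)
      next
        case 4
        have "card (C \<inter> D) \<noteq> 0" using int[OF C D] 4 finite_circ[OF C] by simp
        moreover have "card (C \<inter> D) \<noteq> 1" using 4 by (simp add: tan_def)
        ultimately have "card (C \<inter> D) = 2" using card_Int_le[OF C D 4(1)] by linarith
        thus ?thesis using 4 by simp
      qed (auto simp: tan_def)
    qed
    also have "\<dots> = 2 * g C * total g - g C * (\<Sum>D\<in>circs. if tan C D then g D else 0) + (real q - 1) * (g C * g C)"
      using C finite_circs by (simp add: sum.distrib sum_subtractf sum_distrib_left)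
    also have "(\<Sum>D\<in>circs. if tan C D then g D else 0) = adj g C"
      unfolding adj_def using finite_circs by (simp add: sum.inter_filter)
    finally show "(\<Sum>D\<in>circs. g C * g D * real (card (C \<inter> D))) =
       2 * g C * total g - g C * adj g C + (real q - 1) * (g C * g C)" .
  qed
  also have "\<dots> = 2 * (total g)\<^sup>2 - (\<Sum>C\<in>circs. g C * adj g C) + (real q - 1) * (\<Sum>C\<in>circs. g C * g C)"
    by (simp add: sum.distrib sum_subtractf sum_distrib_left[symmetric] sum_distrib_right[symmetric] power2_eq_square)
  finally show ?thesis unfolding sum_inc_sq by simp
qed

text \<open>A ratio bound in the sense of Hoffman. In case of equality both the projection
  \<open>h\<close> and the twisted degrees \<open>gp\<close> vanish, which leaves the indicator as a
  constant plus a sum over the points of the circle.\<close>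

theorem intersecting_family_degree_one:
  assumes F: "F \<subseteq> circs" and int: "\<And>C D. C \<in> F \<Longrightarrow> D \<in> F \<Longrightarrow> C \<inter> D \<noteq> {}"
    and card_F: "card F \<ge> q * (q + 1 - \<rho>)"
    and large: "\<rho> = 0 \<Longrightarrow> q \<ge> 4" "\<And>C. \<rho> = 0 \<Longrightarrow> C \<in> circs \<Longrightarrow> eps C \<noteq> 0 \<Longrightarrow> q \<ge> 5"
  shows "card F = q * (q + 1 - \<rho>)"
    and "C \<in> circs \<Longrightarrow> (real q^2 - 1) * of_bool (C \<in> F) = (\<Sum>P\<in>C. real (card {D\<in>F. P \<in> D})) - b\<^sup>2"
proof -
  define f :: "'p set \<Rightarrow> real" where "f C = of_bool (C \<in> F)" for C
  define g where "g C = eps C * f C" for C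
  define fp where "fp = inc f"
  define gp where "gp = inc g"
  define n where "n = total f"
  define e where "e = total g"
  define p where "p = real q^2 - 1"
  \<comment> \<open>The constants are determined by the requirement that the pencil sums of
    \<open>h\<close> and of its product with \<open>eps\<close> vanish.\<close>
  define x0 where "x0 = - b * n / (real q * p)"
  define y0 where "y0 = - b * e / (real q * p)"
  define X where "X C = (\<Sum>P\<in>C. fp P)" for C
  define Y where "Y C = (\<Sum>P\<in>C. gp P)" for C
  define h where "h C = f C - (X C / p + x0) - eps C * (Y C / p + y0)" for C
  define S where "S = (\<Sum>P\<in>pts. fp P * fp P)"
  define S' where "S' = (\<Sum>P\<in>pts. gp P * gp P)"
  define \<tau> where "\<tau> = (\<Sum>C\<in>circs. f C * adj f C)"
  define H where "H = (\<Sum>C\<in>circs. h C * h C)"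
  define K where "K = (\<Sum>C\<in>circs. h C * adj h C)"
  have "3 * 3 \<le> real q * real q" using q_real by (intro mult_mono) auto
  hence p: "p > 0" by (simp add: p_def power2_eq_square)
  have n: "n = real (card F)"
    unfolding n_def f_def using F finite_circs by (simp add: of_bool_def sum.If_cases Int_absorb1 cong: if_cong)
  have ff: "f C * f C = f C" for C by (simp add: f_def)
  consider (zero) "\<And>C. C \<in> circs \<Longrightarrow> eps C = 0" | (one) "\<And>C. C \<in> circs \<Longrightarrow> eps C * eps C = 1"
    using eps_cases by fastforce
  note eps_split = this
  have ninc: "inc h P = 0" if P: "P \<in> pts" for P
  proof -
    have "inc h P = inc f P - inc (\<lambda>C. 1 / p * X C + x0) P - inc (\<lambda>C. eps C * (\<Sum>R\<in>C. gp R / p) + y0 * eps C) P"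
      unfolding h_def Y_def inc_linear(2)[symmetric]
      by (intro arg_cong2[where f = inc] refl ext) (simp add: sum_divide_distrib algebra_simps)
    also have "inc (\<lambda>C. eps C * (\<Sum>R\<in>C. gp R / p) + y0 * eps C) P = 0"
      unfolding inc_linear inc_eps_point_sums[OF P] inc_eps[OF P] by simp
    also have "inc (\<lambda>C. 1 / p * X C + x0) P = 1 / p * (p * fp P + b\<^sup>2 * n) + real q * b * x0"
      unfolding inc_linear X_def fp_def inc_point_sums[OF P] inc_const[OF P] p_def n_def ..
    also have "\<dots> = fp P"
      using p q_real by (simp add: x0_def field_simps power2_eq_square)
    finally show ?thesis by (simp add: fp_def)
  qed
  have ninc': "inc (\<lambda>D. eps D * h D) P = 0" if P: "P \<in> pts" for P
  proof (cases rule: eps_split)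
    case zero
    thus ?thesis by (simp add: inc_def)
  next
    case one
    have "inc (\<lambda>D. eps D * h D) P = inc (\<lambda>D. g D - (eps D * (\<Sum>R\<in>D. fp R / p) + x0 * eps D) - (1 / p * Y D + y0)) P"
      unfolding inc_def
    proof (intro sum.cong refl)
      fix D assume "D \<in> {D\<in>circs. P \<in> D}"
      hence e2: "eps D * eps D = 1" using one by blast
      have "eps D * h D = eps D * f D - (eps D * (X D / p) + x0 * eps D) - eps D * eps D * (Y D / p + y0)"
        by (simp add: h_def algebra_simps)
      thus "eps D * h D = g D - (eps D * (\<Sum>R\<in>D. fp R / p) + x0 * eps D) - (1 / p * Y D + y0)"
        unfolding e2 by (simp add: g_def X_def sum_divide_distrib)
    qed
    also have "\<dots> = inc g P - (0 + x0 * 0) - (1 / p * (p * gp P + b\<^sup>2 * e) + real q * b * y0)"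
      unfolding inc_linear Y_def gp_def inc_point_sums[OF P] inc_const[OF P] p_def e_def
        inc_eps_point_sums[OF P] inc_eps[OF P] ..
    also have "\<dots> = 0"
      using p q_real by (simp add: y0_def gp_def field_simps power2_eq_square)
    finally show ?thesis .
  qed
  have "(real q + 1) * total h = 0" "(real q + 1) * total (\<lambda>D. eps D * h D) = 0"
    using sum_inc1[of h] sum_inc1[of "\<lambda>D. eps D * h D"] ninc ninc' by simp_all
  hence toth: "total h = 0" "total (\<lambda>D. eps D * h D) = 0" using q_real by auto
  \<comment> \<open>The function subtracted from \<open>f\<close> in \<open>h\<close> has this
    shape, and by \<open>adjstr\<close> so has its image under \<open>adj\<close>. Hence one factor
    \<open>h\<close> in \<open>H\<close> and in \<open>K\<close> may be replaced by
    \<open>f\<close>.\<close>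
  have orth: "(\<Sum>C\<in>circs. h C * (x + (\<Sum>P\<in>C. u P) + eps C * (y + (\<Sum>P\<in>C. v P)))) = 0" for x y u v
  proof -
    have "(\<Sum>C\<in>circs. h C * (x + (\<Sum>P\<in>C. u P) + eps C * (y + (\<Sum>P\<in>C. v P)))) =
       x * total h + (\<Sum>C\<in>circs. h C * (\<Sum>P\<in>C. u P)) + y * total (\<lambda>C. eps C * h C)
       + (\<Sum>C\<in>circs. (eps C * h C) * (\<Sum>P\<in>C. v P))"
      unfolding sum_distrib_left[of x] sum_distrib_left[of y] sum.distrib[symmetric]
      by (intro sum.cong refl) (simp add: algebra_simps)
    also have "\<dots> = 0" unfolding sum_inc[symmetric] toth using ninc ninc' by simp
    finally show ?thesis .
  qed
  have heq: "h C = f C - (x0 + (\<Sum>P\<in>C. fp P / p) + eps C * (y0 + (\<Sum>P\<in>C. gp P / p)))" for C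
    by (simp add: h_def X_def Y_def sum_divide_distrib algebra_simps)
  have fX: "(\<Sum>C\<in>circs. f C * (\<Sum>P\<in>C. fp P / p)) = S / p"
    unfolding sum_inc[symmetric] by (simp add: S_def fp_def sum_divide_distrib)
  have fY: "(\<Sum>C\<in>circs. f C * (eps C * (\<Sum>P\<in>C. gp P / p))) = S' / p"
  proof -
    have "(\<Sum>C\<in>circs. f C * (eps C * (\<Sum>P\<in>C. gp P / p))) = (\<Sum>C\<in>circs. g C * (\<Sum>P\<in>C. gp P / p))"
      by (intro sum.cong refl) (simp add: g_def)
    thus ?thesis unfolding sum_inc[symmetric] by (simp add: S'_def gp_def sum_divide_distrib)
  qed
  have H1: "H = n - (S + S') / p + b / (real q * p) * (n\<^sup>2 + e\<^sup>2)"
  proof -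
    have "H = (\<Sum>C\<in>circs. h C * f C) - (\<Sum>C\<in>circs. h C * (x0 + (\<Sum>P\<in>C. fp P / p) + eps C * (y0 + (\<Sum>P\<in>C. gp P / p))))"
      unfolding H_def sum_subtractf[symmetric]
      by (intro sum.cong refl) (subst (2) heq, simp add: algebra_simps)
    also have "\<dots> = (\<Sum>C\<in>circs. h C * f C)" unfolding orth by simp
    also have "\<dots> = (\<Sum>C\<in>circs. f C - x0 * f C - f C * (\<Sum>P\<in>C. fp P / p) - y0 * g C - f C * (eps C * (\<Sum>P\<in>C. gp P / p)))"
    proof (intro sum.cong refl)
      fix C
      have "h C * f C = f C * f C - x0 * f C - f C * (\<Sum>P\<in>C. fp P / p) - y0 * g C - f C * (eps C * (\<Sum>P\<in>C. gp P / p))"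
        unfolding heq g_def by (simp add: algebra_simps)
      thus "h C * f C = f C - x0 * f C - f C * (\<Sum>P\<in>C. fp P / p) - y0 * g C - f C * (eps C * (\<Sum>P\<in>C. gp P / p))"
        unfolding ff .
    qed
    also have "\<dots> = n - x0 * n - S / p - y0 * e - S' / p"
      unfolding sum_subtractf fX fY n_def e_def by (simp only: sum_distrib_left[symmetric])
    also have "\<dots> = n - (S + S') / p + b / (real q * p) * (n\<^sup>2 + e\<^sup>2)"
      by (simp add: x0_def y0_def power2_eq_square add_divide_distrib algebra_simps)
    finally show ?thesis .
  qed
  have adjstr: "adj (\<lambda>C. x + (\<Sum>P\<in>C. u P) + eps C * (y + (\<Sum>P\<in>C. v P))) C =
      (p * x + b * sum u pts) + (\<Sum>P\<in>C. a * u P) + eps C * ((p * y + b * sum v pts) + (\<Sum>P\<in>C. a * v P))"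
    if C: "C \<in> circs" for x y u v C
    unfolding adj_linear adj_eps[OF C] adj_const[OF C] adj_point_sums[OF C]
    by (simp add: p_def sum_distrib_left algebra_simps)
  have adjh: "adj h C = adj f C - ((p * x0 + b * (\<Sum>P\<in>pts. fp P / p)) + (\<Sum>P\<in>C. a * (fp P / p)) +
      eps C * ((p * y0 + b * (\<Sum>P\<in>pts. gp P / p)) + (\<Sum>P\<in>C. a * (gp P / p))))" if C: "C \<in> circs" for C
    unfolding adjstr[OF C, symmetric] adj_linear(2)[symmetric]
    by (intro arg_cong2[where f = adj] refl ext heq)
  have sfp: "(\<Sum>P\<in>pts. fp P / p) = (real q + 1) * n / p"
    using sum_inc1[of f] by (simp add: fp_def n_def sum_divide_distrib[symmetric])
  have sgp: "(\<Sum>P\<in>pts. gp P / p) = (real q + 1) * e / p"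
    using sum_inc1[of g] by (simp add: gp_def e_def sum_divide_distrib[symmetric])
  have K1: "K = \<tau> - (a * (S + S') + b * (real q + 1) * (n\<^sup>2 + e\<^sup>2)) / p + b / real q * (n\<^sup>2 + e\<^sup>2)"
  proof -
    have "K = (\<Sum>C\<in>circs. h C * adj f C) - (\<Sum>C\<in>circs. h C * ((p * x0 + b * (\<Sum>P\<in>pts. fp P / p)) + (\<Sum>P\<in>C. a * (fp P / p)) +
      eps C * ((p * y0 + b * (\<Sum>P\<in>pts. gp P / p)) + (\<Sum>P\<in>C. a * (gp P / p)))))"
      unfolding K_def sum_subtractf[symmetric]
      by (intro sum.cong refl) (simp only: adjh right_diff_distrib)
    also have "\<dots> = (\<Sum>C\<in>circs. h C * adj f C)" unfolding orth by simp
    also have "\<dots> = (\<Sum>C\<in>circs. f C * adj h C)" by (rule adj_sym)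
    also have "\<dots> = (\<Sum>C\<in>circs. f C * adj f C - (p * x0 + b * (\<Sum>P\<in>pts. fp P / p)) * f C - a * (f C * (\<Sum>P\<in>C. fp P / p))
       - (p * y0 + b * (\<Sum>P\<in>pts. gp P / p)) * g C - a * (f C * (eps C * (\<Sum>P\<in>C. gp P / p))))"
      by (intro sum.cong refl) (simp only: adjh g_def sum_distrib_left[symmetric], simp add: algebra_simps)
    also have "\<dots> = \<tau> - (p * x0 + b * (\<Sum>P\<in>pts. fp P / p)) * n - a * (S / p)
       - (p * y0 + b * (\<Sum>P\<in>pts. gp P / p)) * e - a * (S' / p)"
      unfolding sum_subtractf sum_distrib_left[symmetric] fX fY n_def[symmetric] e_def[symmetric] \<tau>_def[symmetric] ..
    also have "\<dots> = \<tau> - (a * (S + S') + b * (real q + 1) * (n\<^sup>2 + e\<^sup>2)) / p + b / real q * (n\<^sup>2 + e\<^sup>2)"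
    proof -
      have "p * x0 = - b / real q * n" "p * y0 = - b / real q * e" using p by (simp_all add: x0_def y0_def)
      thus ?thesis unfolding sfp sgp by (simp add: power2_eq_square add_divide_distrib algebra_simps)
    qed
    finally show ?thesis .
  qed
  have psd: "K \<le> (real q - 1) * H"
    unfolding K_def H_def by (rule inc_psd[OF ninc ninc'])
  have H0: "H \<ge> 0" unfolding H_def by (intro sum_nonneg) simp
  have i: "S + \<tau> = 2 * n\<^sup>2 + (real q - 1) * n"
  proof -
    have "S + \<tau> = 2 * (total f)\<^sup>2 + (real q - 1) * (\<Sum>C\<in>circs. f C * f C)"
      unfolding S_def \<tau>_def fp_def by (rule intersecting_count) (use int in \<open>auto simp: f_def\<close>)
    thus ?thesis unfolding ff n_def .
  qed
  \<comment> \<open>The weight of the second count. If \<open>eps\<close> does not vanish, then with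
    weight \<open>0\<close> the terms in \<open>e\<close> and \<open>S'\<close> need not be
    nonnegative in a Moebius plane, and with weight \<open>1\<close> the coefficient of
    \<open>S'\<close> would be zero, so that \<open>S' = 0\<close> could not be read off.\<close>
  define t :: real where "t = (if \<forall>C\<in>circs. eps C = 0 then 0 else 1/2)"
  have tcase: "(t = 0 \<and> e = 0 \<and> S' = 0) \<or> (t = 1/2 \<and> S' + \<tau> = 2 * e\<^sup>2 + (real q - 1) * n)"
  proof (cases "\<forall>C\<in>circs. eps C = 0")
    case True
    hence "e = 0" by (simp add: e_def g_def)
    moreover have "gp P = 0" for P using True by (simp add: gp_def g_def inc_def)
    ultimately show ?thesis using True by (simp add: t_def S'_def)
  next
    case False
    hence sq: "\<And>C. C \<in> circs \<Longrightarrow> eps C * eps C = 1" using eps_cases by fastforce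
    have 1: "S' + (\<Sum>C\<in>circs. g C * adj g C) = 2 * (total g)\<^sup>2 + (real q - 1) * (\<Sum>C\<in>circs. g C * g C)"
      unfolding S'_def gp_def by (rule intersecting_count) (use int in \<open>auto simp: g_def f_def\<close>)
    have 2: "(\<Sum>C\<in>circs. g C * g C) = n" unfolding n_def
    proof (intro sum.cong refl)
      fix C assume "C \<in> circs"
      have "g C * g C = (eps C * eps C) * (f C * f C)" by (simp add: g_def)
      thus "g C * g C = f C" using sq[OF \<open>C \<in> circs\<close>] ff by simp
    qed
    have 3: "(\<Sum>C\<in>circs. g C * adj g C) = \<tau>" unfolding \<tau>_def
    proof (intro sum.cong refl)
      fix C assume C: "C \<in> circs"
      have "adj g C = eps C * adj f C" unfolding g_def by (rule adj_eps[OF C])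
      hence "g C * adj g C = (eps C * eps C) * (f C * adj f C)" by (simp add: g_def)
      thus "g C * adj g C = f C * adj f C" using sq[OF C] by simp
    qed
    have "t = 1/2" using False by (simp only: t_def if_False)
    thus ?thesis using 1 2 3 by (simp add: e_def)
  qed
  define v where "v = real (card pts)"
  have v: "(a = -2 \<and> b = real q + 1 \<and> v = (real q)\<^sup>2 + 1) \<or> (a = 0 \<and> b = real q - 1 \<and> v = (real q + 1)\<^sup>2)"
    using rho
  proof
    assume r: "\<rho> = 0"
    have "card pts * (q + 1) = (q\<^sup>2 + 1) * (q + 1)" using card_pts r by (simp add: mult.commute)
    hence "card pts = q\<^sup>2 + 1" unfolding mult_cancel2 by simp
    moreover have "a = -2" "b = real q + 1" using r a_def b_def by simp_all
    ultimately show ?thesis by (simp add: v_def)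
  next
    assume r: "\<rho> = 2"
    have "card pts * (q - 1) = (q + 1) * (q\<^sup>2 - 1)" using card_pts r q_ge_3 by (simp add: numeral_2_eq_2)
    also have "q\<^sup>2 - 1 = (q + 1) * (q - 1)" by (simp add: power2_eq_square algebra_simps)
    finally have "card pts * (q - 1) = (q + 1) * (q + 1) * (q - 1)" by (simp only: mult.assoc)
    hence "card pts = (q + 1) * (q + 1)" unfolding mult_cancel2 using q_ge_3 by simp
    moreover have "a = 0" "b = real q - 1" using r a_def b_def by simp_all
    ultimately show ?thesis by (simp add: v_def power2_eq_square algebra_simps)
  qed
  have cs: "(real q + 1)\<^sup>2 * e\<^sup>2 \<le> v * S'"
  proof -
    have "((real q + 1) * e)\<^sup>2 = (\<Sum>P\<in>pts. gp P)\<^sup>2" using sum_inc1[of g] by (simp add: gp_def e_def)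
    also have "\<dots> \<le> (\<Sum>P\<in>pts. (gp P)\<^sup>2) * card pts" by (rule sum_squared_le_sum_of_squares)
    finally show ?thesis by (simp add: v_def S'_def power2_eq_square algebra_simps)
  qed
  have nge: "n \<ge> real q * b" using card_F unfolding n b_nat by (metis of_nat_le_iff of_nat_mult)
  have al: "real q \<ge> 4" if "a = -2" using that large by (simp add: a_def)
  have al5: "real q \<ge> 5" if x: "a = -2" "t = 1/2"
  proof -
    have "\<rho> = 0" using x(1) by (simp add: a_def)
    moreover obtain C where "C \<in> circs" "eps C \<noteq> 0" using x(2) unfolding t_def by (auto split: if_splits)
    ultimately have "q \<ge> 5" using large(2) by blast
    thus ?thesis by simp
  qed
  have res: "n = real q * b \<and> H = 0 \<and> S' = 0"
    by (rule ratio_bound_arith[OF q_real v tcase al al5 i H1[unfolded p_def] K1[unfolded p_def] psd H0 nge cs])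
  show "card F = q * (q + 1 - \<rho>)"
    using res unfolding n b_nat by (metis of_nat_eq_iff of_nat_mult)
  have h0: "h C = 0" if "C \<in> circs" for C
    using res that finite_circs unfolding H_def by (simp add: sum_nonneg_eq_0_iff)
  have gp0: "gp P = 0" if "P \<in> pts" for P
    using res that finite_pts unfolding S'_def by (simp add: sum_nonneg_eq_0_iff)
  have "(real q + 1) * e = 0" using sum_inc1[of g] gp0 by (simp add: gp_def e_def)
  hence e0: "e = 0" using q_real by simp
  assume C: "C \<in> circs"
  have "Y C = 0" unfolding Y_def using gp0 circ_sub[OF C] by (intro sum.neutral) auto
  hence "f C = X C / p + x0" using h0[OF C] by (simp add: h_def y0_def e0)
  hence "p * f C = X C + p * x0" using p by (simp add: field_simps)
  also have "p * x0 = - b\<^sup>2" using p q_real res by (simp add: x0_def power2_eq_square)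
  also have "X C = (\<Sum>P\<in>C. real (card {D\<in>F. P \<in> D}))"
    unfolding X_def
  proof (intro sum.cong refl)
    fix P
    have "fp P = (\<Sum>D\<in>{D\<in>circs. P \<in> D}. if D \<in> F then 1 else 0)" by (simp add: fp_def inc_def f_def of_bool_def)
    also have "\<dots> = real (card ({D\<in>circs. P \<in> D} \<inter> F))" using finite_circs by (simp add: sum.If_cases)
    also have "{D\<in>circs. P \<in> D} \<inter> F = {D\<in>F. P \<in> D}" using F by blast
    finally show "fp P = real (card {D\<in>F. P \<in> D})" .
  qed
  finally show "(real q^2 - 1) * of_bool (C \<in> F) = (\<Sum>P\<in>C. real (card {D\<in>F. P \<in> D})) - b\<^sup>2"
    by (simp add: p_def f_def)
qed

end

section \<open>Moebius planes\<close>

context circle_geometry begin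

text \<open>Since \<open>f\<close> is idempotent, \<open>f D\<close> may be written as
  \<open>f D * f D\<close> in the sum over the circles through \<open>P\<close>, and one factor
  expanded by \<open>f\<close>. The sums of \<open>f\<close> over the circles through
  \<open>P\<close> and \<open>R\<close> that remain are known, because each point not parallel to
  these two lies on exactly one such circle.\<close>

lemma degree_one_pointwise:
  fixes f :: "'p set \<Rightarrow> real"
  assumes f: "\<And>C. C \<in> circs \<Longrightarrow> f C = \<kappa> + (\<Sum>R\<in>C. x R)" and idem: "\<And>C. f C * f C = f C"
    and P: "P \<in> pts"
  shows "(\<Sum>D\<in>{D\<in>circs. P \<in> D}. f D) * (1 - \<kappa> - x P) =
    (\<Sum>R\<in>{R\<in>pts. R \<noteq> P \<and> \<not> par P R}. x R * ((real q + 1 - real \<rho>) * (\<kappa> + x P + x R)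
      + (\<Sum>T\<in>{T\<in>pts. T \<noteq> P \<and> T \<noteq> R \<and> \<not> par P T \<and> \<not> par R T}. x T)))"
proof -
  let ?D = "{D\<in>circs. P \<in> D}"
  let ?A = "{R\<in>pts. R \<noteq> P \<and> \<not> par P R}"
  define s where "s = (\<Sum>D\<in>?D. f D)"
  have bn: "real (q + 1 - \<rho>) = real q + 1 - real \<rho>" using rho q_ge_3 by auto
  have fin: "finite ?D" "finite ?A" using finite_circs finite_pts by auto
  have pair: "(\<Sum>D\<in>{D\<in>?D. R \<in> D}. f D) = (real q + 1 - real \<rho>) * (\<kappa> + x P + x R)
      + (\<Sum>T\<in>{T\<in>pts. T \<noteq> P \<and> T \<noteq> R \<and> \<not> par P T \<and> \<not> par R T}. x T)" if R: "R \<in> ?A" for R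
  proof -
    let ?B = "{D\<in>?D. R \<in> D}"
    let ?T = "{T\<in>pts. T \<noteq> P \<and> T \<noteq> R \<and> \<not> par P T \<and> \<not> par R T}"
    have cB: "card ?B = q + 1 - \<rho>"
      using card_through2[of P R] R P by auto
    have "(\<Sum>D\<in>?B. f D) = (\<Sum>D\<in>?B. (\<kappa> + x P + x R) + (\<Sum>T\<in>{T\<in>?T. T \<in> D}. x T))"
    proof (intro sum.cong refl)
      fix D assume "D \<in> ?B"
      hence D: "D \<in> circs" "P \<in> D" "R \<in> D" by auto
      have "{T\<in>?T. T \<in> D} = D - {P} - {R}"
        using circ_sub[OF D(1)] circ_not_par[OF D(1,2)] circ_not_par[OF D(1,3)] by auto
      moreover have "(\<Sum>T\<in>D. x T) = x P + (x R + (\<Sum>T\<in>D - {P} - {R}. x T))"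
        using D R finite_circ[OF D(1)] by (subst sum.remove[of D P], simp, simp) (subst sum.remove[of "D - {P}" R], auto)
      ultimately show "f D = (\<kappa> + x P + x R) + (\<Sum>T\<in>{T\<in>?T. T \<in> D}. x T)"
        unfolding f[OF D(1)] by simp
    qed
    also have "\<dots> = real (q + 1 - \<rho>) * (\<kappa> + x P + x R) + (\<Sum>D\<in>?B. \<Sum>T\<in>{T\<in>?T. T \<in> D}. x T)"
      by (simp only: sum.distrib sum_constant cB distrib_left)
    also have "(\<Sum>D\<in>?B. \<Sum>T\<in>{T\<in>?T. T \<in> D}. x T) = (\<Sum>T\<in>?T. \<Sum>D\<in>{D\<in>?B. T \<in> D}. x T)"
      by (rule sum.swap_restrict) (use finite_circs finite_pts in auto)
    also have "\<dots> = (\<Sum>T\<in>?T. x T)"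
    proof (intro sum.cong refl)
      fix T assume T: "T \<in> ?T"
      have "\<exists>!C. C \<in> circs \<and> P \<in> C \<and> R \<in> C \<and> T \<in> C"
        by (rule three) (use P R T in auto)
      then obtain C where "{D\<in>?B. T \<in> D} = {C}" by blast
      thus "(\<Sum>D\<in>{D\<in>?B. T \<in> D}. x T) = x T" by (simp only: sum.insert sum.empty finite.emptyI empty_iff not_False_eq_True add_0_right)
    qed
    finally show ?thesis unfolding bn .
  qed
  have "s = (\<Sum>D\<in>?D. (\<kappa> + x P) * f D + (\<Sum>R\<in>{R\<in>?A. R \<in> D}. f D * x R))"
    unfolding s_def
  proof (intro sum.cong refl)
    fix D assume "D \<in> ?D"
    hence D: "D \<in> circs" "P \<in> D" by auto
    have "{R\<in>?A. R \<in> D} = D - {P}" using circ_sub[OF D(1)] circ_not_par[OF D] by auto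
    moreover have "f D = f D * (\<kappa> + (x P + (\<Sum>R\<in>D - {P}. x R)))"
      using f[OF D(1)] idem[of D] sum.remove[OF finite_circ[OF D(1)] D(2), of x] by simp
    ultimately show "f D = (\<kappa> + x P) * f D + (\<Sum>R\<in>{R\<in>?A. R \<in> D}. f D * x R)"
      unfolding sum_distrib_left[symmetric] by (simp add: algebra_simps)
  qed
  also have "\<dots> = (\<kappa> + x P) * s + (\<Sum>D\<in>?D. \<Sum>R\<in>{R\<in>?A. R \<in> D}. f D * x R)"
    by (simp add: sum.distrib s_def sum_distrib_left)
  also have "(\<Sum>D\<in>?D. \<Sum>R\<in>{R\<in>?A. R \<in> D}. f D * x R) = (\<Sum>R\<in>?A. \<Sum>D\<in>{D\<in>?D. R \<in> D}. f D * x R)"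
    by (rule sum.swap_restrict) (use fin in auto)
  also have "\<dots> = (\<Sum>R\<in>?A. x R * (\<Sum>D\<in>{D\<in>?D. R \<in> D}. f D))"
    by (simp add: sum_distrib_right[symmetric] mult.commute)
  also have "\<dots> = (\<Sum>R\<in>?A. x R * ((real q + 1 - real \<rho>) * (\<kappa> + x P + x R)
      + (\<Sum>T\<in>{T\<in>pts. T \<noteq> P \<and> T \<noteq> R \<and> \<not> par P T \<and> \<not> par R T}. x T)))"
    by (intro sum.cong refl) (use pair in auto)
  finally show ?thesis unfolding s_def[symmetric] by (simp add: algebra_simps)
qed

end

context classed_circle_geometry begin

lemma through_eq_if_full:
  assumes F: "F \<subseteq> circs" "card F = q * (q + 1 - \<rho>)" and P: "P \<in> pts"
    and full: "card {D\<in>F. P \<in> D} \<ge> q * (q + 1 - \<rho>)"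
  shows "F = {C\<in>circs. P \<in> C}"
proof -
  have finF: "finite F" using F finite_circs finite_subset by blast
  have 1: "{D\<in>F. P \<in> D} = F"
    by (rule card_seteq) (use F full finF in auto)
  have "F \<subseteq> {C\<in>circs. P \<in> C}" using F(1) 1 by blast
  thus ?thesis using finite_circs F(2) card_through[OF P] by (intro card_seteq) auto
qed

text \<open>Let \<open>f P\<close> be the number of circles of the family through \<open>P\<close>. The numbers
  \<open>x = (f P - (q + 1)) / (q\<^sup>2 - 1)\<close> satisfy \<open>x (1 - x) = 0\<close> and have sum \<open>1\<close>.\<close>

theorem moebius_intersecting_family:
  assumes moebius: "\<rho> = 0" "\<And>P R. \<not> par P R"
    and F: "F \<subseteq> circs" and int: "\<And>C D. C \<in> F \<Longrightarrow> D \<in> F \<Longrightarrow> C \<inter> D \<noteq> {}"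
    and card_F: "card F \<ge> q * (q + 1 - \<rho>)"
    and large: "q \<ge> 4" "\<And>C. C \<in> circs \<Longrightarrow> eps C \<noteq> 0 \<Longrightarrow> q \<ge> 5"
  shows "\<exists>P\<in>pts. F = {C\<in>circs. P \<in> C}"
proof -
  have deg: "card F = q * (q + 1 - \<rho>)"
    "\<And>C. C \<in> circs \<Longrightarrow> (real q^2 - 1) * of_bool (C \<in> F) = (\<Sum>P\<in>C. real (card {D\<in>F. P \<in> D})) - b\<^sup>2"
    by (rule intersecting_family_degree_one[OF F int card_F]; use large in blast)+
  define p where "p = real q^2 - 1"
  have "4 * 4 \<le> real q * real q" using large by (intro mult_mono) auto
  hence p: "p > 0" by (simp add: p_def power2_eq_square)
  define f :: "'p set \<Rightarrow> real" where "f C = of_bool (C \<in> F)" for C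
  define fp where "fp P = real (card {D\<in>F. P \<in> D})" for P
  \<comment> \<open>The shift by \<open>q + 1\<close> at each of the \<open>q + 1\<close> points of
    a circle absorbs the constant \<open>b\<^sup>2 = (q + 1)\<^sup>2\<close>, so the constant term
    in \<open>fx\<close> is zero.\<close>
  define x where "x P = (fp P - (real q + 1)) / p" for P
  have n: "total f = real q * (real q + 1)"
    unfolding f_def using F finite_circs deg(1) moebius
    by (simp add: of_bool_def sum.If_cases Int_absorb1 algebra_simps cong: if_cong)
  have incf: "inc f P = fp P" for P
  proof -
    have "{D\<in>circs. P \<in> D} \<inter> F = {D\<in>F. P \<in> D}" using F by blast
    thus ?thesis unfolding inc_def f_def fp_def using finite_circs by (simp add: of_bool_def sum.If_cases)
  qed
  have b: "b = real q + 1" using moebius b_def by simp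
  have fx: "f C = 0 + (\<Sum>R\<in>C. x R)" if C: "C \<in> circs" for C
  proof -
    have "(\<Sum>R\<in>C. x R) = ((\<Sum>R\<in>C. fp R) - (real q + 1) * (real q + 1)) / p"
      unfolding x_def sum_divide_distrib[symmetric] using card_circ[OF C] by (simp add: sum_subtractf)
    also have "(\<Sum>R\<in>C. fp R) - (real q + 1) * (real q + 1) = p * f C"
      using deg(2)[OF C] by (simp add: f_def fp_def p_def b power2_eq_square)
    also have "p * f C / p = f C" using p by simp
    finally show ?thesis by simp
  qed
  have idem: "f C * f C = f C" for C by (simp add: f_def)
  have fpx: "fp P = p * x P + (real q + 1)" for P using p by (simp add: x_def)
  have cp: "card pts = q\<^sup>2 + 1"
  proof -
    have "card pts * (q + 1) = (q\<^sup>2 + 1) * (q + 1)" using card_pts moebius by (simp add: mult.commute)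
    thus ?thesis unfolding mult_cancel2 by simp
  qed
  have s1: "(\<Sum>P\<in>pts. x P) = 1"
  proof -
    have "(\<Sum>P\<in>pts. fp P) = (real q + 1) * (real q * (real q + 1))"
      using sum_inc1[of f] n by (simp add: incf)
    moreover have "(\<Sum>P\<in>pts. fp P) = p * (\<Sum>P\<in>pts. x P) + (real q^2 + 1) * (real q + 1)"
      unfolding fpx sum.distrib sum_distrib_left using cp by (simp add: algebra_simps)
    ultimately have "p * (\<Sum>P\<in>pts. x P) = p * 1" by (simp add: p_def power2_eq_square algebra_simps)
    thus ?thesis using p by simp
  qed
  \<comment> \<open>After exchanging the summations, the sum of \<open>x P * fp P\<close> is the sum
    of \<open>f C * f C\<close>, which is the sum of \<open>f C\<close>.\<close>
  have s2: "(\<Sum>P\<in>pts. x P * x P) = 1"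
  proof -
    have "(\<Sum>P\<in>pts. x P * fp P) = total f"
      unfolding incf[symmetric] sum_inc by (intro sum.cong refl) (metis fx idem add_0)
    moreover have "(\<Sum>P\<in>pts. x P * fp P) = p * (\<Sum>P\<in>pts. x P * x P) + (real q + 1) * (\<Sum>P\<in>pts. x P)"
      unfolding fpx sum_distrib_left sum.distrib[symmetric] by (intro sum.cong refl) (simp add: algebra_simps)
    ultimately have "p * (\<Sum>P\<in>pts. x P * x P) = p * 1" using n s1 by (simp add: p_def power2_eq_square algebra_simps)
    thus ?thesis using p by simp
  qed
  have x01: "x P = 0 \<or> x P = 1" if P: "P \<in> pts" for P
  proof -
    let ?A = "{R\<in>pts. R \<noteq> P \<and> \<not> par P R}"
    have A: "?A = pts - {P}" using moebius by auto
    have a1: "(\<Sum>R\<in>?A. x R) = 1 - x P" "(\<Sum>R\<in>?A. x R * x R) = 1 - x P * x P"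
      unfolding A using P finite_pts s1 s2 by (simp_all add: sum_diff1)
    have "fp P * (1 - 0 - x P) = (\<Sum>R\<in>?A. x R * ((real q + 1 - real \<rho>) * (0 + x P + x R)
      + (\<Sum>T\<in>{T\<in>pts. T \<noteq> P \<and> T \<noteq> R \<and> \<not> par P T \<and> \<not> par R T}. x T)))"
      unfolding incf[symmetric] inc_def by (rule degree_one_pointwise[OF fx idem P])
    also have "\<dots> = (\<Sum>R\<in>?A. x R * (1 + real q * x P) + real q * (x R * x R))"
    proof (intro sum.cong refl)
      fix R assume R: "R \<in> ?A"
      have "{T\<in>pts. T \<noteq> P \<and> T \<noteq> R \<and> \<not> par P T \<and> \<not> par R T} = pts - {P} - {R}" using moebius by auto
      hence e: "(\<Sum>T\<in>{T\<in>pts. T \<noteq> P \<and> T \<noteq> R \<and> \<not> par P T \<and> \<not> par R T}. x T) = 1 - x P - x R"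
        using R P finite_pts s1 by (simp add: sum_diff1)
      show "x R * ((real q + 1 - real \<rho>) * (0 + x P + x R)
        + (\<Sum>T\<in>{T\<in>pts. T \<noteq> P \<and> T \<noteq> R \<and> \<not> par P T \<and> \<not> par R T}. x T)) =
        x R * (1 + real q * x P) + real q * (x R * x R)"
        unfolding e using moebius(1) by (simp add: algebra_simps)
    qed
    also have "\<dots> = (1 - x P) * (1 + real q * x P) + real q * (1 - x P * x P)"
      unfolding sum.distrib sum_distrib_left[symmetric] sum_distrib_right[symmetric] a1 ..
    finally have "(1 - x P) * x P * (real q * (real q - 2) - 1) = 0"
      unfolding fpx p_def by (simp add: power2_eq_square algebra_simps)
    moreover have "real q * (real q - 2) \<ge> 4 * 2" using large by (intro mult_mono) auto
    ultimately show ?thesis by auto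
  qed
  have "\<exists>P\<in>pts. x P \<noteq> 0"
  proof (rule ccontr)
    assume "\<not> ?thesis"
    hence "(\<Sum>P\<in>pts. x P) = 0" by simp
    thus False using s1 by simp
  qed
  then obtain P where P: "P \<in> pts" "x P = 1" using x01 by blast
  have "fp P = real (q * (q + 1 - \<rho>))" using fpx[of P] P moebius by (simp add: p_def power2_eq_square algebra_simps)
  hence "card {D\<in>F. P \<in> D} = q * (q + 1 - \<rho>)" unfolding fp_def of_nat_eq_iff .
  hence "F = {C\<in>circs. P \<in> C}" by (intro through_eq_if_full[OF F deg(1) P(1)]) auto
  thus ?thesis using P by blast
qed

end

section \<open>Minkowski planes\<close>

lemma sum_fst_eq:
  assumes "finite I" "finite J" "i \<in> I"
  shows "(\<Sum>P\<in>I \<times> J. of_bool (fst P = i) * g P) = (\<Sum>j\<in>J. (g (i, j) :: real))"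
proof -
  have "(\<Sum>P\<in>I \<times> J. of_bool (fst P = i) * g P) = (\<Sum>P\<in>{i} \<times> J. g P)"
    by (rule sum.mono_neutral_cong_right) (use assms in auto)
  thus ?thesis by (simp add: sum.cartesian_product')
qed

lemma sum_snd_eq:
  assumes "finite I" "finite J" "j \<in> J"
  shows "(\<Sum>P\<in>I \<times> J. of_bool (snd P = j) * g P) = (\<Sum>i\<in>I. (g (i, j) :: real))"
proof -
  have "(\<Sum>P\<in>I \<times> J. of_bool (snd P = j) * g P) = (\<Sum>P\<in>I \<times> {j}. g P)"
    by (rule sum.mono_neutral_cong_right) (use assms in auto)
  thus ?thesis by (simp add: sum.cartesian_product')
qed

text \<open>The scaled deviation \<open>W\<close> of the point degrees from their mean lies between \<open>- q\<close> and \<open>q\<^sup>2\<close>, has mean square \<open>q\<^sup>2\<close>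
  and satisfies \<open>(W - q\<^sup>2) ((q - 2) W - q) \<ge> 0\<close>. If it is always less than \<open>q\<^sup>2\<close>, then its only values are \<open>q\<close>
  and \<open>- q\<close>, which is impossible.\<close>

theorem minkowski_intersecting_family:
  fixes I :: "'i set" and J :: "'j set"
  assumes geo: "classed_circle_geometry (I \<times> J) circs (\<lambda>P R. fst P = fst R \<or> snd P = snd R) q 2 eps"
    and IJ: "card I = q + 1" "card J = q + 1"
    and row: "\<And>C i. C \<in> circs \<Longrightarrow> i \<in> I \<Longrightarrow> \<exists>!j. (i, j) \<in> C"
    and col: "\<And>C j. C \<in> circs \<Longrightarrow> j \<in> J \<Longrightarrow> \<exists>!i. (i, j) \<in> C"
    and F: "F \<subseteq> circs" and int: "\<And>C D. C \<in> F \<Longrightarrow> D \<in> F \<Longrightarrow> C \<inter> D \<noteq> {}"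
    and card_F: "card F \<ge> q * (q - 1)"
  shows "\<exists>P\<in>I \<times> J. F = {C\<in>circs. P \<in> C}"
proof -
  interpret classed_circle_geometry "I \<times> J" circs "\<lambda>P R. fst P = fst R \<or> snd P = snd R" q 2 eps
    by (rule geo)
  have deg: "card F = q * (q + 1 - 2)"
    "\<And>C. C \<in> circs \<Longrightarrow> (real q^2 - 1) * of_bool (C \<in> F) = (\<Sum>P\<in>C. real (card {D\<in>F. P \<in> D})) - b\<^sup>2"
    by (rule intersecting_family_degree_one[OF F int]; use card_F in simp)+
  define p where "p = (real q - 1) * (real q + 1)"
  \<comment> \<open>The mean degree, since every row contains one point of each of the
    \<open>q * (q - 1)\<close> circles. Subtracting it makes all row and column sums of
    \<open>z\<close> zero.\<close>
  define m where "m = real q * (real q - 1) / (real q + 1)"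
  define \<kappa> where "\<kappa> = 1 / (real q + 1)"
  have q: "real q \<ge> 3" by (rule q_real)
  have p: "p > 0" using q by (simp add: p_def)
  have finI: "finite I" "finite J" using IJ by (auto intro: card_ge_0_finite)
  define f :: "('i \<times> 'j) set \<Rightarrow> real" where "f C = of_bool (C \<in> F)" for C
  define fp where "fp P = real (card {D\<in>F. P \<in> D})" for P
  define z where "z P = (fp P - m) / p" for P
  have n: "total f = real q * (real q - 1)"
    unfolding f_def using F finite_circs deg(1) q
    by (simp add: of_bool_def sum.If_cases Int_absorb1 of_nat_diff cong: if_cong)
  have incf: "inc f P = fp P" for P
  proof -
    have "{D\<in>circs. P \<in> D} \<inter> F = {D\<in>F. P \<in> D}" using F by blast
    thus ?thesis unfolding inc_def f_def fp_def using finite_circs by (simp add: of_bool_def sum.If_cases)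
  qed
  have b: "b = real q - 1" by (simp add: b_def)
  have fz: "f C = \<kappa> + (\<Sum>R\<in>C. z R)" if C: "C \<in> circs" for C
  proof -
    have "(\<Sum>R\<in>C. z R) = ((\<Sum>R\<in>C. fp R) - (real q + 1) * m) / p"
      unfolding z_def sum_divide_distrib[symmetric] using card_circ[OF C] by (simp add: sum_subtractf)
    also have "(\<Sum>R\<in>C. fp R) = p * f C + (real q - 1) * (real q - 1)"
      using deg(2)[OF C] by (simp add: f_def fp_def p_def b power2_eq_square algebra_simps)
    also have "(real q + 1) * m = real q * (real q - 1)" by (simp add: m_def)
    also have "(p * f C + (real q - 1) * (real q - 1) - real q * (real q - 1)) / p = (p * f C - (real q - 1)) / p"
      by (simp add: algebra_simps)
    also have "\<dots> = f C - (real q - 1) / p" using p by (simp add: diff_divide_distrib)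
    also have "(real q - 1) / p = \<kappa>" using q by (simp add: p_def \<kappa>_def)
    finally show ?thesis by simp
  qed
  have idem: "f C * f C = f C" for C by (simp add: f_def)
  have fpz: "fp P = p * z P + m" for P using p by (simp add: z_def)
  have rowsum: "(\<Sum>j\<in>J. z (i, j)) = 0" if i: "i \<in> I" for i
  proof -
    have "(\<Sum>j\<in>J. fp (i, j)) = (\<Sum>P\<in>I \<times> J. of_bool (fst P = i) * inc f P)"
      unfolding incf by (rule sum_fst_eq[symmetric]) (use i finI in auto)
    also have "\<dots> = (\<Sum>C\<in>circs. f C * (\<Sum>P\<in>C. of_bool (fst P = i)))" by (rule sum_inc)
    also have "\<dots> = total f"
    proof (intro sum.cong refl)
      fix C assume C: "C \<in> circs"
      obtain j where j: "(i, j) \<in> C" "\<And>j'. (i, j') \<in> C \<Longrightarrow> j' = j" using row[OF C i] by blast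
      have "P = (i, j)" if "P \<in> C" "fst P = i" for P using j(2)[of "snd P"] that by (metis prod.collapse)
      hence "{P\<in>C. fst P = i} \<subseteq> {(i, j)}" by blast
      moreover have "{(i, j)} \<subseteq> {P\<in>C. fst P = i}" using j(1) by simp
      ultimately have one: "{P\<in>C. fst P = i} = {(i, j)}" by (rule equalityI)
      have "(\<Sum>P\<in>C. of_bool (fst P = i) :: real) = 1"
        using finite_circ[OF C] one by (simp add: of_bool_def sum.If_cases Int_def)
      thus "f C * (\<Sum>P\<in>C. of_bool (fst P = i)) = f C" by simp
    qed
    finally have "p * (\<Sum>j\<in>J. z (i, j)) + (real q + 1) * m = real q * (real q - 1)"
      unfolding fpz sum.distrib n using IJ by (simp add: sum_distrib_left add.commute)
    moreover have "(real q + 1) * m = real q * (real q - 1)" by (simp add: m_def)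
    ultimately show ?thesis using p by simp
  qed
  have colsum: "(\<Sum>i\<in>I. z (i, j)) = 0" if j: "j \<in> J" for j
  proof -
    have "(\<Sum>i\<in>I. fp (i, j)) = (\<Sum>P\<in>I \<times> J. of_bool (snd P = j) * inc f P)"
      unfolding incf by (rule sum_snd_eq[symmetric]) (use j finI in auto)
    also have "\<dots> = (\<Sum>C\<in>circs. f C * (\<Sum>P\<in>C. of_bool (snd P = j)))" by (rule sum_inc)
    also have "\<dots> = total f"
    proof (intro sum.cong refl)
      fix C assume C: "C \<in> circs"
      obtain i where i: "(i, j) \<in> C" "\<And>i'. (i', j) \<in> C \<Longrightarrow> i' = i" using col[OF C j] by blast
      have "P = (i, j)" if "P \<in> C" "snd P = j" for P using i(2)[of "fst P"] that by (metis prod.collapse)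
      hence "{P\<in>C. snd P = j} \<subseteq> {(i, j)}" by blast
      moreover have "{(i, j)} \<subseteq> {P\<in>C. snd P = j}" using i(1) by simp
      ultimately have one: "{P\<in>C. snd P = j} = {(i, j)}" by (rule equalityI)
      have "(\<Sum>P\<in>C. of_bool (snd P = j) :: real) = 1"
        using finite_circ[OF C] one by (simp add: of_bool_def sum.If_cases Int_def)
      thus "f C * (\<Sum>P\<in>C. of_bool (snd P = j)) = f C" by simp
    qed
    finally have "p * (\<Sum>i\<in>I. z (i, j)) + (real q + 1) * m = real q * (real q - 1)"
      unfolding fpz sum.distrib n using IJ by (simp add: sum_distrib_left add.commute)
    moreover have "(real q + 1) * m = real q * (real q - 1)" by (simp add: m_def)
    ultimately show ?thesis using p by simp
  qed
  define R where "R i = (\<Sum>j\<in>J. z (i, j) * z (i, j))" for i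
  define G where "G j = (\<Sum>i\<in>I. z (i, j) * z (i, j))" for j
  define E where "E = (\<Sum>i\<in>I. R i)"
  have E: "E = real q^2 / (real q + 1)^2"
  proof -
    have "(\<Sum>P\<in>I\<times>J. z P * fp P) = total f - \<kappa> * total f"
    proof -
      have "(\<Sum>P\<in>I\<times>J. z P * fp P) = (\<Sum>C\<in>circs. f C - \<kappa> * f C)"
        unfolding incf[symmetric] sum_inc
      proof (intro sum.cong refl)
        fix C assume C: "C \<in> circs"
        have "f C * (\<Sum>P\<in>C. z P) = f C * f C - \<kappa> * f C" using fz[OF C] by (simp add: algebra_simps)
        thus "f C * (\<Sum>P\<in>C. z P) = f C - \<kappa> * f C" unfolding idem .
      qed
      thus ?thesis by (simp add: sum_subtractf sum_distrib_left)
    qed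
    moreover have "(\<Sum>P\<in>I\<times>J. z P * fp P) = p * E + m * (\<Sum>i\<in>I. \<Sum>j\<in>J. z (i, j))"
    proof -
      have "(\<Sum>P\<in>I\<times>J. z P * fp P) = (\<Sum>i\<in>I. \<Sum>j\<in>J. z (i,j) * fp (i,j))" by (simp add: sum.cartesian_product)
      also have "\<dots> = p * E + m * (\<Sum>i\<in>I. \<Sum>j\<in>J. z (i, j))"
        unfolding fpz E_def R_def sum_distrib_left sum.distrib[symmetric]
        by (intro sum.cong refl) (simp add: algebra_simps)
      finally show ?thesis .
    qed
    ultimately have "p * E = (1 - \<kappa>) * total f" using rowsum by (simp add: algebra_simps)
    also have "1 - \<kappa> = real q / (real q + 1)" using q by (simp add: \<kappa>_def field_simps)
    finally have "p * E = real q / (real q + 1) * (real q * (real q - 1))" unfolding n .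
    hence "E = real q / (real q + 1) * (real q * (real q - 1)) / p" using p by (metis nonzero_mult_div_cancel_left less_irrefl)
    also have "\<dots> = real q^2 / (real q + 1)^2" using q by (simp add: p_def power2_eq_square)
    finally show ?thesis .
  qed
  define W where "W P = (real q + 1)^2 * z P" for P
  \<comment> \<open>This is \<open>degree_one_pointwise\<close> at \<open>(i, j)\<close>. The points
    not parallel to a given one form a product set, so the vanishing row and column sums reduce
    everything to the sums of squares \<open>R i\<close>, \<open>G j\<close> and
    \<open>E\<close>.\<close>
  have rel: "(real q + 1)^3 * (R i + G j) = W (i,j) * W (i,j) - (real q - 1)^2 * W (i,j) + real q^2"
    if i: "i \<in> I" and j: "j \<in> J" for i j
  proof -
    define w where "w = z (i, j)"
    have rs: "(\<Sum>j'\<in>J - {j}. z (k, j')) = - z (k, j)" if "k \<in> I" for k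
      using rowsum[OF that] j finI by (simp add: sum_diff1)
    have cs: "(\<Sum>i'\<in>I - {i}. z (i', k)) = - z (i, k)" if "k \<in> J" for k
      using colsum[OF that] i finI by (simp add: sum_diff1)
    have A: "{P\<in>I \<times> J. P \<noteq> (i,j) \<and> \<not> (fst (i,j) = fst P \<or> snd (i,j) = snd P)} = (I - {i}) \<times> (J - {j})" by auto
    have "fp (i,j) * (1 - \<kappa> - z (i,j)) = (\<Sum>P\<in>(I - {i}) \<times> (J - {j}). z P * ((real q + 1 - real 2) * (\<kappa> + z (i,j) + z P)
      + (\<Sum>T\<in>{T\<in>I \<times> J. T \<noteq> (i,j) \<and> T \<noteq> P \<and> \<not> (fst (i,j) = fst T \<or> snd (i,j) = snd T) \<and> \<not> (fst P = fst T \<or> snd P = snd T)}. z T)))"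
      unfolding incf[symmetric] inc_def A[symmetric] by (rule degree_one_pointwise[OF fz idem]) (use i j in auto)
    also have "\<dots> = (\<Sum>i'\<in>I - {i}. \<Sum>j'\<in>J - {j}. ((real q - 1) * \<kappa> + real q * w) * z (i',j') + real q * (z (i',j') * z (i',j'))
        + z (i',j') * z (i,j') + z (i',j') * z (i',j))"
      unfolding sum.cartesian_product'
    proof (rule sum.cong[OF refl], rule sum.cong[OF refl])
      fix i' j' assume "i' \<in> I - {i}" "j' \<in> J - {j}"
      hence i': "i' \<in> I" "i' \<noteq> i" and j': "j' \<in> J" "j' \<noteq> j" by auto
      have "{T\<in>I \<times> J. T \<noteq> (i,j) \<and> T \<noteq> (i',j') \<and> \<not> (fst (i,j) = fst T \<or> snd (i,j) = snd T) \<and> \<not> (fst (i',j') = fst T \<or> snd (i',j') = snd T)}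
        = (I - {i} - {i'}) \<times> (J - {j} - {j'})" by auto
      hence "(\<Sum>T\<in>{T\<in>I \<times> J. T \<noteq> (i,j) \<and> T \<noteq> (i',j') \<and> \<not> (fst (i,j) = fst T \<or> snd (i,j) = snd T) \<and> \<not> (fst (i',j') = fst T \<or> snd (i',j') = snd T)}. z T)
        = (\<Sum>k\<in>I - {i} - {i'}. \<Sum>l\<in>J - {j} - {j'}. z (k, l))" by (simp add: sum.cartesian_product)
      also have "\<dots> = (\<Sum>k\<in>I - {i} - {i'}. - z (k, j) - z (k, j'))"
      proof (intro sum.cong refl)
        fix k assume "k \<in> I - {i} - {i'}"
        hence k: "k \<in> I" by blast
        have "(\<Sum>l\<in>J - {j} - {j'}. z (k, l)) = (\<Sum>l\<in>J - {j}. z (k, l)) - z (k, j')"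
          using finI j' by (simp add: sum_diff1)
        thus "(\<Sum>l\<in>J - {j} - {j'}. z (k, l)) = - z (k, j) - z (k, j')" using rs[OF k] by simp
      qed
      also have "\<dots> = - (\<Sum>k\<in>I - {i} - {i'}. z (k, j)) - (\<Sum>k\<in>I - {i} - {i'}. z (k, j'))"
        by (simp add: sum_subtractf sum_negf)
      also have "(\<Sum>k\<in>I - {i} - {i'}. z (k, j)) = - z (i, j) - z (i', j)"
        using finI i' cs[OF j] by (simp add: sum_diff1)
      also have "(\<Sum>k\<in>I - {i} - {i'}. z (k, j')) = - z (i, j') - z (i', j')"
        using finI i' cs[OF j'(1)] by (simp add: sum_diff1)
      finally show "z (i',j') * ((real q + 1 - real 2) * (\<kappa> + z (i,j) + z (i',j')) +
          (\<Sum>T\<in>{T\<in>I \<times> J. T \<noteq> (i,j) \<and> T \<noteq> (i',j') \<and> \<not> (fst (i,j) = fst T \<or> snd (i,j) = snd T) \<and> \<not> (fst (i',j') = fst T \<or> snd (i',j') = snd T)}. z T))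
        = ((real q - 1) * \<kappa> + real q * w) * z (i',j') + real q * (z (i',j') * z (i',j'))
        + z (i',j') * z (i,j') + z (i',j') * z (i',j)"
        by (simp only: w_def) (simp add: algebra_simps)
    qed
    also have "\<dots> = ((real q - 1) * \<kappa> + real q * w) * (\<Sum>i'\<in>I - {i}. \<Sum>j'\<in>J - {j}. z (i',j'))
        + real q * (\<Sum>i'\<in>I - {i}. \<Sum>j'\<in>J - {j}. z (i',j') * z (i',j'))
        + (\<Sum>i'\<in>I - {i}. \<Sum>j'\<in>J - {j}. z (i',j') * z (i,j')) + (\<Sum>i'\<in>I - {i}. \<Sum>j'\<in>J - {j}. z (i',j') * z (i',j))"
      by (simp only: sum.distrib sum_distrib_left)
    also have "(\<Sum>i'\<in>I - {i}. \<Sum>j'\<in>J - {j}. z (i',j')) = (\<Sum>i'\<in>I - {i}. - z (i', j))"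
      by (intro sum.cong refl) (use rs in auto)
    also have "(\<Sum>i'\<in>I - {i}. - z (i', j)) = w" unfolding sum_negf cs[OF j] w_def by simp
    also have "(\<Sum>i'\<in>I - {i}. \<Sum>j'\<in>J - {j}. z (i',j') * z (i',j)) = (\<Sum>i'\<in>I - {i}. - (z (i', j) * z (i', j)))"
      by (intro sum.cong refl) (use rs in \<open>auto simp: sum_distrib_right[symmetric]\<close>)
    also have "\<dots> = - (G j - w * w)" unfolding sum_negf G_def w_def using i finI by (simp add: sum_diff1)
    also have "(\<Sum>i'\<in>I - {i}. \<Sum>j'\<in>J - {j}. z (i',j') * z (i,j')) = (\<Sum>j'\<in>J - {j}. \<Sum>i'\<in>I - {i}. z (i',j') * z (i,j'))"
      by (rule sum.swap)
    also have "\<dots> = (\<Sum>j'\<in>J - {j}. - (z (i, j') * z (i, j')))"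
      by (intro sum.cong refl) (use cs in \<open>auto simp: sum_distrib_right[symmetric]\<close>)
    also have "\<dots> = - (R i - w * w)" unfolding sum_negf R_def w_def using j finI by (simp add: sum_diff1)
    also have "(\<Sum>i'\<in>I - {i}. \<Sum>j'\<in>J - {j}. z (i',j') * z (i',j')) = (\<Sum>i'\<in>I - {i}. R i' - z (i', j) * z (i', j))"
      by (intro sum.cong refl) (use j finI in \<open>auto simp: R_def sum_diff1\<close>)
    also have "\<dots> = E - R i - (G j - w * w)"
      unfolding sum_subtractf E_def G_def w_def using i finI by (simp add: sum_diff1)
    finally have main: "(p * w + m) * (1 - \<kappa> - w) = ((real q - 1) * \<kappa> + real q * w) * w + real q * (E - R i - (G j - w * w))
       - (R i - w * w) - (G j - w * w)"
      unfolding fpz w_def[symmetric] by simp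
    define u where "u = 1 / (real q + 1)"
    have u: "(real q + 1) * u = 1" using q by (simp add: u_def)
    have mu: "m = real q * (real q - 1) * u" "\<kappa> = u" "E = real q^2 * u * u"
      by (simp_all add: m_def \<kappa>_def u_def E power2_eq_square)
    have "(real q + 1) * (R i + G j) = ((real q - 1) * u + real q * w) * w + real q * (real q^2 * u * u) + (real q + 2) * (w * w)
       - (p * w + real q * (real q - 1) * u) * (1 - u - w)"
      using main unfolding mu by (simp add: algebra_simps)
    hence "(real q + 1)^2 * ((real q + 1) * (R i + G j)) = (real q + 1)^2 * (((real q - 1) * u + real q * w) * w + real q * (real q^2 * u * u) + (real q + 2) * (w * w)
       - (p * w + real q * (real q - 1) * u) * (1 - u - w))" by simp
    also have "\<dots> = (real q - 1) * ((real q + 1) * u) * (real q + 1) * w + real q * (real q + 1)^2 * (w * w)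
       + real q * real q^2 * ((real q + 1) * u) * ((real q + 1) * u) + (real q + 2) * (real q + 1)^2 * (w * w)
       - p * w * (real q + 1) * (real q + 1) * (1 - w) + p * w * (real q + 1) * ((real q + 1) * u)
       - real q * (real q - 1) * ((real q + 1) * u) * (real q + 1) * (1 - w) + real q * (real q - 1) * ((real q + 1) * u) * ((real q + 1) * u)"
      by (simp add: power2_eq_square algebra_simps)
    also have "\<dots> = W (i,j) * W (i,j) - (real q - 1)^2 * W (i,j) + real q^2"
      unfolding u W_def w_def[symmetric] p_def by (simp add: power2_eq_square algebra_simps)
    finally show ?thesis by (simp add: power3_eq_cube power2_eq_square mult.assoc)
  qed
  \<comment> \<open>The other \<open>q\<close> entries of the row have sum
    \<open>- z (i, j)\<close>.\<close>
  have Rge: "R i * real q \<ge> z (i,j) * z (i,j) * (real q + 1)" if i: "i \<in> I" and j: "j \<in> J" for i j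
  proof -
    have "(z (i,j))^2 = (\<Sum>j'\<in>J - {j}. z (i, j'))^2" using rowsum[OF i] j finI by (simp add: sum_diff1)
    also have "\<dots> \<le> (\<Sum>j'\<in>J - {j}. (z (i, j'))^2) * card (J - {j})" by (rule sum_squared_le_sum_of_squares)
    also have "(\<Sum>j'\<in>J - {j}. (z (i, j'))^2) = R i - z (i,j) * z (i,j)"
      using j finI by (simp add: R_def sum_diff1 power2_eq_square)
    finally show ?thesis using IJ j finI by (simp add: power2_eq_square algebra_simps)
  qed
  have Gge: "G j * real q \<ge> z (i,j) * z (i,j) * (real q + 1)" if i: "i \<in> I" and j: "j \<in> J" for i j
  proof -
    have "(z (i,j))^2 = (\<Sum>i'\<in>I - {i}. z (i', j))^2" using colsum[OF j] i finI by (simp add: sum_diff1)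
    also have "\<dots> \<le> (\<Sum>i'\<in>I - {i}. (z (i', j))^2) * card (I - {i})" by (rule sum_squared_le_sum_of_squares)
    also have "(\<Sum>i'\<in>I - {i}. (z (i', j))^2) = G j - z (i,j) * z (i,j)"
      using i finI by (simp add: G_def sum_diff1 power2_eq_square)
    finally show ?thesis using IJ i finI by (simp add: power2_eq_square algebra_simps)
  qed
  have dich: "(W P - real q^2) * ((real q - 2) * W P - real q) \<ge> 0" if P: "P \<in> I \<times> J" for P
  proof -
    obtain i j where ij: "P = (i,j)" "i \<in> I" "j \<in> J" using P by blast
    have "(real q + 1)^3 * ((R i + G j) * real q) \<ge> (real q + 1)^3 * (2 * (z P * z P * (real q + 1)))"
      using Rge[OF ij(2,3)] Gge[OF ij(2,3)] q unfolding ij(1) by (intro mult_left_mono) (auto simp: algebra_simps)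
    hence "2 * (W P * W P) \<le> (real q + 1)^3 * (R i + G j) * real q"
      by (simp add: W_def power2_eq_square power3_eq_cube algebra_simps)
    also have "\<dots> = (W P * W P - (real q - 1)^2 * W P + real q^2) * real q" unfolding rel[OF ij(2,3)] ij(1) ..
    finally show ?thesis by (simp add: power2_eq_square algebra_simps)
  qed
  \<comment> \<open>Degree \<open>q * (q - 1)\<close>, which means that all circles of the family
    pass through \<open>P\<close>, corresponds to \<open>W P = q\<^sup>2\<close>, and degree
    \<open>0\<close> to \<open>W P = - q\<close>.\<close>
  have Wfp: "W P - real q^2 = (fp P - real q * (real q - 1)) * ((real q + 1) / (real q - 1))" for P
  proof -
    have "(real q + 1) / (real q - 1) * m = real q" using q by (simp add: m_def)
    hence m': "(real q + 1) / (real q - 1) * (p * z P + m) = (real q + 1) / (real q - 1) * p * z P + real q" by (simp only: distrib_left mult.assoc)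
    have p': "(real q + 1) / (real q - 1) * p = (real q + 1)^2" using q by (simp add: p_def power2_eq_square)
    have "(fp P - real q * (real q - 1)) * ((real q + 1) / (real q - 1)) = (real q + 1) / (real q - 1) * (p * z P + m) - real q * (real q + 1)"
      unfolding fpz left_diff_distrib using q by (simp add: mult.commute)
    also have "\<dots> = W P - real q^2" unfolding m' p' W_def by (simp add: power2_eq_square algebra_simps)
    finally show ?thesis by simp
  qed
  have "\<exists>P\<in>I \<times> J. W P \<ge> real q^2"
  proof (rule ccontr)
    assume "\<not> ?thesis"
    hence lt: "W P < real q^2" if "P \<in> I \<times> J" for P using that by force
    have le: "(real q - 2) * W P \<le> real q" if "P \<in> I \<times> J" for P
      using dich[OF that] lt[OF that] by (simp add: zero_le_mult_iff)
    have ub: "W P \<le> real q" if "P \<in> I \<times> J" for P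
    proof (rule ccontr)
      assume a: "\<not> W P \<le> real q"
      have "1 * W P \<le> (real q - 2) * W P" using a q by (intro mult_right_mono) auto
      hence "W P \<le> real q" using le[OF that] by linarith
      thus False using a by blast
    qed
    have lb: "- real q \<le> W P" for P
    proof -
      have "(fp P - real q * (real q - 1)) * ((real q + 1) / (real q - 1)) \<ge> (- (real q * (real q - 1))) * ((real q + 1) / (real q - 1))"
        using q by (intro mult_right_mono) (auto simp: fp_def)
      also have "(- (real q * (real q - 1))) * ((real q + 1) / (real q - 1)) = - (real q * (real q + 1))" using q by simp
      finally show ?thesis unfolding Wfp[symmetric] by (simp add: power2_eq_square algebra_simps)
    qed
    have "(\<Sum>P\<in>I \<times> J. (real q - W P) * (real q + W P)) = 0"
    proof -
      have "(\<Sum>P\<in>I \<times> J. (real q - W P) * (real q + W P)) = (\<Sum>P\<in>I \<times> J. real q^2 - (real q + 1)^4 * (z P * z P))"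
        by (intro sum.cong refl) (simp add: W_def power2_eq_square power4_eq_xxxx algebra_simps)
      also have "\<dots> = (real q + 1)^2 * real q^2 - (real q + 1)^4 * E"
      proof -
        have e: "(\<Sum>P\<in>I \<times> J. z P * z P) = E" unfolding E_def R_def by (simp add: sum.cartesian_product')
        have c: "real (card (I \<times> J)) = (real q + 1)^2" unfolding card_cartesian_product IJ by (simp add: power2_eq_square algebra_simps)
        show ?thesis unfolding sum_subtractf sum_distrib_left[symmetric] e sum_constant c ..
      qed
      also have "\<dots> = 0" using q unfolding E by (simp add: power2_eq_square power4_eq_xxxx)
      finally show ?thesis .
    qed
    hence W2: "W P = real q \<or> W P = - real q" if "P \<in> I \<times> J" for P
    proof -
      have "0 \<le> (real q - W P) * (real q + W P)" if "P \<in> I \<times> J" for P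
        using ub[OF that] lb[of P] by (intro mult_nonneg_nonneg) auto
      hence "\<forall>P\<in>I \<times> J. (real q - W P) * (real q + W P) = 0"
        using \<open>(\<Sum>P\<in>I \<times> J. (real q - W P) * (real q + W P)) = 0\<close> finI
        by (simp add: sum_nonneg_eq_0_iff del: mult_eq_0_iff)
      hence "(real q - W P) * (real q + W P) = 0" using that by blast
      hence "real q - W P = 0 \<or> real q + W P = 0" unfolding mult_eq_0_iff .
      thus ?thesis by linarith
    qed
    have W2': "W P * W P = real q^2" if "P \<in> I \<times> J" for P using W2[OF that] by (auto simp: power2_eq_square)
    \<comment> \<open>A row with sum zero must contain a value \<open>- q\<close>. All sums of
      squares are now known, and at that point \<open>rel\<close> would say
      \<open>(q - 1)\<^sup>2 * q = 0\<close>.\<close>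
    obtain i where i: "i \<in> I" using IJ by fastforce
    have "\<exists>j\<in>J. W (i,j) = - real q"
    proof (rule ccontr)
      assume "\<not> ?thesis"
      hence "(\<Sum>j\<in>J. W (i,j)) = (\<Sum>j\<in>J. real q)" using W2 i by (intro sum.cong) auto
      moreover have "(\<Sum>j\<in>J. W (i,j)) = 0" using rowsum[OF i] by (simp add: W_def sum_distrib_left[symmetric])
      ultimately show False using IJ q by simp
    qed
    then obtain j where j: "j \<in> J" "W (i,j) = - real q" by blast
    have "(real q + 1)^4 * R i = (\<Sum>j\<in>J. W (i,j) * W (i,j))"
      unfolding R_def sum_distrib_left by (intro sum.cong refl) (simp add: W_def power2_eq_square power4_eq_xxxx algebra_simps)
    also have "\<dots> = (real q + 1) * real q^2" using W2' i IJ by simp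
    finally have R4: "(real q + 1)^4 * R i = (real q + 1) * real q^2" .
    have "(real q + 1)^4 * G j = (\<Sum>i\<in>I. W (i,j) * W (i,j))"
      unfolding G_def sum_distrib_left by (intro sum.cong refl) (simp add: W_def power2_eq_square power4_eq_xxxx algebra_simps)
    also have "\<dots> = (real q + 1) * real q^2" using W2' j IJ by simp
    finally have G4: "(real q + 1)^4 * G j = (real q + 1) * real q^2" .
    have "(real q + 1) * ((real q + 1)^3 * (R i + G j)) = (real q + 1) * (2 * real q^2)"
      using R4 G4 by (simp add: power4_eq_xxxx power3_eq_cube algebra_simps)
    hence "(real q + 1)^3 * (R i + G j) = 2 * real q^2" using q by simp
    hence "(real q - 1)^2 * real q = 0" using rel[OF i j(1)] unfolding j(2) by (simp add: power2_eq_square)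
    thus False using q by simp
  qed
  then obtain P where P: "P \<in> I \<times> J" "W P \<ge> real q^2" by blast
  have "0 \<le> (fp P - real q * (real q - 1)) * ((real q + 1) / (real q - 1))" using Wfp[of P] P by simp
  hence "fp P \<ge> real q * (real q - 1)" using q by (simp add: zero_le_mult_iff zero_le_divide_iff)
  hence "real (card {D\<in>F. P \<in> D}) \<ge> real (q * (q + 1 - 2))" using q by (simp add: fp_def of_nat_diff)
  hence "F = {C\<in>circs. P \<in> C}" by (intro through_eq_if_full[OF F deg(1) P(1)]) linarith
  thus ?thesis using P by blast
qed

section \<open>Tangency from a polarity\<close>

definition quad_char :: "'a::field \<Rightarrow> real" where
  "quad_char a = (if a = 0 then 0 else if \<exists>y. y * y = a then 1 else -1)"

lemma sqrt_set:
  fixes y :: "'a::field"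
  shows "{z. z * z = y * y} = {y, -y}"
proof -
  have "z = y \<or> z = -y" if "z * z = y * y" for z
  proof -
    have "(z - y) * (z + y) = 0" using that by (simp add: algebra_simps)
    thus ?thesis by (auto simp: eq_neg_iff_add_eq_0)
  qed
  hence "{z. z * z = y * y} \<subseteq> {y, -y}" by blast
  thus ?thesis by (simp add: subset_antisym)
qed

lemma minus_neq_self:
  fixes y :: "'a::field"
  assumes "(2::'a) \<noteq> 0" "y \<noteq> 0" shows "y \<noteq> -y"
proof
  assume "y = -y"
  hence "y + y = 0" by (metis ab_left_minus)
  hence "2 * y = 0" unfolding mult_2 .
  thus False using assms unfolding mult_eq_0_iff by blast
qed

lemma card_nonzero_squares:
  assumes two: "(2::'a::{field,finite}) \<noteq> 0"
  shows "card (UNIV - {0::'a}) = 2 * card ((\<lambda>y::'a. y * y) ` (UNIV - {0}))"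
proof -
  define X where "X = UNIV - {0::'a}"
  define S where "S = (\<lambda>y::'a. y * y) ` X"
  have "(\<Sum>y\<in>X. card {s\<in>S. y * y = s}) = 2 * card S"
  proof (rule sum_multicount)
    show "\<forall>s\<in>S. card {y\<in>X. y * y = s} = 2"
    proof
      fix s assume "s \<in> S"
      then obtain y where y: "y \<noteq> 0" "s = y * y" by (auto simp: S_def X_def)
      have "{z\<in>X. z * z = s} = {z. z * z = y * y}" using y by (auto simp: X_def)
      thus "card {z\<in>X. z * z = s} = 2" using minus_neq_self[OF two y(1)] by (simp add: sqrt_set)
    qed
  qed (simp_all add: X_def S_def)
  moreover have "card {s\<in>S. y * y = s} = 1" if "y \<in> X" for y
  proof -
    have "{s\<in>S. y * y = s} = {y * y}" using that by (auto simp: S_def)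
    thus ?thesis by simp
  qed
  ultimately show ?thesis by (simp add: X_def S_def)
qed

text \<open>The nonzero squares \<open>S\<close> are half of the nonzero elements, and for a
  nonsquare \<open>a\<close> the set of all \<open>a * y\<close> with \<open>y\<close> in
  \<open>S\<close> is disjoint from \<open>S\<close>. It is therefore the other half and contains
  \<open>b\<close>.\<close>

lemma nonsquare_mult:
  fixes a b :: "'a::{field,finite}"
  assumes two: "(2::'a) \<noteq> 0" and a: "\<nexists>y. y * y = a" and b: "\<nexists>y. y * y = b"
  shows "\<exists>y. y * y = a * b"
proof -
  define X where "X = UNIV - {0::'a}"
  define S where "S = (\<lambda>y::'a. y * y) ` X"
  have a0: "a \<noteq> 0" "b \<noteq> 0" using a b by (metis mult_zero_left)+
  have cX: "card X = 2 * card S" unfolding X_def S_def by (rule card_nonzero_squares[OF two])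
  have cT: "card ((\<lambda>y. a * y) ` S) = card S" using a0 by (intro card_image) (auto intro: inj_onI)
  have disj: "S \<inter> (\<lambda>y. a * y) ` S = {}"
  proof (rule ccontr)
    assume "S \<inter> (\<lambda>y. a * y) ` S \<noteq> {}"
    then obtain y z where yz: "z \<noteq> 0" "y * y = a * (z * z)" by (auto simp: S_def X_def)
    hence "(y / z) * (y / z) = a" by (simp add: field_simps)
    thus False using a by blast
  qed
  have sub: "S \<union> (\<lambda>y. a * y) ` S \<subseteq> X" using a0 by (auto simp: S_def X_def)
  have "card (S \<union> (\<lambda>y. a * y) ` S) = card X"
    unfolding cX using disj cT by (subst card_Un_disjoint) (auto simp: S_def X_def)
  hence "S \<union> (\<lambda>y. a * y) ` S = X" using sub by (intro card_seteq) (auto simp: X_def)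
  hence "b \<in> S \<union> (\<lambda>y. a * y) ` S" using a0 by (simp add: X_def)
  moreover have "b \<notin> S" using b by (auto simp: S_def)
  ultimately obtain y where "b = a * (y * y)" by (auto simp: S_def)
  hence "(a * y) * (a * y) = a * b" by simp
  thus ?thesis by blast
qed

lemma card_sqrt_mult:
  fixes a b :: "'a::{field,finite}"
  assumes two: "(2::'a) \<noteq> 0" and a: "a \<noteq> 0" and b: "b \<noteq> 0"
  shows "real (card {y. y * y = a * b}) = 1 + quad_char a * quad_char b"
proof -
  have sq: "real (card {y. y * y = a * b}) = 2" if ex: "\<exists>y. y * y = a * b"
  proof -
    obtain y where y: "y * y = a * b" using ex by blast
    hence "y \<noteq> 0" using a b by auto
    thus ?thesis unfolding y[symmetric] sqrt_set using minus_neq_self[OF two] by simp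
  qed
  have nsq: "card {y. y * y = a * b} = 0" if "\<nexists>y. y * y = a * b" using that by simp
  consider "\<exists>y. y * y = a" "\<exists>y. y * y = b" | "\<nexists>y. y * y = a" "\<nexists>y. y * y = b"
    | "\<exists>y. y * y = a" "\<nexists>y. y * y = b" | "\<nexists>y. y * y = a" "\<exists>y. y * y = b" by blast
  thus ?thesis
  proof cases
    case 1
    then obtain y z where "y * y = a" "z * z = b" by blast
    hence "(y * z) * (y * z) = a * b" by (auto simp: algebra_simps)
    thus ?thesis using 1 sq a b by (auto simp: quad_char_def)
  next
    case 2
    thus ?thesis using sq[OF nonsquare_mult[OF two 2]] a b by (auto simp: quad_char_def)
  next
    case 3
    have "\<nexists>y. y * y = a * b"
    proof
      assume "\<exists>y. y * y = a * b"
      then obtain y z where "y * y = a * b" "z * z = a" using 3 by blast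
      hence "(y / z) * (y / z) = b" using a by (auto simp: field_simps)
      thus False using 3 by blast
    qed
    thus ?thesis using 3 nsq a b by (auto simp: quad_char_def)
  next
    case 4
    have "\<nexists>y. y * y = a * b"
    proof
      assume "\<exists>y. y * y = a * b"
      then obtain y z where "y * y = a * b" "z * z = b" using 4 by blast
      hence "(y / z) * (y / z) = a" using b by (auto simp: field_simps)
      thus False using 4 by blast
    qed
    thus ?thesis using 4 nsq a b by (auto simp: quad_char_def)
  qed
qed

text \<open>\<open>w P\<close> is a vector of the point \<open>P\<close>, and \<open>pole C\<close>
  is perpendicular to the points of \<open>C\<close>; both matter only up to scalars. Adding a
  multiple of \<open>w P\<close> to the pole of a circle through \<open>P\<close> gives the pole of
  another circle, and circles touch if the Gram determinant of their poles vanishes. The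
  alternatives in \<open>norms\<close> correspond to even and odd characteristic; in the first one
  \<open>gram\<close> speaks about perpendicular poles.\<close>

locale polar_circle_geometry = circle_geometry pts circs par q \<rho>
  for pts :: "'p set" and circs par q \<rho> +
  fixes B :: "'a::{field,finite} ^ 4 \<Rightarrow> 'a ^ 4 \<Rightarrow> 'a"
    and w :: "'p \<Rightarrow> 'a ^ 4" and pole :: "'p set \<Rightarrow> 'a ^ 4"
  assumes q_card: "q = CARD('a)"
    and B_add: "B (x + y) z = B x z + B y z"
    and B_scale: "B (c *s x) z = c * B x z"
    and B_sym: "B x z = B z x"
    and incident: "C \<in> circs \<Longrightarrow> P \<in> pts \<Longrightarrow> P \<in> C \<longleftrightarrow> B (pole C) (w P) = 0"
    and w_isotropic: "P \<in> pts \<Longrightarrow> B (w P) (w P) = 0"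
    and w_not_perp: "C \<in> circs \<Longrightarrow> P \<in> C \<Longrightarrow> R \<in> C \<Longrightarrow> P \<noteq> R \<Longrightarrow> B (w P) (w R) \<noteq> 0"
    and pole_not_w: "C \<in> circs \<Longrightarrow> P \<in> C \<Longrightarrow> pole C \<noteq> t *s w P"
    and pencil: "C \<in> circs \<Longrightarrow> P \<in> C \<Longrightarrow> \<exists>D\<in>circs. \<exists>s. s \<noteq> 0 \<and> pole C + c *s w P = s *s pole D"
    and gram: "C \<in> circs \<Longrightarrow> D \<in> circs \<Longrightarrow> C \<noteq> D \<Longrightarrow>
      B (pole C) (pole D) * B (pole C) (pole D) = B (pole C) (pole C) * B (pole D) (pole D) \<Longrightarrow> tan C D"
    and norms: "(\<forall>C\<in>circs. B (pole C) (pole C) = 0) \<or> ((\<forall>C\<in>circs. B (pole C) (pole C) \<noteq> 0) \<and> (2::'a) \<noteq> 0)"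
begin

lemma B_add2: "B z (x + y) = B z x + B z y"
  by (metis B_add B_sym)

lemma B_scale2: "B z (c *s x) = c * B z x"
  by (metis B_scale B_sym)

lemmas B_simps = B_add B_add2 B_scale B_scale2

definition circ_of :: "'a ^ 4 \<Rightarrow> 'p set" where
  "circ_of v = {P\<in>pts. B v (w P) = 0}"

definition eps :: "'p set \<Rightarrow> real" where
  "eps C = quad_char (B (pole C) (pole C))"

lemma circ_of_pole: "C \<in> circs \<Longrightarrow> s \<noteq> 0 \<Longrightarrow> circ_of (s *s pole C) = C"
  unfolding circ_of_def using incident circ_sub by (auto simp: B_scale)

lemma pencilE:
  assumes "C \<in> circs" "P \<in> C"
  obtains s where "s \<noteq> 0" "circ_of (pole C + c *s w P) \<in> circs"
    "pole C + c *s w P = s *s pole (circ_of (pole C + c *s w P))"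
  using pencil[OF assms, of c] circ_of_pole by metis

lemma pencil_tangent:
  assumes C: "C \<in> circs" and P: "P \<in> C" and c: "c \<noteq> 0"
  shows "C \<inter> circ_of (pole C + c *s w P) = {P}"
proof -
  have P': "P \<in> pts" using C P circ_sub by auto
  have "P \<in> circ_of (pole C + c *s w P)"
    using incident[OF C P'] P w_isotropic[OF P'] P' by (simp add: circ_of_def B_simps)
  moreover have "R = P" if "R \<in> C" "R \<in> circ_of (pole C + c *s w P)" for R
  proof (rule ccontr)
    assume "R \<noteq> P"
    hence "B (w P) (w R) \<noteq> 0" using w_not_perp[OF C P that(1)] by blast
    moreover have "R \<in> pts" using that C circ_sub by auto
    ultimately show False using that c incident[OF C \<open>R \<in> pts\<close>] by (auto simp: circ_of_def B_simps)
  qed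
  ultimately show ?thesis using P by auto
qed

text \<open>Adding a nonzero multiple of \<open>w P\<close> keeps the incidence with
  \<open>P\<close> and destroys it for all other points of \<open>C\<close>. The map is injective,
  and there are \<open>(q + 1) * (q - 1)\<close> parameters, as many as tangent circles.\<close>

lemma tangents_param:
  assumes C: "C \<in> circs"
  defines "g \<equiv> \<lambda>(P, c). circ_of (pole C + c *s w P)"
  shows "bij_betw g (C \<times> (UNIV - {0})) {D\<in>circs. tan C D}"
proof -
  let ?A = "C \<times> (UNIV - {0::'a})"
  have sub: "g ` ?A \<subseteq> {D\<in>circs. tan C D}"
  proof
    fix D assume "D \<in> g ` ?A"
    then obtain P c where Pc: "P \<in> C" "c \<noteq> 0" "D = circ_of (pole C + c *s w P)" by (auto simp: g_def)
    have "D \<in> circs" using pencilE[OF C Pc(1), of c] Pc(3) by metis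
    thus "D \<in> {D\<in>circs. tan C D}" using pencil_tangent[OF C Pc(1,2)] Pc(3) tanI[OF C, of D P] by auto
  qed
  have inj: "inj_on g ?A"
  proof (rule inj_onI)
    fix X Y assume XY: "X \<in> ?A" "Y \<in> ?A" "g X = g Y"
    obtain P c P' c' where X: "X = (P, c)" and Y: "Y = (P', c')" by (cases X, cases Y) blast
    have a: "P \<in> C" "P' \<in> C" "c \<noteq> 0" "c' \<noteq> 0" "g (P, c) = g (P', c')" using XY X Y by auto
    hence e: "circ_of (pole C + c *s w P) = circ_of (pole C + c' *s w P')" by (simp add: g_def)
    have PP: "P = P'" using pencil_tangent[OF C a(1,3)] pencil_tangent[OF C a(2,4)] e by auto
    define Z where "Z = pole (circ_of (pole C + c *s w P))"
    obtain s where s: "s \<noteq> 0" "pole C + c *s w P = s *s Z"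
      unfolding Z_def by (rule pencilE[OF C a(1), of c])
    have Z': "Z = pole (circ_of (pole C + c' *s w P))" using e PP by (simp add: Z_def)
    obtain s' where s': "s' \<noteq> 0" "pole C + c' *s w P = s' *s Z"
      unfolding Z' by (rule pencilE[OF C a(1), of c'])
    have "s' *s (pole C + c *s w P) = s *s (pole C + c' *s w P)"
      unfolding s(2) s'(2) by (simp add: vector_smult_assoc mult.commute)
    hence eq: "(s' - s) *s pole C = (s * c' - s' * c) *s w P"
      by (simp add: vec_eq_iff algebra_simps)
    have "s' = s"
    proof (rule ccontr)
      assume "s' \<noteq> s"
      hence "inverse (s' - s) *s ((s' - s) *s pole C) = pole C" by (simp add: vector_smult_assoc)
      hence "pole C = (inverse (s' - s) * (s * c' - s' * c)) *s w P" unfolding eq vector_smult_assoc by simp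
      thus False using pole_not_w[OF C a(1)] by blast
    qed
    moreover have "w P \<noteq> 0"
    proof
      assume w0: "w P = 0"
      obtain R where R: "R \<in> C" "R \<noteq> P"
      proof -
        have "C \<noteq> {P}" using card_circ[OF C] q_ge_3 by auto
        thus ?thesis using that a(1) by blast
      qed
      have "B (0 *s w P) (w R) = 0" unfolding B_scale by simp
      thus False using w_not_perp[OF C a(1) R(1)] R(2) w0 by auto
    qed
    ultimately have "s * c' - s * c = 0" using eq by (auto simp: vec_eq_iff)
    hence "c = c'" using s(1) by simp
    thus "X = Y" using PP X Y by simp
  qed
  have "card (g ` ?A) = (q + 1) * (q - 1)"
    using card_image[OF inj] card_circ[OF C] q_card by (simp add: card_cartesian_product card_Diff_subset)
  also have "\<dots> = card {D\<in>circs. tan C D}"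
    unfolding card_tangents[OF C] by (simp add: power2_eq_square algebra_simps)
  finally have "g ` ?A = {D\<in>circs. tan C D}"
    using sub finite_circs by (intro card_seteq) auto
  thus ?thesis using inj by (simp add: bij_betw_def)
qed

lemma tan_pole:
  assumes C: "C \<in> circs" and D: "D \<in> circs" and t: "tan C D"
  obtains s where "s \<noteq> 0" "s * B (pole C) (pole D) = B (pole C) (pole C)"
    "s * s * B (pole D) (pole D) = B (pole C) (pole C)"
proof -
  have "D \<in> (\<lambda>(P, c). circ_of (pole C + c *s w P)) ` (C \<times> (UNIV - {0}))"
    using tangents_param[OF C] D t by (simp add: bij_betw_def)
  then obtain P c where P: "P \<in> C" and Dp: "D = circ_of (pole C + c *s w P)" by auto
  obtain s where s: "s \<noteq> 0" "pole C + c *s w P = s *s pole D"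
    using pencilE[OF C P, of c] Dp by metis
  have P': "P \<in> pts" using C P circ_sub by auto
  have i: "B (pole C) (w P) = 0" "B (w P) (pole C) = 0" using incident[OF C P'] P B_sym by auto
  have "B (pole C) (pole C + c *s w P) = B (pole C) (pole C)" using i by (simp add: B_simps)
  hence 1: "s * B (pole C) (pole D) = B (pole C) (pole C)" unfolding s(2) B_simps .
  have "B (pole C + c *s w P) (pole C + c *s w P) = B (pole C) (pole C)"
    using i w_isotropic[OF P'] by (simp add: B_simps)
  hence 2: "s * s * B (pole D) (pole D) = B (pole C) (pole C)" unfolding s(2) B_simps by (simp add: mult.assoc)
  show ?thesis using that s(1) 1 2 by blast
qed

lemma tan_iff_gram:
  assumes C: "C \<in> circs" and D: "D \<in> circs" and ne: "C \<noteq> D"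
  shows "tan C D \<longleftrightarrow> B (pole C) (pole D) * B (pole C) (pole D) = B (pole C) (pole C) * B (pole D) (pole D)"
proof
  assume "tan C D"
  then obtain s where s: "s \<noteq> 0" "s * B (pole C) (pole D) = B (pole C) (pole C)"
    "s * s * B (pole D) (pole D) = B (pole C) (pole C)" using tan_pole[OF C D] by blast
  have "(s * s) * (B (pole C) (pole D) * B (pole C) (pole D)) = (s * B (pole C) (pole D)) * (s * B (pole C) (pole D))" by simp
  also have "\<dots> = B (pole C) (pole C) * (s * s * B (pole D) (pole D))" unfolding s ..
  finally have "(s * s) * (B (pole C) (pole D) * B (pole C) (pole D)) = (s * s) * (B (pole C) (pole C) * B (pole D) (pole D))"
    by (simp add: mult.left_commute mult.assoc)
  thus "B (pole C) (pole D) * B (pole C) (pole D) = B (pole C) (pole C) * B (pole D) (pole D)" using s(1) by simp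
qed (rule gram[OF C D ne])

text \<open>By \<open>tan_pole\<close> the norms of the two poles differ by the nonzero square
  \<open>s * s\<close>.\<close>

lemma eps_tangent:
  assumes C: "C \<in> circs" and D: "D \<in> circs" and t: "tan C D"
  shows "eps C = eps D"
proof -
  obtain s where s: "s \<noteq> 0" "s * s * B (pole D) (pole D) = B (pole C) (pole C)" using tan_pole[OF C D t] by blast
  have "(\<exists>y. y * y = s * s * x) \<longleftrightarrow> (\<exists>y. y * y = x)" for x
  proof
    assume "\<exists>y. y * y = s * s * x"
    then obtain y where "y * y = s * s * x" by blast
    hence "(y / s) * (y / s) = x" using s(1) by (simp add: field_simps)
    thus "\<exists>y. y * y = x" by blast
  next
    assume "\<exists>y. y * y = x"
    then obtain y where "y * y = x" by blast
    hence "(s * y) * (s * y) = s * s * x" by (auto simp: algebra_simps)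
    thus "\<exists>y. y * y = s * s * x" by blast
  qed
  thus ?thesis unfolding eps_def s(2)[symmetric] quad_char_def using s(1) by auto
qed

lemma card_sqrt_norms:
  assumes "C \<in> circs" "D \<in> circs"
  shows "real (card {y. y * y = B (pole C) (pole C) * B (pole D) (pole D)}) = 1 + eps C * eps D"
  using norms
proof
  assume "\<forall>C\<in>circs. B (pole C) (pole C) = 0"
  hence "B (pole C) (pole C) = 0" using assms by blast
  moreover from this have "{y. y * y = B (pole C) (pole C) * B (pole D) (pole D)} = {0}" by auto
  ultimately show ?thesis by (simp add: eps_def quad_char_def)
next
  assume "(\<forall>C\<in>circs. B (pole C) (pole C) \<noteq> 0) \<and> (2::'a) \<noteq> 0"
  thus ?thesis using card_sqrt_mult assms unfolding eps_def by blast
qed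

text \<open>In the parameters \<open>(P, c)\<close> of \<open>tangents_param\<close> the condition
  \<open>gram\<close> for \<open>D\<close> becomes
  \<open>(\<beta> + c * B (w P) (pole D))\<^sup>2 = k\<close>. For \<open>P\<close> on
  \<open>D\<close> it does not involve \<open>c\<close>. For \<open>P\<close> off \<open>D\<close>
  the base is an affine bijection in \<open>c\<close>, so the solutions correspond to the square
  roots of \<open>k\<close>, of which there are \<open>1 + eps C * eps D\<close>; the solution
  \<open>c = 0\<close>, which occurs if \<open>\<beta>\<^sup>2 = k\<close>, has to be left
  out.\<close>

theorem common_tangents_count:
  assumes C: "C \<in> circs" and D: "D \<in> circs" and ne: "C \<noteq> D"
  shows "real (card {E\<in>circs. tan C E \<and> tan E D}) + 2 * (if tan C D then 1 else 0) =
      (real q + 1 - real (card (C \<inter> D))) * (1 + eps C * eps D)"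
proof -
  define g where "g = (\<lambda>(P, c). circ_of (pole C + c *s w P))"
  define k where "k = B (pole C) (pole C) * B (pole D) (pole D)"
  define \<beta> where "\<beta> = B (pole C) (pole D)"
  define m where "m = card {y. y * y = k}"
  define A where "A P = {c. c \<noteq> 0 \<and> (\<beta> + c * B (w P) (pole D)) * (\<beta> + c * B (w P) (pole D)) = k}" for P
  have m: "real m = 1 + eps C * eps D" unfolding m_def k_def by (rule card_sqrt_norms[OF C D])
  have bij: "bij_betw g (C \<times> (UNIV - {0})) {E\<in>circs. tan C E}"
    unfolding g_def by (rule tangents_param[OF C])
  have cond: "(\<beta> + c * B (w P) (pole D)) * (\<beta> + c * B (w P) (pole D)) = k \<longleftrightarrow> (g (P, c) = D \<or> tan (g (P, c)) D)"
    if P: "P \<in> C" and c: "c \<noteq> 0" for P c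
  proof -
    define E where "E = g (P, c)"
    have E: "E = circ_of (pole C + c *s w P)" by (simp add: E_def g_def)
    obtain s where s: "s \<noteq> 0" "E \<in> circs" "pole C + c *s w P = s *s pole E"
      using pencilE[OF C P, of c] E by metis
    have P': "P \<in> pts" using C P circ_sub by auto
    have i: "B (pole C) (w P) = 0" "B (w P) (pole C) = 0" using incident[OF C P'] P B_sym by auto
    have 1: "\<beta> + c * B (w P) (pole D) = s * B (pole E) (pole D)"
      using arg_cong[OF s(3), of "\<lambda>v. B v (pole D)"] by (simp add: B_simps \<beta>_def)
    have "B (pole C + c *s w P) (pole C + c *s w P) = B (pole C) (pole C)"
      using i w_isotropic[OF P'] by (simp add: B_simps)
    hence 2: "B (pole C) (pole C) = s * s * B (pole E) (pole E)" unfolding s(3) B_simps by (simp add: mult.assoc)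
    have "(\<beta> + c * B (w P) (pole D)) * (\<beta> + c * B (w P) (pole D)) = k \<longleftrightarrow>
       (s * s) * (B (pole E) (pole D) * B (pole E) (pole D)) = (s * s) * (B (pole E) (pole E) * B (pole D) (pole D))"
      unfolding 1 k_def 2 by (simp add: mult.left_commute mult.assoc)
    also have "\<dots> \<longleftrightarrow> B (pole E) (pole D) * B (pole E) (pole D) = B (pole E) (pole E) * B (pole D) (pole D)" using s(1) by simp
    also have "\<dots> \<longleftrightarrow> (E = D \<or> tan E D)" using tan_iff_gram[OF s(2) D] by blast
    finally show ?thesis unfolding E_def .
  qed
  \<comment> \<open>The Gram condition is also satisfied by \<open>E = D\<close>, so
    \<open>D\<close> itself is counted if it is tangent to \<open>C\<close>.\<close>
  have im: "g ` (SIGMA P:C. A P) = {E\<in>circs. tan C E \<and> (E = D \<or> tan E D)}"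
  proof
    show "g ` (SIGMA P:C. A P) \<subseteq> {E\<in>circs. tan C E \<and> (E = D \<or> tan E D)}"
    proof
      fix E assume "E \<in> g ` (SIGMA P:C. A P)"
      then obtain P c where Pc: "P \<in> C" "c \<in> A P" "E = g (P, c)" by auto
      hence "E \<in> g ` (C \<times> (UNIV - {0}))" by (auto simp: A_def)
      hence "E \<in> circs \<and> tan C E" using bij by (auto simp: bij_betw_def)
      thus "E \<in> {E\<in>circs. tan C E \<and> (E = D \<or> tan E D)}" using cond[of P c] Pc by (auto simp: A_def)
    qed
    show "{E\<in>circs. tan C E \<and> (E = D \<or> tan E D)} \<subseteq> g ` (SIGMA P:C. A P)"
    proof
      fix E assume E: "E \<in> {E\<in>circs. tan C E \<and> (E = D \<or> tan E D)}"
      hence "E \<in> g ` (C \<times> (UNIV - {0}))" using bij by (auto simp: bij_betw_def)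
      then obtain P c where Pc: "P \<in> C" "c \<noteq> 0" "E = g (P, c)" by auto
      hence "c \<in> A P" using cond[of P c] E by (simp add: A_def)
      thus "E \<in> g ` (SIGMA P:C. A P)" using Pc by blast
    qed
  qed
  have "inj_on g (SIGMA P:C. A P)"
    by (rule inj_on_subset[OF bij_betw_imp_inj_on[OF bij]]) (auto simp: A_def)
  hence "card {E\<in>circs. tan C E \<and> (E = D \<or> tan E D)} = card (SIGMA P:C. A P)"
    unfolding im[symmetric] by (rule card_image)
  also have "\<dots> = (\<Sum>P\<in>C. card (A P))" using finite_circ[OF C] by (intro card_SigmaI) auto
  finally have card1: "card {E\<in>circs. tan C E \<and> (E = D \<or> tan E D)} = (\<Sum>P\<in>C. card (A P))" .
  have in_D: "card (A P) = (if \<beta> * \<beta> = k then q - 1 else 0)" if "P \<in> C \<inter> D" for P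
  proof -
    have "P \<in> pts" using that C circ_sub by auto
    hence "B (w P) (pole D) = 0" using incident[OF D] that B_sym by auto
    hence "A P = (if \<beta> * \<beta> = k then UNIV - {0} else {})" by (auto simp: A_def)
    thus ?thesis using q_card by (simp add: card_Diff_subset)
  qed
  have out_D: "real (card (A P)) = real m - (if \<beta> * \<beta> = k then 1 else 0)" if P: "P \<in> C - D" for P
  proof -
    have "P \<in> pts" using that C circ_sub by auto
    hence nz: "B (w P) (pole D) \<noteq> 0" using incident[OF D] that B_sym by auto
    have "bij_betw (\<lambda>c. \<beta> + c * B (w P) (pole D)) {c. (\<beta> + c * B (w P) (pole D)) * (\<beta> + c * B (w P) (pole D)) = k} {y. y * y = k}"
      by (rule bij_betwI[where g = "\<lambda>y. (y - \<beta>) / B (w P) (pole D)"]) (use nz in auto)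
    hence "card {c. (\<beta> + c * B (w P) (pole D)) * (\<beta> + c * B (w P) (pole D)) = k} = m"
      unfolding m_def by (rule bij_betw_same_card)
    moreover have "A P = {c. (\<beta> + c * B (w P) (pole D)) * (\<beta> + c * B (w P) (pole D)) = k} - {0}" by (auto simp: A_def)
    moreover have "0 \<in> {c. (\<beta> + c * B (w P) (pole D)) * (\<beta> + c * B (w P) (pole D)) = k} \<longleftrightarrow> \<beta> * \<beta> = k" by simp
    moreover define Z where "Z = {c. (\<beta> + c * B (w P) (pole D)) * (\<beta> + c * B (w P) (pole D)) = k}"
    ultimately have Z: "card Z = m" "A P = Z - {0}" "0 \<in> Z \<longleftrightarrow> \<beta> * \<beta> = k" by auto
    show ?thesis
    proof (cases "\<beta> * \<beta> = k")
      case True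
      hence "card (Z - {0}) + 1 = card Z" using Z(3) card.remove[of Z 0] by simp
      thus ?thesis using True Z by simp
    qed (use Z in simp)
  qed
  have split: "(\<Sum>P\<in>C. card (A P)) = (\<Sum>P\<in>C \<inter> D. card (A P)) + (\<Sum>P\<in>C - D. card (A P))"
    using finite_circ[OF C] by (rule sum.Int_Diff)
  have cCD: "real (card (C - D)) = real q + 1 - real (card (C \<inter> D))"
    using card_circ[OF C] finite_circ[OF C] card_Diff_subset_Int[of C D] card_mono[of C "C \<inter> D"] by (simp add: of_nat_diff)
  show ?thesis
  proof (cases "tan C D")
    case False
    hence nk: "\<beta> * \<beta> \<noteq> k" using tan_iff_gram[OF C D ne] by (simp add: \<beta>_def k_def)
    have "{E\<in>circs. tan C E \<and> (E = D \<or> tan E D)} = {E\<in>circs. tan C E \<and> tan E D}" using False by blast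
    hence "real (card {E\<in>circs. tan C E \<and> tan E D}) = (\<Sum>P\<in>C - D. real (card (A P)))"
      using card1 split in_D nk by simp
    also have "\<dots> = real (card (C - D)) * real m" using out_D nk by simp
    finally show ?thesis using False cCD m by simp
  next
    case True
    hence k: "\<beta> * \<beta> = k" using tan_iff_gram[OF C D ne] by (simp add: \<beta>_def k_def)
    have c1: "card (C \<inter> D) = 1" using True by (simp add: tan_def)
    have "{E\<in>circs. tan C E \<and> (E = D \<or> tan E D)} = insert D {E\<in>circs. tan C E \<and> tan E D}" using True D by blast
    moreover have "D \<notin> {E\<in>circs. tan C E \<and> tan E D}" by (simp add: tan_def)
    ultimately have "card {E\<in>circs. tan C E \<and> tan E D} + 1 = (\<Sum>P\<in>C. card (A P))"
      using card1 finite_circs by simp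
    hence "real (card {E\<in>circs. tan C E \<and> tan E D} + 1) = real (\<Sum>P\<in>C. card (A P))"
      by (rule arg_cong)
    hence "real (card {E\<in>circs. tan C E \<and> tan E D}) + 1 = real (\<Sum>P\<in>C. card (A P))"
      by (simp only: of_nat_add of_nat_1)
    also have "\<dots> = (\<Sum>P\<in>C \<inter> D. real (card (A P))) + (\<Sum>P\<in>C - D. real (card (A P)))" unfolding split by simp
    also have "(\<Sum>P\<in>C \<inter> D. real (card (A P))) = real q - 1" using in_D k c1 q_ge_3 by (simp add: of_nat_diff)
    also have "(\<Sum>P\<in>C - D. real (card (A P))) = real q * (real m - 1)" using out_D k cCD c1 by simp
    finally show ?thesis using True m c1 by (simp add: algebra_simps)
  qed
qed

sublocale classed_circle_geometry pts circs par q \<rho> eps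
proof
  show "(\<forall>C\<in>circs. eps C = 0) \<or> (\<forall>C\<in>circs. eps C = 1 \<or> eps C = -1)"
    using norms by (auto simp: eps_def quad_char_def)
qed (use eps_tangent common_tangents_count in auto)

end

section \<open>Projective spaces over finite fields\<close>

abbreviation pt :: "'a::field ^ 'n \<Rightarrow> ('a ^ 'n) set" where
  "pt v \<equiv> vec.span {v}"

definition on :: "('a::field ^ 'n) set set \<Rightarrow> ('a ^ 'n) set \<Rightarrow> ('a ^ 'n) set set" where
  "on S X = {P\<in>S. P \<subseteq> X}"

lemma pt_def: "pt v = range (\<lambda>c. c *s v)"
  by (rule vec.span_singleton)

lemma self_in_pt [simp]: "v \<in> pt v"
  by (simp add: vec.span_base)

lemma pt_subset_iff: "vec.subspace S \<Longrightarrow> pt v \<subseteq> S \<longleftrightarrow> v \<in> S"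
  by (metis empty_subsetI insert_subset self_in_pt subset_iff vec.span_minimal)

lemma pt_in_pg_points: "v \<noteq> 0 \<Longrightarrow> pt v \<in> pg_points"
  by (simp add: pg_points_def)

lemma pg_pointE:
  assumes "P \<in> pg_points"
  obtains v where "v \<noteq> 0" "P = pt v"
proof -
  have P: "vec.subspace P" "vec.dim P = 1" using assms by (auto simp: pg_points_def)
  have "P \<noteq> {0}" using P(2) by auto
  then obtain v where v: "v \<in> P" "v \<noteq> 0" using vec.subspace_0[OF P(1)] by blast
  have "pt v = P"
    by (rule vec.subspace_dim_equal) (use P v in \<open>auto simp: pt_subset_iff\<close>)
  thus ?thesis using that v by blast
qed

lemma pg_point_eqI:
  assumes "P \<in> pg_points" "v \<in> P" "v \<noteq> 0"
  shows "P = pt v"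
proof -
  have P: "vec.subspace P" "vec.dim P = 1" using assms by (auto simp: pg_points_def)
  have "pt v = P"
    by (rule vec.subspace_dim_equal) (use P assms in \<open>auto simp: pt_subset_iff\<close>)
  thus ?thesis by simp
qed

lemma pt_eq_iff:
  fixes v w :: "'a::{field,finite} ^ 'n"
  assumes "v \<noteq> 0" "w \<noteq> 0"
  shows "pt v = pt w \<longleftrightarrow> (\<exists>c. w = c *s v)"
proof
  assume "pt v = pt w"
  hence "w \<in> pt v" by simp
  thus "\<exists>c. w = c *s v" unfolding pt_def by blast
next
  assume "\<exists>c. w = c *s v"
  hence "w \<in> pt v" unfolding pt_def by blast
  thus "pt v = pt w" using pg_point_eqI[OF pt_in_pg_points[OF assms(1)]] assms by blast
qed

lemma pg_point_subspace: "P \<in> pg_points \<Longrightarrow> vec.subspace P"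
  by (simp add: pg_points_def)

lemma pg_line_subspace: "L \<in> pg_lines \<Longrightarrow> vec.subspace L" "L \<in> pg_lines \<Longrightarrow> vec.dim L = 2"
  by (simp_all add: pg_lines_def)

lemma pg_plane_subspace: "E \<in> pg_planes \<Longrightarrow> vec.subspace E" "E \<in> pg_planes \<Longrightarrow> vec.dim E = 3"
  by (simp_all add: pg_planes_def)

section \<open>Numbers of points, lines and planes\<close>

lemma card_span_insert:
  fixes S :: "('a::{field,finite} ^ 'n) set"
  assumes "a \<notin> vec.span S"
  shows "card (vec.span (insert a S)) = CARD('a) * card (vec.span S)"
proof -
  let ?f = "\<lambda>(k, v). k *s a + v"
  have "vec.span (insert a S) = ?f ` (UNIV \<times> vec.span S)"
  proof
    show "vec.span (insert a S) \<subseteq> ?f ` (UNIV \<times> vec.span S)"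
    proof
      fix x assume "x \<in> vec.span (insert a S)"
      then obtain k where "x - k *s a \<in> vec.span S" using vec.span_breakdown_eq by blast
      hence "x = ?f (k, x - k *s a)" "(k, x - k *s a) \<in> UNIV \<times> vec.span S" by auto
      thus "x \<in> ?f ` (UNIV \<times> vec.span S)" by blast
    qed
    show "?f ` (UNIV \<times> vec.span S) \<subseteq> vec.span (insert a S)"
    proof
      fix x assume "x \<in> ?f ` (UNIV \<times> vec.span S)"
      then obtain k v where "x = k *s a + v" "v \<in> vec.span S" by auto
      moreover have "a \<in> vec.span (insert a S)" by (simp add: vec.span_base)
      moreover have "vec.span S \<subseteq> vec.span (insert a S)" by (rule vec.span_mono) blast
      ultimately show "x \<in> vec.span (insert a S)"
        by (auto intro!: vec.span_add vec.span_scale)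
    qed
  qed
  moreover have "inj_on ?f (UNIV \<times> vec.span S)"
  proof (rule inj_onI)
    fix x y assume x: "x \<in> UNIV \<times> vec.span S" and y: "y \<in> UNIV \<times> vec.span S" and e: "?f x = ?f y"
    obtain k v k' v' where xy: "x = (k, v)" "y = (k', v')" by (cases x, cases y) blast
    have vv: "v \<in> vec.span S" "v' \<in> vec.span S" using x y xy by auto
    have "(k - k') *s a = v' - v" using e xy by (simp add: algebra_simps vec.scale_left_diff_distrib)
    hence in1: "(k - k') *s a \<in> vec.span S" using vv by (simp add: vec.span_diff)
    have "k = k'"
    proof (rule ccontr)
      assume "k \<noteq> k'"
      hence "a \<in> vec.span S" using vec.span_scale[OF in1, of "inverse (k - k')"] by (simp add: vector_smult_assoc)
      thus False using assms by simp
    qed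
    thus "x = y" using e xy by simp
  qed
  ultimately show ?thesis by (simp add: card_image card_cartesian_product)
qed

lemma card_subspace:
  fixes S :: "('a::{field,finite} ^ 'n) set"
  assumes "vec.subspace S"
  shows "card S = CARD('a) ^ vec.dim S"
proof -
  obtain Bs where Bs: "Bs \<subseteq> S" "vec.independent Bs" "S \<subseteq> vec.span Bs" "card Bs = vec.dim S"
    using vec.basis_exists by blast
  have S: "S = vec.span Bs" using Bs assms by (metis vec.span_subspace)
  have fin: "finite Bs" by simp
  from fin Bs(2) have "card (vec.span Bs) = CARD('a) ^ card Bs"
  proof (induction Bs rule: finite_induct)
    case (insert a T)
    have "a \<notin> vec.span T" "vec.independent T"
      using insert.prems insert.hyps vec.independent_insert[of a T] by auto
    thus ?case using insert card_span_insert[of a T] by simp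
  qed simp
  thus ?thesis using S Bs(4) by simp
qed

lemma two_le_card_field: "2 \<le> CARD('a::{field,finite})"
proof -
  have "card {0, 1::'a} \<le> CARD('a)" by (rule card_mono) auto
  thus ?thesis by simp
qed

lemma card_points_subspace:
  fixes S :: "('a::{field,finite} ^ 'n) set"
  assumes S: "vec.subspace S"
  shows "card (on pg_points S) * (CARD('a) - 1) = CARD('a) ^ vec.dim S - 1"
proof -
  have "(\<Sum>v\<in>S - {0}. card {P\<in>on pg_points S. v \<in> P}) = (CARD('a) - 1) * card (on pg_points S)"
  proof (rule sum_multicount)
    show "\<forall>P\<in>on pg_points S. card {v\<in>S - {0}. v \<in> P} = CARD('a) - 1"
    proof
      fix P assume P: "P \<in> on pg_points S"
      hence "{v\<in>S - {0}. v \<in> P} = P - {0}" by (auto simp: on_def)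
      moreover have "vec.subspace P" "vec.dim P = 1" using P by (auto simp: on_def pg_points_def)
      ultimately show "card {v\<in>S - {0}. v \<in> P} = CARD('a) - 1"
        using card_subspace[of P] vec.subspace_0[of P] by simp
    qed
  qed auto
  moreover have "card {P\<in>on pg_points S. v \<in> P} = 1" if v: "v \<in> S - {0}" for v
  proof -
    have "P = pt v" if "P \<in> on pg_points S" "v \<in> P" for P
      by (rule pg_point_eqI) (use that v in \<open>auto simp: on_def\<close>)
    hence "{P\<in>on pg_points S. v \<in> P} \<subseteq> {pt v}" by blast
    moreover have "pt v \<in> on pg_points S" using v S pt_in_pg_points[of v] by (simp add: on_def pt_subset_iff)
    hence "{pt v} \<subseteq> {P\<in>on pg_points S. v \<in> P}" by simp
    ultimately have "{P\<in>on pg_points S. v \<in> P} = {pt v}" by (rule equalityI)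
    thus ?thesis by simp
  qed
  ultimately have "card (S - {0}) = (CARD('a) - 1) * card (on pg_points S)" by simp
  thus ?thesis using card_subspace[OF S] vec.subspace_0[OF S] by (simp add: mult.commute)
qed

lemma card_on_point: "P \<in> pg_points \<Longrightarrow> on pg_points P = {P}"
proof -
  assume P: "P \<in> pg_points"
  have "R = P" if "R \<in> pg_points" "R \<subseteq> P" for R
    by (rule vec.subspace_dim_equal) (use that P in \<open>auto simp: pg_points_def\<close>)
  thus ?thesis using P by (auto simp: on_def)
qed

lemma card_on_line:
  fixes L :: "('a::{field,finite} ^ 'n) set"
  assumes "L \<in> pg_lines" shows "card (on pg_points L) = CARD('a) + 1"
proof -
  have "card (on pg_points L) * (CARD('a) - 1) = CARD('a)^2 - 1"
    using card_points_subspace[of L] pg_line_subspace[OF assms] by simp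
  also have "\<dots> = (CARD('a) + 1) * (CARD('a) - 1)" by (simp add: power2_eq_square algebra_simps)
  finally show ?thesis unfolding mult_cancel2 using two_le_card_field[where 'a='a] by auto
qed

lemma card_on_plane:
  fixes E :: "('a::{field,finite} ^ 'n) set"
  assumes "E \<in> pg_planes" shows "card (on pg_points E) = CARD('a)\<^sup>2 + CARD('a) + 1"
proof -
  have "card (on pg_points E) * (CARD('a) - 1) = CARD('a)^3 - 1"
    using card_points_subspace[of E] pg_plane_subspace[OF assms] by simp
  also have "\<dots> = (CARD('a)^2 + CARD('a) + 1) * (CARD('a) - 1)"
    by (simp add: power2_eq_square power3_eq_cube algebra_simps)
  finally show ?thesis unfolding mult_cancel2 using two_le_card_field[where 'a='a] by auto
qed

lemma dim_UNIV4: "vec.dim (UNIV :: ('a::field ^ 4) set) = 4"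
  unfolding vec_dim_card by simp

lemma card_on_UNIV:
  "card (on pg_points (UNIV :: ('a::{field,finite} ^ 4) set)) = CARD('a)^3 + CARD('a)\<^sup>2 + CARD('a) + 1"
proof -
  have "card (on pg_points (UNIV :: ('a ^ 4) set)) * (CARD('a) - 1) = CARD('a)^4 - 1"
    using card_points_subspace[of "UNIV :: ('a ^ 4) set"] unfolding dim_UNIV4 by simp
  also have "\<dots> = (CARD('a)^3 + CARD('a)^2 + CARD('a) + 1) * (CARD('a) - 1)"
    by (simp add: power2_eq_square power3_eq_cube power4_eq_xxxx algebra_simps)
  finally show ?thesis unfolding mult_cancel2 using two_le_card_field[where 'a='a] by auto
qed

text \<open>The points of the quotient of \<open>W\<close> by \<open>U\<close>. Lines through a
  point and planes through a line become instances of one notion.\<close>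

definition covers :: "('a::field ^ 'n) set \<Rightarrow> ('a ^ 'n) set \<Rightarrow> ('a ^ 'n) set set" where
  "covers U W = {X. vec.subspace X \<and> vec.dim X = vec.dim U + 1 \<and> U \<subseteq> X \<and> X \<subseteq> W}"

lemma ex1_cover:
  fixes U W :: "('a::{field,finite} ^ 'n) set"
  assumes U: "vec.subspace U" "U \<subseteq> W" and W: "vec.subspace W" and P: "P \<in> pg_points" "P \<subseteq> W" "\<not> P \<subseteq> U"
  shows "\<exists>!X. X \<in> covers U W \<and> P \<subseteq> X"
proof -
  obtain v where v: "v \<noteq> 0" "P = pt v" using P(1) by (rule pg_pointE)
  have vW: "v \<in> W" "v \<notin> U" using P v pt_subset_iff U W by metis+
  have span: "vec.span U = U" using U(1) by (rule vec.span_eq_iff[THEN iffD2])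
  let ?X = "vec.span (insert v U)"
  have "v \<notin> vec.span U" unfolding span by (rule vW)
  hence d: "vec.dim ?X = vec.dim U + 1" by (simp add: vec.dim_insert)
  have "?X \<subseteq> W" by (rule vec.span_minimal) (use U vW W in auto)
  moreover have "U \<subseteq> ?X" using vec.span_superset[of "insert v U"] by blast
  ultimately have "?X \<in> covers U W" unfolding covers_def using d by simp
  moreover have "P \<subseteq> ?X" using v by (simp add: pt_subset_iff vec.span_base)
  moreover have "X = ?X" if X: "X \<in> covers U W" "P \<subseteq> X" for X
  proof -
    have sX: "vec.subspace X" "U \<subseteq> X" "vec.dim X = vec.dim U + 1" using X by (auto simp: covers_def)
    have "v \<in> X" using X v sX by (simp add: pt_subset_iff)
    hence "?X \<subseteq> X" using sX by (simp add: vec.span_minimal)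
    hence "?X = X" by (rule vec.subspace_dim_equal[rotated 2]) (use d sX in auto)
    thus ?thesis by simp
  qed
  ultimately show ?thesis by blast
qed

text \<open>By \<open>ex1_cover\<close> the points of \<open>W\<close> outside \<open>U\<close> are
  partitioned by the covers. The later counts over lines through a point and planes through a line
  rest on this.\<close>

lemma sum_covers:
  fixes U W :: "('a::{field,finite} ^ 'n) set"
  assumes U: "vec.subspace U" "U \<subseteq> W" and W: "vec.subspace W" and S: "S \<subseteq> pg_points"
  shows "(\<Sum>X\<in>covers U W. card (on S X - on S U)) = card (on S W - on S U)"
proof -
  have "on S W - on S U = (\<Union>X\<in>covers U W. on S X - on S U)"
  proof
    show "on S W - on S U \<subseteq> (\<Union>X\<in>covers U W. on S X - on S U)"
    proof
      fix P assume P: "P \<in> on S W - on S U"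
      hence "P \<in> pg_points" "P \<subseteq> W" "\<not> P \<subseteq> U" using S by (auto simp: on_def)
      then obtain X where "X \<in> covers U W" "P \<subseteq> X" using ex1_cover[OF U W] by blast
      thus "P \<in> (\<Union>X\<in>covers U W. on S X - on S U)" using P by (auto simp: on_def)
    qed
  qed (auto simp: on_def covers_def)
  moreover have "(on S X - on S U) \<inter> (on S Y - on S U) = {}" if "X \<in> covers U W" "Y \<in> covers U W" "X \<noteq> Y" for X Y
  proof (rule ccontr)
    assume "(on S X - on S U) \<inter> (on S Y - on S U) \<noteq> {}"
    then obtain P where "P \<in> S" "P \<subseteq> X" "P \<subseteq> Y" "\<not> P \<subseteq> U" by (auto simp: on_def)
    moreover from this have "P \<in> pg_points" "P \<subseteq> W" using S that by (auto simp: covers_def)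
    ultimately show False using ex1_cover[OF U W, of P] that by blast
  qed
  ultimately show ?thesis by (simp only:) (rule card_UN_disjoint[symmetric]; simp)
qed

lemma mem_lines_iff: "P \<in> pg_points \<Longrightarrow> L \<in> covers P W \<longleftrightarrow> L \<in> pg_lines \<and> P \<subseteq> L \<and> L \<subseteq> W"
  by (auto simp: covers_def pg_points_def pg_lines_def)

lemma mem_planes_iff: "L \<in> pg_lines \<Longrightarrow> E \<in> covers L W \<longleftrightarrow> E \<in> pg_planes \<and> L \<subseteq> E \<and> E \<subseteq> W"
  by (auto simp: covers_def pg_lines_def pg_planes_def)

lemma card_covers:
  fixes U W :: "('a::{field,finite} ^ 'n) set"
  assumes U: "vec.subspace U" "U \<subseteq> W" and W: "vec.subspace W"
    and u: "\<And>X. X \<in> covers U W \<Longrightarrow> card (on pg_points X) = card (on pg_points U) + k"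
  shows "card (covers U W) * k = card (on pg_points W) - card (on pg_points U)"
proof -
  have sub: "on pg_points U \<subseteq> on pg_points X" if "U \<subseteq> X" for X :: "('a ^ 'n) set" using that by (auto simp: on_def)
  have "card (on pg_points X - on pg_points U) = k" if "X \<in> covers U W" for X
    using u[OF that] sub[of X] that by (simp add: card_Diff_subset covers_def)
  hence "card (covers U W) * k = card (on pg_points W - on pg_points U)"
    using sum_covers[OF U W order_refl] by simp
  thus ?thesis using sub[OF U(2)] by (simp add: card_Diff_subset)
qed

lemma card_lines_plane:
  fixes E :: "('a::{field,finite} ^ 'n) set"
  assumes P: "P \<in> pg_points" and E: "E \<in> pg_planes" "P \<subseteq> E"
  shows "card (covers P E) = CARD('a) + 1"
proof -
  have "card (covers P E) * CARD('a) = card (on pg_points E) - card (on pg_points P)"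
    by (rule card_covers) (use P E in \<open>auto simp: pg_point_subspace pg_plane_subspace mem_lines_iff card_on_line card_on_point\<close>)
  also have "\<dots> = (CARD('a) + 1) * CARD('a)"
    using P E by (simp add: card_on_plane card_on_point power2_eq_square)
  finally show ?thesis unfolding mult_cancel2 by simp
qed

lemma card_lines_space:
  fixes P :: "('a::{field,finite} ^ 4) set"
  assumes P: "P \<in> pg_points"
  shows "card (covers P UNIV) = CARD('a)\<^sup>2 + CARD('a) + 1"
proof -
  have "card (covers P UNIV) * CARD('a) = card (on pg_points (UNIV :: ('a ^ 4) set)) - card (on pg_points P)"
    by (rule card_covers) (use P in \<open>auto simp: pg_point_subspace mem_lines_iff card_on_line card_on_point\<close>)
  also have "\<dots> = (CARD('a)\<^sup>2 + CARD('a) + 1) * CARD('a)"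
    using P unfolding card_on_UNIV by (simp add: card_on_point power2_eq_square power3_eq_cube algebra_simps)
  finally show ?thesis unfolding mult_cancel2 by simp
qed

lemma card_planes_line:
  fixes L :: "('a::{field,finite} ^ 4) set"
  assumes L: "L \<in> pg_lines"
  shows "card (covers L UNIV) = CARD('a) + 1"
proof -
  have "card (covers L UNIV) * CARD('a)\<^sup>2 = card (on pg_points (UNIV :: ('a ^ 4) set)) - card (on pg_points L)"
    by (rule card_covers) (use L in \<open>auto simp: pg_line_subspace mem_planes_iff card_on_line card_on_plane\<close>)
  also have "\<dots> = (CARD('a) + 1) * CARD('a)\<^sup>2"
    using L unfolding card_on_UNIV by (simp add: card_on_line power2_eq_square power3_eq_cube algebra_simps)
  finally show ?thesis unfolding mult_cancel2 by simp
qed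

lemma join_line:
  assumes X: "X \<in> pg_points" and Y: "Y \<in> pg_points" and ne: "X \<noteq> Y"
  shows "\<exists>!L. L \<in> pg_lines \<and> X \<subseteq> L \<and> Y \<subseteq> L"
proof -
  have "\<not> Y \<subseteq> X" using card_on_point[OF X] Y ne by (auto simp: on_def)
  thus ?thesis using ex1_cover[of X UNIV Y] X Y by (simp add: mem_lines_iff pg_point_subspace conj_assoc)
qed

lemma join_plane:
  fixes L :: "('a::{field,finite} ^ 'n) set"
  assumes L: "L \<in> pg_lines" and Y: "Y \<in> pg_points" and ne: "\<not> Y \<subseteq> L"
  shows "\<exists>!E. E \<in> pg_planes \<and> L \<subseteq> E \<and> Y \<subseteq> E"
  using ex1_cover[of L UNIV Y] L Y ne by (simp add: mem_planes_iff pg_line_subspace conj_assoc)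

lemma line_subset:
  assumes "X \<in> pg_points" "Y \<in> pg_points" "X \<noteq> Y" "L \<in> pg_lines" "X \<subseteq> L" "Y \<subseteq> L"
    "vec.subspace W" "X \<subseteq> W" "Y \<subseteq> W"
  shows "L \<subseteq> W"
proof -
  obtain x where x: "x \<noteq> 0" "X = pt x" using assms(1) by (rule pg_pointE)
  obtain y where y: "y \<noteq> 0" "Y = pt y" using assms(2) by (rule pg_pointE)
  have "y \<notin> pt x" using pg_point_eqI[OF assms(1), of y] x y assms(3) by auto
  hence d: "vec.dim (vec.span {y, x}) = 2" using x by (simp add: vec.dim_insert)
  have "x \<in> L" "y \<in> L" using assms x y self_in_pt by blast+
  hence "vec.span {y, x} \<subseteq> L" using assms(4) by (intro vec.span_minimal) (auto simp: pg_line_subspace)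
  hence "vec.span {y, x} = L" using d assms(4) by (intro vec.subspace_dim_equal) (auto simp: pg_line_subspace)
  moreover have "x \<in> W" "y \<in> W" using assms x y self_in_pt by blast+
  ultimately show ?thesis using assms(7) vec.span_minimal[of "{y, x}" W] by auto
qed

lemma Int_subspaces_dim:
  fixes S T :: "('a::field ^ 'n) set"
  assumes "vec.subspace S" "vec.subspace T" "S \<subseteq> W" "T \<subseteq> W" "vec.subspace W"
  shows "vec.dim S + vec.dim T \<le> vec.dim (S \<inter> T) + vec.dim W"
proof -
  have "{x + y |x y. x \<in> S \<and> y \<in> T} \<subseteq> W" using assms vec.subspace_add by blast
  hence "vec.dim {x + y |x y. x \<in> S \<and> y \<in> T} \<le> vec.dim W" by (rule vec.dim_subset)
  thus ?thesis using vec.dim_sums_Int[OF assms(1,2)] by linarith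
qed

lemma Int_dim_less:
  assumes "vec.subspace S" "vec.subspace T" "\<not> S \<subseteq> T"
  shows "vec.dim (S \<inter> T) < vec.dim S"
proof -
  have "vec.subspace (S \<inter> T)" using assms by (simp add: vec.subspace_inter)
  moreover have "S \<inter> T \<noteq> S" using assms by blast
  ultimately have "\<not> vec.dim S \<le> vec.dim (S \<inter> T)" using vec.subspace_dim_equal[of "S \<inter> T" S] assms(1) by blast
  thus ?thesis by simp
qed

lemma planes_Int:
  fixes E :: "('a::{field,finite} ^ 4) set"
  assumes "E \<in> pg_planes" "E' \<in> pg_planes" "E \<noteq> E'"
  shows "E \<inter> E' \<in> pg_lines"
proof -
  have ns: "\<not> E \<subseteq> E'" using assms vec.subspace_dim_equal[of E E'] by (auto simp: pg_planes_def)
  have "vec.dim (E \<inter> E') < 3" using Int_dim_less[of E E'] assms ns by (simp add: pg_planes_def)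
  moreover have "6 \<le> vec.dim (E \<inter> E') + 4"
    using Int_subspaces_dim[of E E' UNIV] assms unfolding dim_UNIV4 by (simp add: pg_planes_def)
  ultimately show ?thesis using assms by (auto simp: pg_lines_def pg_planes_def vec.subspace_inter)
qed

lemma lines_Int:
  assumes "L \<in> pg_lines" "L' \<in> pg_lines" "L \<noteq> L'" "E \<in> pg_planes" "L \<subseteq> E" "L' \<subseteq> E"
  shows "L \<inter> L' \<in> pg_points"
proof -
  have ns: "\<not> L \<subseteq> L'" using assms vec.subspace_dim_equal[of L L'] by (auto simp: pg_lines_def)
  have "vec.dim (L \<inter> L') < 2" using Int_dim_less[of L L'] assms ns by (simp add: pg_lines_def)
  moreover have "4 \<le> vec.dim (L \<inter> L') + 3"
    using Int_subspaces_dim[of L L' E] assms by (simp add: pg_lines_def pg_planes_def)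
  ultimately show ?thesis using assms by (auto simp: pg_lines_def pg_points_def vec.subspace_inter)
qed

section \<open>Arcs and ovals\<close>

lemma on_subset: "on S X \<subseteq> S" "on S X \<subseteq> on S Y" if "X \<subseteq> Y"
  using that by (auto simp: on_def)

lemma mem_on: "P \<in> on S X \<longleftrightarrow> P \<in> S \<and> P \<subseteq> X"
  by (simp add: on_def)

locale arc =
  fixes S :: "('a::{field,finite} ^ 'n) set set"
  assumes points: "S \<subseteq> pg_points" and no_three: "no_three_on_a_line S"
begin

lemma no_threeD:
  assumes "X \<in> S" "Y \<in> S" "Z \<in> S" "X \<noteq> Y" "X \<noteq> Z" "Y \<noteq> Z" "L \<in> pg_lines" "X \<subseteq> L" "Y \<subseteq> L" "Z \<subseteq> L"
  shows False
  using no_three assms unfolding no_three_on_a_line_def by meson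

lemma card_line_le: assumes "L \<in> pg_lines" shows "card (on S L) \<le> 2"
proof (rule ccontr)
  assume "\<not> card (on S L) \<le> 2"
  hence "3 \<le> card (on S L)" by simp
  then obtain x y z where "x \<in> on S L" "y \<in> on S L" "z \<in> on S L" "x \<noteq> y" "x \<noteq> z" "y \<noteq> z"
    by (rule three_elementsE)
  thus False using no_threeD[of x y z L] assms by (simp add: mem_on)
qed

lemma on_point: "P \<in> S \<Longrightarrow> on S P = {P}"
  using card_on_point[of P] points by (auto simp: on_def)

lemma on_point_empty: "P \<in> pg_points \<Longrightarrow> P \<notin> S \<Longrightarrow> on S P = {}"
  using card_on_point[of P] points by (auto simp: on_def)

lemma sum_lines_in:
  assumes P: "P \<in> S" "P \<subseteq> W" and W: "vec.subspace W"
  shows "(\<Sum>L\<in>covers P W. card (on S L) - 1) = card (on S W) - 1"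
proof -
  have PP: "P \<in> pg_points" using P points by blast
  have c: "card (on S X - on S P) = card (on S X) - 1" if "P \<subseteq> X" for X
    unfolding on_point[OF P(1)] by (rule card_Diff_singleton) (use P that in \<open>simp add: mem_on\<close>)
  have "(\<Sum>L\<in>covers P W. card (on S L) - 1) = (\<Sum>L\<in>covers P W. card (on S L - on S P))"
    by (intro sum.cong refl) (use c in \<open>auto simp: covers_def\<close>)
  also have "\<dots> = card (on S W - on S P)"
    by (rule sum_covers) (use PP P W points pg_point_subspace in auto)
  finally show ?thesis using c[OF P(2)] by simp
qed

lemma sum_lines_out:
  assumes P: "P \<in> pg_points" "P \<notin> S" "P \<subseteq> W" and W: "vec.subspace W"
  shows "(\<Sum>L\<in>covers P W. card (on S L)) = card (on S W)"
  using sum_covers[of P W S] assms points pg_point_subspace[OF P(1)] by (simp add: on_point_empty)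

text \<open>The secants through \<open>P\<close> correspond to the other points of the arc in
  \<open>W\<close>, and all remaining lines through \<open>P\<close> are tangents. The additive form
  avoids truncated subtraction.\<close>

lemma card_tangents_in:
  assumes P: "P \<in> S" "P \<subseteq> W" and W: "vec.subspace W"
  shows "card {L\<in>covers P W. card (on S L) = 1} + (card (on S W) - 1) = card (covers P W)"
proof -
  have PP: "P \<in> pg_points" using P points by blast
  have c: "card (on S L) = 1 \<or> card (on S L) = 2" if L: "L \<in> covers P W" for L
  proof -
    have "P \<in> on S L" "L \<in> pg_lines" using L P PP by (auto simp: mem_lines_iff mem_on)
    hence "card (on S L) \<noteq> 0" "card (on S L) \<le> 2" using card_line_le by (auto simp: card_eq_0_iff)
    thus ?thesis by linarith
  qed
  have "card (on S W) - 1 = (\<Sum>L\<in>covers P W. if card (on S L) = 2 then 1 else 0)"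
    unfolding sum_lines_in[OF assms, symmetric] by (intro sum.cong refl) (use c in force)
  also have "\<dots> = card {L\<in>covers P W. card (on S L) = 2}" by (simp add: sum.inter_filter[symmetric])
  finally have "card (on S W) - 1 = card {L\<in>covers P W. card (on S L) = 2}" .
  moreover have "card {L\<in>covers P W. card (on S L) = 1} + card {L\<in>covers P W. card (on S L) = 2} =
      card ({L\<in>covers P W. card (on S L) = 1} \<union> {L\<in>covers P W. card (on S L) = 2})"
    by (rule card_Un_disjoint[symmetric]) auto
  moreover have "{L\<in>covers P W. card (on S L) = 1} \<union> {L\<in>covers P W. card (on S L) = 2} = covers P W"
    using c by blast
  ultimately show ?thesis by simp
qed

lemma card_tangents_plane:
  assumes P: "P \<in> S" "P \<subseteq> E" and E: "E \<in> pg_planes"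
  shows "card {L\<in>covers P E. card (on S L) = 1} + card (on S E) = CARD('a) + 2"
proof -
  have "P \<in> on S E" using P by (simp add: mem_on)
  hence "on S E \<noteq> {}" by blast
  hence "card (on S E) \<ge> 1" by (simp add: Suc_le_eq card_gt_0_iff)
  moreover have "P \<in> pg_points" using P points by blast
  ultimately show ?thesis
    using card_tangents_in[OF P pg_plane_subspace(1)[OF E]] card_lines_plane[OF _ E P(2)] by linarith
qed

lemma card_plane_le: "E \<in> pg_planes \<Longrightarrow> card (on S E) \<le> CARD('a) + 2"
proof (cases "on S E = {}")
  case False
  then obtain P where "P \<in> S" "P \<subseteq> E" by (auto simp: on_def)
  moreover assume "E \<in> pg_planes"
  ultimately show ?thesis using card_tangents_plane[of P E] by linarith
qed simp

lemma line_pointE: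
  assumes "L \<in> pg_lines" "card (on S L) = 1"
  obtains P where "P \<in> S" "P \<subseteq> L" "on S L = {P}"
proof -
  obtain P where P: "on S L = {P}" using assms(2) card_1_singletonE by blast
  hence "P \<in> on S L" by simp
  thus ?thesis using that P unfolding mem_on by blast
qed

lemma card_plane_tangent_le:
  assumes E: "E \<in> pg_planes" and L: "L \<in> pg_lines" "L \<subseteq> E" "card (on S L) = 1"
  shows "card (on S E) \<le> CARD('a) + 1"
proof -
  obtain P where P: "P \<in> S" "P \<subseteq> L" by (rule line_pointE[OF L(1,3)])
  have "L \<in> {L\<in>covers P E. card (on S L) = 1}" using P L points by (auto simp: mem_lines_iff)
  hence "card {L\<in>covers P E. card (on S L) = 1} > 0" unfolding card_gt_0_iff by (intro conjI finite) blast
  moreover have "P \<subseteq> E" using P L by blast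
  ultimately show ?thesis using card_tangents_plane[OF P(1) _ E] by linarith
qed

lemma hyperoval_no_tangent:
  assumes E: "E \<in> pg_planes" "card (on S E) = CARD('a) + 2" and L: "L \<in> pg_lines" "L \<subseteq> E"
  shows "card (on S L) \<noteq> 1"
  using card_plane_tangent_le[OF E(1) L] E(2) by linarith

text \<open>The secants through \<open>P\<close> pair off points of the arc, and the external lines
  contribute nothing.\<close>

lemma parity:
  assumes E: "E \<in> pg_planes" and P: "P \<in> pg_points" "P \<notin> S" "P \<subseteq> E"
  shows "even (card (on S E)) \<longleftrightarrow> even (card {L\<in>covers P E. card (on S L) = 1})"
proof -
  have c: "card (on S L) = (if card (on S L) = 1 then 1 else 0) + 2 * (if card (on S L) = 2 then 1 else 0)" if "L \<in> covers P E" for L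
  proof -
    have "card (on S L) \<le> 2" using that P card_line_le by (simp add: mem_lines_iff)
    hence "card (on S L) = 0 \<or> card (on S L) = 1 \<or> card (on S L) = 2" by linarith
    thus ?thesis by auto
  qed
  have "card (on S E) = (\<Sum>L\<in>covers P E. card (on S L))"
    using sum_lines_out[OF P] E by (simp add: pg_plane_subspace)
  also have "\<dots> = (\<Sum>L\<in>covers P E. (if card (on S L) = 1 then 1 else 0) + 2 * (if card (on S L) = 2 then 1 else 0))"
    by (rule sum.cong[OF refl c])
  also have "\<dots> = (\<Sum>L\<in>covers P E. if card (on S L) = 1 then 1 else 0) + 2 * (\<Sum>L\<in>covers P E. if card (on S L) = 2 then 1 else 0)"
    by (simp only: sum.distrib sum_distrib_left)
  also have "(\<Sum>L\<in>covers P E. if card (on S L) = 1 then 1 else 0) = card {L\<in>covers P E. card (on S L) = 1}"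
    by (simp add: sum.inter_filter[symmetric])
  finally show ?thesis by simp
qed

lemma off_point:
  assumes E: "E \<in> pg_planes"
  obtains P where "P \<in> pg_points" "P \<subseteq> E" "P \<notin> S"
proof -
  have "card (on S E) < card (on pg_points E)"
  proof -
    have "2 * CARD('a) \<le> CARD('a) * CARD('a)" using two_le_card_field[where 'a='a] by (intro mult_right_mono) auto
    thus ?thesis using card_plane_le[OF E] two_le_card_field[where 'a='a] unfolding card_on_plane[OF E] power2_eq_square by linarith
  qed
  hence "\<not> on pg_points E \<subseteq> on S E" using card_mono[of "on S E" "on pg_points E"] by auto
  then obtain P where "P \<in> on pg_points E" "P \<notin> on S E" by blast
  thus ?thesis using that[of P] by (simp add: mem_on)
qed

text \<open>A point off a hyperoval lies only on secants and external lines, so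
  \<open>parity\<close> makes \<open>q + 2\<close> even.\<close>

lemma hyperoval_even:
  assumes E: "E \<in> pg_planes" "card (on S E) = CARD('a) + 2"
  shows "even (CARD('a))"
proof -
  obtain P where P: "P \<in> pg_points" "P \<subseteq> E" "P \<notin> S" by (rule off_point[OF E(1)])
  have e: "{L\<in>covers P E. card (on S L) = 1} = {}"
    using hyperoval_no_tangent[OF E] P by (auto simp: mem_lines_iff)
  have "even (card (on S E))" unfolding parity[OF E(1) P(1,3,2)] e by simp
  thus ?thesis using E by simp
qed

text \<open>Each of the \<open>q + 1\<close> points of a secant \<open>s\<close> lies on a tangent:
  a point of the oval on its own one, any other point on an odd number of them by
  \<open>parity\<close>. The plane has only \<open>q + 1\<close> tangents and each meets
  \<open>s\<close> once, so no point of \<open>s\<close> lies on two. Hence \<open>N\<close> is on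
  no secant, and the \<open>q + 1\<close> lines through \<open>N\<close> share the
  \<open>q + 1\<close> points of the oval evenly.\<close>

lemma two_tangents_no_secant:
  assumes E: "E \<in> pg_planes" "card (on S E) = CARD('a) + 1" and ev: "even (CARD('a))"
    and N: "N \<in> pg_points" "N \<notin> S"
    and t: "t \<in> pg_lines" "t \<subseteq> E" "N \<subseteq> t" "card (on S t) = 1"
    and t': "t' \<in> pg_lines" "t' \<subseteq> E" "N \<subseteq> t'" "card (on S t') = 1" and ne: "t \<noteq> t'"
    and L: "L \<in> pg_lines" "N \<subseteq> L" "L \<subseteq> E"
  shows "card (on S L) = 1"
proof -
  define T where "T = {L\<in>pg_lines. L \<subseteq> E \<and> card (on S L) = 1}"
  have NE: "N \<subseteq> E" using t by blast
  have cT: "card T = CARD('a) + 1"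
  proof -
    have "(\<Sum>L\<in>T. card {P\<in>on S E. P \<subseteq> L}) = 1 * card (on S E)"
    proof (rule sum_multicount)
      show "\<forall>P\<in>on S E. card {L\<in>T. P \<subseteq> L} = 1"
      proof
        fix P assume P: "P \<in> on S E"
        have "P \<in> pg_points" using P points by (auto simp: mem_on)
        hence "{L\<in>T. P \<subseteq> L} = {L\<in>covers P E. card (on S L) = 1}"
          by (auto simp: T_def mem_lines_iff)
        thus "card {L\<in>T. P \<subseteq> L} = 1" using card_tangents_plane[of P E] P E by (simp add: mem_on)
      qed
    qed auto
    moreover have "card {P\<in>on S E. P \<subseteq> L} = 1" if "L \<in> T" for L
    proof -
      have "{P\<in>on S E. P \<subseteq> L} = on S L" using that by (auto simp: T_def on_def)
      thus ?thesis using that by (simp add: T_def)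
    qed
    ultimately show ?thesis using E by simp
  qed
  have secant: "card (on S s) \<noteq> 2" if s: "s \<in> pg_lines" "N \<subseteq> s" "s \<subseteq> E" for s
  proof
    assume s2: "card (on S s) = 2"
    let ?Y = "on pg_points s"
    have ge: "card {L\<in>T. Y \<subseteq> L} \<ge> 1" if Y: "Y \<in> ?Y" for Y
    proof -
      have YE: "Y \<in> pg_points" "Y \<subseteq> E" using Y s by (auto simp: mem_on)
      have eq: "{L\<in>T. Y \<subseteq> L} = {L\<in>covers Y E. card (on S L) = 1}"
        using YE by (auto simp: T_def mem_lines_iff)
      show ?thesis
      proof (cases "Y \<in> S")
        case True
        thus ?thesis using card_tangents_plane[of Y E] YE E unfolding eq by simp
      next
        case False
        have "odd (card (on S E))" using E ev by simp
        hence "odd (card {L\<in>T. Y \<subseteq> L})" unfolding eq using parity[OF E(1) YE(1) False YE(2)] by simp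
        thus ?thesis by (metis One_nat_def Suc_leI odd_pos)
      qed
    qed
    have N_ge: "card {L\<in>T. N \<subseteq> L} \<ge> 2"
    proof -
      have "{t, t'} \<subseteq> {L\<in>T. N \<subseteq> L}" using t t' by (auto simp: T_def)
      hence "card {t, t'} \<le> card {L\<in>T. N \<subseteq> L}" by (intro card_mono) auto
      thus ?thesis using ne by simp
    qed
    have NY: "N \<in> ?Y" using N s by (simp add: mem_on)
    have "(\<Sum>Y\<in>?Y. card {L\<in>T. Y \<subseteq> L}) = 1 * card T"
    proof (rule sum_multicount)
      show "\<forall>L\<in>T. card {Y\<in>?Y. Y \<subseteq> L} = 1"
      proof
        fix L assume LT: "L \<in> T"
        hence "L \<noteq> s" using s2 by (auto simp: T_def)
        hence I: "L \<inter> s \<in> pg_points" using LT s E lines_Int[of L s E] by (auto simp: T_def)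
        have "{Y\<in>?Y. Y \<subseteq> L} = on pg_points (L \<inter> s)" by (auto simp: on_def)
        thus "card {Y\<in>?Y. Y \<subseteq> L} = 1" using card_on_point[OF I] by simp
      qed
    qed auto
    moreover have "(\<Sum>Y\<in>?Y. card {L\<in>T. Y \<subseteq> L}) = card {L\<in>T. N \<subseteq> L} + (\<Sum>Y\<in>?Y - {N}. card {L\<in>T. Y \<subseteq> L})"
      using NY by (intro sum.remove) auto
    moreover have "(\<Sum>Y\<in>?Y - {N}. card {L\<in>T. Y \<subseteq> L}) \<ge> (\<Sum>Y\<in>?Y - {N}. 1)"
      by (intro sum_mono) (use ge in auto)
    moreover have "card (?Y - {N}) = CARD('a)" using card_on_line[OF s(1)] NY by simp
    ultimately show False using N_ge cT by simp
  qed
  have le: "card (on S L) \<le> 1" if "L \<in> covers N E" for L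
  proof -
    have L: "L \<in> pg_lines" "N \<subseteq> L" "L \<subseteq> E" using that N by (auto simp: mem_lines_iff)
    show ?thesis using secant[OF L] card_line_le[OF L(1)] by linarith
  qed
  have Lc: "L \<in> covers N E" using L N by (simp add: mem_lines_iff)
  have "card (on S E) = (\<Sum>L\<in>covers N E. card (on S L))"
    using sum_lines_out[OF N NE] E by (simp add: pg_plane_subspace)
  also have "\<dots> = card (on S L) + (\<Sum>L\<in>covers N E - {L}. card (on S L))"
    using Lc by (intro sum.remove) auto
  also have "\<dots> \<le> card (on S L) + (\<Sum>L\<in>covers N E - {L}. 1)"
    by (intro add_left_mono sum_mono) (use le in auto)
  also have "\<dots> = card (on S L) + CARD('a)" using Lc card_lines_plane[OF N(1) E(1) NE] by simp
  finally show ?thesis using E le[OF Lc] by simp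
qed

text \<open>The nucleus is the intersection of \<open>t\<close> with the tangent at another point of
  the oval.\<close>

lemma nucleus_exists:
  assumes E: "E \<in> pg_planes" "card (on S E) = CARD('a) + 1" and ev: "even (CARD('a))"
    and t: "t \<in> pg_lines" "t \<subseteq> E" "card (on S t) = 1"
  obtains N where "N \<in> pg_points" "N \<notin> S" "N \<subseteq> t"
    "\<And>L. L \<in> pg_lines \<Longrightarrow> N \<subseteq> L \<Longrightarrow> L \<subseteq> E \<Longrightarrow> card (on S L) = 1"
proof -
  obtain P where P: "P \<in> S" "P \<subseteq> t" "on S t = {P}" by (rule line_pointE[OF t(1,3)])
  have "card (on S E - {P}) \<noteq> 0" using E P t two_le_card_field[where 'a='a] by (simp add: mem_on)
  then obtain R where R: "R \<in> S" "R \<subseteq> E" "R \<noteq> P" by (metis Diff_iff card.empty equals0I mem_on singletonI)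
  have "card {L\<in>covers R E. card (on S L) = 1} = 1" using card_tangents_plane[OF R(1,2) E(1)] E by simp
  then obtain t' where "t' \<in> {L\<in>covers R E. card (on S L) = 1}" by (metis card_1_singletonE singletonI)
  moreover have "R \<in> pg_points" using R points by blast
  ultimately have t': "t' \<in> pg_lines" "t' \<subseteq> E" "R \<subseteq> t'" "card (on S t') = 1" by (auto simp: mem_lines_iff)
  have ne: "t \<noteq> t'" using t' P R by (auto simp: on_def)
  have N: "t \<inter> t' \<in> pg_points" using lines_Int[OF t(1) t'(1) ne E(1) t(2) t'(2)] .
  have "t \<inter> t' \<notin> S"
  proof
    assume a: "t \<inter> t' \<in> S"
    hence "t \<inter> t' \<in> on S t" "t \<inter> t' \<in> on S t'" by (auto simp: mem_on)
    hence "P \<in> on S t'" using P by simp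
    moreover have "R \<in> on S t'" using R t' by (simp add: mem_on)
    ultimately have "card {P, R} \<le> card (on S t')" by (intro card_mono) auto
    thus False using R t' by simp
  qed
  thus ?thesis using that[of "t \<inter> t'"] N two_tangents_no_secant[OF E ev N _ t(1,2) _ t(3) t'(1,2) _ t'(4) ne] by blast
qed

end

text \<open>Adding \<open>N\<close> to the oval gives \<open>q + 2\<close> points of
  \<open>E\<close> with no three on a line, that is a hyperoval.\<close>

lemma no_external_arc_point:
  fixes S :: "('a::{field,finite} ^ 'n) set set"
  assumes S: "arc S" and E: "E \<in> pg_planes" "card (on S E) = CARD('a) + 1"
    and N: "N \<in> pg_points" "N \<notin> S" "N \<subseteq> E"
    and le: "\<And>L. L \<in> pg_lines \<Longrightarrow> N \<subseteq> L \<Longrightarrow> L \<subseteq> E \<Longrightarrow> card (on S L) \<le> 1"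
  shows "even (CARD('a))"
proof -
  interpret arc S by (rule S)
  let ?S = "insert N (on S E)"
  have S_pts: "on S E \<subseteq> pg_points" using points by (auto simp: on_def)
  have not_two: False if X: "X \<in> on S E" "Y \<in> on S E" "X \<noteq> Y" and L: "L \<in> pg_lines" "X \<subseteq> L" "Y \<subseteq> L" "N \<subseteq> L" for X Y L
  proof -
    have "L \<subseteq> E"
      by (rule line_subset[of X Y L E]) (use X L S_pts E in \<open>simp_all add: mem_on pg_plane_subspace subset_iff\<close>)
    hence "card (on S L) \<le> 1" using le L by blast
    moreover have "card {X, Y} \<le> card (on S L)" by (rule card_mono) (use X L in \<open>auto simp: mem_on\<close>)
    ultimately show False using X by simp
  qed
  have "arc ?S"
  proof
    show "no_three_on_a_line ?S"
      unfolding no_three_on_a_line_def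
    proof (intro ballI impI notI, elim bexE conjE)
      fix X Y Z L assume a: "X \<in> ?S" "Y \<in> ?S" "Z \<in> ?S" "X \<noteq> Y" "X \<noteq> Z" "Y \<noteq> Z" "L \<in> pg_lines" "X \<subseteq> L" "Y \<subseteq> L" "Z \<subseteq> L"
      show False
      proof (cases "N \<in> {X, Y, Z}")
        case False
        hence "X \<in> S" "Y \<in> S" "Z \<in> S" using a by (auto simp: mem_on)
        thus False using no_threeD[of X Y Z L] a by blast
      next
        case True
        thus False using a not_two[of X Y L] not_two[of X Z L] not_two[of Y Z L] by auto
      qed
    qed
  qed (use S_pts N in auto)
  moreover have "on ?S E = ?S" using N by (auto simp: on_def)
  moreover have "N \<notin> on S E" using N by (simp add: mem_on)
  ultimately show ?thesis using arc.hyperoval_even[of ?S E] E by simp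
qed

section \<open>Ovoids\<close>

lemma line_eq_of_subset: "L \<in> pg_lines \<Longrightarrow> L' \<in> pg_lines \<Longrightarrow> L \<subseteq> L' \<Longrightarrow> L = L'"
  by (rule vec.subspace_dim_equal) (auto simp: pg_lines_def)

lemma joinE:
  assumes "X \<in> pg_points" "Y \<in> pg_points" "X \<noteq> Y"
  obtains L where "L \<in> pg_lines" "X \<subseteq> L" "Y \<subseteq> L"
  using join_line[OF assms] by blast

lemma join_unique:
  assumes "X \<in> pg_points" "Y \<in> pg_points" "X \<noteq> Y" "L \<in> pg_lines" "X \<subseteq> L" "Y \<subseteq> L"
    "L' \<in> pg_lines" "X \<subseteq> L'" "Y \<subseteq> L'"
  shows "L = L'"
  using join_line[OF assms(1-3)] assms(4-9) by blast

lemma plane_eqI: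
  assumes "L \<in> pg_lines" "Y \<in> pg_points" "\<not> Y \<subseteq> L" "E \<in> pg_planes" "L \<subseteq> E" "Y \<subseteq> E"
    "E' \<in> pg_planes" "L \<subseteq> E'" "Y \<subseteq> E'"
  shows "E = E'"
  using join_plane[OF assms(1-3)] assms(4-9) by blast

text \<open>Only the number of points and the absence of three collinear ones are given. For even
  \<open>q\<close> a plane might still meet \<open>S\<close> in a hyperoval, and the whole section
  serves to exclude this.\<close>

locale ovoid_space = arc S for S :: "('a::{field,finite} ^ 4) set set" +
  assumes card_S: "card S = CARD('a)\<^sup>2 + 1" and q_gt_2: "CARD('a) > 2"
begin

lemma sum_planes:
  assumes L: "L \<in> pg_lines"
  shows "(\<Sum>E\<in>covers L UNIV. card (on S E) - card (on S L)) = CARD('a)\<^sup>2 + 1 - card (on S L)"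
proof -
  have c: "card (on S X - on S L) = card (on S X) - card (on S L)" if "L \<subseteq> X" for X
    using on_subset(2)[OF that] by (simp add: card_Diff_subset)
  have "(\<Sum>E\<in>covers L UNIV. card (on S E) - card (on S L)) = (\<Sum>E\<in>covers L UNIV. card (on S E - on S L))"
    by (intro sum.cong refl) (use c in \<open>auto simp: covers_def\<close>)
  also have "\<dots> = card (on S UNIV - on S L)"
    by (rule sum_covers) (use points pg_line_subspace[OF L] in auto)
  finally show ?thesis using c[of UNIV] card_S by (simp add: on_def)
qed

lemma field_card_sq: "(CARD('a) + 1) * (CARD('a) - 1) < CARD('a)\<^sup>2"
proof -
  have "(CARD('a) + 1) * (CARD('a) - 1) + 1 = CARD('a)\<^sup>2"
    using q_gt_2 by (cases "CARD('a)") (simp_all add: power2_eq_square)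
  thus ?thesis by linarith
qed

text \<open>The \<open>q\<^sup>2\<close> points off \<open>t\<close> lie in the \<open>q + 1\<close>
  planes through \<open>t\<close>. Since \<open>(q + 1) * (q - 1) < q\<^sup>2\<close>, some plane
  holds at least \<open>q\<close> of them, and it cannot hold more because it contains a
  tangent.\<close>

lemma tangent_plane_full:
  assumes t: "t \<in> pg_lines" "card (on S t) = 1"
  obtains E where "E \<in> pg_planes" "t \<subseteq> E" "card (on S E) = CARD('a) + 1"
proof -
  have "\<exists>E\<in>covers t UNIV. card (on S E) \<ge> CARD('a) + 1"
  proof (rule ccontr)
    assume "\<not> ?thesis"
    hence "(\<Sum>E\<in>covers t UNIV. card (on S E) - card (on S t)) \<le> (\<Sum>E\<in>covers t UNIV. CARD('a) - 1)"
      using t by (intro sum_mono) (auto simp: not_le)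
    hence "CARD('a)\<^sup>2 \<le> (CARD('a) + 1) * (CARD('a) - 1)"
      unfolding sum_planes[OF t(1)] using t card_planes_line[OF t(1)] by simp
    thus False using field_card_sq by linarith
  qed
  then obtain E where "E \<in> covers t UNIV" "card (on S E) \<ge> CARD('a) + 1" by blast
  thus ?thesis using that[of E] card_plane_tangent_le[of E t] t by (simp add: mem_planes_iff)
qed

lemma S_point: "P \<in> S \<Longrightarrow> P \<in> pg_points"
  using points by blast

lemma tangent_unique_point:
  assumes "card (on S t) = 1" "P \<in> S" "P \<subseteq> t" "R \<in> S" "R \<subseteq> t"
  shows "P = R"
proof -
  obtain X where "on S t = {X}" using assms(1) card_1_singletonE by blast
  moreover have "P \<in> on S t" "R \<in> on S t" using assms by (auto simp: mem_on)
  ultimately show ?thesis by simp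
qed

text \<open>\<open>N\<close> is the nucleus of a plane \<open>E'\<close> through \<open>t\<close>
  with \<open>q + 1\<close> points. A hyperoval plane through \<open>N\<close> would meet
  \<open>E'\<close> in a tangent. If \<open>N\<close> were on a secant, then all planes through that
  secant would have \<open>q + 1\<close> points, from which a plane through \<open>t\<close> arises
  that meets the ovoid only in \<open>X\<close>. It cuts the hyperoval plane \<open>E\<close> in a
  tangent, a contradiction.\<close>

lemma all_tangents_through:
  assumes E: "E \<in> pg_planes" "card (on S E) = CARD('a) + 2"
    and X: "X \<in> S" "X \<subseteq> E" and t: "t \<in> pg_lines" "X \<subseteq> t" "card (on S t) = 1"
  obtains N where "N \<in> pg_points" "N \<notin> S" "N \<subseteq> t"
    "\<And>F. F \<in> pg_planes \<Longrightarrow> N \<subseteq> F \<Longrightarrow> card (on S F) \<noteq> CARD('a) + 2"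
    "\<And>L P. L \<in> pg_lines \<Longrightarrow> N \<subseteq> L \<Longrightarrow> P \<in> S \<Longrightarrow> P \<subseteq> L \<Longrightarrow> card (on S L) = 1"
proof -
  have ev: "even (CARD('a))" by (rule hyperoval_even[OF E])
  obtain E' where E': "E' \<in> pg_planes" "t \<subseteq> E'" "card (on S E') = CARD('a) + 1"
    by (rule tangent_plane_full[OF t(1,3)])
  obtain N where N: "N \<in> pg_points" "N \<notin> S" "N \<subseteq> t"
    and nuc: "\<And>L. L \<in> pg_lines \<Longrightarrow> N \<subseteq> L \<Longrightarrow> L \<subseteq> E' \<Longrightarrow> card (on S L) = 1"
    by (rule nucleus_exists[OF E'(1,3) ev t(1) E'(2) t(3)]) blast
  have NE': "N \<subseteq> E'" using N E' by blast
  have no_hyp: "card (on S F) \<noteq> CARD('a) + 2" if F: "F \<in> pg_planes" "N \<subseteq> F" for F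
  proof
    assume h: "card (on S F) = CARD('a) + 2"
    hence "F \<noteq> E'" using E' by auto
    hence I: "F \<inter> E' \<in> pg_lines" using planes_Int F E' by blast
    have "card (on S (F \<inter> E')) = 1" using nuc[OF I] F NE' by blast
    thus False using hyperoval_no_tangent[OF F(1) h I] by blast
  qed
  have no_sec: "card (on S s) \<noteq> 2" if s: "s \<in> pg_lines" "N \<subseteq> s" for s
  proof
    assume s2: "card (on S s) = 2"
    have full: "card (on S F) = CARD('a) + 1" if F: "F \<in> pg_planes" "s' \<subseteq> F" and s': "s' \<in> pg_lines" "N \<subseteq> s'" "card (on S s') = 2" for F s'
    proof -
      have le: "card (on S G) - 2 \<le> CARD('a) - 1" if G: "G \<in> covers s' UNIV" for G
      proof -
        have G: "G \<in> pg_planes" "s' \<subseteq> G" using G s' by (auto simp: mem_planes_iff)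
        thus ?thesis using card_plane_le[OF G(1)] no_hyp[OF G(1)] s' by fastforce
      qed
      have Fc: "F \<in> covers s' UNIV" using F s' by (simp add: mem_planes_iff)
      have "CARD('a)\<^sup>2 - 1 = (\<Sum>G\<in>covers s' UNIV. card (on S G) - 2)" using sum_planes[OF s'(1)] s' by simp
      also have "\<dots> = card (on S F) - 2 + (\<Sum>G\<in>covers s' UNIV - {F}. card (on S G) - 2)"
        using Fc by (intro sum.remove) auto
      also have "\<dots> \<le> card (on S F) - 2 + (\<Sum>G\<in>covers s' UNIV - {F}. CARD('a) - 1)"
        using le by (intro add_left_mono sum_mono) auto
      also have "\<dots> = card (on S F) - 2 + CARD('a) * (CARD('a) - 1)"
        using Fc card_planes_line[OF s'(1)] by simp
      finally have "CARD('a)\<^sup>2 - 1 \<le> card (on S F) - 2 + CARD('a) * (CARD('a) - 1)" .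
      moreover have "CARD('a)\<^sup>2 - 1 = CARD('a) - 1 + CARD('a) * (CARD('a) - 1)"
        by (simp add: power2_eq_square algebra_simps)
      ultimately have "CARD('a) - 1 \<le> card (on S F) - 2" by linarith
      thus ?thesis using le[OF Fc] q_gt_2 by linarith
    qed
    \<comment> \<open>Otherwise every plane through \<open>t\<close> turns out to have
      \<open>q + 1\<close> points, which makes \<open>(q + 1) * q\<close> points off
      \<open>t\<close> instead of \<open>q\<^sup>2\<close>.\<close>
    have "\<exists>G\<in>covers t UNIV. card (on S G) = 1"
    proof (rule ccontr)
      assume not1: "\<not> ?thesis"
      have "card (on S G) = CARD('a) + 1" if G: "G \<in> covers t UNIV" for G
      proof (cases "G = E'")
        case False
        have G: "G \<in> pg_planes" "t \<subseteq> G" using G t by (auto simp: mem_planes_iff)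
        have XG: "X \<in> on S G" using X t G by (auto simp: mem_on)
        have "on S G \<noteq> {X}" using not1 that by auto
        then obtain P where P: "P \<in> on S G" "P \<noteq> X" using XG by blast
        have PN: "P \<noteq> N" using P N by (auto simp: mem_on)
        obtain L where L: "L \<in> pg_lines" "P \<subseteq> L" "N \<subseteq> L"
          using joinE[OF _ N(1) PN] P S_point by (auto simp: mem_on)
        have LG: "L \<subseteq> G"
          by (rule line_subset[OF _ N(1) PN L]) (use P G N S_point in \<open>auto simp: mem_on pg_plane_subspace\<close>)
        have Lt: "L \<noteq> t"
          using tangent_unique_point[OF t(3), of P X] P L X t by (auto simp: mem_on)
        have "P \<in> on S L" using P L by (simp add: mem_on)
        hence "card (on S L) > 0" unfolding card_gt_0_iff by (intro conjI finite) blast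
        hence "card (on S L) = 1 \<or> card (on S L) = 2" using card_line_le[OF L(1)] by linarith
        thus ?thesis
        proof
          assume "card (on S L) = 2"
          thus ?thesis using full[OF G(1) LG L(1,3)] by blast
        next
          \<comment> \<open>The plane \<open>F\<close> spanned by \<open>L\<close> and the secant
            \<open>s\<close> has \<open>q + 1\<close> points and contains two tangents through
            \<open>N\<close>, namely \<open>L\<close> and its line in \<open>E'\<close>. By
            \<open>two_tangents_no_secant\<close> also \<open>s\<close> would be a tangent.\<close>
          assume L1: "card (on S L) = 1"
          have LE': "\<not> L \<subseteq> E'"
          proof
            assume "L \<subseteq> E'"
            hence "L \<subseteq> G \<inter> E'" "t \<subseteq> G \<inter> E'" using LG G E' by auto
            moreover have "G \<inter> E' \<in> pg_lines" using planes_Int G E' False by blast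
            ultimately have "L = G \<inter> E'" "t = G \<inter> E'"
              using line_eq_of_subset L(1) t(1) by blast+
            thus False using Lt by simp
          qed
          have "s \<noteq> L" using s2 L1 by auto
          obtain R where R: "R \<in> on S s" using s2 by (metis card.empty equals0I zero_neq_numeral)
          have RL: "\<not> R \<subseteq> L"
          proof
            assume "R \<subseteq> L"
            moreover have "R \<noteq> N" using R N by (auto simp: mem_on)
            ultimately show False using join_unique[of R N L s] R N s L S_point \<open>s \<noteq> L\<close> by (auto simp: mem_on)
          qed
          obtain F where F: "F \<in> pg_planes" "L \<subseteq> F" "R \<subseteq> F"
            using join_plane[OF L(1) _ RL] R S_point by (auto simp: mem_on)
          have sF: "s \<subseteq> F"
            by (rule line_subset[of R N]) (use R N s F L S_point in \<open>auto simp: mem_on pg_plane_subspace\<close>)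
          have mF: "card (on S F) = CARD('a) + 1" using full[OF F(1) sF s s2] .
          have FE: "F \<noteq> E'" using F LE' by blast
          have I: "F \<inter> E' \<in> pg_lines" using planes_Int F E' FE by blast
          have NI: "N \<subseteq> F \<inter> E'" using NE' L F by blast
          have I1: "card (on S (F \<inter> E')) = 1" using nuc[OF I NI] by blast
          have "card (on S s) = 1"
            by (rule two_tangents_no_secant[OF F(1) mF ev N(1,2) L(1) F(2) L(3) L1 I _ NI I1 _ s sF])
               (use LE' in auto)
          thus ?thesis using s2 by simp
        qed
      qed (use E' in simp)
      hence "(\<Sum>G\<in>covers t UNIV. card (on S G) - 1) = (CARD('a) + 1) * CARD('a)"
        using card_planes_line[OF t(1)] by simp
      thus False using sum_planes[OF t(1)] t q_gt_2 by (simp add: power2_eq_square)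
    qed
    then obtain G where G: "G \<in> pg_planes" "t \<subseteq> G" "card (on S G) = 1" using t by (auto simp: mem_planes_iff)
    have XG: "X \<subseteq> G" using t G by blast
    have "G \<noteq> E" using G E by auto
    hence I: "G \<inter> E \<in> pg_lines" using planes_Int G E by blast
    have "on S (G \<inter> E) \<subseteq> on S G" by (auto simp: on_def)
    hence "card (on S (G \<inter> E)) \<le> 1" using G by (metis card_mono finite)
    moreover have "X \<in> on S (G \<inter> E)" using X XG by (simp add: mem_on)
    hence "card (on S (G \<inter> E)) > 0" unfolding card_gt_0_iff by (intro conjI finite) blast
    ultimately show False using hyperoval_no_tangent[OF E I] by simp
  qed
  show ?thesis
  proof (rule that[OF N no_hyp])
    fix L P assume L: "L \<in> pg_lines" "N \<subseteq> L" "P \<in> S" "P \<subseteq> L"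
    hence "P \<in> on S L" by (simp add: mem_on)
    hence "card (on S L) > 0" unfolding card_gt_0_iff by (intro conjI finite) blast
    thus "card (on S L) = 1" using no_sec[OF L(1,2)] card_line_le[OF L(1)] by linarith
  qed
qed

text \<open>A point off the ovoid that lies on no secant, in other words a nucleus of the whole
  ovoid.\<close>

definition big :: "('a ^ 4) set \<Rightarrow> bool" where
  "big N \<longleftrightarrow> N \<in> pg_points \<and> N \<notin> S \<and> (\<forall>L P. L \<in> pg_lines \<longrightarrow> N \<subseteq> L \<longrightarrow> P \<in> S \<longrightarrow> P \<subseteq> L \<longrightarrow> card (on S L) = 1)"

text \<open>In a plane through \<open>t\<close>, a point of the ovoid off \<open>t\<close> is joined
  to \<open>N\<close> and to \<open>N'\<close> by different tangents, so the plane has at most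
  \<open>q\<close> points by \<open>card_tangents_plane\<close>. Then the planes through
  \<open>t\<close> contain too few points altogether.\<close>

lemma big_unique:
  assumes N: "big N" "big N'" and t: "t \<in> pg_lines" "N \<subseteq> t" "N' \<subseteq> t" "card (on S t) = 1"
  shows "N = N'"
proof (rule ccontr)
  assume ne: "N \<noteq> N'"
  have Np: "N \<in> pg_points" "N' \<in> pg_points" "N \<notin> S" "N' \<notin> S" using N by (auto simp: big_def)
  have "card (on S G) \<le> CARD('a)" if G: "G \<in> covers t UNIV" for G
  proof (cases "\<exists>P\<in>on S G. \<not> P \<subseteq> t")
    case True
    then obtain P where "P \<in> on S G" and P3: "\<not> P \<subseteq> t" by blast
    hence P: "P \<in> S" "P \<subseteq> G" "\<not> P \<subseteq> t" by (simp_all add: mem_on)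
    have G: "G \<in> pg_planes" "t \<subseteq> G" using G t by (auto simp: mem_planes_iff)
    have PN: "P \<noteq> N" "P \<noteq> N'" using P Np by auto
    obtain L where L: "L \<in> pg_lines" "P \<subseteq> L" "N \<subseteq> L" using joinE[OF S_point[OF P(1)] Np(1) PN(1)] .
    obtain L' where L': "L' \<in> pg_lines" "P \<subseteq> L'" "N' \<subseteq> L'" using joinE[OF S_point[OF P(1)] Np(2) PN(2)] .
    have "L \<subseteq> G" by (rule line_subset[OF S_point[OF P(1)] Np(1) PN(1) L]) (use P G t in \<open>auto simp: pg_plane_subspace\<close>)
    moreover have "L' \<subseteq> G" by (rule line_subset[OF S_point[OF P(1)] Np(2) PN(2) L']) (use P G t in \<open>auto simp: pg_plane_subspace\<close>)
    moreover have "card (on S L) = 1" "card (on S L') = 1" using N L L' P(1) unfolding big_def by blast+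
    ultimately have "{L, L'} \<subseteq> {M\<in>covers P G. card (on S M) = 1}" using L L' P S_point by (simp add: mem_lines_iff)
    hence "card {L, L'} \<le> card {M\<in>covers P G. card (on S M) = 1}" by (intro card_mono finite)
    moreover have "L \<noteq> L'"
    proof
      assume "L = L'"
      hence "L = t" using join_unique[OF Np(1,2) ne, of L t] L L' t by blast
      thus False using P L by blast
    qed
    ultimately have "2 \<le> card {M\<in>covers P G. card (on S M) = 1}" by simp
    thus ?thesis using card_tangents_plane[OF P(1,2) G(1)] by linarith
  next
    case False
    hence "on S G \<subseteq> on S t" by (auto simp: mem_on)
    hence "card (on S G) \<le> 1" using t by (metis card_mono finite)
    thus ?thesis using q_gt_2 by linarith
  qed
  hence "(\<Sum>G\<in>covers t UNIV. card (on S G) - 1) \<le> (\<Sum>G\<in>covers t UNIV. CARD('a) - 1)"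
    by (intro sum_mono diff_le_mono) auto
  hence "CARD('a)\<^sup>2 \<le> (CARD('a) + 1) * (CARD('a) - 1)"
    using sum_planes[OF t(1)] t card_planes_line[OF t(1)] by simp
  thus False using field_card_sq by linarith
qed

text \<open>A hyperoval plane yields a set of \<open>q + 1\<close> points such that each tangent of the ovoid contains exactly one of them.
  Together with the ovoid they form sets of \<open>0\<close> or \<open>q + 2\<close> points in all planes, so counting over the planes through
  an external line shows that \<open>q + 2\<close> divides \<open>q\<^sup>2 + q + 2 = (q + 2) (q - 1) + 4\<close>.\<close>

lemma no_hyperoval_plane:
  assumes E: "E \<in> pg_planes"
  shows "card (on S E) \<noteq> CARD('a) + 2"
proof
  assume h: "card (on S E) = CARD('a) + 2"
  have "on S E \<noteq> {}" using h by auto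
  then obtain X where X: "X \<in> S" "X \<subseteq> E" by (auto simp: mem_on)
  define T where "T = {t\<in>covers X UNIV. card (on S t) = 1}"
  have cS: "card (on S UNIV) = CARD('a)\<^sup>2 + 1" using card_S by (simp add: on_def)
  have cT: "card {t\<in>covers P UNIV. card (on S t) = 1} = CARD('a) + 1" if "P \<in> S" for P
    using card_tangents_in[OF that, of UNIV] card_lines_space[OF S_point[OF that]] cS by simp
  have "\<forall>t\<in>T. \<exists>N. big N \<and> N \<subseteq> t \<and> (\<forall>F. F \<in> pg_planes \<longrightarrow> N \<subseteq> F \<longrightarrow> card (on S F) \<noteq> CARD('a) + 2)"
  proof
    fix t assume "t \<in> T"
    hence t: "t \<in> pg_lines" "X \<subseteq> t" "card (on S t) = 1" using X S_point by (auto simp: T_def mem_lines_iff)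
    obtain N where N: "N \<in> pg_points" "N \<notin> S" "N \<subseteq> t"
      "\<And>F. F \<in> pg_planes \<Longrightarrow> N \<subseteq> F \<Longrightarrow> card (on S F) \<noteq> CARD('a) + 2"
      "\<And>L P. L \<in> pg_lines \<Longrightarrow> N \<subseteq> L \<Longrightarrow> P \<in> S \<Longrightarrow> P \<subseteq> L \<Longrightarrow> card (on S L) = 1"
      by (rule all_tangents_through[OF E h X t]) blast
    thus "\<exists>N. big N \<and> N \<subseteq> t \<and> (\<forall>F. F \<in> pg_planes \<longrightarrow> N \<subseteq> F \<longrightarrow> card (on S F) \<noteq> CARD('a) + 2)"
      unfolding big_def by blast
  qed
  from bchoice[OF this] obtain \<nu> where \<nu>: "\<And>t. t \<in> T \<Longrightarrow> big (\<nu> t) \<and> \<nu> t \<subseteq> t \<and> (\<forall>F. F \<in> pg_planes \<longrightarrow> \<nu> t \<subseteq> F \<longrightarrow> card (on S F) \<noteq> CARD('a) + 2)"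
    by blast
  define \<N> where "\<N> = \<nu> ` T"
  have bigN: "big N" "N \<in> pg_points" "N \<notin> S" "\<not> N \<subseteq> E" if "N \<in> \<N>" for N
    using that \<nu> E h by (auto simp: \<N>_def big_def)
  have inj: "inj_on \<nu> T"
  proof (rule inj_onI)
    fix t t' assume a: "t \<in> T" "t' \<in> T" "\<nu> t = \<nu> t'"
    have ne: "X \<noteq> \<nu> t" using \<nu>[OF a(1)] X by (auto simp: big_def)
    have "t \<in> pg_lines" "X \<subseteq> t" "t' \<in> pg_lines" "X \<subseteq> t'" using a X S_point by (auto simp: T_def mem_lines_iff)
    thus "t = t'" using join_unique[OF S_point[OF X(1)] _ ne, of t t'] \<nu>[OF a(1)] \<nu>[OF a(2)] a(3) by (auto simp: big_def)
  qed
  have cN: "card \<N> = CARD('a) + 1" unfolding \<N>_def using card_image[OF inj] cT[OF X(1)] by (simp add: T_def)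
  have tang: "\<exists>!L. L \<in> pg_lines \<and> P \<subseteq> L \<and> N \<subseteq> L" "\<And>L. L \<in> pg_lines \<Longrightarrow> P \<subseteq> L \<Longrightarrow> N \<subseteq> L \<Longrightarrow> card (on S L) = 1"
    if "P \<in> S" "N \<in> \<N>" for P N
  proof -
    have "P \<noteq> N" using that bigN by auto
    thus "\<exists>!L. L \<in> pg_lines \<and> P \<subseteq> L \<and> N \<subseteq> L" using join_line[of P N] that S_point bigN by blast
    fix L assume "L \<in> pg_lines" "P \<subseteq> L" "N \<subseteq> L"
    thus "card (on S L) = 1" using bigN(1)[OF that(2)] that(1) unfolding big_def by blast
  qed
  define ln where "ln P N = (THE L. L \<in> pg_lines \<and> P \<subseteq> L \<and> N \<subseteq> L)" for P N :: "('a ^ 4) set"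
  have ln: "ln P N \<in> pg_lines" "P \<subseteq> ln P N" "N \<subseteq> ln P N" "card (on S (ln P N)) = 1" if "P \<in> S" "N \<in> \<N>" for P N
    using theI'[OF tang(1)[OF that]] tang(2)[OF that] unfolding ln_def by blast+
  have ln_inj: "inj_on (ln P) \<N>" if "P \<in> S" for P
  proof (rule inj_onI)
    fix N N' assume a: "N \<in> \<N>" "N' \<in> \<N>" "ln P N = ln P N'"
    show "N = N'"
      by (rule big_unique[OF bigN(1)[OF a(1)] bigN(1)[OF a(2)] ln(1)[OF that a(1)] ln(3)[OF that a(1)] _ ln(4)[OF that a(1)]])
         (use ln(3)[OF that a(2)] a(3) in simp)
  qed
  \<comment> \<open>Both sides have \<open>q + 1\<close> elements; thus the points found on the
    tangents at \<open>X\<close> also account for the tangents at every other point of the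
    ovoid.\<close>
  have ln_im: "ln P ` \<N> = {t\<in>covers P UNIV. card (on S t) = 1}" if P: "P \<in> S" for P
  proof (rule card_seteq)
    show "ln P ` \<N> \<subseteq> {t\<in>covers P UNIV. card (on S t) = 1}"
      using ln[OF P] P S_point by (auto simp: mem_lines_iff)
    show "card {t\<in>covers P UNIV. card (on S t) = 1} \<le> card (ln P ` \<N>)"
      using cT[OF P] card_image[OF ln_inj[OF P]] cN by simp
  qed simp
  have count: "card (on \<N> G) + card (on S G) = CARD('a) + 2" if G: "G \<in> pg_planes" and P: "P \<in> on S G" for G P
  proof -
    have P': "P \<in> S" "P \<subseteq> G" using P by (auto simp: mem_on)
    have "ln P ` on \<N> G = {t\<in>covers P G. card (on S t) = 1}"
    proof
      show "ln P ` on \<N> G \<subseteq> {t\<in>covers P G. card (on S t) = 1}"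
      proof
        fix t assume "t \<in> ln P ` on \<N> G"
        then obtain N where N: "N \<in> \<N>" "N \<subseteq> G" "t = ln P N" by (auto simp: mem_on)
        have "P \<noteq> N" using P' bigN(3)[OF N(1)] by auto
        hence "t \<subseteq> G" unfolding N(3)
          by (rule line_subset[OF S_point[OF P'(1)] bigN(2)[OF N(1)] _ ln(1-3)[OF P'(1) N(1)]]) (use P' N G in \<open>simp_all add: pg_plane_subspace\<close>)
        thus "t \<in> {t\<in>covers P G. card (on S t) = 1}" using ln[OF P'(1) N(1)] N(3) S_point[OF P'(1)] by (simp add: mem_lines_iff)
      qed
      show "{t\<in>covers P G. card (on S t) = 1} \<subseteq> ln P ` on \<N> G"
      proof
        fix t assume t: "t \<in> {t\<in>covers P G. card (on S t) = 1}"
        hence "t \<in> ln P ` \<N>" unfolding ln_im[OF P'(1)] by (auto simp: covers_def)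
        then obtain N where N: "N \<in> \<N>" "t = ln P N" by blast
        have "t \<subseteq> G" using t by (simp add: covers_def)
        hence "N \<subseteq> G" using ln(3)[OF P'(1) N(1)] N(2) by blast
        thus "t \<in> ln P ` on \<N> G" using N by (simp add: mem_on)
      qed
    qed
    moreover have "inj_on (ln P) (on \<N> G)" by (rule inj_on_subset[OF ln_inj[OF P'(1)]]) (auto simp: on_def)
    ultimately have "card (on \<N> G) = card {t\<in>covers P G. card (on S t) = 1}" using card_image by fastforce
    thus ?thesis using card_tangents_plane[OF P' G] by simp
  qed
  \<comment> \<open>A point \<open>N\<close> in such a plane is joined to the
    \<open>q\<^sup>2 + 1\<close> points of the ovoid by different lines not in \<open>G\<close>, but
    only \<open>q\<^sup>2\<close> lines through \<open>N\<close> leave \<open>G\<close>.\<close>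
  have empty: "on \<N> G = {}" if G: "G \<in> pg_planes" and e: "on S G = {}" for G
  proof (rule ccontr)
    assume "on \<N> G \<noteq> {}"
    then obtain N where N: "N \<in> \<N>" "N \<subseteq> G" by (auto simp: mem_on)
    note Np = bigN[OF N(1)]
    have le: "card (on S L) \<le> (if L \<subseteq> G then 0 else 1)" if L: "L \<in> covers N UNIV" for L
    proof (cases "L \<subseteq> G")
      case True
      hence "on S L = {}" using on_subset(2)[OF True, of S] e by blast
      thus ?thesis by simp
    next
      case False
      have L': "L \<in> pg_lines" "N \<subseteq> L" using L Np(2) by (auto simp: mem_lines_iff)
      have "card (on S L) = 1" if "P \<in> on S L" for P
        using Np(1) L' that unfolding big_def mem_on by blast
      hence "card (on S L) \<le> 1" by (cases "on S L = {}") auto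
      thus ?thesis using False by simp
    qed
    have "CARD('a)\<^sup>2 + 1 = (\<Sum>L\<in>covers N UNIV. card (on S L))"
      using sum_lines_out[OF Np(2,3), of UNIV] cS by simp
    also have "\<dots> \<le> (\<Sum>L\<in>covers N UNIV. if L \<subseteq> G then 0 else 1)" by (rule sum_mono[OF le])
    also have "\<dots> = card {L\<in>covers N UNIV. \<not> L \<subseteq> G}" by (simp add: sum.If_cases Int_def)
    also have "{L\<in>covers N UNIV. \<not> L \<subseteq> G} = covers N UNIV - covers N G" by (auto simp: covers_def)
    also have "card \<dots> = card (covers N UNIV) - card (covers N G)"
      by (rule card_Diff_subset) (auto simp: covers_def)
    also have "\<dots> = CARD('a)\<^sup>2" using card_lines_space[OF Np(2)] card_lines_plane[OF Np(2) G N(2)] by simp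
    finally show False by simp
  qed
  \<comment> \<open>An external line exists through \<open>Y\<close>: \<open>q + 1\<close> secants
    through \<open>Y\<close> would need \<open>2 * (q + 1)\<close> points of the hyperoval.\<close>
  obtain Y where Y: "Y \<in> pg_points" "Y \<subseteq> E" "Y \<notin> S" by (rule off_point[OF E])
  have "\<exists>l\<in>covers Y E. card (on S l) = 0"
  proof (rule ccontr)
    assume ne: "\<not> ?thesis"
    have "card (on S l) = 2" if l: "l \<in> covers Y E" for l
    proof -
      have l': "l \<in> pg_lines" "l \<subseteq> E" using l Y by (auto simp: mem_lines_iff)
      show ?thesis using ne l hyperoval_no_tangent[OF E h l'] card_line_le[OF l'(1)]
        by (metis One_nat_def le_antisym less_2_cases not_less)
    qed
    hence "card (on S E) = (CARD('a) + 1) * 2"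
      using sum_lines_out[OF Y(1,3,2)] E card_lines_plane[OF Y(1) E Y(2)] by (simp add: pg_plane_subspace)
    thus False using h q_gt_2 by simp
  qed
  then obtain l where l: "l \<in> pg_lines" "l \<subseteq> E" "on S l = {}" using Y by (auto simp: mem_lines_iff)
  have "(CARD('a) + 2) dvd (\<Sum>G\<in>covers l UNIV. card (on S G) + card (on \<N> G))"
  proof (rule dvd_sum)
    fix G assume "G \<in> covers l UNIV"
    hence G: "G \<in> pg_planes" using l by (simp add: mem_planes_iff)
    show "(CARD('a) + 2) dvd (card (on S G) + card (on \<N> G))"
    proof (cases "on S G = {}")
      case True
      thus ?thesis using empty[OF G] by simp
    next
      case False
      then obtain P where "P \<in> on S G" by blast
      thus ?thesis using count[OF G, of P] by (metis add.commute dvd_refl)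
    qed
  qed
  also have "(\<Sum>G\<in>covers l UNIV. card (on S G) + card (on \<N> G)) = (CARD('a)\<^sup>2 + 1) + (CARD('a) + 1)"
  proof -
    have "(\<Sum>G\<in>covers l UNIV. card (on S G)) = CARD('a)\<^sup>2 + 1" using sum_planes[OF l(1)] l(3) by simp
    moreover have "on \<N> l = {}" using bigN(4) l(2) by (auto simp: on_def)
    hence "(\<Sum>G\<in>covers l UNIV. card (on \<N> G)) = card (on \<N> UNIV)"
      using sum_covers[of l UNIV \<N>] bigN(2) l(1) by (auto simp: pg_line_subspace)
    ultimately show ?thesis using cN by (simp add: sum.distrib on_def)
  qed
  finally have d: "(CARD('a) + 2) dvd (CARD('a)\<^sup>2 + 1) + (CARD('a) + 1)" .
  have "(CARD('a)\<^sup>2 + 1) + (CARD('a) + 1) = (CARD('a) + 2) * (CARD('a) - 1) + 4"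
    using q_gt_2 by (simp add: power2_eq_square algebra_simps)
  hence "(CARD('a) + 2) dvd 4" using d by (metis dvd_add_right_iff dvd_triv_left)
  hence "CARD('a) + 2 \<le> 4" by (rule dvd_imp_le) simp
  thus False using q_gt_2 by simp
qed

end

section \<open>Nondegenerate forms and planes as perpendiculars\<close>

definition dot :: "'a::field ^ 'n \<Rightarrow> 'a ^ 'n \<Rightarrow> 'a" where
  "dot u v = (\<Sum>i\<in>UNIV. u $ i * v $ i)"

lemma dot_add: "dot u (v + w) = dot u v + dot u w" "dot (v + w) u = dot v u + dot w u"
  by (simp_all add: dot_def algebra_simps sum.distrib)

lemma dot_scale: "dot u (c *s v) = c * dot u v" "dot (c *s v) u = c * dot v u"
  by (simp_all add: dot_def sum_distrib_left algebra_simps)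

lemma dot_diff: "dot u (v - w) = dot u v - dot u w" "dot (v - w) u = dot v u - dot w u"
  by (simp_all add: dot_def algebra_simps sum_subtractf)

lemma dot_axis: "dot u (axis i 1) = u $ i"
  by (simp add: dot_def axis_def if_distrib cong: if_cong)

text \<open>Pigeonhole principle: \<open>q ^ 4\<close> vectors have at most \<open>q ^ 3\<close>
  triples of values, and the difference of two vectors with the same triple is the witness.\<close>

lemma ex_common_zero:
  fixes f g h :: "'a::{field,finite} ^ 4 \<Rightarrow> 'a"
  assumes "\<And>x y. f (x - y) = f x - f y" "\<And>x y. g (x - y) = g x - g y" "\<And>x y. h (x - y) = h x - h y"
  shows "\<exists>u. u \<noteq> 0 \<and> f u = 0 \<and> g u = 0 \<and> h u = 0"
proof -
  let ?F = "\<lambda>u. (f u, g u, h u)"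
  have "\<not> inj ?F"
  proof
    assume "inj ?F"
    hence "card (UNIV :: ('a ^ 4) set) \<le> card (UNIV :: ('a \<times> 'a \<times> 'a) set)"
      by (metis card_image card_mono finite top_greatest)
    hence "CARD('a) ^ 4 \<le> CARD('a) ^ 3"
      using card_subspace[of "UNIV :: ('a ^ 4) set"] unfolding dim_UNIV4
      by (simp add: card_prod power3_eq_cube)
    thus False using two_le_card_field[where 'a='a] by simp
  qed
  then obtain x y where "x \<noteq> y" "?F x = ?F y" unfolding inj_def by blast
  thus ?thesis using assms by (intro exI[of _ "x - y"]) auto
qed

lemma span3:
  fixes E :: "('a::{field,finite} ^ 'n) set"
  assumes "E \<in> pg_planes"
  obtains x y z where "E = vec.span {x, y, z}"
proof -
  have E: "vec.subspace E" "vec.dim E = 3" using assms by (auto simp: pg_planes_def)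
  obtain Bs where Bs: "Bs \<subseteq> E" "vec.independent Bs" "E \<subseteq> vec.span Bs" "card Bs = 3"
    using vec.basis_exists[of E] E by auto
  hence "E = vec.span Bs" using E by (metis vec.span_subspace)
  moreover obtain x y z where "Bs = {x, y, z}" using Bs(4) by (auto simp: card_3_iff)
  ultimately show ?thesis using that by blast
qed

locale bilinear_form =
  fixes B :: "'a::{field,finite} ^ 4 \<Rightarrow> 'a ^ 4 \<Rightarrow> 'a"
  assumes add_left: "B (x + y) z = B x z + B y z"
    and scale_left: "B (c *s x) z = c * B x z"
    and sym: "B x z = B z x"
    and nondegenerate: "x \<noteq> 0 \<Longrightarrow> \<exists>z. B x z \<noteq> 0"
begin

lemma add_right: "B z (x + y) = B z x + B z y" by (metis add_left sym)
lemma scale_right: "B z (c *s x) = c * B z x" by (metis scale_left sym)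
lemma diff_left: "B (x - y) z = B x z - B y z"
proof -
  have "B (x + (-1) *s y) z = B x z + (-1) * B y z" unfolding add_left scale_left ..
  thus ?thesis by simp
qed
lemma diff_right: "B z (x - y) = B z x - B z y" by (metis diff_left sym)
lemma zero_left: "B 0 z = 0" using scale_left[of 0 0 z] by simp
lemma zero_right: "B z 0 = 0" using zero_left sym by metis

lemmas B_simps = add_left add_right scale_left scale_right diff_left diff_right zero_left zero_right

definition perp :: "'a ^ 4 \<Rightarrow> ('a ^ 4) set" where "perp N = {x. B N x = 0}"

lemma perp_subspace: "vec.subspace (perp N)"
  by (auto simp: vec.subspace_def perp_def B_simps)

lemma dim_perp:
  assumes "N \<noteq> 0" shows "vec.dim (perp N) = 3"
proof -
  obtain z where z: "B N z \<noteq> 0" using nondegenerate[OF assms] by blast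
  have s: "vec.span (perp N) = perp N" by (rule vec.span_eq_iff[THEN iffD2, OF perp_subspace])
  have zn: "z \<notin> vec.span (perp N)" unfolding s using z by (simp add: perp_def)
  have "x \<in> vec.span (insert z (perp N))" for x
  proof -
    have "x - (B N x / B N z) *s z \<in> perp N" using z by (simp add: perp_def B_simps)
    hence "x - (B N x / B N z) *s z \<in> vec.span (insert z (perp N))" by (simp add: vec.span_base)
    moreover have "(B N x / B N z) *s z \<in> vec.span (insert z (perp N))" by (intro vec.span_scale vec.span_base) simp
    ultimately have "(x - (B N x / B N z) *s z) + (B N x / B N z) *s z \<in> vec.span (insert z (perp N))" by (rule vec.span_add)
    thus ?thesis by simp
  qed
  hence "vec.span (insert z (perp N)) = UNIV" by blast
  hence "vec.dim (insert z (perp N)) = 4" by (metis dim_UNIV4 vec.dim_span)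
  thus ?thesis using zn by (simp add: vec.dim_insert)
qed

lemma perp_plane: "N \<noteq> 0 \<Longrightarrow> perp N \<in> pg_planes"
  by (simp add: pg_planes_def perp_subspace dim_perp)

lemma perp_eqD:
  assumes "N \<noteq> 0" "perp N = perp M" shows "\<exists>s. M = s *s N"
proof -
  obtain z where z: "B N z \<noteq> 0" using nondegenerate[OF assms(1)] by blast
  define s where "s = B M z / B N z"
  have "B (M - s *s N) x = 0" for x
  proof -
    have "x - (B N x / B N z) *s z \<in> perp N" using z by (simp add: perp_def B_simps)
    hence "x - (B N x / B N z) *s z \<in> perp M" unfolding assms(2) .
    hence "B M (x - (B N x / B N z) *s z) = 0" by (simp add: perp_def)
    thus ?thesis by (simp add: B_simps s_def)
  qed
  hence "M - s *s N = 0" using nondegenerate by blast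
  thus ?thesis by auto
qed

lemma plane_perp:
  assumes E: "E \<in> pg_planes"
  obtains N where "N \<noteq> 0" "E = perp N"
proof -
  obtain x y z where xyz: "E = vec.span {x, y, z}" by (rule span3[OF E])
  obtain N where N: "N \<noteq> 0" "B N x = 0" "B N y = 0" "B N z = 0"
    using ex_common_zero[of "\<lambda>N. B N x" "\<lambda>N. B N y" "\<lambda>N. B N z"] by (auto simp: B_simps)
  have "E \<subseteq> perp N" unfolding xyz by (rule vec.span_minimal) (use N perp_subspace in \<open>auto simp: perp_def\<close>)
  hence "E = perp N" by (rule vec.subspace_dim_equal[rotated 2]) (use E dim_perp[OF N(1)] perp_subspace in \<open>auto simp: pg_planes_def\<close>)
  thus ?thesis using that N by blast
qed

end

lemma prod_involution:
  fixes A :: "'a::field set"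
  assumes "finite A" "\<And>x. x \<in> A \<Longrightarrow> x \<noteq> 0 \<and> x * x \<noteq> 1 \<and> inverse x \<in> A"
  shows "\<Prod>A = 1"
  using assms
proof (induction "card A" arbitrary: A rule: less_induct)
  case less
  show ?case
  proof (cases "A = {}")
    case False
    then obtain x where x: "x \<in> A" by blast
    hence x0: "x \<noteq> 0" "inverse x \<noteq> x" "inverse x \<in> A" using less.prems(2)[OF x] by auto (metis right_inverse)
    let ?A = "A - {x} - {inverse x}"
    have "\<Prod>A = x * (inverse x * \<Prod>?A)"
      using less.prems(1) x x0 by (subst prod.remove[of A x], simp, simp) (subst prod.remove[of "A - {x}" "inverse x"], auto)
    moreover have "\<Prod>?A = 1"
    proof (rule less.hyps)
      show "card ?A < card A" using less.prems(1) x by (metis card_Diff1_less_iff card_Diff1_le finite_Diff le_less_trans)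
      fix y assume y: "y \<in> ?A"
      hence "y \<noteq> 0 \<and> y * y \<noteq> 1 \<and> inverse y \<in> A" using less.prems(2) by blast
      moreover have "inverse y \<noteq> x" "inverse y \<noteq> inverse x" using y by auto
      ultimately show "y \<noteq> 0 \<and> y * y \<noteq> 1 \<and> inverse y \<in> ?A" by blast
    qed (use less.prems(1) in simp)
    ultimately show ?thesis using x0 by simp
  qed simp
qed

text \<open>All factors other than \<open>1\<close> and \<open>-1\<close> cancel against their
  inverses. In characteristic two these exceptions coincide, and the remaining factor is still
  \<open>-1\<close>.\<close>

lemma wilson: "\<Prod>(UNIV - {0::'a::{field,finite}}) = -1"
proof -
  let ?A = "{x::'a. x \<noteq> 0 \<and> x * x \<noteq> 1}"
  have A: "\<Prod>?A = 1"
    by (rule prod_involution) (auto simp: nonzero_inverse_mult_distrib[symmetric] simp del: inverse_mult_distrib)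
  have sq: "x * x = 1 \<longleftrightarrow> x = 1 \<or> x = -1" for x :: 'a
    using sqrt_set[of "1::'a"] by auto
  have U: "UNIV - {0::'a} = ?A \<union> {1, -1}" using sq by auto
  have d: "?A \<inter> {1, -1} = {}" by auto
  have "\<Prod>(UNIV - {0::'a}) = \<Prod>?A * \<Prod>{1, -1::'a}" unfolding U by (rule prod.union_disjoint) (use d in auto)
  also have "\<Prod>{1, -1::'a} = -1"
  proof (cases "(1::'a) = -1")
    case True
    hence e: "{1, -1::'a} = {-1}" by (metis insert_absorb2)
    show ?thesis unfolding e by simp
  qed simp
  finally show ?thesis using A by simp
qed

lemma odd_card_field:
  assumes "(2::'a::{field,finite}) \<noteq> 0" shows "odd (CARD('a))"
proof -
  have "CARD('a) = Suc (card (UNIV - {0::'a}))" using card.remove[of UNIV "0::'a"] by simp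
  thus ?thesis using card_nonzero_squares[OF assms] by simp
qed

definition rep :: "('a::{field,finite} ^ 'n) set \<Rightarrow> 'a ^ 'n" where
  "rep P = (SOME v. v \<noteq> 0 \<and> P = pt v)"

lemma rep: "P \<in> pg_points \<Longrightarrow> rep P \<noteq> 0 \<and> P = pt (rep P)"
  unfolding rep_def by (rule someI_ex) (auto elim: pg_pointE)

lemma rep_subset_iff: "P \<in> pg_points \<Longrightarrow> vec.subspace W \<Longrightarrow> P \<subseteq> W \<longleftrightarrow> rep P \<in> W"
  using rep pt_subset_iff by metis

lemma in_line_span:
  assumes X: "X \<in> pg_points" and Y: "Y \<in> pg_points" and ne: "X \<noteq> Y"
    and L: "L \<in> pg_lines" "X \<subseteq> L" "Y \<subseteq> L" "v \<in> L"
  obtains a b where "v = a *s rep X + b *s rep Y"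
proof -
  have "L \<subseteq> vec.span {rep X, rep Y}"
  proof (rule line_subset[OF X Y ne L(1-3)])
    show "vec.subspace (vec.span {rep X, rep Y})" by (rule vec.subspace_span)
    thus "X \<subseteq> vec.span {rep X, rep Y}" "Y \<subseteq> vec.span {rep X, rep Y}"
      using rep_subset_iff X Y by (metis insertCI vec.span_base)+
  qed
  hence "v \<in> vec.span {rep X, rep Y}" using L(4) by blast
  then obtain a b where "v - a *s rep X - b *s rep Y = 0" unfolding vec.span_breakdown_eq by auto
  hence "v = a *s rep X + b *s rep Y" by (simp add: algebra_simps)
  thus ?thesis using that by blast
qed

section \<open>Segre's lemma of tangents and the polarity of an ovoid\<close>

lemma bilinear_dot: "bilinear_form (dot :: 'a::{field,finite} ^ 4 \<Rightarrow> 'a ^ 4 \<Rightarrow> 'a)"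
proof
  fix x :: "'a::{field,finite} ^ 4" assume "x \<noteq> 0"
  then obtain i where "x $ i \<noteq> 0" by (auto simp: vec_eq_iff)
  thus "\<exists>z. dot x z \<noteq> 0" using dot_axis by metis
next
  show "dot x z = dot z x" for x z :: "'a::{field,finite} ^ 4" by (simp add: dot_def mult.commute)
qed (simp_all only: dot_add dot_scale)

context ovoid_space begin

text \<open>Without hyperovals, each of the \<open>q + 1\<close> planes through a secant holds at
  most \<open>q - 1\<close> of the other \<open>q\<^sup>2 - 1 = (q + 1) * (q - 1)\<close> points, so
  equality holds in every plane.\<close>

lemma plane_card:
  assumes E: "E \<in> pg_planes" and two: "card (on S E) \<ge> 2"
  shows "card (on S E) = CARD('a) + 1"
proof -
  obtain T where T: "T \<subseteq> on S E" "card T = 2" using two by (meson obtain_subset_with_card_n)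
  then obtain P R where PR: "P \<in> on S E" "R \<in> on S E" "P \<noteq> R" by (auto simp: card_2_iff)
  hence PR': "P \<in> S" "P \<subseteq> E" "R \<in> S" "R \<subseteq> E" by (auto simp: mem_on)
  obtain L where L: "L \<in> pg_lines" "P \<subseteq> L" "R \<subseteq> L" using joinE[OF S_point[OF PR'(1)] S_point[OF PR'(3)] PR(3)] .
  have LE: "L \<subseteq> E" by (rule line_subset[OF S_point[OF PR'(1)] S_point[OF PR'(3)] PR(3) L]) (use PR' E in \<open>simp_all add: pg_plane_subspace\<close>)
  have "card {P, R} \<le> card (on S L)" by (rule card_mono) (use PR' L in \<open>simp_all add: mem_on\<close>)
  hence L2: "card (on S L) = 2" using PR(3) card_line_le[OF L(1)] by simp
  have le: "card (on S G) - 2 \<le> CARD('a) - 1" if G: "G \<in> covers L UNIV" for G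
  proof -
    have G: "G \<in> pg_planes" using G L by (simp add: mem_planes_iff)
    show ?thesis using card_plane_le[OF G] no_hyperoval_plane[OF G] by linarith
  qed
  have Ec: "E \<in> covers L UNIV" using E LE L by (simp add: mem_planes_iff)
  have "CARD('a)\<^sup>2 - 1 = (\<Sum>G\<in>covers L UNIV. card (on S G) - 2)" using sum_planes[OF L(1)] L2 by simp
  also have "\<dots> = card (on S E) - 2 + (\<Sum>G\<in>covers L UNIV - {E}. card (on S G) - 2)"
    using Ec by (intro sum.remove) auto
  also have "\<dots> \<le> card (on S E) - 2 + (\<Sum>G\<in>covers L UNIV - {E}. CARD('a) - 1)"
    using le by (intro add_left_mono sum_mono) auto
  also have "\<dots> = card (on S E) - 2 + CARD('a) * (CARD('a) - 1)"
    using Ec card_planes_line[OF L(1)] by simp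
  finally have "CARD('a)\<^sup>2 - 1 \<le> card (on S E) - 2 + CARD('a) * (CARD('a) - 1)" .
  moreover have "CARD('a)\<^sup>2 - 1 = CARD('a) - 1 + CARD('a) * (CARD('a) - 1)"
    by (simp add: power2_eq_square algebra_simps)
  ultimately have "CARD('a) - 1 \<le> card (on S E) - 2" by linarith
  thus ?thesis using le[OF Ec] q_gt_2 by linarith
qed

text \<open>Existence: the planes through a tangent \<open>t\<close> hold \<open>q\<^sup>2\<close>
  points off \<open>t\<close>, which is less than \<open>(q + 1) * q\<close>. Uniqueness: if two
  such planes met in a line, the other \<open>q - 1\<close> planes through it, with at most
  \<open>q\<close> further points each, could not hold the remaining \<open>q\<^sup>2\<close>
  points.\<close>

lemma ex1_tangent_plane:
  assumes P: "P \<in> S"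
  shows "\<exists>!E. E \<in> pg_planes \<and> on S E = {P}"
proof (rule ex_ex1I)
  have cS: "card (on S UNIV) = CARD('a)\<^sup>2 + 1" using card_S by (simp add: on_def)
  have "card {t\<in>covers P UNIV. card (on S t) = 1} = CARD('a) + 1"
    using card_tangents_in[OF P, of UNIV] card_lines_space[OF S_point[OF P]] cS by simp
  hence "{t\<in>covers P UNIV. card (on S t) = 1} \<noteq> {}" by (metis card.empty add_is_0 one_neq_zero)
  then obtain t where t: "t \<in> pg_lines" "P \<subseteq> t" "card (on S t) = 1" using S_point[OF P] by (auto simp: mem_lines_iff)
  have "\<exists>E\<in>covers t UNIV. card (on S E) \<noteq> CARD('a) + 1"
  proof (rule ccontr)
    assume "\<not> ?thesis"
    hence "(\<Sum>G\<in>covers t UNIV. card (on S G) - 1) = (CARD('a) + 1) * CARD('a)"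
      using card_planes_line[OF t(1)] by simp
    thus False using sum_planes[OF t(1)] t q_gt_2 by (simp add: power2_eq_square)
  qed
  then obtain E where E: "E \<in> pg_planes" "t \<subseteq> E" "card (on S E) \<noteq> CARD('a) + 1" using t by (auto simp: mem_planes_iff)
  have PE: "P \<in> on S E" using P t E by (auto simp: mem_on)
  hence "card (on S E) > 0" unfolding card_gt_0_iff by (intro conjI finite) blast
  hence "card (on S E) = 1" using plane_card[OF E(1)] E(3) by linarith
  hence "on S E = {P}" using PE by (auto simp: card_1_singleton_iff)
  thus "\<exists>E. E \<in> pg_planes \<and> on S E = {P}" using E by blast
next
  fix E E' assume a: "E \<in> pg_planes \<and> on S E = {P}" "E' \<in> pg_planes \<and> on S E' = {P}"
  show "E = E'"
  proof (rule ccontr)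
    assume ne: "E \<noteq> E'"
    have I: "E \<inter> E' \<in> pg_lines" using planes_Int a ne by blast
    have "on S (E \<inter> E') = on S E \<inter> on S E'" by (auto simp: on_def)
    hence I1: "on S (E \<inter> E') = {P}" using a by simp
    have EE: "E \<in> covers (E \<inter> E') UNIV" "E' \<in> covers (E \<inter> E') UNIV - {E}" using a I ne by (auto simp: mem_planes_iff)
    have le: "card (on S G) - 1 \<le> CARD('a)" if "G \<in> covers (E \<inter> E') UNIV" for G
    proof -
      have G: "G \<in> pg_planes" using that I by (simp add: mem_planes_iff)
      show ?thesis using card_plane_le[OF G] no_hyperoval_plane[OF G] by linarith
    qed
    have "CARD('a)\<^sup>2 = (\<Sum>G\<in>covers (E \<inter> E') UNIV. card (on S G) - 1)" using sum_planes[OF I] I1 by simp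
    also have "\<dots> = (card (on S E) - 1) + ((card (on S E') - 1) + (\<Sum>G\<in>covers (E \<inter> E') UNIV - {E} - {E'}. card (on S G) - 1))"
      using EE by (subst sum.remove[of _ E], simp, simp) (subst sum.remove[of "covers (E \<inter> E') UNIV - {E}" E'], auto)
    also have "\<dots> = (\<Sum>G\<in>covers (E \<inter> E') UNIV - {E} - {E'}. card (on S G) - 1)" using a by simp
    also have "\<dots> \<le> (\<Sum>G\<in>covers (E \<inter> E') UNIV - {E} - {E'}. CARD('a))" by (rule sum_mono) (use le in auto)
    also have "\<dots> = (CARD('a) - 1) * CARD('a)" using EE card_planes_line[OF I] by simp
    also have "\<dots> < CARD('a)\<^sup>2" using q_gt_2 by (simp add: power2_eq_square)
    finally show False by simp
  qed
qed

text \<open>The coefficients of an equation of the tangent plane at \<open>P\<close>. The scalar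
  left open by the choice is adjusted in \<open>ex_form\<close>.\<close>

definition tangent_functional :: "('a ^ 4) set \<Rightarrow> 'a ^ 4" where
  "tangent_functional P = (SOME u. u \<noteq> 0 \<and> {v. dot u v = 0} \<in> pg_planes \<and> on S {v. dot u v = 0} = {P})"

definition \<tau> :: "('a ^ 4) set \<Rightarrow> 'a ^ 4 \<Rightarrow> 'a" where "\<tau> P v = dot (tangent_functional P) v"

lemma \<tau>_zero_iff: assumes P: "P \<in> S" and R: "R \<in> S" shows "\<tau> P (rep R) = 0 \<longleftrightarrow> P = R"
proof -
  interpret d: bilinear_form "dot :: 'a ^ 4 \<Rightarrow> 'a ^ 4 \<Rightarrow> 'a" by (rule bilinear_dot)
  obtain E where E: "E \<in> pg_planes" "on S E = {P}" using ex1_tangent_plane[OF P] by blast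
  obtain u where u: "u \<noteq> 0" "E = d.perp u" by (rule d.plane_perp[OF E(1)])
  hence "\<exists>u. u \<noteq> 0 \<and> {v. dot u v = 0} \<in> pg_planes \<and> on S {v. dot u v = 0} = {P}"
    using E by (auto simp: d.perp_def)
  from someI_ex[OF this] have t: "{v. \<tau> P v = 0} \<in> pg_planes" "on S {v. \<tau> P v = 0} = {P}"
    unfolding tangent_functional_def[symmetric] \<tau>_def by auto
  have "\<tau> P (rep R) = 0 \<longleftrightarrow> R \<subseteq> {v. \<tau> P v = 0}"
    using rep_subset_iff[OF S_point[OF R] pg_plane_subspace(1)[OF t(1)]] by simp
  also have "\<dots> \<longleftrightarrow> R \<in> on S {v. \<tau> P v = 0}" using R by (simp add: mem_on)
  finally show ?thesis using t(2) by auto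
qed

lemma \<tau>_linear: "\<tau> P (x + y) = \<tau> P x + \<tau> P y" "\<tau> P (c *s x) = c * \<tau> P x"
  by (simp_all add: \<tau>_def dot_add dot_scale)

lemma not_collinear:
  assumes "P \<in> S" "R \<in> S" "X \<in> S" "P \<noteq> R" "P \<noteq> X" "R \<noteq> X"
  shows "rep X \<notin> vec.span {rep P, rep R}"
proof
  assume a: "rep X \<in> vec.span {rep P, rep R}"
  obtain L where L: "L \<in> pg_lines" "P \<subseteq> L" "R \<subseteq> L" using joinE[OF S_point S_point] assms by metis
  note subs = rep_subset_iff[OF _ pg_line_subspace(1)[OF L(1)]]
  have "rep P \<in> L" "rep R \<in> L" using subs L assms S_point by blast+
  hence "vec.span {rep P, rep R} \<subseteq> L" using pg_line_subspace(1)[OF L(1)] by (intro vec.span_minimal) auto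
  hence "X \<subseteq> L" using a subs assms S_point by blast
  thus False using no_threeD[of P R X L] assms L by blast
qed

text \<open>The \<open>q - 1\<close> lines of \<open>E\<close> through \<open>P\<close> other than \<open>P Q\<close> and \<open>P R\<close> correspond to the nonzero field elements,
  whose product is \<open>- 1\<close>. All of them but the tangent contain a further point \<open>X\<close> of the ovoid.\<close>

lemma segre_product:
  assumes S: "P \<in> S" "Q \<in> S" "R \<in> S" "P \<noteq> Q" "P \<noteq> R" "Q \<noteq> R"
    and E: "E \<in> pg_planes" "P \<subseteq> E" "Q \<subseteq> E" "R \<subseteq> E"
    and co: "\<And>X. X \<in> on S E - {P, Q, R} \<Longrightarrow> rep X = a X *s rep P + (b X *s rep Q + c X *s rep R) \<and> b X \<noteq> 0 \<and> c X \<noteq> 0"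
  shows "(\<Prod>X\<in>on S E - {P, Q, R}. b X / c X) * (- \<tau> P (rep R) / \<tau> P (rep Q)) = -1"
proof -
  let ?D = "on S E - {P, Q, R}"
  let ?r = "\<lambda>X. b X / c X"
  let ?t = "- \<tau> P (rep R) / \<tau> P (rep Q)"
  have tz: "\<tau> P (rep Q) \<noteq> 0" "\<tau> P (rep R) \<noteq> 0" "\<tau> P (rep P) = 0" using \<tau>_zero_iff S by auto
  have inj: "inj_on ?r ?D"
  proof (rule inj_onI, rule ccontr)
    fix X Y assume X: "X \<in> ?D" and Y: "Y \<in> ?D" and e: "?r X = ?r Y" and ne: "X \<noteq> Y"
    have cX: "b X \<noteq> 0" "c X \<noteq> 0" "b Y \<noteq> 0" "c Y \<noteq> 0" using co[OF X] co[OF Y] by auto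
    define s where "s = c Y / c X"
    have s: "c Y = s * c X" "b Y = s * b X" using e cX by (auto simp: s_def field_simps)
    have "rep Y = (a Y - s * a X) *s rep P + s *s rep X"
      using co[OF X] co[OF Y] unfolding s by (simp add: vec_eq_iff algebra_simps)
    hence "rep Y \<in> vec.span {rep P, rep X}"
      by (simp add: vec.span_add vec.span_scale vec.span_base)
    moreover have "X \<in> S" "Y \<in> S" "P \<noteq> X" "P \<noteq> Y" using X Y by (auto simp: mem_on)
    ultimately show False using not_collinear[OF S(1), of X Y] ne by blast
  qed
  have notin: "?t \<notin> ?r ` ?D"
  proof
    assume "?t \<in> ?r ` ?D"
    then obtain X where X: "X \<in> ?D" "?t = ?r X" by blast
    hence cX: "c X \<noteq> 0" using co by blast
    have "X \<in> S" "P \<noteq> X" using X by (auto simp: mem_on)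
    hence "\<tau> P (rep X) \<noteq> 0" using \<tau>_zero_iff[OF S(1)] by blast
    moreover have "\<tau> P (rep X) = b X * \<tau> P (rep Q) + c X * \<tau> P (rep R)"
      using co[OF X(1)] tz(3) by (simp add: \<tau>_linear)
    moreover have "b X * \<tau> P (rep Q) + c X * \<tau> P (rep R) = 0"
    proof -
      have "- (c X * \<tau> P (rep R)) = b X * \<tau> P (rep Q)" using X(2) cX tz by (simp add: field_simps)
      thus ?thesis by (metis add.left_inverse)
    qed
    ultimately show False by simp
  qed
  have "insert ?t (?r ` ?D) = UNIV - {0}"
  proof (rule card_seteq)
    show "insert ?t (?r ` ?D) \<subseteq> UNIV - {0}"
    proof (rule insert_subsetI)
      show "?t \<in> UNIV - {0}" using tz by simp
      show "?r ` ?D \<subseteq> UNIV - {0}"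
      proof (rule image_subsetI)
        fix X assume "X \<in> ?D"
        thus "?r X \<in> UNIV - {0}" using co[of X] by simp
      qed
    qed
    have "card {P, Q, R} = 3" using S by simp
    moreover have PQR: "{P, Q, R} \<subseteq> on S E" using S E by (simp add: mem_on)
    ultimately have cge: "card (on S E) \<ge> 3" by (metis card_mono finite)
    hence "card (on S E) = CARD('a) + 1" using plane_card[OF E(1)] by simp
    hence "card ?D = CARD('a) - 2" using PQR \<open>card {P, Q, R} = 3\<close> by (simp add: card_Diff_subset)
    hence "card (insert ?t (?r ` ?D)) = CARD('a) - 1" using notin card_image[OF inj] q_gt_2 by simp
    thus "card (UNIV - {0::'a}) \<le> card (insert ?t (?r ` ?D))" by (simp add: card_Diff_singleton)
  qed simp
  hence "\<Prod>(insert ?t (?r ` ?D)) = -1" using wilson[where 'a='a] by simp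
  moreover have "\<Prod>(insert ?t (?r ` ?D)) = ?t * \<Prod>(?r ` ?D)" using notin by (intro prod.insert) auto
  moreover have "\<Prod>(?r ` ?D) = (\<Prod>X\<in>?D. ?r X)" using prod.reindex[OF inj] by simp
  ultimately show ?thesis by (simp add: mult.commute)
qed

text \<open>The three cyclic instances of \<open>segre_product\<close> are multiplied. The
  coordinate ratios \<open>b / c\<close>, \<open>c / a\<close> and \<open>a / b\<close> cancel, and
  so do the three minus signs on either side.\<close>

lemma segre:
  assumes S: "P \<in> S" "Q \<in> S" "R \<in> S" "P \<noteq> Q" "P \<noteq> R" "Q \<noteq> R"
  shows "\<tau> P (rep Q) * \<tau> Q (rep R) * \<tau> R (rep P) = \<tau> P (rep R) * \<tau> R (rep Q) * \<tau> Q (rep P)"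
proof -
  define E where "E = vec.span {rep P, rep Q, rep R}"
  have nP: "rep P \<noteq> 0" "rep Q \<noteq> 0" "rep R \<noteq> 0" using rep S_point S by blast+
  have "rep Q \<notin> vec.span {rep R}"
  proof
    assume "rep Q \<in> vec.span {rep R}"
    hence "rep Q \<in> R" using rep[OF S_point[OF S(3)]] by blast
    hence "R = pt (rep Q)" using pg_point_eqI[OF S_point[OF S(3)] _ nP(2)] by blast
    thus False using rep[OF S_point[OF S(2)]] S by simp
  qed
  moreover have "rep P \<notin> vec.span {rep Q, rep R}" using not_collinear[of Q R P] S by auto
  ultimately have "vec.dim E = 3" unfolding E_def using nP by (simp add: vec.dim_insert)
  hence E: "E \<in> pg_planes" by (simp add: pg_planes_def E_def)
  have inE: "P \<subseteq> E" "Q \<subseteq> E" "R \<subseteq> E"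
    using rep_subset_iff[OF S_point pg_plane_subspace(1)[OF E]] S unfolding E_def by (auto simp: vec.span_base)
  let ?D = "on S E - {P, Q, R}"
  have "\<forall>X\<in>?D. \<exists>t. rep X = fst t *s rep P + (fst (snd t) *s rep Q + snd (snd t) *s rep R)"
  proof
    fix X assume X: "X \<in> ?D"
    hence "rep X \<in> E" using rep_subset_iff[OF S_point pg_plane_subspace(1)[OF E]] by (auto simp: mem_on)
    then obtain a b c where "rep X - a *s rep P - b *s rep Q - c *s rep R = 0"
      unfolding E_def vec.span_breakdown_eq by auto
    hence "rep X = a *s rep P + (b *s rep Q + c *s rep R)" by (simp add: algebra_simps)
    thus "\<exists>t. rep X = fst t *s rep P + (fst (snd t) *s rep Q + snd (snd t) *s rep R)" by (intro exI[of _ "(a, b, c)"]) simp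
  qed
  from bchoice[OF this] obtain t where t: "\<And>X. X \<in> ?D \<Longrightarrow> rep X = fst (t X) *s rep P + (fst (snd (t X)) *s rep Q + snd (snd (t X)) *s rep R)" by blast
  define a where "a X = fst (t X)" for X
  define b where "b X = fst (snd (t X))" for X
  define c where "c X = snd (snd (t X))" for X
  have co: "rep X = a X *s rep P + (b X *s rep Q + c X *s rep R)" if "X \<in> ?D" for X
    using t[OF that] by (simp add: a_def b_def c_def)
  have nz: "a X \<noteq> 0" "b X \<noteq> 0" "c X \<noteq> 0" if X: "X \<in> ?D" for X
  proof -
    have XS: "X \<in> S" "X \<noteq> P" "X \<noteq> Q" "X \<noteq> R" using X by (auto simp: mem_on)
    have "x *s u + y *s v \<in> vec.span {u, v}" for x y and u v :: "'a ^ 4"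
      by (intro vec.span_add vec.span_scale vec.span_base) auto
    note sp = this
    show "a X \<noteq> 0" using co[OF X] sp[of "b X" "rep Q" "c X" "rep R"] not_collinear[of Q R X] S XS by auto
    show "b X \<noteq> 0" using co[OF X] sp[of "a X" "rep P" "c X" "rep R"] not_collinear[of P R X] S XS by auto
    show "c X \<noteq> 0" using co[OF X] sp[of "a X" "rep P" "b X" "rep Q"] not_collinear[of P Q X] S XS by auto
  qed
  have 1: "(\<Prod>X\<in>?D. b X / c X) * (- \<tau> P (rep R) / \<tau> P (rep Q)) = -1"
    by (rule segre_product[OF S E inE]) (use co nz in blast)
  have D2: "on S E - {Q, R, P} = ?D" "on S E - {R, P, Q} = ?D" by auto
  have 2: "(\<Prod>X\<in>on S E - {Q, R, P}. c X / a X) * (- \<tau> Q (rep P) / \<tau> Q (rep R)) = -1"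
    by (rule segre_product[of Q R P, where a = b]) (use S E inE co nz in \<open>simp_all add: D2 add_ac\<close>)
  have 3: "(\<Prod>X\<in>on S E - {R, P, Q}. a X / b X) * (- \<tau> R (rep Q) / \<tau> R (rep P)) = -1"
    by (rule segre_product[of R P Q, where a = c]) (use S E inE co nz in \<open>simp_all add: D2 add_ac\<close>)
  have "(\<Prod>X\<in>?D. b X / c X) * (\<Prod>X\<in>?D. c X / a X) * (\<Prod>X\<in>?D. a X / b X) = (\<Prod>X\<in>?D. 1)"
    unfolding prod.distrib[symmetric] by (rule prod.cong) (use nz in auto)
  hence pr: "(\<Prod>X\<in>?D. b X / c X) * (\<Prod>X\<in>?D. c X / a X) * (\<Prod>X\<in>?D. a X / b X) = 1" by simp
  define x where "x = (\<Prod>X\<in>?D. b X / c X)"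
  define y where "y = (\<Prod>X\<in>?D. c X / a X)"
  define z where "z = (\<Prod>X\<in>?D. a X / b X)"
  have "(x * (- \<tau> P (rep R) / \<tau> P (rep Q))) * (y * (- \<tau> Q (rep P) / \<tau> Q (rep R))) * (z * (- \<tau> R (rep Q) / \<tau> R (rep P))) = -1"
    using 1 2 3 unfolding D2 x_def[symmetric] y_def[symmetric] z_def[symmetric] by simp
  hence "(x * y * z) * ((\<tau> P (rep R) / \<tau> P (rep Q)) * (\<tau> Q (rep P) / \<tau> Q (rep R)) * (\<tau> R (rep Q) / \<tau> R (rep P))) = 1"
    by (simp add: algebra_simps)
  hence "(\<tau> P (rep R) / \<tau> P (rep Q)) * (\<tau> Q (rep P) / \<tau> Q (rep R)) * (\<tau> R (rep Q) / \<tau> R (rep P)) = 1"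
    using pr unfolding x_def[symmetric] y_def[symmetric] z_def[symmetric] by simp
  moreover have "\<tau> P (rep Q) \<noteq> 0" "\<tau> Q (rep R) \<noteq> 0" "\<tau> R (rep P) \<noteq> 0" using \<tau>_zero_iff S by auto
  ultimately show ?thesis by (simp add: field_simps)
qed

end

lemma two_pointsE:
  fixes S :: "('a::{field,finite} ^ 'n) set set"
  assumes "2 \<le> card (on S X)"
  obtains P R where "P \<in> S" "P \<subseteq> X" "R \<in> S" "R \<subseteq> X" "P \<noteq> R"
proof -
  obtain C where C: "C \<subseteq> on S X" "card C = 2" using assms by (meson obtain_subset_with_card_n)
  then obtain P R where "C = {P, R}" "P \<noteq> R" by (auto simp: card_2_iff)
  hence "P \<in> on S X" "R \<in> on S X" "P \<noteq> R" using C(1) by simp_all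
  thus ?thesis using that unfolding mem_on by blast
qed

context ovoid_space begin

text \<open>A proper subspace lies in a plane, and a plane has at most \<open>q + 2\<close> points
  of the ovoid, fewer than \<open>q\<^sup>2 + 1\<close>.\<close>

lemma span_S: "vec.span (rep ` S) = UNIV"
proof (rule ccontr)
  let ?V = "vec.span (rep ` S)"
  assume "?V \<noteq> UNIV"
  hence ne: "\<not> UNIV \<subseteq> ?V" by blast
  have d: "vec.dim ?V < 4"
    using Int_dim_less[of UNIV ?V] ne unfolding dim_UNIV4 by simp
  have two: "card S \<ge> 2" using card_S q_gt_2 by (simp add: power2_eq_square)
  obtain P where P: "P \<in> S" using two by fastforce
  have inV: "X \<subseteq> ?V" if "X \<in> S" for X
    using rep_subset_iff[OF S_point[OF that], of ?V] that by (simp add: vec.span_base)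
  have "\<exists>E\<in>pg_planes. ?V \<subseteq> E"
  proof -
    interpret d: bilinear_form "dot :: 'a ^ 4 \<Rightarrow> 'a ^ 4 \<Rightarrow> 'a" by (rule bilinear_dot)
    obtain Bs where Bs: "Bs \<subseteq> ?V" "vec.independent Bs" "?V \<subseteq> vec.span Bs" "card Bs = vec.dim ?V"
      using vec.basis_exists by blast
    have "\<exists>x y z. Bs \<subseteq> {x, y, z}"
    proof -
      have "card Bs \<le> 3" using Bs(4) d by simp
      then obtain C where C: "Bs \<subseteq> C" "card C = 3"
      proof -
        have "3 \<le> card (UNIV :: ('a ^ 4) set)"
        proof -
          have "CARD('a) ^ 1 \<le> CARD('a) ^ 4" using q_gt_2 by (intro power_increasing) auto
          thus ?thesis using card_subspace[of "UNIV :: ('a ^ 4) set"] q_gt_2 unfolding dim_UNIV4 by simp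
        qed
        thus ?thesis using that exists_subset_between[of Bs 3 UNIV] \<open>card Bs \<le> 3\<close> by auto
      qed
      thus ?thesis by (auto simp: card_3_iff)
    qed
    then obtain x y z where xyz: "Bs \<subseteq> {x, y, z}" by blast
    obtain N where N: "N \<noteq> 0" "dot N x = 0" "dot N y = 0" "dot N z = 0"
      using ex_common_zero[of "\<lambda>N. dot N x" "\<lambda>N. dot N y" "\<lambda>N. dot N z"] by (auto simp: dot_diff)
    have "vec.span Bs \<subseteq> d.perp N" by (rule vec.span_minimal) (use xyz N d.perp_subspace in \<open>auto simp: d.perp_def\<close>)
    thus ?thesis using d.perp_plane[OF N(1)] Bs(3) by blast
  qed
  then obtain E where E: "E \<in> pg_planes" "?V \<subseteq> E" by blast
  hence "on S E = S" using inV by (auto simp: on_def)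
  hence "card S \<le> CARD('a) + 2" using card_plane_le[OF E(1)] by simp
  moreover have "2 * CARD('a) < CARD('a)\<^sup>2" using q_gt_2 by (simp add: power2_eq_square)
  ultimately show False using card_S q_gt_2 by linarith
qed

text \<open>The tangent functionals are rescaled so that \<open>T P (rep R)\<close> becomes
  symmetric in \<open>P\<close> and \<open>R\<close>; Segre's lemma for \<open>P0\<close>,
  \<open>P\<close>, \<open>R\<close> is exactly the condition for this. On a basis taken from the
  vectors \<open>rep P\<close>, the symmetric values extend to a bilinear form with
  \<open>B (rep P) = T P\<close>.\<close>

lemma ex_form:
  obtains B where "bilinear_form B" "\<And>P R. P \<in> S \<Longrightarrow> R \<in> S \<Longrightarrow> B (rep P) (rep R) = 0 \<longleftrightarrow> P = R"
proof -
  have "S \<noteq> {}" using card_S by auto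
  then obtain P0 where P0: "P0 \<in> S" by blast
  \<comment> \<open>Forced by symmetry for the pairs containing \<open>P0\<close>.\<close>
  define \<sigma> where "\<sigma> P = (if P = P0 then 1 else \<tau> P0 (rep P) / \<tau> P (rep P0))" for P
  define T where "T P v = \<sigma> P * \<tau> P v" for P v
  have T_lin: "T P (x + y) = T P x + T P y" "T P (c *s x) = c * T P x" for P c x y
    by (simp_all add: T_def \<tau>_linear algebra_simps)
  have \<sigma>: "\<sigma> P \<noteq> 0" if "P \<in> S" for P using \<tau>_zero_iff that P0 by (auto simp: \<sigma>_def)
  have T_zero: "T P (rep R) = 0 \<longleftrightarrow> P = R" if "P \<in> S" "R \<in> S" for P R
    using \<sigma>[OF that(1)] \<tau>_zero_iff[OF that] by (simp add: T_def)
  have T_sym: "T P (rep R) = T R (rep P)" if P: "P \<in> S" and R: "R \<in> S" for P R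
  proof -
    consider "P = R" | "P = P0" "R \<noteq> P0" | "R = P0" "P \<noteq> P0" | "P \<noteq> R" "P \<noteq> P0" "R \<noteq> P0" by blast
    thus ?thesis
    proof cases
      case 2
      thus ?thesis using \<tau>_zero_iff[OF R P0] by (simp add: T_def \<sigma>_def)
    next
      case 3
      thus ?thesis using \<tau>_zero_iff[OF P P0] by (simp add: T_def \<sigma>_def)
    next
      case 4
      have nz: "\<tau> P (rep P0) \<noteq> 0" "\<tau> R (rep P0) \<noteq> 0" using \<tau>_zero_iff P R P0 4 by auto
      have "\<tau> P0 (rep P) * \<tau> P (rep R) * \<tau> R (rep P0) = \<tau> P0 (rep R) * \<tau> R (rep P) * \<tau> P (rep P0)"
        using segre[OF P0 P R] 4 by auto
      thus ?thesis using 4 nz by (simp add: T_def \<sigma>_def field_simps)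
    qed simp
  qed
  obtain Bs where Bs: "Bs \<subseteq> rep ` S" "vec.independent Bs" "rep ` S \<subseteq> vec.span Bs"
    using vec.basis_exists by blast
  have sp: "v \<in> vec.span Bs" for v
  proof -
    have "vec.span (rep ` S) \<subseteq> vec.span Bs" using Bs(3) by (rule vec.span_minimal) simp
    thus ?thesis unfolding span_S by blast
  qed
  define r where "r = vec.representation Bs"
  have r_sum: "(\<Sum>b\<in>Bs. r v b *s b) = v" for v
    unfolding r_def by (rule vec.sum_representation_eq) (use Bs sp in auto)
  have T_sum: "T P v = (\<Sum>b\<in>Bs. r v b * T P b)" for P v
  proof -
    have T0: "T P 0 = 0" using T_lin(2)[of P 0 0] by simp
    have "T P (\<Sum>b\<in>A. r v b *s b) = (\<Sum>b\<in>A. r v b * T P b)" for A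
      by (induction A rule: infinite_finite_induct) (simp_all add: T0 T_lin)
    from this[of Bs] show ?thesis unfolding r_sum .
  qed
  define B where "B v x = (\<Sum>b\<in>Bs. r x b * T (pt b) v)" for v x
  have pt_b: "pt b \<in> S" "rep (pt b) = b" if b: "b \<in> Bs" for b
  proof -
    obtain P where P: "P \<in> S" "b = rep P" using Bs(1) b by blast
    have "pt b = P" unfolding P(2) using rep[OF S_point[OF P(1)]] by simp
    thus "pt b \<in> S" "rep (pt b) = b" using P by simp_all
  qed
  have B_rep: "B (rep P) x = T P x" if P: "P \<in> S" for P x
  proof -
    have "T (pt b) (rep P) = T P b" if "b \<in> Bs" for b using T_sym[OF pt_b(1)[OF that] P] pt_b(2)[OF that] by simp
    hence "B (rep P) x = (\<Sum>b\<in>Bs. r x b * T P b)" unfolding B_def by (intro sum.cong refl) simp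
    thus ?thesis unfolding T_sum[of P x, symmetric] .
  qed
  have B_eq: "B v x = (\<Sum>b\<in>Bs. \<Sum>b'\<in>Bs. r x b * r v b' * T (pt b) b')" for v x
    unfolding B_def T_sum[of _ v] sum_distrib_left by (simp add: mult.assoc)
  have B_sym: "B v x = B x v" for v x
  proof -
    have "B v x = (\<Sum>b'\<in>Bs. \<Sum>b\<in>Bs. r x b * r v b' * T (pt b) b')" unfolding B_eq by (rule sum.swap)
    also have "\<dots> = (\<Sum>b'\<in>Bs. \<Sum>b\<in>Bs. r v b' * r x b * T (pt b') b)"
    proof (intro sum.cong refl)
      fix b b' assume b: "b \<in> Bs" "b' \<in> Bs"
      hence "T (pt b) b' = T (pt b') b" using T_sym[OF pt_b(1)[OF b(1)] pt_b(1)[OF b(2)]] pt_b by simp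
      thus "r x b * r v b' * T (pt b) b' = r v b' * r x b * T (pt b') b" by simp
    qed
    finally show ?thesis unfolding B_eq[of x v] .
  qed
  have B_lin: "B (x + y) z = B x z + B y z" "B (c *s x) z = c * B x z" for x y z c
    by (simp_all add: B_def T_lin sum.distrib sum_distrib_left algebra_simps)
  \<comment> \<open>A vector \<open>v\<close> of the radical lies in all tangent planes, so no line
    through it contains two points of the ovoid. There are more than \<open>q\<^sup>2 + 1\<close>
    lines through \<open>v\<close>, hence one of them, \<open>g\<close>, is external. A plane
    through \<open>g\<close> has only \<open>q\<close> other lines through \<open>v\<close>, thus
    fewer than \<open>q + 1\<close> points and therefore at most one, which is too few in
    total.\<close>
  have nondeg: "\<exists>z. B v z \<noteq> 0" if v: "v \<noteq> 0" for v
  proof (rule ccontr)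
    assume "\<not> ?thesis"
    hence z: "B v x = 0" for x by blast
    have Tv: "T P v = 0" if "P \<in> S" for P using B_rep[OF that, of v] z B_sym by metis
    let ?V = "pt v"
    have V: "?V \<in> pg_points" using v by (rule pt_in_pg_points)
    have VS: "?V \<notin> S"
    proof
      assume a: "?V \<in> S"
      have "rep ?V \<in> ?V" using rep[OF V] by (metis self_in_pt)
      then obtain c where c: "rep ?V = c *s v" unfolding pt_def by blast
      have "card S \<noteq> card {?V}" using card_S q_gt_2 by simp
      hence "S \<noteq> {?V}" by auto
      then obtain P where P: "P \<in> S" "P \<noteq> ?V" using a by blast
      hence "T P (rep ?V) \<noteq> 0" using T_zero[OF P(1) a] by simp
      thus False unfolding c T_lin using Tv[OF P(1)] by simp
    qed
    have one: "card (on S L) \<le> 1" if L: "L \<in> pg_lines" "?V \<subseteq> L" for L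
    proof (rule ccontr)
      assume "\<not> ?thesis"
      hence "2 \<le> card (on S L)" by simp
      then obtain P R where PR: "P \<in> S" "P \<subseteq> L" "R \<in> S" "R \<subseteq> L" "P \<noteq> R" by (rule two_pointsE)
      have "L \<subseteq> {x. T P x = 0}"
      proof (rule line_subset[OF V S_point[OF PR(1)] _ L(1,2) PR(2)])
        show "?V \<noteq> P" using VS PR by auto
        show sub: "vec.subspace {x. T P x = 0}"
          using T_lin(2)[of P 0 0] by (auto simp: vec.subspace_def T_lin)
        show "?V \<subseteq> {x. T P x = 0}" using Tv[OF PR(1)] by (simp add: pt_subset_iff[OF sub])
        show "P \<subseteq> {x. T P x = 0}" using T_zero[OF PR(1) PR(1)] by (simp add: rep_subset_iff[OF S_point[OF PR(1)] sub])
      qed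
      moreover have "rep R \<in> R" using rep[OF S_point[OF PR(3)]] by (metis self_in_pt)
      ultimately have "T P (rep R) = 0" using PR(4) by blast
      thus False using T_zero[OF PR(1,3)] PR(5) by simp
    qed
    have "\<exists>g\<in>covers ?V UNIV. card (on S g) = 0"
    proof (rule ccontr)
      assume a: "\<not> ?thesis"
      have "card (on S g) = 1" if "g \<in> covers ?V UNIV" for g
      proof -
        have "\<forall>g\<in>covers ?V UNIV. card (on S g) \<noteq> 0" using a by simp
        hence "card (on S g) \<noteq> 0" using that by simp
        moreover have "card (on S g) \<le> 1" using one[of g] that V by (simp add: mem_lines_iff)
        ultimately show ?thesis by linarith
      qed
      hence "card (on S UNIV) = CARD('a)\<^sup>2 + CARD('a) + 1"
        using sum_lines_out[OF V VS, of UNIV] card_lines_space[OF V] by simp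
      thus False using card_S q_gt_2 by (simp add: on_def)
    qed
    then obtain g where g: "g \<in> pg_lines" "?V \<subseteq> g" "card (on S g) = 0" using V by (auto simp: mem_lines_iff)
    have "card (on S G) \<le> 1" if G: "G \<in> covers g UNIV" for G
    proof (rule ccontr)
      have G': "G \<in> pg_planes" "g \<subseteq> G" using G g by (auto simp: mem_planes_iff)
      assume "\<not> ?thesis"
      hence full: "card (on S G) = CARD('a) + 1" using plane_card[OF G'(1)] by simp
      have VG: "?V \<subseteq> G" using g G' by blast
      have gc: "g \<in> covers ?V G" using g G' V by (simp add: mem_lines_iff)
      have "card (on S G) = (\<Sum>L\<in>covers ?V G. card (on S L))"
        using sum_lines_out[OF V VS VG] G' by (simp add: pg_plane_subspace)
      also have "\<dots> = (\<Sum>L\<in>covers ?V G - {g}. card (on S L))"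
        using gc g(3) by (subst sum.remove[of _ g]) auto
      also have "\<dots> \<le> (\<Sum>L\<in>covers ?V G - {g}. 1)"
        by (rule sum_mono) (use one V in \<open>auto simp: mem_lines_iff\<close>)
      also have "\<dots> = CARD('a)" using gc card_lines_plane[OF V G'(1) VG] by simp
      finally show False using full by simp
    qed
    hence "(\<Sum>G\<in>covers g UNIV. card (on S G)) \<le> (\<Sum>G\<in>covers g UNIV. 1)" by (rule sum_mono)
    hence "CARD('a)\<^sup>2 + 1 \<le> CARD('a) + 1" using sum_planes[OF g(1)] g(3) card_planes_line[OF g(1)] by simp
    thus False using q_gt_2 by (simp add: power2_eq_square)
  qed
  have "bilinear_form B" by (rule bilinear_form.intro) (use B_lin B_sym nondeg in blast)+
  moreover have "B (rep P) (rep R) = 0 \<longleftrightarrow> P = R" if "P \<in> S" "R \<in> S" for P R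
    unfolding B_rep[OF that(1)] by (rule T_zero[OF that])
  ultimately show ?thesis using that by blast
qed

end

lemma even_field_add_self:
  assumes "(2::'a::field) = 0" shows "x + x = (0::'a)"
  using assms by (metis mult_2 mult_zero_left)

lemma mem_oval_sections:
  fixes S :: "('a::{field,finite} ^ 4) set set"
  assumes "arc S"
  shows "C \<in> oval_sections S \<longleftrightarrow> (\<exists>E\<in>pg_planes. C = on S E \<and> card (on S E) = CARD('a) + 1)"
proof -
  interpret arc S by (rule assms)
  have s: "section_by S E = on S E" for E by (auto simp: section_by_def on_def)
  have "oval_plane S E \<longleftrightarrow> E \<in> pg_planes \<and> card (on S E) = CARD('a) + 1" for E
  proof -
    have sub: "on S E \<subseteq> S" unfolding on_def by (rule Collect_subset)
    have "no_three_on_a_line (on S E)"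
      using no_three subsetD[OF sub] unfolding no_three_on_a_line_def by meson
    moreover have "\<forall>P\<in>on S E. P \<subseteq> E" by (intro ballI) (simp only: mem_on)
    moreover have "on S E \<subseteq> pg_points" using sub points by (rule subset_trans)
    ultimately show ?thesis unfolding oval_plane_def oval_in_def s by iprover
  qed
  thus ?thesis unfolding oval_sections_def s by blast
qed

section \<open>The Moebius plane of an ovoid and its poles\<close>

context ovoid_space begin

lemma ovoid_circle_geometry:
  "circle_geometry S (oval_sections S) (\<lambda>_ _. False) (CARD('a)) 0"
proof
  have a: "arc S" by unfold_locales
  note os = mem_oval_sections[OF a]
  show "finite S" by simp
  show "C \<subseteq> S" if "C \<in> oval_sections S" for C using that unfolding os by (auto simp: on_def)
  show "card C = CARD('a) + 1" if "C \<in> oval_sections S" for C using that unfolding os by auto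
  show "CARD('a) \<ge> 3" using q_gt_2 by simp
  fix P Q R assume PQR: "P \<in> S" "Q \<in> S" "R \<in> S" "P \<noteq> Q" "P \<noteq> R" "Q \<noteq> R"
  obtain L where L: "L \<in> pg_lines" "P \<subseteq> L" "Q \<subseteq> L" using joinE[OF S_point S_point] PQR by metis
  have RL: "\<not> R \<subseteq> L" using no_threeD[of P Q R L] PQR L by blast
  obtain E where E: "E \<in> pg_planes" "L \<subseteq> E" "R \<subseteq> E" using join_plane[OF L(1) S_point[OF PQR(3)] RL] by blast
  have in_E: "P \<in> on S E" "Q \<in> on S E" "R \<in> on S E" using PQR L E by (auto simp: mem_on)
  have "card {P, Q} \<le> card (on S E)" using in_E by (intro card_mono) auto
  hence "card (on S E) \<ge> 2" using PQR by simp
  hence "on S E \<in> oval_sections S" unfolding os using plane_card[OF E(1)] E(1) by blast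
  moreover have "C = on S E" if C: "C \<in> oval_sections S" "P \<in> C" "Q \<in> C" "R \<in> C" for C
  proof -
    obtain E' where E': "E' \<in> pg_planes" "C = on S E'" using C(1) unfolding os by blast
    have "P \<subseteq> E'" "Q \<subseteq> E'" "R \<subseteq> E'" using C E' by (auto simp: mem_on)
    moreover from this have "L \<subseteq> E'"
      using line_subset[OF S_point[OF PQR(1)] S_point[OF PQR(2)] PQR(4) L] E' by (simp add: pg_plane_subspace)
    ultimately show ?thesis using plane_eqI[OF L(1) S_point[OF PQR(3)] RL E] E' by blast
  qed
  ultimately show "\<exists>!C. C \<in> oval_sections S \<and> P \<in> C \<and> Q \<in> C \<and> R \<in> C" using in_E by blast
next
  fix P assume P: "P \<in> S"
  have "{R\<in>S. R \<noteq> P \<and> \<not> False} = S - {P}" by blast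
  thus "card {R\<in>S. R \<noteq> P \<and> \<not> False} = CARD('a)\<^sup>2" using P card_S by simp
  fix Q assume Q: "Q \<in> S" "P \<noteq> Q"
  have "{R\<in>S. R \<noteq> P \<and> R \<noteq> Q \<and> \<not> False \<and> \<not> False} = S - {P} - {Q}" by blast
  moreover have "card (S - {P} - {Q}) = CARD('a)\<^sup>2 - 1" using P Q card_S by simp
  moreover have "CARD('a)\<^sup>2 - 1 = (CARD('a) - 1) * (CARD('a) + 1 - 0)" by (simp add: power2_eq_square algebra_simps)
  ultimately show "card {R\<in>S. R \<noteq> P \<and> R \<noteq> Q \<and> \<not> False \<and> \<not> False} = (CARD('a) - 1) * (CARD('a) + 1 - 0)" by simp
qed (use card_S in \<open>simp_all add: mult.commute\<close>)

lemma in_span_two: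
  assumes P: "P \<in> S" and R: "R \<in> S" and ne: "P \<noteq> R" and L: "L \<in> pg_lines" "P \<subseteq> L" "R \<subseteq> L" "x \<in> L"
    and x: "x \<noteq> 0" "pt x \<notin> S"
  obtains a b where "a \<noteq> 0" "b \<noteq> 0" "x = a *s rep P + b *s rep R"
proof -
  obtain a b where ab: "x = a *s rep P + b *s rep R"
    by (rule in_line_span[OF S_point[OF P] S_point[OF R] ne L])
  have no: "x \<noteq> c *s rep X" if X: "X \<in> S" for c X
  proof
    assume e: "x = c *s rep X"
    have X': "rep X \<noteq> 0" "X = pt (rep X)" using rep[OF S_point[OF X]] by auto
    have "pt (rep X) = pt x" using pt_eq_iff[OF X'(1) x(1)] e by blast
    thus False using X X'(2) x(2) by simp
  qed
  have "a \<noteq> 0" using ab no[OF R, of b] by auto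
  moreover have "b \<noteq> 0" using ab no[OF P, of a] by auto
  ultimately show ?thesis using that ab by blast
qed

text \<open>The pole of a circle is a vector perpendicular to its plane. The delicate condition is
  \<open>gram\<close>: a vanishing Gram determinant has to produce a point of the ovoid in the span
  of the two poles and perpendicular to both. Any common point of the circles is then perpendicular
  to it, hence equal to it.\<close>

lemma ovoid_polar:
  "\<exists>(B :: 'a ^ 4 \<Rightarrow> 'a ^ 4 \<Rightarrow> 'a) (w :: ('a ^ 4) set \<Rightarrow> 'a ^ 4) pole.
     polar_circle_geometry S (oval_sections S) (\<lambda>_ _. False) (CARD('a)) 0 B w pole"
proof -
  have a: "arc S" by unfold_locales
  note os = mem_oval_sections[OF a]
  obtain B where B: "bilinear_form B" "\<And>P R. P \<in> S \<Longrightarrow> R \<in> S \<Longrightarrow> B (rep P) (rep R) = 0 \<longleftrightarrow> P = R"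
    by (rule ex_form) blast
  interpret f: bilinear_form B by (rule B(1))
  interpret g: circle_geometry S "oval_sections S" "\<lambda>_ _. False" "CARD('a)" 0 by (rule ovoid_circle_geometry)
  have sub_perp: "P \<subseteq> f.perp N \<longleftrightarrow> B N (rep P) = 0" if "P \<in> S" for P N
    using rep_subset_iff[OF S_point[OF that] f.perp_subspace] by (simp add: f.perp_def)
  have rep0: "rep P \<noteq> 0" if "P \<in> S" for P using rep[OF S_point[OF that]] by blast
  have tp: "on S (f.perp (rep P)) = {P}" if P: "P \<in> S" for P
    using sub_perp B(2)[OF P] P by (auto simp: on_def)
  define pole where "pole C = (SOME N. N \<noteq> 0 \<and> C = on S (f.perp N))" for C
  have pole: "pole C \<noteq> 0" "C = on S (f.perp (pole C))" if C: "C \<in> oval_sections S" for C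
  proof -
    obtain E where E: "E \<in> pg_planes" "C = on S E" using C unfolding os by blast
    obtain N where "N \<noteq> 0" "E = f.perp N" by (rule f.plane_perp[OF E(1)])
    hence "\<exists>N. N \<noteq> 0 \<and> C = on S (f.perp N)" using E by blast
    from someI_ex[OF this] show "pole C \<noteq> 0" "C = on S (f.perp (pole C))" unfolding pole_def by auto
  qed
  have circ_perp: "f.perp N \<in> pg_planes" if "N \<noteq> 0" for N using f.perp_plane[OF that] .
  have inc: "P \<in> C \<longleftrightarrow> B (pole C) (rep P) = 0" if C: "C \<in> oval_sections S" and P: "P \<in> S" for P C
    using arg_cong[OF pole(2)[OF C], of "\<lambda>X. P \<in> X"] sub_perp[OF P, of "pole C"] P unfolding mem_on by argo
  have cC: "card (on S (f.perp (pole C))) = CARD('a) + 1" if C: "C \<in> oval_sections S" for C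
    using g.card_circ[OF C] arg_cong[OF pole(2)[OF C], of card] by linarith
  have not_w: "pole C \<noteq> t *s rep P" if C: "C \<in> oval_sections S" and P: "P \<in> S" for C P t
  proof
    assume e: "pole C = t *s rep P"
    hence "t \<noteq> 0" using pole(1)[OF C] by auto
    hence "f.perp (pole C) = f.perp (rep P)" unfolding e by (auto simp: f.perp_def f.B_simps)
    hence "card (on S (f.perp (pole C))) = 1" using tp[OF P] by simp
    thus False using cC[OF C] by simp
  qed
  \<comment> \<open>Different planes share only a line, and a line contains at most two points of
    the ovoid, so a circle determines its plane.\<close>
  have pole_unique: "\<exists>s. s \<noteq> 0 \<and> v = s *s pole (on S (f.perp v))"
    if v: "v \<noteq> 0" and full: "card (on S (f.perp v)) = CARD('a) + 1" for v
  proof -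
    define D where "D = on S (f.perp v)"
    have D: "D \<in> oval_sections S" unfolding os D_def using circ_perp[OF v] full by blast
    have eq: "on S (f.perp v) = on S (f.perp (pole D))" unfolding D_def by (rule pole(2)[OF D, unfolded D_def])
    have "f.perp v = f.perp (pole D)"
    proof (rule ccontr)
      assume ne: "f.perp v \<noteq> f.perp (pole D)"
      have I: "f.perp v \<inter> f.perp (pole D) \<in> pg_lines"
        using planes_Int[OF circ_perp[OF v] circ_perp[OF pole(1)[OF D]] ne] .
      have "on S (f.perp v \<inter> f.perp (pole D)) = on S (f.perp v)" using eq by (auto simp: on_def)
      thus False using card_line_le[OF I] full q_gt_2 by simp
    qed
    then obtain s where s: "v = s *s pole D" using f.perp_eqD[OF pole(1)[OF D]] by metis
    hence "s \<noteq> 0" using v by auto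
    thus ?thesis using s unfolding D_def by blast
  qed
  \<comment> \<open>In characteristic two the cross terms \<open>B y z + B z y\<close> cancel, so
    \<open>B x x\<close> is additive in \<open>x\<close> and vanishes because it does so on the
    spanning vectors \<open>rep P\<close>.\<close>
  have even_zero: "B x x = 0" if two: "(2::'a) = 0" for x
  proof -
    obtain Bs where Bs: "Bs \<subseteq> rep ` S" "vec.independent Bs" "rep ` S \<subseteq> vec.span Bs"
      using vec.basis_exists by blast
    have "vec.span (rep ` S) \<subseteq> vec.span Bs" using Bs(3) by (rule vec.span_minimal) simp
    hence "x \<in> vec.span (rep ` S)" unfolding span_S by blast
    thus ?thesis
    proof (induction rule: vec.span_induct_alt)
      case base thus ?case by (simp add: f.B_simps)
    next
      case (step c y z)
      then obtain P where P: "P \<in> S" "y = rep P" by blast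
      have "B (c *s y + z) (c *s y + z) = c * c * B y y + (c * B y z + c * B y z) + B z z"
        using f.sym[of z y] by (simp add: f.B_simps algebra_simps)
      thus ?case using step(2) B(2)[OF P(1) P(1)] P(2) even_field_add_self[OF two] by simp
    qed
  qed
  \<comment> \<open>An isotropic vector \<open>x\<close> off the ovoid cannot be on a secant
    \<open>P R\<close>, since with \<open>x = a *s rep P + b *s rep R\<close> its norm is
    \<open>2 * a * b * B (rep P) (rep R)\<close>. A point of an oval plane off the oval on no secant
    requires even \<open>q\<close>. Thus poles are not isotropic, and isotropic points of oval
    planes belong to the ovoid.\<close>
  have no_odd: False if two: "(2::'a) \<noteq> 0" and N: "N \<noteq> 0" "card (on S (f.perp N)) = CARD('a) + 1"
    and x: "x \<noteq> 0" "pt x \<notin> S" "B N x = 0" "B x x = 0" for N x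
  proof -
    have E: "f.perp N \<in> pg_planes" using circ_perp[OF N(1)] .
    have "even (CARD('a))"
    proof (rule no_external_arc_point[OF a E N(2) pt_in_pg_points[OF x(1)] x(2)])
      show "pt x \<subseteq> f.perp N" unfolding pt_subset_iff[OF f.perp_subspace] using x(3) by (simp add: f.perp_def)
      fix L assume L: "L \<in> pg_lines" "pt x \<subseteq> L" "L \<subseteq> f.perp N"
      show "card (on S L) \<le> 1"
      proof (rule ccontr)
        assume "\<not> ?thesis"
        hence "2 \<le> card (on S L)" by simp
        then obtain P R where PR: "P \<in> S" "P \<subseteq> L" "R \<in> S" "R \<subseteq> L" "P \<noteq> R" by (rule two_pointsE)
        have xL: "x \<in> L" using L(2) self_in_pt by blast
        obtain a b where ab: "a \<noteq> 0" "b \<noteq> 0" "x = a *s rep P + b *s rep R"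
          by (rule in_span_two[OF PR(1,3,5) L(1) PR(2,4) xL x(1,2)])
        have "B x x = 2 * (a * b * B (rep P) (rep R))"
        proof -
          have z: "B (rep P) (rep P) = 0" "B (rep R) (rep R) = 0" using B(2) PR(1,3) by blast+
          have "B x x = a * a * B (rep P) (rep P) + (a * b * B (rep P) (rep R) + a * b * B (rep R) (rep P)) + b * b * B (rep R) (rep R)"
            unfolding ab(3) by (simp add: f.B_simps algebra_simps)
          thus ?thesis unfolding z f.sym[of "rep R" "rep P"] by simp
        qed
        hence "B (rep P) (rep R) = 0" using x(4) two ab by simp
        thus False using B(2)[OF PR(1,3)] PR(5) by simp
      qed
    qed
    thus False using odd_card_field[OF two] by simp
  qed
  have pole_notin: "pt (pole C) \<notin> S" if C: "C \<in> oval_sections S" for C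
  proof
    assume P: "pt (pole C) \<in> S"
    have "pole C \<in> pt (rep (pt (pole C)))" using rep[OF S_point[OF P]] by (metis self_in_pt)
    then obtain t where "pole C = t *s rep (pt (pole C))" unfolding pt_def by blast
    thus False using not_w[OF C P] by blast
  qed
  have gram: "g.tan C D" if C: "C \<in> oval_sections S" and D: "D \<in> oval_sections S" and ne: "C \<noteq> D"
    and gr: "B (pole C) (pole D) * B (pole C) (pole D) = B (pole C) (pole C) * B (pole D) (pole D)" for C D
  proof -
    define N where "N = pole C"
    define M where "M = pole D"
    have N0: "N \<noteq> 0" "M \<noteq> 0" using pole(1) C D by (simp_all add: N_def M_def)
    have np: "M \<noteq> s *s N" for s
    proof
      assume e: "M = s *s N"
      hence "s \<noteq> 0" using N0 by auto
      hence "f.perp M = f.perp N" unfolding e by (auto simp: f.perp_def f.B_simps)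
      moreover have "C = on S (f.perp N)" "D = on S (f.perp M)" unfolding N_def M_def using pole(2) C D by blast+
      ultimately show False using ne by simp
    qed
    have "\<exists>P x y. P \<in> S \<and> rep P = x *s N + y *s M \<and> B N (rep P) = 0 \<and> B M (rep P) = 0"
    proof (cases "(2::'a) = 0")
      case False
      have k0: "B N N \<noteq> 0"
        using no_odd[OF False N0(1) _ N0(1)] cC[OF C] pole_notin[OF C] by (auto simp: N_def)
      \<comment> \<open>The component of \<open>M\<close> perpendicular to \<open>N\<close>. Its
        norm is the Gram determinant divided by \<open>B N N\<close>, hence zero.\<close>
      define W where "W = M - (B N M / B N N) *s N"
      have W0: "W \<noteq> 0" using np by (auto simp: W_def)
      have NW: "B N W = 0" using k0 by (simp add: W_def f.B_simps)
      have gr': "B N M * B N M = B N N * B M M" using gr by (simp add: N_def M_def)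
      have MW: "B M W = 0" unfolding W_def f.B_simps f.sym[of M N] using k0 gr' by (simp add: field_simps)
      have "B W W = B M W - (B N M / B N N) * B N W"
        by (subst (1) W_def) (simp only: f.B_simps)
      hence WW: "B W W = 0" using NW MW by simp
      have "pt W \<in> S"
      proof (rule ccontr)
        assume "pt W \<notin> S"
        thus False using no_odd[OF False N0(1) _ W0 _ NW WW] cC[OF C] by (simp add: N_def)
      qed
      moreover have "rep (pt W) \<in> pt W" using rep[OF pt_in_pg_points[OF W0]] by (metis self_in_pt)
      then obtain c where c: "rep (pt W) = c *s W" unfolding pt_def by blast
      have "rep (pt W) = (- c * (B N M / B N N)) *s N + c *s M"
        unfolding c by (simp add: W_def vec_eq_iff algebra_simps)
      moreover have "B N (rep (pt W)) = 0" "B M (rep (pt W)) = 0" unfolding c using NW MW by (simp_all add: f.B_simps)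
      ultimately show ?thesis by blast
    next
      case True
      have NN: "B N N = 0" "B M M = 0" using even_zero[OF True] by blast+
      have NM: "B N M = 0" using gr NN by (simp add: N_def M_def)
      have E: "f.perp N \<in> pg_planes" using circ_perp[OF N0(1)] .
      have mE: "card (on S (f.perp N)) = CARD('a) + 1" using cC[OF C] by (simp add: N_def)
      have ptN: "pt N \<in> pg_points" "pt N \<notin> S" using pt_in_pg_points[OF N0(1)] pole_notin[OF C] by (simp_all add: N_def)
      have NE: "pt N \<subseteq> f.perp N" unfolding pt_subset_iff[OF f.perp_subspace] using NN by (simp add: f.perp_def)
      \<comment> \<open>In characteristic two \<open>N\<close> lies in its own plane and on no
        secant there. So each of the \<open>q + 1\<close> lines through it, in particular the one
        through \<open>M\<close>, contains exactly one point of the circle.\<close>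
      have le: "card (on S L) \<le> 1" if L: "L \<in> covers (pt N) (f.perp N)" for L
      proof (rule ccontr)
        have L': "L \<in> pg_lines" "pt N \<subseteq> L" "L \<subseteq> f.perp N" using L ptN by (auto simp: mem_lines_iff)
        assume "\<not> ?thesis"
        hence "2 \<le> card (on S L)" by simp
        then obtain P R where PR: "P \<in> S" "P \<subseteq> L" "R \<in> S" "R \<subseteq> L" "P \<noteq> R" by (rule two_pointsE)
        have NL: "N \<in> L" using L'(2) self_in_pt by blast
        obtain a b where ab: "a \<noteq> 0" "b \<noteq> 0" "N = a *s rep P + b *s rep R"
          by (rule in_span_two[OF PR(1,3,5) L'(1) PR(2,4) NL N0(1) ptN(2)])
        have "P \<subseteq> f.perp N" using PR L' by blast
        hence "B N (rep P) = 0" using sub_perp[OF PR(1)] by simp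
        hence "a * B (rep P) (rep P) + b * B (rep R) (rep P) = 0" by (subst (asm) ab(3)) (simp only: f.B_simps)
        thus False using B(2)[OF PR(1,1)] B(2)[OF PR(3,1)] PR(5) ab by simp
      qed
      define L where "L = vec.span {N, M}"
      have "N \<notin> vec.span {M}"
      proof
        assume "N \<in> vec.span {M}"
        then obtain c where c: "N = c *s M" unfolding pt_def by blast
        hence "c \<noteq> 0" using N0 by auto
        hence "M = inverse c *s N" unfolding c by (simp add: vector_smult_assoc)
        thus False using np by blast
      qed
      hence "vec.dim L = 2" unfolding L_def using N0 by (simp add: vec.dim_insert)
      hence L: "L \<in> pg_lines" by (simp add: pg_lines_def L_def)
      have "L \<subseteq> f.perp N" unfolding L_def
        by (rule vec.span_minimal) (use NN NM f.perp_subspace in \<open>auto simp: f.perp_def\<close>)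
      moreover have "pt N \<subseteq> L" unfolding L_def by (rule vec.span_mono) simp
      ultimately have Lc: "L \<in> covers (pt N) (f.perp N)" using L ptN by (simp add: mem_lines_iff)
      have "CARD('a) + 1 = (\<Sum>L\<in>covers (pt N) (f.perp N). card (on S L))"
        using sum_lines_out[OF ptN NE f.perp_subspace] mE by simp
      also have "\<dots> = card (on S L) + (\<Sum>L\<in>covers (pt N) (f.perp N) - {L}. card (on S L))"
        using Lc by (intro sum.remove) auto
      also have "\<dots> \<le> card (on S L) + (\<Sum>L\<in>covers (pt N) (f.perp N) - {L}. 1)"
        by (intro add_left_mono sum_mono) (use le in auto)
      also have "\<dots> = card (on S L) + CARD('a)" using Lc card_lines_plane[OF ptN(1) E NE] by simp
      finally have "card (on S L) \<noteq> 0" by linarith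
      hence "on S L \<noteq> {}" by auto
      then obtain P where P: "P \<in> S" "P \<subseteq> L" by (auto simp: mem_on)
      have "rep P \<in> L" using rep_subset_iff[OF S_point[OF P(1)], of L] P(2) by (simp add: L_def)
      then obtain x y where "rep P - x *s N - y *s M = 0" unfolding L_def vec.span_breakdown_eq by auto
      hence xy: "rep P = x *s N + y *s M" by (simp add: algebra_simps)
      have "B N (rep P) = 0" "B M (rep P) = 0" unfolding xy using NN NM f.sym[of M N] by (simp_all add: f.B_simps)
      thus ?thesis using P(1) xy by blast
    qed
    then obtain P x y where P: "P \<in> S" "rep P = x *s N + y *s M" "B N (rep P) = 0" "B M (rep P) = 0" by blast
    have PC: "P \<in> C" "P \<in> D" using inc[OF C P(1)] inc[OF D P(1)] P by (simp_all add: N_def M_def)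
    have "R = P" if R: "R \<in> C" "R \<in> D" for R
    proof -
      have RS: "R \<in> S" using R(1) C g.circ_sub by blast
      have "B N (rep R) = 0" "B M (rep R) = 0" using inc[OF C RS] inc[OF D RS] R by (simp_all add: N_def M_def)
      hence "B (rep P) (rep R) = 0" unfolding P(2) by (simp add: f.B_simps)
      thus ?thesis using B(2)[OF P(1) RS] by simp
    qed
    hence "C \<inter> D = {P}" using PC by blast
    thus ?thesis using g.tanI[OF C D] by blast
  qed
  have "polar_circle_geometry S (oval_sections S) (\<lambda>_ _. False) (CARD('a)) 0 B rep pole"
  proof
    show "CARD('a) = CARD('a)" ..
    show "B (x + y) z = B x z + B y z" "B (c *s x) z = c * B x z" "B x z = B z x" for x y z c
      by (simp_all only: f.add_left f.scale_left f.sym[of x z])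
    show "P \<in> C \<longleftrightarrow> B (pole C) (rep P) = 0" if "C \<in> oval_sections S" "P \<in> S" for C P using inc that by blast
    show "B (rep P) (rep P) = 0" if "P \<in> S" for P using B(2) that by blast
    show "B (rep P) (rep R) \<noteq> 0" if "C \<in> oval_sections S" "P \<in> C" "R \<in> C" "P \<noteq> R" for C P R
      using B(2)[of P R] that g.circ_sub by blast
    show "pole C \<noteq> t *s rep P" if "C \<in> oval_sections S" "P \<in> C" for C P t using not_w[of C P] that g.circ_sub by blast
    show "\<exists>D\<in>oval_sections S. \<exists>s. s \<noteq> 0 \<and> pole C + c *s rep P = s *s pole D" if C: "C \<in> oval_sections S" and P: "P \<in> C" for C P c
    proof -
      define v where "v = pole C + c *s rep P"
      have PS: "P \<in> S" using P C g.circ_sub by blast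
      have nw: "v \<noteq> t *s rep P" for t
      proof
        assume "v = t *s rep P"
        hence "pole C = (t - c) *s rep P" by (simp add: v_def vec_eq_iff algebra_simps)
        thus False using not_w[OF C PS] by blast
      qed
      have v0: "v \<noteq> 0" using nw[of 0] by simp
      have "B v (rep P) = 0" using inc[OF C PS] P B(2)[OF PS PS] by (simp add: v_def f.B_simps)
      hence Pv: "P \<in> on S (f.perp v)" using PS sub_perp[OF PS] by (simp add: mem_on)
      \<comment> \<open>The only plane that meets the ovoid just in \<open>P\<close> is the
        perpendicular of \<open>rep P\<close>.\<close>
      have "card (on S (f.perp v)) \<noteq> 1"
      proof
        assume "card (on S (f.perp v)) = 1"
        hence "on S (f.perp v) = {P}" using Pv by (auto simp: card_1_singleton_iff)
        hence "f.perp v = f.perp (rep P)" using ex1_tangent_plane[OF PS] circ_perp[OF v0] circ_perp[OF rep0[OF PS]] tp[OF PS] by blast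
        hence "\<exists>s. v = s *s rep P" using f.perp_eqD[OF rep0[OF PS], of v] by simp
        thus False using nw by blast
      qed
      moreover have "card (on S (f.perp v)) \<noteq> 0" using Pv by auto
      ultimately have "card (on S (f.perp v)) = CARD('a) + 1" using plane_card[OF circ_perp[OF v0]] by linarith
      moreover from this have "on S (f.perp v) \<in> oval_sections S" unfolding os using circ_perp[OF v0] by blast
      ultimately show ?thesis using pole_unique[OF v0] unfolding v_def[symmetric] by blast
    qed
    show "g.tan C D" if "C \<in> oval_sections S" "D \<in> oval_sections S" "C \<noteq> D"
      "B (pole C) (pole D) * B (pole C) (pole D) = B (pole C) (pole C) * B (pole D) (pole D)" for C D
      using gram that by blast
    show "(\<forall>C\<in>oval_sections S. B (pole C) (pole C) = 0) \<or> ((\<forall>C\<in>oval_sections S. B (pole C) (pole C) \<noteq> 0) \<and> (2::'a) \<noteq> 0)"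
    proof (cases "(2::'a) = 0")
      case False
      have "B (pole C) (pole C) \<noteq> 0" if C: "C \<in> oval_sections S" for C
        using no_odd[OF False pole(1)[OF C] cC[OF C] pole(1)[OF C] pole_notin[OF C]] by blast
      thus ?thesis using False by blast
    qed (use even_zero in blast)
  qed
  thus ?thesis by blast
qed

end

lemma largest_ge:
  assumes F: "largest_intersecting_family G F" and P: "P \<in> fst G"
  shows "card (circles_through G P) \<le> card F"
proof -
  have "intersecting_family G (circles_through G P)"
    unfolding intersecting_family_def circles_through_def by blast
  thus ?thesis using F by (simp add: largest_intersecting_family_def)
qed

theorem ovoidal_moebius_largest:
  fixes G :: "('a::{field,finite} ^ 4) set incidence_structure"
  assumes G: "ovoidal_moebius_plane G" and q: "CARD('a) > 3" and F: "largest_intersecting_family G F"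
  shows "\<exists>P\<in>fst G. F = circles_through G P"
proof -
  obtain Q where Q: "ovoid Q" "G = (Q, oval_sections Q)" using G by (auto simp: ovoidal_moebius_plane_def)
  interpret ovoid_space Q
    by unfold_locales (use Q(1) q in \<open>auto simp: ovoid_def\<close>)
  obtain B :: "'a ^ 4 \<Rightarrow> 'a ^ 4 \<Rightarrow> 'a" and w :: "('a ^ 4) set \<Rightarrow> 'a ^ 4" and pole where "polar_circle_geometry Q (oval_sections Q) (\<lambda>_ _. False) (CARD('a)) 0 B w pole"
    using ovoid_polar by blast
  then interpret p: polar_circle_geometry Q "oval_sections Q" "\<lambda>_ _. False" "CARD('a)" 0 B w pole .
  have FS: "F \<subseteq> oval_sections Q" and int: "\<And>C D. C \<in> F \<Longrightarrow> D \<in> F \<Longrightarrow> C \<inter> D \<noteq> {}"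
    using F Q(2) by (auto simp: largest_intersecting_family_def intersecting_family_def)
  have "Q \<noteq> {}" using card_S by auto
  then obtain P where P: "P \<in> Q" by blast
  have "card F \<ge> CARD('a) * (CARD('a) + 1 - 0)"
    using largest_ge[OF F, of P] P p.card_through[OF P] Q(2) by (simp add: circles_through_def)
  \<comment> \<open>A nonzero \<open>eps\<close> occurs only in odd characteristic, which rules out
    \<open>q = 4\<close>.\<close>
  moreover have "CARD('a) \<ge> 5" if "C \<in> oval_sections Q" "p.eps C \<noteq> 0" for C
  proof -
    have "(2::'a) \<noteq> 0" using p.norms that by (auto simp: p.eps_def quad_char_def)
    hence "odd (CARD('a))" by (rule odd_card_field)
    hence "CARD('a) \<noteq> 4" by auto
    thus ?thesis using q by linarith
  qed
  ultimately have "\<exists>P\<in>Q. F = {C\<in>oval_sections Q. P \<in> C}"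
    using p.moebius_intersecting_family[OF refl _ FS int] q by auto
  thus ?thesis using Q(2) by (simp add: circles_through_def)
qed

section \<open>Planes of matrices\<close>

text \<open>A \<open>2 \<times> 2\<close> matrix \<open>M\<close> is stored as the vector \<open>(m\<^sub>1\<^sub>1, m\<^sub>1\<^sub>2, m\<^sub>2\<^sub>1, m\<^sub>2\<^sub>2)\<close>. The rank one matrix
  \<open>ten t u\<close> is chosen such that \<open>M\<close> maps \<open>u\<close> to a multiple of \<open>t\<close> iff \<open>M\<close> and \<open>ten t u\<close> are orthogonal
  for the polar form of the determinant (see \<open>det_form_ten\<close>).\<close>

definition cross2 :: "'a::field ^ 2 \<Rightarrow> 'a ^ 2 \<Rightarrow> 'a" where
  "cross2 a b = a $ 1 * b $ 2 - a $ 2 * b $ 1"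

definition det4 :: "'a::field ^ 4 \<Rightarrow> 'a" where
  "det4 v = v $ 1 * v $ 4 - v $ 2 * v $ 3"

definition det_form :: "'a::field ^ 4 \<Rightarrow> 'a ^ 4 \<Rightarrow> 'a" where
  "det_form v w = v $ 1 * w $ 4 + v $ 4 * w $ 1 - v $ 2 * w $ 3 - v $ 3 * w $ 2"

definition app :: "'a::field ^ 4 \<Rightarrow> 'a ^ 2 \<Rightarrow> 'a ^ 2" where
  "app v a = vector [v $ 1 * a $ 1 + v $ 2 * a $ 2, v $ 3 * a $ 1 + v $ 4 * a $ 2]"

definition adj4 :: "'a::field ^ 4 \<Rightarrow> 'a ^ 4" where
  "adj4 v = vector [v $ 4, - v $ 2, - v $ 3, v $ 1]"

definition ten :: "'a::field ^ 2 \<Rightarrow> 'a ^ 2 \<Rightarrow> 'a ^ 4" where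
  "ten a b = vector [a $ 1 * b $ 2, - a $ 1 * b $ 1, a $ 2 * b $ 2, - a $ 2 * b $ 1]"

lemma vector_4:
  "(vector [a, b, c, d] :: 'a::zero ^ 4) $ 1 = a" "(vector [a, b, c, d] :: 'a ^ 4) $ 2 = b"
  "(vector [a, b, c, d] :: 'a ^ 4) $ 3 = c" "(vector [a, b, c, d] :: 'a ^ 4) $ 4 = d"
  unfolding vector_def by simp_all

lemma app_nth [simp]:
  "app v a $ 1 = v $ 1 * a $ 1 + v $ 2 * a $ 2" "app v a $ 2 = v $ 3 * a $ 1 + v $ 4 * a $ 2"
  by (simp_all add: app_def vector_2)

lemma adj4_nth [simp]: "adj4 v $ 1 = v $ 4" "adj4 v $ 2 = - v $ 2" "adj4 v $ 3 = - v $ 3" "adj4 v $ 4 = v $ 1"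
  by (simp_all add: adj4_def vector_4)

lemma ten_nth [simp]:
  "ten a b $ 1 = a $ 1 * b $ 2" "ten a b $ 2 = - a $ 1 * b $ 1"
  "ten a b $ 3 = a $ 2 * b $ 2" "ten a b $ 4 = - a $ 2 * b $ 1"
  by (simp_all add: ten_def vector_4)

lemma vec2_eq_iff: "(a :: 'a ^ 2) = b \<longleftrightarrow> a $ 1 = b $ 1 \<and> a $ 2 = b $ 2"
  by (simp add: vec_eq_iff forall_2)

lemma vec4_eq_iff: "(a :: 'a ^ 4) = b \<longleftrightarrow> a $ 1 = b $ 1 \<and> a $ 2 = b $ 2 \<and> a $ 3 = b $ 3 \<and> a $ 4 = b $ 4"
  by (simp add: vec_eq_iff forall_4)

lemma det_form_add: "det_form (x + y) z = det_form x z + det_form y z"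
  by (simp add: det_form_def algebra_simps)

lemma det_form_scale: "det_form (c *s x) z = c * det_form x z"
  by (simp add: det_form_def algebra_simps)

lemma det_form_sym: "det_form x z = det_form z x"
  by (simp add: det_form_def algebra_simps)

lemma det_form_diff: "det_form (x - y) z = det_form x z - det_form y z"
  by (simp add: det_form_def algebra_simps)

lemma det_form_self: "det_form v v = 2 * det4 v"
  by (simp add: det_form_def det4_def algebra_simps)

lemma det_form_ten: "det_form v (ten a b) = cross2 a (app v b)"
  by (simp add: det_form_def cross2_def algebra_simps)

lemma det_form_ten_ten: "det_form (ten a b) (ten c d) = cross2 a c * cross2 b d"
  by (simp add: det_form_def cross2_def algebra_simps)

lemma cross2_app_adj: "cross2 a (app v b) = cross2 (app (adj4 v) a) b"
  by (simp add: cross2_def algebra_simps)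

lemma cross2_app: "cross2 (app v a) (app v b) = det4 v * cross2 a b"
  by (simp add: cross2_def det4_def algebra_simps)

lemma det4_adj: "det4 (adj4 v) = det4 v"
  by (simp add: det4_def algebra_simps)

lemma det4_ten: "det4 (ten a b) = 0"
  by (simp add: det4_def algebra_simps)

lemma det4_scale: "det4 (c *s v) = c * c * det4 v"
  by (simp add: det4_def algebra_simps)

lemma det4_add: "det4 (v + w) = det4 v + det_form v w + det4 w"
  by (simp add: det4_def det_form_def algebra_simps)

lemma cross2_sym: "cross2 a b = - cross2 b a"
  by (simp add: cross2_def algebra_simps)

lemma cross2_self [simp]: "cross2 a a = 0"
  by (simp add: cross2_def)

lemma cross2_scale [simp]: "cross2 (c *s a) b = c * cross2 a b" "cross2 a (c *s b) = c * cross2 a b"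
  by (simp_all add: cross2_def algebra_simps)

lemma cross2_eq_0D:
  assumes "cross2 a b = 0" "a \<noteq> 0" obtains c where "b = c *s a"
proof (cases "a $ 1 = 0")
  case True
  hence "a $ 2 \<noteq> 0" using assms(2) by (simp add: vec2_eq_iff)
  hence "b = (b $ 2 / a $ 2) *s a" using assms(1) True by (simp add: vec2_eq_iff cross2_def)
  thus ?thesis using that by blast
next
  case False
  hence "b = (b $ 1 / a $ 1) *s a" using assms(1) by (simp add: vec2_eq_iff cross2_def field_simps)
  thus ?thesis using that by blast
qed

lemma cross2_trans:
  assumes "cross2 a b = 0" "cross2 c b = 0" "b \<noteq> 0" shows "cross2 a c = 0"
proof -
  have z: "cross2 b a = 0" "cross2 b c = 0" using assms cross2_sym[of b] by simp_all
  obtain r s where "a = r *s b" "c = s *s b" using cross2_eq_0D[OF z(1) assms(3)] cross2_eq_0D[OF z(2) assms(3)] by metis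
  thus ?thesis by simp
qed

lemma app_nonzero:
  assumes "det4 v \<noteq> 0" "a \<noteq> 0" shows "app v a \<noteq> 0"
proof
  assume "app v a = 0"
  hence "cross2 (app v a) (app v b) = 0" for b by (simp add: cross2_def)
  hence z: "cross2 a b = 0" for b using assms(1) unfolding cross2_app by simp
  show False using z[of "axis 1 1"] z[of "axis 2 1"] assms(2) by (simp add: cross2_def axis_def vec2_eq_iff)
qed

lemma det4_eq_0D:
  assumes "det4 v = 0" obtains a b where "v = ten a b"
proof (cases "v $ 1 = 0 \<and> v $ 2 = 0")
  case True
  have "v = ten (vector [0, 1]) (vector [- v $ 4, v $ 3])" using True by (simp add: vec4_eq_iff vector_2)
  thus ?thesis using that by blast
next
  case False
  have e: "v $ 1 * v $ 4 = v $ 2 * v $ 3" using assms by (simp add: det4_def)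
  define k where "k = (if v $ 1 = 0 then v $ 4 / v $ 2 else v $ 3 / v $ 1)"
  have "v = ten (vector [1, k]) (vector [- v $ 2, v $ 1])"
    using False e by (auto simp: vec4_eq_iff vector_2 k_def field_simps)
  thus ?thesis using that by blast
qed

lemma square_char_two:
  assumes "(2::'a::{field,finite}) = 0" shows "\<exists>y::'a. y * y = a"
proof -
  have "inj (\<lambda>y::'a. y * y)"
  proof (rule injI)
    fix y z :: 'a assume "y * y = z * z"
    hence "y \<in> {z, - z}" using sqrt_set[of z] by blast
    moreover have "- z = z" using even_field_add_self[OF assms, of z] by (simp add: neg_eq_iff_add_eq_0)
    ultimately show "y = z" by auto
  qed
  hence "surj (\<lambda>y::'a. y * y)" by (simp add: finite_UNIV_inj_surj)
  thus ?thesis by (metis surjD)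
qed

text \<open>Two systems of vectors, each representing all points of the projective line. They are
  separate parameters so that a field automorphism can be applied to only one of them.\<close>

locale ruled =
  fixes I :: "'i set" and J :: "'j set" and u :: "'i \<Rightarrow> 'a::{field,finite} ^ 2" and t :: "'j \<Rightarrow> 'a ^ 2"
  assumes q3: "CARD('a) \<ge> 3"
    and card_I: "card I = CARD('a) + 1" and card_J: "card J = CARD('a) + 1"
    and u_cross: "x \<in> I \<Longrightarrow> x' \<in> I \<Longrightarrow> cross2 (u x) (u x') = 0 \<longleftrightarrow> x = x'"
    and t_cross: "y \<in> J \<Longrightarrow> y' \<in> J \<Longrightarrow> cross2 (t y) (t y') = 0 \<longleftrightarrow> y = y'"

lemma representative_nonzero:
  assumes "card I > 1" and u: "\<And>x x'. x \<in> I \<Longrightarrow> x' \<in> I \<Longrightarrow> cross2 (u x) (u x') = 0 \<longleftrightarrow> x = x'"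
    and x: "x \<in> I"
  shows "u x \<noteq> 0"
proof
  assume "u x = 0"
  hence "x' = x" if "x' \<in> I" for x' using u[OF x that] by (simp add: cross2_def)
  hence "I = {x}" using x by blast
  thus False using assms(1) by simp
qed

text \<open>The vectors \<open>u x\<close> span \<open>q + 1\<close> different points, and the
  projective line has no more.\<close>

lemma ex1_representative:
  fixes u :: "'i \<Rightarrow> 'a::{field,finite} ^ 2"
  assumes c: "card I = CARD('a) + 1" and u: "\<And>x x'. x \<in> I \<Longrightarrow> x' \<in> I \<Longrightarrow> cross2 (u x) (u x') = 0 \<longleftrightarrow> x = x'"
    and a: "a \<noteq> 0"
  shows "\<exists>!x. x \<in> I \<and> cross2 (u x) a = 0"
proof -
  have u0: "u x \<noteq> 0" if "x \<in> I" for x using representative_nonzero[OF _ u that] c by simp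
  have inj: "inj_on (\<lambda>x. pt (u x)) I"
  proof (rule inj_onI)
    fix x x' assume x: "x \<in> I" "x' \<in> I" and "pt (u x) = pt (u x')"
    then obtain c where "u x' = c *s u x" using pt_eq_iff[OF u0 u0] by blast
    thus "x = x'" using u[OF x] by simp
  qed
  have L: "(UNIV :: ('a ^ 2) set) \<in> pg_lines" by (simp add: pg_lines_def vec.dim_UNIV card_cart_basis)
  have "card (pg_points :: ('a ^ 2) set set) = CARD('a) + 1" using card_on_line[OF L] by (simp add: on_def)
  hence e: "card ((\<lambda>x. pt (u x)) ` I) = card (pg_points :: ('a ^ 2) set set)" unfolding card_image[OF inj] c by simp
  have s: "(\<lambda>x. pt (u x)) ` I \<subseteq> pg_points" by (rule image_subsetI) (rule pt_in_pg_points[OF u0])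
  have "(\<lambda>x. pt (u x)) ` I = pg_points" by (rule card_subset_eq[OF finite s e])
  hence "pt a \<in> (\<lambda>x. pt (u x)) ` I" using pt_in_pg_points[OF a] by argo
  then obtain x where x: "pt a = pt (u x)" "x \<in> I" by (rule imageE)
  have "\<exists>c. a = c *s u x" using pt_eq_iff[OF u0[OF x(2)] a] x(1) by argo
  then obtain c where "a = c *s u x" by (rule exE)
  hence "cross2 (u x) a = 0" by simp
  moreover have "x' = x" if "x' \<in> I" "cross2 (u x') a = 0" for x'
    using u[OF that(1) x(2)] cross2_trans[OF that(2) \<open>cross2 (u x) a = 0\<close> a] by simp
  ultimately show ?thesis using x(2) by blast
qed

section \<open>Circles as graphs of projectivities\<close>

context ruled begin

definition w :: "'i \<times> 'j \<Rightarrow> 'a ^ 4" where "w P = ten (t (snd P)) (u (fst P))"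

text \<open>By \<open>det_form_ten\<close> these are the pairs \<open>(x, y)\<close> for which the
  matrix \<open>v\<close> maps \<open>u x\<close> to a multiple of \<open>t y\<close>; for
  nonsingular \<open>v\<close> this is the graph of a projectivity.\<close>

definition gr :: "'a ^ 4 \<Rightarrow> ('i \<times> 'j) set" where "gr v = {P\<in>I \<times> J. det_form v (w P) = 0}"

definition circs :: "('i \<times> 'j) set set" where "circs = gr ` {v. det4 v \<noteq> 0}"

abbreviation par :: "'i \<times> 'j \<Rightarrow> 'i \<times> 'j \<Rightarrow> bool" where "par P R \<equiv> fst P = fst R \<or> snd P = snd R"

lemma finite_IJ: "finite I" "finite J" using card_I card_J by (auto intro: card_ge_0_finite)

lemma t_nonzero: "y \<in> J \<Longrightarrow> t y \<noteq> 0"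
  using representative_nonzero[of J t y] t_cross card_J q3 by simp

lemma u_nonzero: "x \<in> I \<Longrightarrow> u x \<noteq> 0"
  using representative_nonzero[of I u x] u_cross card_I q3 by simp

lemma gr_row:
  assumes "det4 v \<noteq> 0" "x \<in> I" shows "\<exists>!y. (x, y) \<in> gr v"
  using ex1_representative[OF card_J t_cross app_nonzero[OF assms(1) u_nonzero[OF assms(2)]]] assms(2)
  by (simp add: gr_def w_def det_form_ten)

lemma gr_col:
  assumes "det4 v \<noteq> 0" "y \<in> J" shows "\<exists>!x. (x, y) \<in> gr v"
proof -
  have n: "app (adj4 v) (t y) \<noteq> 0" by (rule app_nonzero) (use assms t_nonzero in \<open>simp_all add: det4_adj\<close>)
  have "\<exists>!x. x \<in> I \<and> cross2 (u x) (app (adj4 v) (t y)) = 0"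
    by (rule ex1_representative[OF card_I u_cross n])
  moreover have "(x, y) \<in> gr v \<longleftrightarrow> x \<in> I \<and> cross2 (u x) (app (adj4 v) (t y)) = 0" for x
    using assms(2) cross2_app_adj[of "t y" v "u x"] cross2_sym[of "u x" "app (adj4 v) (t y)"]
    by (auto simp only: gr_def w_def det_form_ten neg_equal_0_iff_equal mem_Collect_eq mem_Times_iff fst_conv snd_conv)
  ultimately show ?thesis by simp
qed

lemma circ_row: "C \<in> circs \<Longrightarrow> x \<in> I \<Longrightarrow> \<exists>!y. (x, y) \<in> C"
  unfolding circs_def using gr_row by blast

lemma circ_col: "C \<in> circs \<Longrightarrow> y \<in> J \<Longrightarrow> \<exists>!x. (x, y) \<in> C"
  unfolding circs_def using gr_col by blast

lemma circ_subset: "C \<in> circs \<Longrightarrow> C \<subseteq> I \<times> J"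
  by (auto simp: circs_def gr_def)

lemma circ_not_par:
  assumes C: "C \<in> circs" "P \<in> C" "R \<in> C" "P \<noteq> R" shows "\<not> par P R"
proof -
  have m: "fst P \<in> I" "snd P \<in> J" using circ_subset[OF C(1)] C(2) by auto
  have "(fst P, snd P) \<in> C" "(fst R, snd R) \<in> C" using C by simp_all
  thus ?thesis using circ_row[OF C(1) m(1)] circ_col[OF C(1) m(2)] C(4) by (metis prod_eqI)
qed

lemma card_circ:
  assumes C: "C \<in> circs" shows "card C = CARD('a) + 1"
proof -
  have "inj_on fst C" using circ_not_par[OF C] by (auto simp: inj_on_def)
  moreover have "fst ` C = I"
  proof
    show "fst ` C \<subseteq> I" using circ_subset[OF C] by auto
    show "I \<subseteq> fst ` C"
    proof
      fix x assume "x \<in> I"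
      then obtain y where "(x, y) \<in> C" using circ_row[OF C] by blast
      thus "x \<in> fst ` C" by (metis fst_conv image_eqI)
    qed
  qed
  ultimately show ?thesis using card_I card_image by metis
qed

text \<open>A nonzero singular matrix is \<open>ten a b\<close>, and it is perpendicular to
  \<open>w P\<close> only if \<open>fst P\<close> or \<open>snd P\<close> has one fixed value. Among
  three pairwise nonparallel points at most two satisfy this.\<close>

lemma nonsingular:
  assumes v: "v \<noteq> 0" and P: "P \<in> I \<times> J" "Q \<in> I \<times> J" "R \<in> I \<times> J"
    and np: "\<not> par P Q" "\<not> par P R" "\<not> par Q R"
    and z: "det_form v (w P) = 0" "det_form v (w Q) = 0" "det_form v (w R) = 0"
  shows "det4 v \<noteq> 0"
proof
  assume "det4 v = 0"
  then obtain a b where ab: "v = ten a b" by (rule det4_eq_0D)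
  have a0: "a \<noteq> 0" "b \<noteq> 0" using v unfolding ab by (auto simp: vec4_eq_iff)
  have d: "cross2 (t (snd X)) a = 0 \<or> cross2 (u (fst X)) b = 0" if "det_form v (w X) = 0" for X
    using that cross2_sym[of a] cross2_sym[of b] unfolding ab w_def det_form_ten_ten by auto
  have T: "\<not> (cross2 (t (snd X)) a = 0 \<and> cross2 (t (snd Y)) a = 0)"
    if "X \<in> I \<times> J" "Y \<in> I \<times> J" "\<not> par X Y" for X Y
    using cross2_trans[OF _ _ a0(1)] t_cross[of "snd X" "snd Y"] that by auto
  have U: "\<not> (cross2 (u (fst X)) b = 0 \<and> cross2 (u (fst Y)) b = 0)"
    if "X \<in> I \<times> J" "Y \<in> I \<times> J" "\<not> par X Y" for X Y
    using cross2_trans[OF _ _ a0(2)] u_cross[of "fst X" "fst Y"] that by auto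
  show False
    using T[OF P(1,2) np(1)] T[OF P(1,3) np(2)] T[OF P(2,3) np(3)]
      U[OF P(1,2) np(1)] U[OF P(1,3) np(2)] U[OF P(2,3) np(3)] d[OF z(1)] d[OF z(2)] d[OF z(3)] by argo
qed

text \<open>The combination \<open>v' - s *s v\<close> is chosen to vanish also at the point
  \<open>S\<close>, which has the first coordinate in common with \<open>P\<close>. If it were
  nonzero, it would be nonsingular, and its graph would contain two points with the same first
  coordinate.\<close>

lemma proportional:
  assumes d: "det4 v \<noteq> 0" and P: "P \<in> I \<times> J" "Q \<in> I \<times> J" "R \<in> I \<times> J"
    and np: "\<not> par P Q" "\<not> par P R" "\<not> par Q R"
    and z: "det_form v (w P) = 0" "det_form v (w Q) = 0" "det_form v (w R) = 0"
    and z': "det_form v' (w P) = 0" "det_form v' (w Q) = 0" "det_form v' (w R) = 0"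
  shows "\<exists>s. v' = s *s v"
proof -
  define S where "S = (fst P, snd Q)"
  have S: "S \<in> I \<times> J" using P by (auto simp: S_def)
  have row: "det_form x (w S) \<noteq> 0" if x: "det4 x \<noteq> 0" "det_form x (w P) = 0" for x
  proof
    assume "det_form x (w S) = 0"
    hence "(fst P, snd Q) \<in> gr x" "(fst P, snd P) \<in> gr x" using S x(2) P(1) by (auto simp: gr_def S_def)
    hence "snd P = snd Q" using gr_row[OF x(1), of "fst P"] P(1) by auto
    thus False using np(1) by blast
  qed
  define s where "s = det_form v' (w S) / det_form v (w S)"
  have "v' - s *s v = 0"
  proof (rule ccontr)
    assume n: "v' - s *s v \<noteq> 0"
    have "det4 (v' - s *s v) \<noteq> 0"
      by (rule nonsingular[OF n P np]) (simp_all add: det_form_diff det_form_scale z z')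
    from row[OF this] show False
      using row[OF d z(1)] by (simp add: det_form_diff det_form_scale z z' s_def)
  qed
  thus ?thesis by auto
qed

lemma three_points:
  assumes C: "C \<in> circs"
  obtains P Q R where "P \<in> C" "Q \<in> C" "R \<in> C" "\<not> par P Q" "\<not> par P R" "\<not> par Q R"
proof -
  have "3 \<le> card C" using card_circ[OF C] q3 by simp
  then obtain P Q R where "P \<in> C" "Q \<in> C" "R \<in> C" "P \<noteq> Q" "P \<noteq> R" "Q \<noteq> R" by (rule three_elementsE)
  thus ?thesis using that circ_not_par[OF C] by metis
qed

lemma gr_scale: "s \<noteq> 0 \<Longrightarrow> gr (s *s v) = gr v"
  by (simp add: gr_def det_form_scale)

lemma gr_eqD:
  assumes d: "det4 v \<noteq> 0" and e: "gr v' = gr v" and v': "v' \<noteq> 0"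
  obtains s where "s \<noteq> 0" "v' = s *s v"
proof -
  have "gr v \<in> circs" using d by (auto simp: circs_def)
  then obtain P Q R where P: "P \<in> gr v" "Q \<in> gr v" "R \<in> gr v" "\<not> par P Q" "\<not> par P R" "\<not> par Q R" by (rule three_points)
  have "\<exists>s. v' = s *s v"
  proof (rule proportional[OF d _ _ _ P(4-6)])
    show "P \<in> I \<times> J" "Q \<in> I \<times> J" "R \<in> I \<times> J" "det_form v (w P) = 0" "det_form v (w Q) = 0" "det_form v (w R) = 0"
      using P unfolding gr_def by blast+
    show "det_form v' (w P) = 0" "det_form v' (w Q) = 0" "det_form v' (w R) = 0"
      using P unfolding e[symmetric] unfolding gr_def by blast+
  qed
  thus ?thesis using v' that by (metis vector_smult_lzero)
qed

definition pole :: "('i \<times> 'j) set \<Rightarrow> 'a ^ 4" where "pole C = (SOME v. det4 v \<noteq> 0 \<and> C = gr v)"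

lemma pole: assumes "C \<in> circs" shows "det4 (pole C) \<noteq> 0" "C = gr (pole C)"
proof -
  have "\<exists>v. det4 v \<noteq> 0 \<and> C = gr v" using assms by (auto simp: circs_def)
  from someI_ex[OF this] show "det4 (pole C) \<noteq> 0" "C = gr (pole C)" unfolding pole_def by auto
qed

lemma pole_gr:
  assumes d: "det4 v \<noteq> 0"
  obtains s where "s \<noteq> 0" "v = s *s pole (gr v)"
proof -
  have C: "gr v \<in> circs" using d by (auto simp: circs_def)
  have "v \<noteq> 0" using d by (auto simp: det4_def)
  thus ?thesis using gr_eqD[OF pole(1)[OF C] pole(2)[OF C]] that by blast
qed

lemma circle_geometry_axioms: "circle_geometry (I \<times> J) circs par (CARD('a)) 2"
proof
  show "finite (I \<times> J)" using finite_IJ by simp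
  show "C \<subseteq> I \<times> J" if "C \<in> circs" for C using circ_subset that .
  show "card C = CARD('a) + 1" if "C \<in> circs" for C using card_circ that .
  show "CARD('a) \<ge> 3" by (rule q3)
  show "\<not> par P R" if "C \<in> circs" "P \<in> C" "R \<in> C" "P \<noteq> R" for C P R using circ_not_par that .
  fix P assume P: "P \<in> I \<times> J"
  have "{R\<in>I \<times> J. R \<noteq> P \<and> \<not> par P R} = (I - {fst P}) \<times> (J - {snd P})" by (rule set_eqI) auto
  moreover have "card (I - {fst P}) = CARD('a)" "card (J - {snd P}) = CARD('a)"
    using P card_I card_J finite_IJ by (simp_all add: mem_Times_iff)
  ultimately show "card {R\<in>I \<times> J. R \<noteq> P \<and> \<not> par P R} = CARD('a)\<^sup>2"
    by (simp add: card_cartesian_product power2_eq_square)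
  show "card {R\<in>C. par P R} = 2" if C: "C \<in> circs" and nP: "P \<notin> C" for C
  proof -
    have m: "fst P \<in> I" "snd P \<in> J" using P by (simp_all add: mem_Times_iff)
    obtain y where y: "(fst P, y) \<in> C" "\<And>y'. (fst P, y') \<in> C \<Longrightarrow> y' = y" using circ_row[OF C m(1)] by blast
    obtain x where x: "(x, snd P) \<in> C" "\<And>x'. (x', snd P) \<in> C \<Longrightarrow> x' = x" using circ_col[OF C m(2)] by blast
    have "{R\<in>C. par P R} = {(fst P, y), (x, snd P)}"
    proof (rule set_eqI)
      fix R
      have "R = (fst P, y) \<or> R = (x, snd P)" if "R \<in> C" "par P R"
        using y(2)[of "snd R"] x(2)[of "fst R"] that by (cases R) auto
      thus "R \<in> {R\<in>C. par P R} \<longleftrightarrow> R \<in> {(fst P, y), (x, snd P)}" using x(1) y(1) by auto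
    qed
    moreover have "(fst P, y) \<noteq> (x, snd P)" using x(1) nP by auto
    ultimately show ?thesis by simp
  qed
  fix Q assume Q: "Q \<in> I \<times> J" "P \<noteq> Q" "\<not> par P Q"
  have "{R\<in>I \<times> J. R \<noteq> P \<and> R \<noteq> Q \<and> \<not> par P R \<and> \<not> par Q R} = (I - {fst P} - {fst Q}) \<times> (J - {snd P} - {snd Q})" by (rule set_eqI) auto
  moreover have "fst Q \<noteq> fst P" "snd Q \<noteq> snd P" using Q(3) by auto
  hence "card (I - {fst P} - {fst Q}) = CARD('a) - 1" "card (J - {snd P} - {snd Q}) = CARD('a) - 1"
    using P Q(1,3) card_I card_J finite_IJ by (simp_all add: mem_Times_iff)
  ultimately show "card {R\<in>I \<times> J. R \<noteq> P \<and> R \<noteq> Q \<and> \<not> par P R \<and> \<not> par Q R} = (CARD('a) - 1) * (CARD('a) + 1 - 2)"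
    by (simp add: card_cartesian_product)
next
  fix P Q R assume P: "P \<in> I \<times> J" "Q \<in> I \<times> J" "R \<in> I \<times> J" and "P \<noteq> Q" "P \<noteq> R" "Q \<noteq> R"
    and np: "\<not> par P Q" "\<not> par P R" "\<not> par Q R"
  obtain v where v: "v \<noteq> 0" "det_form v (w P) = 0" "det_form v (w Q) = 0" "det_form v (w R) = 0"
    using ex_common_zero[of "\<lambda>v. det_form v (w P)" "\<lambda>v. det_form v (w Q)" "\<lambda>v. det_form v (w R)"]
    by (auto simp: det_form_diff)
  have d: "det4 v \<noteq> 0" by (rule nonsingular[OF v(1) P np v(2-4)])
  show "\<exists>!C. C \<in> circs \<and> P \<in> C \<and> Q \<in> C \<and> R \<in> C"
  proof (rule ex1I[of _ "gr v"])
    show "gr v \<in> circs \<and> P \<in> gr v \<and> Q \<in> gr v \<and> R \<in> gr v" using d v P by (auto simp: gr_def circs_def)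
    fix C assume "C \<in> circs \<and> P \<in> C \<and> Q \<in> C \<and> R \<in> C"
    then obtain v' where v': "det4 v' \<noteq> 0" "C = gr v'" "P \<in> gr v'" "Q \<in> gr v'" "R \<in> gr v'" by (auto simp: circs_def)
    obtain s where s: "v' = s *s v" using proportional[OF d P np v(2-4)] v'(3-5) by (auto simp: gr_def)
    hence "s \<noteq> 0" using v'(1) by (auto simp: det4_scale)
    thus "C = gr v" using v'(2) s gr_scale by simp
  qed
next
  have "((CARD('a) + 1) * (CARD('a) + 1)) * (CARD('a) + 1 - 2) = (CARD('a) + 1) * ((CARD('a))\<^sup>2 + 1 - 2)"
    using q3 by (cases "CARD('a)") (simp_all add: power2_eq_square algebra_simps)
  thus "card (I \<times> J) * (CARD('a) + 1 - 2) = (CARD('a) + 1) * ((CARD('a))\<^sup>2 + 1 - 2)"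
    unfolding card_cartesian_product card_I card_J .
qed auto

end

lemma quad_char_mult:
  fixes a b :: "'a::{field,finite}"
  assumes two: "(2::'a) \<noteq> 0"
  shows "quad_char (a * b) = quad_char a * quad_char b"
proof (cases "a = 0 \<or> b = 0")
  case False
  hence c: "real (card {y. y * y = a * b}) = 1 + quad_char a * quad_char b" using card_sqrt_mult[OF two] by blast
  have pm: "quad_char a * quad_char b = 1 \<or> quad_char a * quad_char b = -1"
    using False unfolding quad_char_def by (simp split: if_split)
  have ab: "a * b \<noteq> 0" using False by simp
  show ?thesis
  proof (cases "\<exists>y. y * y = a * b")
    case True
    hence "card {y. y * y = a * b} \<noteq> 0" by simp
    hence "quad_char a * quad_char b = 1" using c pm by auto
    thus ?thesis using True ab by (simp only: quad_char_def[of "a * b"] if_False if_True)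
  next
    case no: False
    hence "card {y. y * y = a * b} = 0" by simp
    hence "quad_char a * quad_char b = -1" using c pm by auto
    thus ?thesis using no ab by (simp only: quad_char_def[of "a * b"] if_False if_True)
  qed
qed (auto simp: quad_char_def)

lemma quad_char_square: "a \<noteq> 0 \<Longrightarrow> quad_char (a * a) = 1"
  by (auto simp: quad_char_def)

context ruled begin

text \<open>The determinant of \<open>M + x *s N\<close> is a quadratic polynomial in
  \<open>x\<close> whose discriminant is the Gram expression. Its double root gives a matrix
  \<open>V\<close> of rank one, and the point of \<open>V\<close> is the only common point of the
  two graphs.\<close>

lemma gr_tangent:
  assumes C: "C \<in> circs" and D: "D \<in> circs" and ne: "C \<noteq> D"
    and gr: "det_form (pole C) (pole D) * det_form (pole C) (pole D) = det_form (pole C) (pole C) * det_form (pole D) (pole D)"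
  shows "\<exists>P. C \<inter> D = {P}"
proof -
  define N where "N = pole C"
  define M where "M = pole D"
  have N: "det4 N \<noteq> 0" "C = gr N" and M: "det4 M \<noteq> 0" "D = gr M"
    using pole[OF C] pole[OF D] by (simp_all add: N_def M_def)
  have g: "det_form N M * det_form N M = 4 * (det4 N * det4 M)"
    using gr by (simp add: N_def M_def det_form_self)
  have "\<exists>x. det_form N M + 2 * x * det4 N = 0 \<and> det4 M = x * x * det4 N"
  proof (cases "(2::'a) = 0")
    \<comment> \<open>In characteristic two the linear coefficient vanishes, and a square root of
      \<open>det4 M / det4 N\<close> is the double root.\<close>
    case True
    obtain y where y: "y * y = det4 M / det4 N" using square_char_two[OF True] by blast
    have "(4::'a) = 2 * 2" by simp
    hence "(4::'a) = 0" unfolding True by simp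
    hence "det_form N M = 0" using g by simp
    thus ?thesis using True y N(1) by (intro exI[of _ y]) simp
  next
    case False
    have four: "(4::'a) = 2 * 2" by simp
    have "(4::'a) \<noteq> 0" unfolding four using False no_zero_divisors by blast
    define x where "x = - det_form N M / (2 * det4 N)"
    have "x * x * (4 * (det4 N * det4 N)) = det_form N M * det_form N M"
      unfolding x_def using \<open>(4::'a) \<noteq> 0\<close> False N(1) by (simp add: field_simps)
    also have "\<dots> = det4 M * (4 * det4 N)" unfolding g by simp
    finally have "(x * x * det4 N) * (4 * det4 N) = det4 M * (4 * det4 N)" by (simp add: algebra_simps)
    hence "x * x * det4 N = det4 M" using \<open>(4::'a) \<noteq> 0\<close> N(1) by simp
    moreover have "det_form N M + 2 * x * det4 N = 0" using False N(1) by (simp add: x_def field_simps)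
    ultimately show ?thesis by metis
  qed
  then obtain x where x: "det_form N M + 2 * x * det4 N = 0" "det4 M = x * x * det4 N" by blast
  have x0: "x \<noteq> 0" using x(2) M(1) by auto
  define V where "V = M + x *s N"
  have NM: "det_form N M = - 2 * x * det4 N" using x(1) by (simp add: add_eq_0_iff2)
  have "det4 V = det4 M + x * det_form N M + x * x * det4 N"
    by (simp add: V_def det4_add det4_scale det_form_sym[of M] det_form_scale)
  also have "\<dots> = 0" unfolding x(2) NM by (simp add: algebra_simps)
  finally have dV: "det4 V = 0" .
  have V0: "V \<noteq> 0"
  proof
    assume "V = 0"
    hence "M = (- x) *s N" by (simp add: V_def vec_eq_iff eq_neg_iff_add_eq_0)
    hence "gr M = gr N" using gr_scale[of "- x" N] x0 by simp
    thus False using ne N(2) M(2) by simp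
  qed
  obtain a b where ab: "V = ten a b" using dV by (rule det4_eq_0D)
  have a0: "a \<noteq> 0" "b \<noteq> 0" using V0 unfolding ab by (auto simp: vec4_eq_iff)
  obtain x1 where x1: "x1 \<in> I" "cross2 (u x1) b = 0" using ex1_representative[OF card_I u_cross a0(2)] by blast
  obtain y1 where y1: "y1 \<in> J" "cross2 (t y1) a = 0" using ex1_representative[OF card_J t_cross a0(1)] by blast
  obtain c where c: "b = c *s u x1" using cross2_eq_0D[OF x1(2) u_nonzero[OF x1(1)]] by blast
  obtain d where d: "a = d *s t y1" using cross2_eq_0D[OF y1(2) t_nonzero[OF y1(1)]] by blast
  define P where "P = (x1, y1)"
  have P: "P \<in> I \<times> J" using x1 y1 by (simp add: P_def)
  define k where "k = d * c"
  have V: "V = k *s w P" by (simp add: ab c d P_def w_def k_def vec4_eq_iff algebra_simps)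
  have k0: "k \<noteq> 0" using V V0 by auto
  have M_eq: "M = k *s w P + (- x) *s N" using V by (simp add: V_def vec_eq_iff algebra_simps)
  have wP: "det_form (w P) (w P) = 0" by (simp add: w_def det_form_ten_ten)
  have BM: "det_form M Z = k * det_form (w P) Z - x * det_form N Z" for Z
    by (subst M_eq) (simp add: det_form_diff det_form_scale)
  \<comment> \<open>At a double root \<open>V\<close> is perpendicular to \<open>N\<close> and
    \<open>M\<close>, so the point \<open>P\<close> of \<open>V\<close> lies on both graphs.\<close>
  have "det_form M (x *s N + M) = 0"
  proof -
    have "det_form M (x *s N + M) = x * det_form N M + det_form M M"
      by (metis det_form_add det_form_scale det_form_sym)
    thus ?thesis unfolding det_form_self x(2) NM by (simp add: algebra_simps)
  qed
  moreover have "x *s N + M = V" by (simp add: V_def)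
  ultimately have "k * det_form M (w P) = 0" unfolding V by (metis det_form_scale det_form_sym)
  hence MP: "det_form M (w P) = 0" using k0 by simp
  hence NP: "det_form N (w P) = 0" using BM[of "w P"] wP x0 by simp
  have "R = P" if R: "R \<in> C" "R \<in> D" for R
  proof -
    have "det_form N (w R) = 0" "det_form M (w R) = 0" using R unfolding N(2) M(2) by (simp_all add: gr_def)
    hence "det_form (w P) (w R) = 0" using BM[of "w R"] k0 by simp
    hence "par P R" using R P t_cross u_cross circ_subset[OF C] by (auto simp: w_def det_form_ten_ten)
    moreover have "P \<in> C" using P NP unfolding N(2) by (simp add: gr_def)
    ultimately show ?thesis using circ_not_par[OF C _ R(1)] by blast
  qed
  moreover have "P \<in> C" "P \<in> D" using P NP MP unfolding N(2) M(2) by (simp_all add: gr_def)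
  ultimately show ?thesis by blast
qed

sublocale circle_geometry "I \<times> J" circs par "CARD('a)" 2
  by (rule circle_geometry_axioms)

sublocale polar_circle_geometry "I \<times> J" circs par "CARD('a)" 2 det_form w pole
proof
  show "P \<in> C \<longleftrightarrow> det_form (pole C) (w P) = 0" if C: "C \<in> circs" and P: "P \<in> I \<times> J" for C P
    using arg_cong[OF pole(2)[OF C], of "\<lambda>X. P \<in> X"] P unfolding gr_def by simp
  show "det_form (w P) (w R) \<noteq> 0" if C: "C \<in> circs" "P \<in> C" "R \<in> C" "P \<noteq> R" for C P R
  proof -
    have "P \<in> I \<times> J" "R \<in> I \<times> J" using C circ_subset[OF C(1)] by blast+
    moreover have "\<not> par P R" using circ_not_par[OF C] .
    ultimately have "cross2 (u (fst P)) (u (fst R)) \<noteq> 0" "cross2 (t (snd P)) (t (snd R)) \<noteq> 0"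
      using u_cross[of "fst P" "fst R"] t_cross[of "snd P" "snd R"] by (simp_all add: mem_Times_iff)
    thus ?thesis by (simp add: w_def det_form_ten_ten)
  qed
  show "pole C \<noteq> s *s w P" if C: "C \<in> circs" for C P s
  proof
    assume "pole C = s *s w P"
    hence "det4 (pole C) = 0" by (simp add: det4_scale w_def det4_ten)
    thus False using pole(1)[OF C] by simp
  qed
  show "\<exists>D\<in>circs. \<exists>s. s \<noteq> 0 \<and> pole C + c *s w P = s *s pole D" if C: "C \<in> circs" and P: "P \<in> C" for C P c
  proof -
    have "P \<in> gr (pole C)" using P arg_cong[OF pole(2)[OF C], of "\<lambda>X. P \<in> X"] by simp
    hence "det_form (pole C) (w P) = 0" by (simp add: gr_def)
    hence "det_form (pole C) (c *s w P) = 0" by (metis det_form_scale det_form_sym mult_zero_right)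
    hence d: "det4 (pole C + c *s w P) \<noteq> 0" using pole(1)[OF C] by (simp add: det4_add det4_scale w_def det4_ten)
    then obtain s where "s \<noteq> 0" "pole C + c *s w P = s *s pole (gr (pole C + c *s w P))" by (rule pole_gr)
    moreover have "gr (pole C + c *s w P) \<in> circs" using d by (auto simp: circs_def)
    ultimately show ?thesis by blast
  qed
  show "tan C D" if "C \<in> circs" "D \<in> circs" "C \<noteq> D"
    "det_form (pole C) (pole D) * det_form (pole C) (pole D) = det_form (pole C) (pole C) * det_form (pole D) (pole D)" for C D
    using gr_tangent[OF that] tanI[OF that(1,2)] by blast
  show "(\<forall>C\<in>circs. det_form (pole C) (pole C) = 0) \<or> ((\<forall>C\<in>circs. det_form (pole C) (pole C) \<noteq> 0) \<and> (2::'a) \<noteq> 0)"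
    unfolding det_form_self using pole(1) by (cases "(2::'a) = 0") auto
  show "det_form x z = det_form z x" for x z by (rule det_form_sym)
qed (simp_all add: det_form_add det_form_scale w_def det_form_ten_ten)

text \<open>The norm of \<open>v\<close> is \<open>2 * det4 v\<close>, and scaling the pole changes
  the determinant by a square.\<close>

lemma eps_gr:
  assumes d: "det4 v \<noteq> 0" and two: "(2::'a) \<noteq> 0"
  shows "eps (gr v) = quad_char (2::'a) * quad_char (det4 v)"
proof -
  obtain s where s: "s \<noteq> 0" "v = s *s pole (gr v)" using d by (rule pole_gr)
  have "quad_char (det4 v) = quad_char (s * s) * quad_char (det4 (pole (gr v)))"
    by (subst s(2)) (simp only: det4_scale quad_char_mult[OF two])
  hence "quad_char (det4 v) = quad_char (det4 (pole (gr v)))" using quad_char_square[OF s(1)] by simp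
  thus ?thesis by (simp only: eps_def det_form_self quad_char_mult[OF two])
qed

text \<open>Multiply \<open>det v * cross2 a b = cross2 (app v a) (app v b)\<close> over the three pairs of points.\<close>

lemma quad_char_three_points:
  assumes d: "det4 v \<noteq> 0" and two: "(2::'a) \<noteq> 0"
    and P: "P \<in> gr v" "Q \<in> gr v" "R \<in> gr v" and np: "\<not> par P Q" "\<not> par P R" "\<not> par Q R"
  shows "quad_char (det4 v) =
    quad_char (cross2 (u (fst P)) (u (fst Q)) * cross2 (u (fst P)) (u (fst R)) * cross2 (u (fst Q)) (u (fst R))) *
    quad_char (cross2 (t (snd P)) (t (snd Q)) * cross2 (t (snd P)) (t (snd R)) * cross2 (t (snd Q)) (t (snd R)))"
proof -
  have I: "fst X \<in> I" "snd X \<in> J" if "X \<in> gr v" for X using that by (auto simp: gr_def)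
  have ex: "\<exists>c. c \<noteq> 0 \<and> app v (u (fst X)) = c *s t (snd X)" if X: "X \<in> gr v" for X
  proof -
    have "cross2 (t (snd X)) (app v (u (fst X))) = 0" using X by (simp add: gr_def w_def det_form_ten)
    then obtain c where c: "app v (u (fst X)) = c *s t (snd X)" by (rule cross2_eq_0D) (rule t_nonzero[OF I(2)[OF X]])
    moreover have "app v (u (fst X)) \<noteq> 0" by (rule app_nonzero[OF d u_nonzero[OF I(1)[OF X]]])
    ultimately show ?thesis by auto
  qed
  obtain p where p: "p \<noteq> 0" "app v (u (fst P)) = p *s t (snd P)" using ex[OF P(1)] by blast
  obtain r where r: "r \<noteq> 0" "app v (u (fst Q)) = r *s t (snd Q)" using ex[OF P(2)] by blast
  obtain s where s: "s \<noteq> 0" "app v (u (fst R)) = s *s t (snd R)" using ex[OF P(3)] by blast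
  define U where "U = cross2 (u (fst P)) (u (fst Q)) * cross2 (u (fst P)) (u (fst R)) * cross2 (u (fst Q)) (u (fst R))"
  define T where "T = cross2 (t (snd P)) (t (snd Q)) * cross2 (t (snd P)) (t (snd R)) * cross2 (t (snd Q)) (t (snd R))"
  have U0: "U \<noteq> 0" using np u_cross I P by (auto simp: U_def)
  have "det4 v * (det4 v * det4 v) * U = (det4 v * cross2 (u (fst P)) (u (fst Q))) * (det4 v * cross2 (u (fst P)) (u (fst R)))
      * (det4 v * cross2 (u (fst Q)) (u (fst R)))" by (simp add: U_def algebra_simps)
  also have "\<dots> = (p * r * s) * (p * r * s) * T"
    unfolding cross2_app[symmetric] p(2) r(2) s(2) by (simp add: T_def algebra_simps)
  finally have e: "det4 v * (det4 v * det4 v) * U = (p * r * s) * (p * r * s) * T" .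
  have prs: "p * r * s \<noteq> 0" using p(1) r(1) s(1) by simp
  have "quad_char (det4 v) * quad_char U = quad_char T"
    using arg_cong[OF e, of quad_char] quad_char_square[OF d] quad_char_square[OF prs]
    by (simp only: quad_char_mult[OF two, of _ U] quad_char_mult[OF two, of _ T]
        quad_char_mult[OF two, of "det4 v" "det4 v * det4 v"] mult_1_right mult_1_left)
  moreover have "quad_char U * quad_char U = 1" using U0 by (simp add: quad_char_def)
  ultimately have "quad_char (det4 v) = quad_char U * quad_char T" by (metis mult.assoc mult.commute mult.right_neutral)
  thus ?thesis unfolding U_def T_def .
qed

end

section \<open>The planes CM\<close>

text \<open>Let \<open>Q\<close> be a further point of \<open>D\<close>. The circle of
  \<open>C1\<close> that touches \<open>C\<close> at the same point and passes through
  \<open>Q\<close> belongs to the class of \<open>C\<close> and hence to \<open>X\<close>, where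
  uniqueness identifies it with \<open>D\<close>.\<close>

lemma tan_class:
  assumes X: "circle_geometry pts X par q \<rho>" and g: "classed_circle_geometry pts C1 par q \<rho> e1"
    and sub: "{C\<in>C1. e1 C = s} \<subseteq> X"
    and C: "C \<in> C1" "e1 C = s" and D: "D \<in> X" and t: "circle_geometry.tan C D"
  shows "D \<in> C1 \<and> e1 D = s"
proof -
  interpret g: classed_circle_geometry pts C1 par q \<rho> e1 by (rule g)
  interpret X: circle_geometry pts X par q \<rho> by (rule X)
  have CX: "C \<in> X" using C sub by blast
  obtain P where P: "C \<inter> D = {P}" using X.tan_iff[OF CX D] t by blast
  obtain Q where Q: "Q \<in> D" "Q \<noteq> P"
  proof -
    have "D \<noteq> {P}" using X.card_circ[OF D] X.q_ge_3 by auto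
    thus ?thesis using that P by blast
  qed
  have Q': "Q \<in> pts" "Q \<notin> C" "\<not> par P Q"
    using Q P X.circ_sub[OF D] X.circ_not_par[OF D, of P Q] by blast+
  have PC: "P \<in> C" using P by blast
  have "card {E\<in>C1. C \<inter> E = {P} \<and> Q \<in> E} = 1" by (rule g.unique_tangent[OF C(1) PC Q'])
  then obtain E where "{E\<in>C1. C \<inter> E = {P} \<and> Q \<in> E} = {E}" by (rule card_1_singletonE)
  hence "E \<in> {E\<in>C1. C \<inter> E = {P} \<and> Q \<in> E}" by blast
  hence E: "E \<in> C1" "C \<inter> E = {P}" "Q \<in> E" by blast+
  have "e1 E = s" using g.eps_tan[OF C(1) E(1) g.tanI[OF C(1) E(1,2)]] C(2) by simp
  hence EX: "E \<in> X" using E sub by blast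
  have "card {E\<in>X. C \<inter> E = {P} \<and> Q \<in> E} = 1" by (rule X.unique_tangent[OF CX PC Q'])
  then obtain E' where "{E\<in>X. C \<inter> E = {P} \<and> Q \<in> E} = {E'}" by (rule card_1_singletonE)
  moreover have "D \<in> {E\<in>X. C \<inter> E = {P} \<and> Q \<in> E}" "E \<in> {E\<in>X. C \<inter> E = {P} \<and> Q \<in> E}"
    using D P Q(1) E EX by blast+
  ultimately have "D = E" by simp
  thus ?thesis using E \<open>e1 E = s\<close> by simp
qed

lemma tangents_class:
  assumes X: "circle_geometry pts X par q \<rho>" and g: "classed_circle_geometry pts C1 par q \<rho> e1"
    and sub: "{C\<in>C1. e1 C = s} \<subseteq> X"
    and C: "C \<in> C1" "e1 C = s"
  shows "{E\<in>X. circle_geometry.tan C E \<and> circle_geometry.tan E D} = {E\<in>C1. circle_geometry.tan C E \<and> circle_geometry.tan E D}"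
proof -
  interpret g: classed_circle_geometry pts C1 par q \<rho> e1 by (rule g)
  have "E \<in> X" if "E \<in> C1" "g.tan C E" for E using g.eps_tan[OF C(1) that] that(1) C(2) sub by auto
  moreover have "E \<in> C1" if "E \<in> X" "g.tan C E" for E using tan_class[OF X g sub C that] by blast
  ultimately show ?thesis by blast
qed

text \<open>Circles from different classes are never tangent: the unique circle touching \<open>C\<close> in \<open>P\<close> and passing
  through a further point \<open>Q\<close> already belongs to the class of \<open>C\<close> (\<open>tan_class\<close>).\<close>

lemma exchange_class:
  assumes g1: "classed_circle_geometry pts C1 par q \<rho> e1" and g2: "classed_circle_geometry pts C2 par q \<rho> e2"
    and pm2: "\<And>C. C \<in> C2 \<Longrightarrow> e2 C = 1 \<or> e2 C = -1"
    and s: "s = 1 \<or> s = -1"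
    and same: "\<And>P Q R C D. C \<in> C1 \<Longrightarrow> D \<in> C2 \<Longrightarrow> P \<in> C \<inter> D \<Longrightarrow> Q \<in> C \<inter> D \<Longrightarrow> R \<in> C \<inter> D \<Longrightarrow>
      P \<noteq> Q \<Longrightarrow> P \<noteq> R \<Longrightarrow> Q \<noteq> R \<Longrightarrow> e1 C = e2 D"
  shows "\<exists>eps. classed_circle_geometry pts ({C\<in>C1. e1 C = s} \<union> {C\<in>C2. e2 C = - s}) par q \<rho> eps"
proof -
  define X where "X = {C\<in>C1. e1 C = s} \<union> {C\<in>C2. e2 C = - s}"
  interpret g1: classed_circle_geometry pts C1 par q \<rho> e1 by (rule g1)
  interpret g2: classed_circle_geometry pts C2 par q \<rho> e2 by (rule g2)
  have s0: "s \<noteq> - s" using s by auto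
  have X1: "{C\<in>C1. e1 C = s} \<subseteq> X" and X2: "{C\<in>C2. e2 C = - s} \<subseteq> X" unfolding X_def by blast+
  have mem: "C \<in> C1 \<and> e1 C = s \<or> C \<in> C2 \<and> e2 C = - s" if "C \<in> X" for C using that unfolding X_def by blast
  have X: "circle_geometry pts X par q \<rho>"
  proof
    show "C \<subseteq> pts" if "C \<in> X" for C using mem[OF that] g1.circ_sub g2.circ_sub by blast
    show "card C = q + 1" if "C \<in> X" for C using mem[OF that] g1.card_circ g2.card_circ by blast
    show "\<not> par P R" if "C \<in> X" "P \<in> C" "R \<in> C" "P \<noteq> R" for C P R
      using mem[OF that(1)] that g1.circ_not_par g2.circ_not_par by blast
    show "card {R\<in>C. par P R} = \<rho>" if "P \<in> pts" "C \<in> X" "P \<notin> C" for P C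
      using mem[OF that(2)] g1.card_par_circ[OF that(1) _ that(3)] g2.card_par_circ[OF that(1) _ that(3)] by blast
    fix P Q R assume P: "P \<in> pts" "Q \<in> pts" "R \<in> pts" "P \<noteq> Q" "P \<noteq> R" "Q \<noteq> R" "\<not> par P Q" "\<not> par P R" "\<not> par Q R"
    obtain C where C: "C \<in> C1" "P \<in> C" "Q \<in> C" "R \<in> C" using g1.three[OF P] by blast
    obtain D where D: "D \<in> C2" "P \<in> D" "Q \<in> D" "R \<in> D" using g2.three[OF P] by blast
    \<comment> \<open>The two candidates for the circle through three points have the same sign, so
      exactly one of them is kept in \<open>X\<close>.\<close>
    have e: "e1 C = e2 D" by (rule same[OF C(1) D(1), of P Q R]) (use C D P in auto)
    have uC: "Z = C" if "Z \<in> C1" "P \<in> Z" "Q \<in> Z" "R \<in> Z" for Z using g1.three[OF P] that C by blast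
    have uD: "Z = D" if "Z \<in> C2" "P \<in> Z" "Q \<in> Z" "R \<in> Z" for Z using g2.three[OF P] that D by blast
    show "\<exists>!C. C \<in> X \<and> P \<in> C \<and> Q \<in> C \<and> R \<in> C"
    proof (cases "e1 C = s")
      case True
      show ?thesis
      proof (rule ex1I[of _ C])
        show "C \<in> X \<and> P \<in> C \<and> Q \<in> C \<and> R \<in> C" using C True X1 by blast
        fix Z assume Z: "Z \<in> X \<and> P \<in> Z \<and> Q \<in> Z \<and> R \<in> Z"
        have "\<not> (Z \<in> C2 \<and> e2 Z = - s)" using uD[of Z] Z e True s0 by auto
        thus "Z = C" using mem[of Z] uC[of Z] Z by blast
      qed
    next
      case False
      hence "e2 D = - s" using e pm2[OF D(1)] s by auto
      show ?thesis
      proof (rule ex1I[of _ D])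
        show "D \<in> X \<and> P \<in> D \<and> Q \<in> D \<and> R \<in> D" using D \<open>e2 D = - s\<close> X2 by blast
        fix Z assume Z: "Z \<in> X \<and> P \<in> Z \<and> Q \<in> Z \<and> R \<in> Z"
        have "\<not> (Z \<in> C1 \<and> e1 Z = s)" using uC[of Z] Z False by auto
        thus "Z = D" using mem[of Z] uD[of Z] Z by blast
      qed
    qed
  qed (use g1.finite_pts g1.q_ge_3 g1.rho g1.par_sym g1.card_not_par g1.card_not_par2 g1.card_pts in blast)+
  interpret X: circle_geometry pts X par q \<rho> by (rule X)
  have disj: False if C: "C \<in> C1" "e1 C = s" "C \<in> C2" "e2 C = - s" for C
  proof -
    have "3 \<le> card C" using g1.card_circ[OF C(1)] g1.q_ge_3 by simp
    then obtain P Q R where "P \<in> C" "Q \<in> C" "R \<in> C" "P \<noteq> Q" "P \<noteq> R" "Q \<noteq> R" by (rule three_elementsE)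
    hence "e1 C = e2 C" using same[OF C(1,3), of P Q R] by blast
    thus False using C s0 by simp
  qed
  define eps where "eps C = (if C \<in> C1 \<and> e1 C = s then s else - s)" for C
  have t1: "D \<in> C1 \<and> e1 D = s" if "C \<in> C1" "e1 C = s" "D \<in> X" "X.tan C D" for C D
    using tan_class[OF X g1 X1 that] .
  have t2: "D \<in> C2 \<and> e2 D = - s" if "C \<in> C2" "e2 C = - s" "D \<in> X" "X.tan C D" for C D
    using tan_class[OF X g2 X2 that] .
  \<comment> \<open>Circles of different classes neither touch nor have a common tangent, in
    agreement with \<open>1 + eps C * eps D = 0\<close>.\<close>
  have mixed: "real (card {E\<in>X. X.tan C E \<and> X.tan E D}) + 2 * (if X.tan C D then 1 else 0) =
      (real q + 1 - real (card (C \<inter> D))) * (1 + eps C * eps D)"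
    if "C \<in> C1" "e1 C = s" "D \<in> C2" "e2 D = - s" for C D
  proof -
    have CX: "C \<in> X" "D \<in> X" using that X1 X2 by blast+
    have no: "{E\<in>X. X.tan C E \<and> X.tan E D} = {}"
    proof -
      have False if "E \<in> X" "X.tan C E" "X.tan E D" for E
        using t1[OF \<open>C \<in> C1\<close> \<open>e1 C = s\<close> that(1,2)] t2[OF \<open>D \<in> C2\<close> \<open>e2 D = - s\<close> that(1)] that(3) X.tan_sym[of E D] disj by blast
      thus ?thesis by blast
    qed
    have "card {E\<in>X. X.tan C E \<and> X.tan E D} = 0" unfolding no by (rule card.empty)
    moreover have "\<not> X.tan C D" using t1[OF that(1,2) CX(2)] that disj by blast
    moreover have "eps C = s" "eps D = - s" using that disj by (auto simp: eps_def)
    ultimately show ?thesis using s by auto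
  qed
  have "classed_circle_geometry pts X par q \<rho> eps"
  proof
    show "(\<forall>C\<in>X. eps C = 0) \<or> (\<forall>C\<in>X. eps C = 1 \<or> eps C = -1)" using s by (auto simp: eps_def)
    show "eps C = eps D" if "C \<in> X" "D \<in> X" "X.tan C D" for C D
      using t1[of C D] t1[of D C] that X.tan_sym[of C D] by (auto simp: eps_def)
    fix C D assume C: "C \<in> X" and D: "D \<in> X" and ne: "C \<noteq> D"
    consider "C \<in> C1" "e1 C = s" "D \<in> C1" "e1 D = s" | "C \<in> C2" "e2 C = - s" "D \<in> C2" "e2 D = - s"
      | "C \<in> C1" "e1 C = s" "D \<in> C2" "e2 D = - s" | "D \<in> C1" "e1 D = s" "C \<in> C2" "e2 C = - s"
      using mem[OF C] mem[OF D] by blast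
    thus "real (card {E\<in>X. X.tan C E \<and> X.tan E D}) + 2 * (if X.tan C D then 1 else 0) =
      (real q + 1 - real (card (C \<inter> D))) * (1 + eps C * eps D)"
    proof cases
      case 1
      thus ?thesis using g1.common_tangents[OF 1(1,3) ne] by (simp add: tangents_class[OF X g1 X1 1(1,2)] eps_def)
    next
      case 2
      have "eps C = - s" "eps D = - s" using 2 disj by (auto simp: eps_def)
      thus ?thesis using g2.common_tangents[OF 2(1,3) ne] 2 by (simp add: tangents_class[OF X g2 X2 2(1,2)])
    next
      case 3
      thus ?thesis by (rule mixed)
    next
      case 4
      thus ?thesis using mixed[OF 4] X.tan_sym by (simp add: Int_commute mult.commute conj_commute)
    qed
  qed
  thus ?thesis unfolding X_def by blast
qed

section \<open>The circles of \<open>CM(2, q, \<phi>)\<close> as graphs of matrices\<close>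

definition mv :: "'a::field ^ 2 ^ 2 \<Rightarrow> 'a ^ 4" where
  "mv M = vector [M $ 1 $ 1, M $ 1 $ 2, M $ 2 $ 1, M $ 2 $ 2]"

lemma det4_mv: "det4 (mv M) = det M"
  by (simp add: det4_def mv_def vector_4 det_2)

lemma app_mv: "M *v a = app (mv M) a"
  by (simp add: vec2_eq_iff mv_def vector_4 matrix_vector_mult_def sum_2)

lemma app_scale: "app v (c *s a) = c *s app v a"
  by (simp add: vec2_eq_iff algebra_simps)

lemma range_mv: "\<exists>M. mv M = v"
proof -
  have "mv (vector [vector [v $ 1, v $ 2], vector [v $ 3, v $ 4]]) = v"
    by (simp add: mv_def vec4_eq_iff vector_4 vector_2)
  thus ?thesis by blast
qed

lemma det_mat2: "det (mat c :: 'a::comm_ring_1 ^ 2 ^ 2) = c * c"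
  by (simp add: det_2 mat_def)

lemma in_PSL2_iff:
  assumes "invertible M" shows "in_PSL2 M \<longleftrightarrow> (\<exists>y. y * y = det M)"
proof
  assume "in_PSL2 M"
  then obtain c N where "det N = 1" "M = mat c ** N" by (auto simp: in_PSL2_def)
  hence "det M = det (mat c :: 'a ^ 2 ^ 2)" by (simp add: det_mul)
  hence "c * c = det M" by (simp add: det_mat2)
  thus "\<exists>y. y * y = det M" by blast
next
  assume "\<exists>y. y * y = det M"
  then obtain c where c: "c * c = det M" by blast
  have c0: "c \<noteq> 0" using c assms by (auto simp: invertible_det_nz)
  have m: "mat c ** mat (1 / c) = (mat 1 :: 'a ^ 2 ^ 2)"
    using c0 by (simp add: vec_eq_iff forall_2 matrix_matrix_mult_def sum_2 mat_def)
  have "det (mat (1 / c) ** M) = 1" using c0 c[symmetric] by (simp add: det_mul det_mat2)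
  moreover have "M = mat c ** (mat (1 / c) ** M)" by (simp add: matrix_mul_assoc m)
  ultimately show "in_PSL2 M" unfolding in_PSL2_def using c0 by blast
qed

lemma card_pg_points2: "card (pg_points :: ('a::{field,finite} ^ 2) set set) = CARD('a) + 1"
proof -
  have "(UNIV :: ('a ^ 2) set) \<in> pg_lines" by (simp add: pg_lines_def vec.dim_UNIV card_cart_basis)
  thus ?thesis using card_on_line by (fastforce simp: on_def)
qed

lemma cross2_rep:
  assumes "y \<in> pg_points" "a \<noteq> 0"
  shows "cross2 (rep y) a = 0 \<longleftrightarrow> y = pt a"
proof -
  have r: "rep y \<noteq> 0" "y = pt (rep y)" using rep[OF assms(1)] by auto
  have "cross2 (rep y) a = 0 \<longleftrightarrow> (\<exists>c. a = c *s rep y)" using cross2_eq_0D[OF _ r(1)] by auto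
  also have "\<dots> \<longleftrightarrow> pt (rep y) = pt a" by (rule pt_eq_iff[OF r(1) assms(2), symmetric])
  finally show ?thesis unfolding r(2)[symmetric] .
qed

lemma cross2_rep_rep:
  assumes "x \<in> pg_points" "y \<in> pg_points"
  shows "cross2 (rep x) (rep y) = 0 \<longleftrightarrow> x = y"
proof -
  have "rep y \<noteq> 0" "y = pt (rep y)" using rep[OF assms(2)] by auto
  thus ?thesis using cross2_rep[OF assms(1), of "rep y"] by argo
qed

definition twist :: "('a \<Rightarrow> 'a) \<Rightarrow> 'a ^ 2 \<Rightarrow> 'a ^ 2" where
  "twist \<phi> v = (\<chi> i. \<phi> (v $ i))"

lemma gr_eq:
  assumes "ruled pg_points pg_points u rep" and d: "det4 v \<noteq> 0"
  shows "ruled.gr pg_points pg_points u rep v = {(x, pt (app v (u x))) | x. x \<in> pg_points}"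
proof -
  interpret ruled pg_points pg_points u rep by (rule assms(1))
  have n: "app v (u x) \<noteq> 0" if "x \<in> pg_points" for x using app_nonzero[OF d u_nonzero[OF that]] .
  have "(x, y) \<in> gr v \<longleftrightarrow> (x, y) \<in> {(x, pt (app v (u x))) | x. x \<in> pg_points}" for x y
    using cross2_rep[of y] n pt_in_pg_points[OF n] by (auto simp: gr_def w_def det_form_ten)
  thus ?thesis by auto
qed

lemma graph_cong: "(\<And>x. x \<in> A \<Longrightarrow> f x = g x) \<Longrightarrow> {(x, f x) | x. x \<in> A} = {(x, g x) | x. x \<in> A}"
  by force

text \<open>In odd characteristic the matrices with square determinant give circles of the plane
  \<open>r1\<close>, the others give circles of \<open>r2\<close>, in which \<open>\<phi>\<close> is
  applied to the first coordinates. Also \<open>r2\<close> is a ruled plane, because the vectors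
  \<open>twist \<phi> (rep x)\<close> again represent all points of the line. As
  \<open>\<phi>\<close> preserves squares, \<open>quad_char_three_points\<close> assigns the same
  class to circles of the two planes that share three points. In characteristic two all circles come
  from \<open>r1\<close>.\<close>

theorem CM_largest:
  fixes \<phi> :: "'a::{field,finite} \<Rightarrow> 'a"
  assumes \<phi>: "field_automorphism \<phi>" and q: "CARD('a) > 2" and F: "largest_intersecting_family (CM_plane \<phi>) F"
  shows "\<exists>P\<in>fst (CM_plane \<phi>). F = circles_through (CM_plane \<phi>) P"
proof -
  have \<phi>_add: "\<phi> (x + y) = \<phi> x + \<phi> y" and \<phi>_mult: "\<phi> (x * y) = \<phi> x * \<phi> y" and bij: "bij \<phi>" for x y
    using \<phi> by (auto simp: field_automorphism_def)
  have \<phi>_0: "\<phi> 0 = 0" using \<phi>_add[of 0 0] by (metis add.right_neutral add_left_cancel)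
  have \<phi>_zero: "\<phi> x = 0 \<longleftrightarrow> x = 0" for x using bij \<phi>_0 by (metis bij_pointE)
  have \<phi>_diff: "\<phi> (x - y) = \<phi> x - \<phi> y" for x y using \<phi>_add[of "x - y" y] by simp
  have \<phi>_char: "quad_char (\<phi> x) = quad_char x" for x
  proof -
    have "(\<exists>y. y * y = \<phi> x) \<longleftrightarrow> (\<exists>y. y * y = x)"
    proof
      assume "\<exists>y. y * y = \<phi> x"
      then obtain y where "y * y = \<phi> x" by blast
      moreover obtain z where "y = \<phi> z" using bij by (metis bij_pointE)
      ultimately have "\<phi> (z * z) = \<phi> x" by (simp add: \<phi>_mult)
      thus "\<exists>y. y * y = x" using bij by (metis bij_pointE)
    qed (metis \<phi>_mult)
    thus ?thesis by (simp add: quad_char_def \<phi>_zero)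
  qed
  have cross_twist: "cross2 (twist \<phi> a) (twist \<phi> b) = \<phi> (cross2 a b)" for a b
    by (simp add: cross2_def twist_def \<phi>_diff \<phi>_mult)
  interpret r1: ruled pg_points pg_points rep "rep :: ('a ^ 2) set \<Rightarrow> 'a ^ 2"
    by unfold_locales (use q in \<open>simp_all add: card_pg_points2 cross2_rep_rep\<close>)
  interpret r2: ruled pg_points pg_points "\<lambda>x. twist \<phi> (rep x)" "rep :: ('a ^ 2) set \<Rightarrow> 'a ^ 2"
    by unfold_locales (use q in \<open>simp_all add: card_pg_points2 cross2_rep_rep cross_twist \<phi>_zero\<close>)
  have img: "(\<lambda>v. M *v v) ` x = pt (app (mv M) (rep x))" if "x \<in> pg_points" for M :: "'a ^ 2 ^ 2" and x
  proof -
    have "(\<lambda>v. M *v v) ` pt (rep x) = pt (app (mv M) (rep x))"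
      by (simp add: pt_def image_image app_mv app_scale)
    thus ?thesis using rep[OF that] by metis
  qed
  have img_twist: "(\<lambda>v. M *v (\<chi> i. \<phi> (v $ i))) ` x = pt (app (mv M) (twist \<phi> (rep x)))"
    if "x \<in> pg_points" for M :: "'a ^ 2 ^ 2" and x
  proof -
    have s: "(\<chi> i. \<phi> ((c *s v) $ i)) = \<phi> c *s twist \<phi> v" for c v
      by (simp add: twist_def vec_eq_iff \<phi>_mult)
    have "(\<lambda>v. M *v (\<chi> i. \<phi> (v $ i))) ` pt (rep x) = (\<lambda>c. \<phi> c *s app (mv M) (twist \<phi> (rep x))) ` UNIV"
      by (simp only: pt_def image_image app_mv app_scale s)
    also have "\<dots> = (\<lambda>c. c *s app (mv M) (twist \<phi> (rep x))) ` range \<phi>" by (simp only: image_image)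
    also have "range \<phi> = UNIV" using bij by (rule bij_is_surj)
    finally show ?thesis using rep[OF that] unfolding pt_def by metis
  qed
  have circle: "{(x, CM_map \<phi> M x) | x. x \<in> pg_points} = (if in_PSL2 M then r1.gr (mv M) else r2.gr (mv M))"
    if M: "invertible M" for M
  proof -
    have d: "det4 (mv M) \<noteq> 0" using M by (simp add: det4_mv invertible_det_nz)
    show ?thesis
    proof (cases "in_PSL2 M")
      case True
      show ?thesis unfolding CM_map_def if_P[OF True] gr_eq[OF r1.ruled_axioms d] by (rule graph_cong) (rule img)
    next
      case False
      show ?thesis unfolding CM_map_def if_not_P[OF False] gr_eq[OF r2.ruled_axioms d] by (rule graph_cong) (rule img_twist)
    qed
  qed
  define X where "X = snd (CM_plane \<phi>)"
  have X: "X = {if in_PSL2 M then r1.gr (mv M) else r2.gr (mv M) | M. invertible M}"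
  proof (rule set_eqI)
    fix C
    have "C \<in> X \<longleftrightarrow> (\<exists>M. C = {(x, CM_map \<phi> M x) | x. x \<in> pg_points} \<and> invertible M)"
      unfolding X_def CM_plane_def snd_conv by (rule mem_Collect_eq)
    also have "\<dots> \<longleftrightarrow> (\<exists>M. C = (if in_PSL2 M then r1.gr (mv M) else r2.gr (mv M)) \<and> invertible M)"
    proof (rule iff_exI)
      fix M :: "'a ^ 2 ^ 2"
      show "(C = {(x, CM_map \<phi> M x) | x. x \<in> pg_points} \<and> invertible M) =
        (C = (if in_PSL2 M then r1.gr (mv M) else r2.gr (mv M)) \<and> invertible M)"
      proof (cases "invertible M")
        case True
        show ?thesis unfolding circle[OF True] by (rule refl)
      qed simp
    qed
    finally show "C \<in> X \<longleftrightarrow> C \<in> {if in_PSL2 M then r1.gr (mv M) else r2.gr (mv M) | M. invertible M}"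
      unfolding mem_Collect_eq .
  qed
  define A1 where "A1 = {v :: 'a ^ 4. det4 v \<noteq> 0 \<and> (\<exists>y. y * y = det4 v)}"
  define A2 where "A2 = {v :: 'a ^ 4. det4 v \<noteq> 0 \<and> \<not> (\<exists>y. y * y = det4 v)}"
  have mv_mem: "mv M \<in> A1 \<longleftrightarrow> invertible M \<and> in_PSL2 M" "mv M \<in> A2 \<longleftrightarrow> invertible M \<and> \<not> in_PSL2 M" for M
    using in_PSL2_iff[of M] by (auto simp: A1_def A2_def det4_mv invertible_det_nz)
  have X': "X = r1.gr ` A1 \<union> r2.gr ` A2"
  proof (intro subset_antisym subsetI)
    fix C assume "C \<in> X"
    then obtain M where M: "C = (if in_PSL2 M then r1.gr (mv M) else r2.gr (mv M))" "invertible M"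
      unfolding X by blast
    show "C \<in> r1.gr ` A1 \<union> r2.gr ` A2"
      using mv_mem[of M] M by (cases "in_PSL2 M") simp_all
  next
    fix C assume "C \<in> r1.gr ` A1 \<union> r2.gr ` A2"
    then consider v where "C = r1.gr v" "v \<in> A1" | v where "C = r2.gr v" "v \<in> A2" by blast
    then obtain M where "C = (if in_PSL2 M then r1.gr (mv M) else r2.gr (mv M))" "invertible M"
    proof cases
      case (1 v)
      obtain M where M: "mv M = v" using range_mv by blast
      hence "invertible M" "in_PSL2 M" using mv_mem(1)[of M] 1(2) by simp_all
      thus ?thesis using that[of M] 1(1) M by simp
    next
      case (2 v)
      obtain M where M: "mv M = v" using range_mv by blast
      hence "invertible M" "\<not> in_PSL2 M" using mv_mem(2)[of M] 2(2) by simp_all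
      thus ?thesis using that[of M] 2(1) M by simp
    qed
    thus "C \<in> X" unfolding X by blast
  qed
  have XR: "C \<in> r1.circs \<or> C \<in> r2.circs" if "C \<in> X" for C
    using that unfolding X' A1_def A2_def r1.circs_def r2.circs_def by blast
  have "\<exists>eps. classed_circle_geometry (pg_points \<times> pg_points) X (\<lambda>P R. fst P = fst R \<or> snd P = snd R) (CARD('a)) 2 eps"
  proof (cases "(2::'a) = 0")
    case True
    have "X = r1.circs" unfolding X' A1_def A2_def r1.circs_def using square_char_two[OF True] by simp
    thus ?thesis using r1.classed_circle_geometry_axioms by blast
  next
    case two: False
    define s where "s = quad_char (2::'a)"
    have s: "s = 1 \<or> s = -1" using two by (simp add: s_def quad_char_def)
    have e1: "r1.eps (r1.gr v) = s * quad_char (det4 v)" and e2: "r2.eps (r2.gr v) = s * quad_char (det4 v)"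
      if "det4 v \<noteq> 0" for v using r1.eps_gr[OF that two] r2.eps_gr[OF that two] by (simp_all add: s_def)
    have pm: "quad_char a = 1 \<or> quad_char a = -1" if "a \<noteq> 0" for a :: 'a
      using that by (simp add: quad_char_def)
    have X1: "{C\<in>r1.circs. r1.eps C = s} = r1.gr ` A1"
    proof -
      have "v \<in> A1 \<longleftrightarrow> det4 v \<noteq> 0 \<and> r1.eps (r1.gr v) = s" for v
        using s e1[of v] by (auto simp: A1_def quad_char_def split: if_splits)
      thus ?thesis unfolding r1.circs_def by blast
    qed
    have X2: "{C\<in>r2.circs. r2.eps C = - s} = r2.gr ` A2"
    proof -
      have "v \<in> A2 \<longleftrightarrow> det4 v \<noteq> 0 \<and> r2.eps (r2.gr v) = - s" for v
        using s e2[of v] by (auto simp: A2_def quad_char_def split: if_splits)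
      thus ?thesis unfolding r2.circs_def by blast
    qed
    have "\<exists>eps. classed_circle_geometry (pg_points \<times> pg_points) ({C\<in>r1.circs. r1.eps C = s} \<union> {C\<in>r2.circs. r2.eps C = - s})
       (\<lambda>P R. fst P = fst R \<or> snd P = snd R) (CARD('a)) 2 eps"
    proof (rule exchange_class[OF r1.classed_circle_geometry_axioms r2.classed_circle_geometry_axioms _ s])
      show "r2.eps C = 1 \<or> r2.eps C = -1" if cc: "C \<in> r2.circs" for C
      proof -
        obtain v where v: "det4 v \<noteq> 0" "C = r2.gr v" using cc by (auto simp: r2.circs_def)
        show ?thesis using e2[OF v(1)] pm[OF v(1)] s unfolding v(2) by auto
      qed
      fix P Q R C D assume C: "C \<in> r1.circs" and D: "D \<in> r2.circs"
        and PQR: "P \<in> C \<inter> D" "Q \<in> C \<inter> D" "R \<in> C \<inter> D" and ne: "P \<noteq> Q" "P \<noteq> R" "Q \<noteq> R"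
      obtain v where v: "det4 v \<noteq> 0" "C = r1.gr v" using C by (auto simp: r1.circs_def)
      obtain v' where v': "det4 v' \<noteq> 0" "D = r2.gr v'" using D by (auto simp: r2.circs_def)
      have np: "\<not> r1.par P Q" "\<not> r1.par P R" "\<not> r1.par Q R" using r1.circ_not_par[OF C] PQR ne by blast+
      have in1: "P \<in> r1.gr v" "Q \<in> r1.gr v" "R \<in> r1.gr v" using PQR unfolding v(2) by blast+
      have in2: "P \<in> r2.gr v'" "Q \<in> r2.gr v'" "R \<in> r2.gr v'" using PQR unfolding v'(2) by blast+
      have "quad_char (det4 v) = quad_char (det4 v')"
        unfolding r1.quad_char_three_points[OF v(1) two in1 np] r2.quad_char_three_points[OF v'(1) two in2 np]
        by (simp only: cross_twist \<phi>_mult[symmetric] \<phi>_char)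
      thus "r1.eps C = r2.eps D" unfolding v(2) v'(2) e1[OF v(1)] e2[OF v'(1)] by simp
    qed
    thus ?thesis unfolding X1 X2 X' .
  qed
  then obtain eps where geo: "classed_circle_geometry (pg_points \<times> pg_points) X (\<lambda>P R. fst P = fst R \<or> snd P = snd R) (CARD('a)) 2 eps"
    by blast
  interpret X: classed_circle_geometry "pg_points \<times> pg_points" X "\<lambda>P R. fst P = fst R \<or> snd P = snd R" "CARD('a)" 2 eps
    by (rule geo)
  have FX: "F \<subseteq> X" and int: "\<And>C D. C \<in> F \<Longrightarrow> D \<in> F \<Longrightarrow> C \<inter> D \<noteq> {}"
    using F by (auto simp: X_def largest_intersecting_family_def intersecting_family_def)
  have pts: "fst (CM_plane \<phi>) = pg_points \<times> pg_points" by (simp add: CM_plane_def)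
  have "pg_points \<noteq> ({} :: ('a ^ 2) set set)" using card_pg_points2[where 'a='a] by auto
  then obtain x :: "('a ^ 2) set" where "x \<in> pg_points" by blast
  hence P: "(x, x) \<in> pg_points \<times> pg_points" by simp
  have "card F \<ge> CARD('a) * (CARD('a) - 1)"
    using largest_ge[OF F, of "(x, x)"] X.card_through[OF P] P
    unfolding pts circles_through_def X_def[symmetric] by simp
  moreover have "\<exists>!j. (i, j) \<in> C" if "C \<in> X" "i \<in> pg_points" for C i
    using XR[OF that(1)] r1.circ_row[OF _ that(2)] r2.circ_row[OF _ that(2)] by blast
  moreover have "\<exists>!i. (i, j) \<in> C" if "C \<in> X" "j \<in> pg_points" for C j
    using XR[OF that(1)] r1.circ_col[OF _ that(2)] r2.circ_col[OF _ that(2)] by blast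
  ultimately have "\<exists>P\<in>pg_points \<times> pg_points. F = {C\<in>X. P \<in> C}"
    by (intro minkowski_intersecting_family[OF geo card_pg_points2 card_pg_points2 _ _ FX int]) blast+
  thus ?thesis unfolding pts circles_through_def X_def .
qed

section \<open>Hyperbolic quadrics\<close>

lemma hyperbolic_quadric_det4:
  fixes Q :: "('a::{field,finite} ^ 4) set set"
  assumes "hyperbolic_quadric Q"
  obtains L L' :: "'a ^ 4 \<Rightarrow> 'a ^ 4" where "\<And>x y. L (x + y) = L x + L y" "\<And>c x. L (c *s x) = c *s L x"
    "\<And>x. L (L' x) = x" "\<And>x. L' (L x) = x" "Q = {P\<in>pg_points. \<forall>v\<in>P. det4 (L v) = 0}"
proof -
  obtain A :: "'a ^ 4 ^ 4" where A: "invertible A"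
    "Q = {P\<in>pg_points. \<forall>v\<in>P. (A *v v) $ 1 * (A *v v) $ 2 + (A *v v) $ 3 * (A *v v) $ 4 = 0}"
    using assms unfolding hyperbolic_quadric_def by blast
  obtain A' where A': "A ** A' = mat 1" "A' ** A = mat 1" using A(1) unfolding invertible_def by blast
  \<comment> \<open>The coordinates are permuted, with one sign, such that \<open>det4 (S z)\<close>
    is the standard form \<open>z $ 1 * z $ 2 + z $ 3 * z $ 4\<close>; \<open>S'\<close> is the
    inverse.\<close>
  define S :: "'a ^ 4 \<Rightarrow> 'a ^ 4" where "S z = vector [z $ 1, - z $ 3, z $ 4, z $ 2]" for z
  define S' :: "'a ^ 4 \<Rightarrow> 'a ^ 4" where "S' y = vector [y $ 1, y $ 4, - y $ 2, y $ 3]" for y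
  have S: "S (S' x) = x" "S' (S x) = x" "S (x + y) = S x + S y" "S (c *s x) = c *s S x" for x y c
    by (simp_all add: S_def S'_def vec4_eq_iff vector_4)
  show ?thesis
  proof (rule that[of "\<lambda>v. S (A *v v)" "\<lambda>y. A' *v S' y"])
    show "S (A *v (x + y)) = S (A *v x) + S (A *v y)" "S (A *v (c *s x)) = c *s S (A *v x)" for x y c
      by (simp_all add: S vec.add vec.scale)
    show "S (A *v (A' *v S' x)) = x" "A' *v S' (S (A *v x)) = x" for x
      by (simp_all add: S matrix_vector_mul_assoc A')
    show "Q = {P\<in>pg_points. \<forall>v\<in>P. det4 (S (A *v v)) = 0}"
      unfolding A(2) by (simp add: S_def det4_def vector_4 mult.commute)
  qed
qed

lemma ten_eq_scaleD:
  assumes "ten a b = c *s ten a' b'"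
  shows "cross2 a a' *s b = 0" "cross2 b b' *s a = 0"
proof -
  have e: "a $ 1 * b $ 2 = c * (a' $ 1 * b' $ 2)" "a $ 1 * b $ 1 = c * (a' $ 1 * b' $ 1)"
    "a $ 2 * b $ 2 = c * (a' $ 2 * b' $ 2)" "a $ 2 * b $ 1 = c * (a' $ 2 * b' $ 1)"
    using assms by (simp_all add: vec4_eq_iff)
  have "cross2 a a' * b $ 1 = a' $ 2 * (a $ 1 * b $ 1) - a' $ 1 * (a $ 2 * b $ 1)"
    "cross2 a a' * b $ 2 = a' $ 2 * (a $ 1 * b $ 2) - a' $ 1 * (a $ 2 * b $ 2)"
    "cross2 b b' * a $ 1 = b' $ 2 * (a $ 1 * b $ 1) - b' $ 1 * (a $ 1 * b $ 2)"
    "cross2 b b' * a $ 2 = b' $ 2 * (a $ 2 * b $ 1) - b' $ 1 * (a $ 2 * b $ 2)"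
    by (simp_all add: cross2_def algebra_simps)
  thus "cross2 a a' *s b = 0" "cross2 b b' *s a = 0" unfolding e by (simp_all add: vec2_eq_iff algebra_simps)
qed

text \<open>In suitable coordinates the points of the quadric are the matrices of rank one, so they
  are indexed by pairs of points of the projective line, and the oval planes are the perpendiculars
  of the nonsingular matrices.\<close>

theorem ovoidal_minkowski_largest:
  fixes G :: "('a::{field,finite} ^ 4) set incidence_structure"
  assumes G: "ovoidal_minkowski_plane G" and q: "CARD('a) > 2" and F: "largest_intersecting_family G F"
  shows "\<exists>P\<in>fst G. F = circles_through G P"
proof -
  obtain Q where Q: "hyperbolic_quadric Q" "G = (Q, oval_sections Q)" using G by (auto simp: ovoidal_minkowski_plane_def)
  obtain L L' :: "'a ^ 4 \<Rightarrow> 'a ^ 4" where L: "\<And>x y. L (x + y) = L x + L y" "\<And>c x. L (c *s x) = c *s L x"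
    "\<And>x. L (L' x) = x" "\<And>x. L' (L x) = x" and QL: "Q = {P\<in>pg_points. \<forall>v\<in>P. det4 (L v) = 0}"
    by (rule hyperbolic_quadric_det4[OF Q(1)]) (rule that)
  have L0: "L x = 0 \<longleftrightarrow> x = 0" for x using L(2)[of 0 0] L(4) by (metis vector_smult_lzero)
  interpret r: ruled pg_points pg_points rep "rep :: ('a ^ 2) set \<Rightarrow> 'a ^ 2"
    by unfold_locales (use q in \<open>simp_all add: card_pg_points2 cross2_rep_rep\<close>)
  let ?I = "pg_points :: ('a ^ 2) set set"
  define g where "g P = pt (L' (r.w P))" for P
  have rep0: "rep x \<noteq> 0" if "x \<in> ?I" for x using rep[OF that] by blast
  have w0: "L' (r.w P) \<noteq> 0" if P: "P \<in> ?I \<times> ?I" for P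
  proof
    assume "L' (r.w P) = 0"
    hence "r.w P = 0" using L(3)[of "r.w P"] L0[of 0] by simp
    hence "rep (snd P) = 0 \<or> rep (fst P) = 0" by (auto simp: r.w_def vec4_eq_iff vec2_eq_iff)
    thus False using rep0 P by (auto simp: mem_Times_iff)
  qed
  have inj: "inj_on g (?I \<times> ?I)"
  proof (rule inj_onI)
    fix P R assume P: "P \<in> ?I \<times> ?I" and R: "R \<in> ?I \<times> ?I" and e: "g P = g R"
    have "\<exists>c. L' (r.w R) = c *s L' (r.w P)" using e unfolding g_def pt_eq_iff[OF w0[OF P] w0[OF R]] .
    then obtain c where "L' (r.w R) = c *s L' (r.w P)" by blast
    hence "L (L' (r.w R)) = c *s L (L' (r.w P))" by (simp only: L(2))
    hence "r.w R = c *s r.w P" unfolding L(3) .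
    note * = ten_eq_scaleD[OF this[unfolded r.w_def]]
    have "rep (fst R) \<noteq> 0" "rep (snd R) \<noteq> 0" using rep0 R by (simp_all add: mem_Times_iff)
    hence "cross2 (rep (snd R)) (rep (snd P)) = 0" "cross2 (rep (fst R)) (rep (fst P)) = 0" using * by auto
    thus "P = R" using cross2_rep_rep P R by (metis mem_Times_iff prod_eqI)
  qed
  have gQ: "g ` (?I \<times> ?I) = Q"
  proof (intro subset_antisym subsetI)
    fix X assume "X \<in> g ` (?I \<times> ?I)"
    then obtain P where P: "P \<in> ?I \<times> ?I" "X = g P" by blast
    have "det4 (L (c *s L' (r.w P))) = 0" for c unfolding L(2,3) by (simp add: det4_scale r.w_def det4_ten)
    thus "X \<in> Q" using pt_in_pg_points[OF w0[OF P(1)]] unfolding QL P(2) g_def pt_def by auto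
  next
    fix X assume X: "X \<in> Q"
    obtain v where v: "v \<noteq> 0" "X = pt v" using X pg_pointE unfolding QL by blast
    have "det4 (L v) = 0" using X v(2) self_in_pt unfolding QL by blast
    then obtain a b where ab: "L v = ten a b" by (rule det4_eq_0D)
    have "L v \<noteq> 0" using L0 v(1) by blast
    hence ab0: "a \<noteq> 0" "b \<noteq> 0" unfolding ab by (auto simp: vec4_eq_iff)
    obtain y where y: "y \<in> ?I" "cross2 (rep y) a = 0" using ex1_representative[OF r.card_J r.t_cross ab0(1)] by blast
    obtain x where x: "x \<in> ?I" "cross2 (rep x) b = 0" using ex1_representative[OF r.card_I r.u_cross ab0(2)] by blast
    obtain d where d: "a = d *s rep y" using cross2_eq_0D[OF y(2) rep0[OF y(1)]] by blast
    obtain c where c: "b = c *s rep x" using cross2_eq_0D[OF x(2) rep0[OF x(1)]] by blast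
    have P: "(x, y) \<in> ?I \<times> ?I" using x y by simp
    have "L v = (d * c) *s L (L' (r.w (x, y)))"
      unfolding ab c d L(3) by (simp add: r.w_def vec4_eq_iff algebra_simps)
    hence "L' (L v) = L' (L ((d * c) *s L' (r.w (x, y))))" unfolding L(2) by simp
    hence "v = (d * c) *s L' (r.w (x, y))" unfolding L(4) .
    hence "\<exists>k. v = k *s L' (r.w (x, y))" by (rule exI)
    hence "pt (L' (r.w (x, y))) = pt v" by (rule pt_eq_iff[OF w0[OF P] v(1), THEN iffD2])
    hence "X = g (x, y)" unfolding v(2) g_def by (rule sym)
    thus "X \<in> g ` (?I \<times> ?I)" using P by (rule image_eqI)
  qed
  define B where "B v x = det_form (L v) (L x)" for v x
  interpret B: bilinear_form B
  proof
    show "B (x + y) z = B x z + B y z" "B (c *s x) z = c * B x z" "B x z = B z x" for x y z c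
      by (simp_all add: B_def L det_form_add det_form_scale det_form_sym[of "L x"])
    fix x :: "'a ^ 4" assume "x \<noteq> 0"
    hence x0: "L x \<noteq> 0" using L0 by blast
    have "\<exists>z. det_form (L x) z \<noteq> 0"
    proof (rule ccontr)
      assume "\<not> ?thesis"
      hence z: "det_form (L x) z = 0" for z by blast
      show False using x0 z[of "axis 1 1"] z[of "axis 2 1"] z[of "axis 3 1"] z[of "axis 4 1"]
        by (simp add: det_form_def axis_def vec4_eq_iff)
    qed
    then obtain z where "det_form (L x) z \<noteq> 0" by blast
    hence "B x (L' z) \<noteq> 0" unfolding B_def L(3) .
    thus "\<exists>z. B x z \<noteq> 0" by blast
  qed
  have sec: "on Q (B.perp N) = g ` r.gr (L N)" for N
  proof -
    have "g P \<subseteq> B.perp N \<longleftrightarrow> det_form (L N) (r.w P) = 0" for P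
      unfolding g_def pt_subset_iff[OF B.perp_subspace] by (simp add: B.perp_def B_def L(3))
    thus ?thesis unfolding gQ[symmetric] on_def r.gr_def by blast
  qed
  have cardg: "card (g ` r.gr v) = card (r.gr v)" for v
    by (rule card_image) (rule inj_on_subset[OF inj], simp add: r.gr_def)
  \<comment> \<open>The determinant of a combination of \<open>w P\<close> and \<open>w R\<close> is
    the product of the coefficients and \<open>det_form (w P) (w R)\<close>, which is nonzero for
    different points of a circle. So a third point of the quadric on their line would have a zero
    coefficient.\<close>
  have no_line: "no_three_on_a_line (g ` C)" if C: "C \<in> r.circs" for C
    unfolding no_three_on_a_line_def
  proof (intro ballI impI notI)
    fix X Y Z assume X: "X \<in> g ` C" and Y: "Y \<in> g ` C" and Z: "Z \<in> g ` C" and ne: "X \<noteq> Y \<and> X \<noteq> Z \<and> Y \<noteq> Z"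
    assume "\<exists>l\<in>pg_lines. X \<subseteq> l \<and> Y \<subseteq> l \<and> Z \<subseteq> l"
    then obtain l where l: "l \<in> pg_lines" "X \<subseteq> l" "Y \<subseteq> l" "Z \<subseteq> l" by blast
    obtain P R where P: "P \<in> C" "X = g P" and R: "R \<in> C" "Y = g R" using X Y by blast
    have pg: "X \<in> pg_points" "Y \<in> pg_points" "Z \<in> pg_points"
      using X Y Z gQ r.circ_sub[OF C] unfolding QL by blast+
    have rX: "det4 (L (rep V)) = 0" "rep V \<in> V" if "V \<in> g ` C" for V
    proof -
      have VQ: "V \<in> Q" using that gQ r.circ_sub[OF C] by blast
      hence V: "V \<in> pg_points" unfolding QL by blast
      show *: "rep V \<in> V" using rep[OF V] by (metis self_in_pt)
      show "det4 (L (rep V)) = 0" using VQ * unfolding QL by blast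
    qed
    have ex: "\<exists>c. c \<noteq> 0 \<and> L (rep (g P)) = c *s r.w P" if P: "P \<in> C" for P
    proof -
      have PI: "P \<in> ?I \<times> ?I" using P r.circ_sub[OF C] by blast
      have "rep (g P) \<in> g P" by (rule rX(2)) (use P in blast)
      then obtain c where c: "rep (g P) = c *s L' (r.w P)" unfolding g_def pt_def by blast
      have "g P \<in> pg_points" unfolding g_def by (rule pt_in_pg_points[OF w0[OF PI]])
      hence "c \<noteq> 0" using c rep by fastforce
      thus ?thesis unfolding c L(2,3) by blast
    qed
    obtain a where a: "a \<noteq> 0" "L (rep X) = a *s r.w P" using ex[OF P(1)] unfolding P(2)[symmetric] by blast
    obtain b where b: "b \<noteq> 0" "L (rep Y) = b *s r.w R" using ex[OF R(1)] unfolding R(2)[symmetric] by blast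
    have XYne: "X \<noteq> Y" using ne by blast
    have "rep Z \<in> l" using rX(2)[OF Z] l(4) by blast
    then obtain c d where cd: "rep Z = c *s rep X + d *s rep Y" by (rule in_line_span[OF pg(1,2) XYne l(1-3)])
    have "det4 (L (rep Z)) = c * d * a * b * det_form (r.w P) (r.w R)"
    proof -
      have "L (rep Z) = (c * a) *s r.w P + (d * b) *s r.w R" unfolding cd L(1,2) a(2) b(2) by (simp add: vector_smult_assoc)
      moreover have "det_form ((c * a) *s r.w P) ((d * b) *s r.w R) = c * a * (d * b * det_form (r.w P) (r.w R))"
        by (metis det_form_scale det_form_sym)
      ultimately show ?thesis by (simp add: det4_add det4_scale r.w_def det4_ten algebra_simps)
    qed
    moreover have "det_form (r.w P) (r.w R) \<noteq> 0"
      using r.w_not_perp[OF C P(1) R(1)] XYne P(2) R(2) by blast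
    ultimately have "c = 0 \<or> d = 0" using rX(1)[OF Z] a(1) b(1) by simp
    moreover have "Z = V" if "V \<in> pg_points" "rep Z = k *s rep V" for V k
    proof -
      have "pt (rep V) = pt (rep Z)"
        unfolding pt_eq_iff[OF conjunct1[OF rep[OF that(1)]] conjunct1[OF rep[OF pg(3)]]] using that(2) by blast
      thus ?thesis using rep that(1) pg(3) by metis
    qed
    ultimately show False using cd ne pg by (metis add.left_neutral add.right_neutral vector_smult_lzero)
  qed
  have on_eq: "section_by Q E = on Q E" for E by (auto simp: section_by_def on_def)
  \<comment> \<open>If the pole is singular, the section contains all points with a certain first
    and all points with a certain second coordinate, hence more than \<open>q + 1\<close>
    points.\<close>
  have oval: "oval_plane Q (B.perp N) \<longleftrightarrow> det4 (L N) \<noteq> 0" if N: "N \<noteq> 0" for N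
  proof
    assume d: "det4 (L N) \<noteq> 0"
    hence C: "r.gr (L N) \<in> r.circs" by (auto simp: r.circs_def)
    have "on Q (B.perp N) \<subseteq> pg_points" unfolding QL on_def by blast
    moreover have "\<forall>P\<in>on Q (B.perp N). P \<subseteq> B.perp N" unfolding on_def by blast
    moreover have "card (on Q (B.perp N)) = CARD('a) + 1" unfolding sec cardg by (rule r.card_circ[OF C])
    moreover have "no_three_on_a_line (on Q (B.perp N))" unfolding sec by (rule no_line[OF C])
    ultimately show "oval_plane Q (B.perp N)"
      unfolding oval_plane_def oval_in_def on_eq using B.perp_plane[OF N] by iprover
  next
    assume o: "oval_plane Q (B.perp N)"
    show "det4 (L N) \<noteq> 0"
    proof
      assume "det4 (L N) = 0"
      then obtain a b where ab: "L N = ten a b" by (rule det4_eq_0D)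
      have "L N \<noteq> 0" using L0 N by blast
      hence ab0: "a \<noteq> 0" "b \<noteq> 0" unfolding ab by (auto simp: vec4_eq_iff)
      obtain y where y: "y \<in> ?I" "cross2 (rep y) a = 0" using ex1_representative[OF r.card_J r.t_cross ab0(1)] by blast
      obtain x where x: "x \<in> ?I" "cross2 (rep x) b = 0" using ex1_representative[OF r.card_I r.u_cross ab0(2)] by blast
      have "cross2 a (rep y) = 0" "cross2 b (rep x) = 0" using x y cross2_sym[of a] cross2_sym[of b] by simp_all
      hence sub: "({x} \<times> ?I) \<union> (?I \<times> {y}) \<subseteq> r.gr (L N)"
        using x(1) y(1) unfolding ab by (auto simp: r.gr_def r.w_def det_form_ten_ten)
      have "card ?I \<noteq> card {x}" using r.card_I q by simp
      hence "?I \<noteq> {x}" by metis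
      then obtain x' where x': "x' \<in> ?I" "x' \<noteq> x" using x(1) by blast
      have fin: "finite (r.gr (L N))" by simp
      have "card (insert (x', y) ({x} \<times> ?I)) \<le> card (r.gr (L N))"
        by (rule card_mono[OF fin]) (use sub x' in blast)
      moreover have "card (insert (x', y) ({x} \<times> ?I)) = card ({x} \<times> ?I) + 1" using x'(2) by simp
      moreover have "card ({x} \<times> ?I) = CARD('a) + 1" using r.card_I by (simp add: card_cartesian_product)
      moreover have "card (on Q (B.perp N)) = CARD('a) + 1" using o unfolding oval_plane_def oval_in_def on_eq by blast
      ultimately show False unfolding sec cardg by linarith
    qed
  qed
  have X: "oval_sections Q = (`) g ` r.circs"
  proof (intro subset_antisym subsetI)
    fix C assume "C \<in> oval_sections Q"
    then obtain E where E: "C = on Q E" "oval_plane Q E" unfolding oval_sections_def on_eq by blast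
    have "E \<in> pg_planes" using E(2) unfolding oval_plane_def oval_in_def by blast
    then obtain N where N: "N \<noteq> 0" "E = B.perp N" by (rule B.plane_perp)
    have "det4 (L N) \<noteq> 0" using oval[OF N(1)] E(2) unfolding N(2) by blast
    thus "C \<in> (`) g ` r.circs" unfolding E(1) N(2) sec r.circs_def by blast
  next
    fix C assume "C \<in> (`) g ` r.circs"
    then obtain v where v: "det4 v \<noteq> 0" "C = g ` r.gr v" unfolding r.circs_def by blast
    have LN: "L (L' v) = v" by (rule L(3))
    have "L' v \<noteq> 0" using v(1) LN L0[of 0] by (auto simp: det4_def)
    hence "oval_plane Q (B.perp (L' v))" using oval[of "L' v"] v(1) unfolding LN by blast
    moreover have "C = on Q (B.perp (L' v))" unfolding sec LN v(2) ..
    ultimately show "C \<in> oval_sections Q" unfolding oval_sections_def on_eq by blast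
  qed
  have FX: "F \<subseteq> oval_sections Q" and int: "\<And>C D. C \<in> F \<Longrightarrow> D \<in> F \<Longrightarrow> C \<inter> D \<noteq> {}"
    using F Q(2) by (auto simp: largest_intersecting_family_def intersecting_family_def)
  define F' where "F' = {C\<in>r.circs. g ` C \<in> F}"
  have FF: "F = (`) g ` F'" using FX unfolding X F'_def by blast
  have injC: "inj_on ((`) g) r.circs"
  proof (rule inj_onI)
    fix C D assume "C \<in> r.circs" "D \<in> r.circs" "g ` C = g ` D"
    thus "C = D" using inj_on_image_eq_iff[OF inj] r.circ_sub by metis
  qed
  have cF: "card F = card F'" unfolding FF
    by (rule card_image) (rule inj_on_subset[OF injC], simp add: F'_def)
  have mem_g: "g P \<in> g ` C \<longleftrightarrow> P \<in> C" if "P \<in> ?I \<times> ?I" "C \<in> r.circs" for P C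
    using inj_on_image_mem_iff[OF inj that(1) r.circ_sub[OF that(2)]] .
  have "?I \<noteq> {}" using r.card_I by auto
  then obtain x where "x \<in> ?I" by blast
  hence P: "(x, x) \<in> ?I \<times> ?I" by simp
  have gG: "g P \<in> fst G" if "P \<in> ?I \<times> ?I" for P
    unfolding Q(2) fst_conv using imageI[OF that, of g] unfolding gQ .
  have thr: "circles_through G (g P) = (`) g ` {C\<in>r.circs. P \<in> C}" if "P \<in> ?I \<times> ?I" for P
    unfolding circles_through_def Q(2) snd_conv X using mem_g[OF that] by blast
  have "card ((`) g ` {C\<in>r.circs. (x, x) \<in> C}) = card {C\<in>r.circs. (x, x) \<in> C}"
    by (rule card_image) (rule inj_on_subset[OF injC], simp)
  hence "card {C\<in>r.circs. (x, x) \<in> C} \<le> card F"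
    using largest_ge[OF F gG[OF P]] unfolding thr[OF P] by linarith
  hence big: "CARD('a) * (CARD('a) - 1) \<le> card F'" using r.card_through[OF P] cF by simp
  have "\<exists>P\<in>?I \<times> ?I. F' = {C\<in>r.circs. P \<in> C}"
  proof (rule minkowski_intersecting_family[OF r.classed_circle_geometry_axioms r.card_I r.card_J r.circ_row r.circ_col _ _ big])
    show "F' \<subseteq> r.circs" unfolding F'_def by blast
    fix C D assume C: "C \<in> F'" and D: "D \<in> F'"
    hence "g ` C \<inter> g ` D \<noteq> {}" using int unfolding F'_def by blast
    moreover have "g ` C \<inter> g ` D = g ` (C \<inter> D)"
      using inj_on_image_Int[OF inj] C D r.circ_sub unfolding F'_def by blast
    ultimately show "C \<inter> D \<noteq> {}" by (simp only: image_is_empty not_False_eq_True)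
  qed
  then obtain P where P: "P \<in> ?I \<times> ?I" "F' = {C\<in>r.circs. P \<in> C}" by blast
  have "F = circles_through G (g P)" unfolding FF P(2) thr[OF P(1)] ..
  thus ?thesis using gG[OF P(1)] by (rule bexI)
qed

section \<open>Laguerre planes\<close>

lemma sum_of_bool_eq: "(\<Sum>a\<in>(UNIV::'a::finite set). of_bool (a = c) * g) = (g :: real)"
  by (simp add: sum_distrib_right[symmetric] of_bool_def)

locale oval_cone = arc S for S :: "('a::{field,finite} ^ 4) set set" +
  fixes R E :: "('a ^ 4) set"
  assumes R: "R \<in> pg_points" and E: "E \<in> pg_planes" and RE: "\<not> R \<subseteq> E"
    and SE: "X \<in> S \<Longrightarrow> X \<subseteq> E" and card_S: "card S = CARD('a) + 1" and q_gt_2: "CARD('a) > 2"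
begin

interpretation d: bilinear_form "dot :: 'a ^ 4 \<Rightarrow> 'a ^ 4 \<Rightarrow> 'a" by (rule bilinear_dot)

definition r :: "'a ^ 4" where "r = rep R"

text \<open>Planes not through \<open>R\<close> are the kernels of the functionals in \<open>U\<close>.\<close>

definition U :: "('a ^ 4) set" where "U = {u. dot u r = 1}"

text \<open>The nucleus is kept as a set with at most one element (\<open>nuc_unique\<close>), empty
  for odd \<open>q\<close> (\<open>nuc_even\<close>), so that both parities are treated
  alike.\<close>

definition nuc :: "('a ^ 4) set set" where
  "nuc = {N\<in>on pg_points E. N \<notin> S \<and> (\<forall>L\<in>pg_lines. N \<subseteq> L \<longrightarrow> L \<subseteq> E \<longrightarrow> card (on S L) = 1)}"

abbreviation val :: "'a ^ 4 \<Rightarrow> ('a ^ 4) set \<Rightarrow> 'a" where "val u p \<equiv> dot u (rep p)"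

lemma r: "r \<noteq> 0" "R = pt r"
  using rep[OF R] by (simp_all add: r_def)

lemma E_subspace: "vec.subspace E" by (rule pg_plane_subspace(1)[OF E])

lemma r_notin: "r \<notin> E"
  using RE pt_subset_iff[OF E_subspace, of r] r(2) by blast

lemma S_E: "X \<in> S \<Longrightarrow> X \<in> on pg_points E"
  using points SE unfolding mem_on by blast

lemma on_E: "on S E = S"
proof (rule set_eqI)
  show "X \<in> on S E \<longleftrightarrow> X \<in> S" for X unfolding mem_on by (rule iffI, erule conjunct1, rule conjI, assumption, erule SE)
qed

lemma R_perp: "R \<subseteq> d.perp f \<longleftrightarrow> dot f r = 0"
proof -
  have "pt r \<subseteq> d.perp f \<longleftrightarrow> dot f r = 0" unfolding pt_subset_iff[OF d.perp_subspace] by (simp add: d.perp_def)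
  thus ?thesis unfolding r(2)[symmetric] .
qed

lemma val_zero: "p \<in> pg_points \<Longrightarrow> val f p = 0 \<longleftrightarrow> p \<subseteq> d.perp f"
  by (simp only: rep_subset_iff[OF _ d.perp_subspace]) (simp only: d.perp_def mem_Collect_eq)

lemma trace_line:
  assumes "f \<noteq> 0" "dot f r = 0" shows "d.perp f \<inter> E \<in> pg_lines"
proof (rule planes_Int[OF d.perp_plane[OF assms(1)] E])
  show "d.perp f \<noteq> E" using R_perp[of f] assms(2) RE by metis
qed

definition indep :: "('a ^ 4) set \<Rightarrow> ('a ^ 4) set \<Rightarrow> ('a ^ 4) set \<Rightarrow> bool" where
  "indep p1 p2 p3 \<longleftrightarrow> p1 \<in> on pg_points E \<and> p2 \<in> on pg_points E \<and> p3 \<in> on pg_points E \<and>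
    \<not> (\<exists>L\<in>pg_lines. p1 \<subseteq> L \<and> p2 \<subseteq> L \<and> p3 \<subseteq> L)"

lemma indep_zero:
  assumes p: "indep p1 p2 p3" and u: "dot u r = 0" "val u p1 = 0" "val u p2 = 0" "val u p3 = 0"
  shows "u = 0"
proof (rule ccontr)
  assume "u \<noteq> 0"
  hence L: "d.perp u \<inter> E \<in> pg_lines" using trace_line u(1) by blast
  have "x \<subseteq> d.perp u \<inter> E" if "x \<in> on pg_points E" "val u x = 0" for x
    using that val_zero[of x u] by (simp only: mem_on Int_subset_iff)
  hence "p1 \<subseteq> d.perp u \<inter> E" "p2 \<subseteq> d.perp u \<inter> E" "p3 \<subseteq> d.perp u \<inter> E"
    using p u unfolding indep_def by iprover+
  thus False using p L unfolding indep_def by blast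
qed

text \<open>The vectors \<open>r\<close>, \<open>rep p1\<close>, \<open>rep p2\<close>,
  \<open>rep p3\<close> form a basis. The values of \<open>u\<close> in \<open>U\<close> at three
  noncollinear points of \<open>E\<close> are therefore independent and determine \<open>u\<close>,
  which turns sums over \<open>U\<close> into triple sums over the field.\<close>

lemma bij3:
  assumes p: "indep p1 p2 p3"
  shows "bij_betw (\<lambda>u. (val u p1, val u p2, val u p3)) U UNIV"
proof -
  let ?f = "\<lambda>u. (dot u r, val u p1, val u p2, val u p3)"
  have inj: "inj ?f"
  proof (rule injI)
    fix u v assume "?f u = ?f v"
    hence "u - v = 0" by (intro indep_zero[OF p]) (simp_all add: dot_diff)
    thus "u = v" by simp
  qed
  have "card (range ?f) = card (UNIV :: ('a ^ 4) set)" by (rule card_image[OF inj])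
  also have "\<dots> = card (UNIV :: ('a \<times> 'a \<times> 'a \<times> 'a) set)"
    using card_subspace[of "UNIV :: ('a ^ 4) set"] unfolding dim_UNIV4 by (simp add: card_prod power4_eq_xxxx)
  finally have surj: "range ?f = UNIV" by (intro card_subset_eq) simp_all
  show ?thesis unfolding bij_betw_def
  proof
    show "inj_on (\<lambda>u. (val u p1, val u p2, val u p3)) U"
      using inj by (auto simp: inj_def inj_on_def U_def)
    have "x \<in> (\<lambda>u. (val u p1, val u p2, val u p3)) ` U" for x
    proof -
      have "(1, x) \<in> range ?f" unfolding surj by (rule UNIV_I)
      then obtain u where "(1, x) = ?f u" by (rule rangeE)
      hence "x = (val u p1, val u p2, val u p3)" "u \<in> U" by (simp_all add: U_def)
      thus ?thesis by (rule image_eqI)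
    qed
    thus "(\<lambda>u. (val u p1, val u p2, val u p3)) ` U = UNIV" by blast
  qed
qed

lemma sum3:
  fixes h :: "'a \<Rightarrow> 'a \<Rightarrow> 'a \<Rightarrow> real"
  assumes p: "indep p1 p2 p3"
  shows "(\<Sum>u\<in>U. h (val u p1) (val u p2) (val u p3)) = (\<Sum>a\<in>UNIV. \<Sum>b\<in>UNIV. \<Sum>c\<in>UNIV. h a b c)"
proof -
  have "(\<Sum>u\<in>U. h (val u p1) (val u p2) (val u p3)) = (\<Sum>x\<in>UNIV. case x of (a, b, c) \<Rightarrow> h a b c)"
    using sum.reindex_bij_betw[OF bij3[OF p], of "\<lambda>(a, b, c). h a b c"] by simp
  also have "\<dots> = (\<Sum>a\<in>UNIV. \<Sum>b\<in>UNIV. \<Sum>c\<in>UNIV. h a b c)"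
    unfolding UNIV_Times_UNIV[symmetric] sum.cartesian_product by (simp only: split_def)
  finally show ?thesis .
qed

lemma four_le: "card S \<ge> 4" using card_S q_gt_2 by simp

lemma indep_S:
  assumes p: "p \<in> on pg_points E"
  obtains X Y where "X \<in> S" "Y \<in> S" "indep p X Y"
proof -
  have "\<not> S \<subseteq> {p}"
  proof
    assume "S \<subseteq> {p}"
    hence "card S \<le> card {p}" by (intro card_mono) auto
    thus False using four_le by simp
  qed
  then obtain X where X: "X \<in> S" "X \<noteq> p" by auto
  have pg: "p \<in> pg_points" "X \<in> pg_points" using p X points by (auto simp: mem_on)
  obtain L where L: "L \<in> pg_lines" "p \<subseteq> L" "X \<subseteq> L" using joinE[OF pg X(2)[symmetric]] .
  have "\<not> S \<subseteq> on S L"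
  proof
    assume "S \<subseteq> on S L"
    hence "card S \<le> card (on S L)" by (intro card_mono) auto
    thus False using card_line_le[OF L(1)] four_le by simp
  qed
  then obtain Y where Y: "Y \<in> S" "Y \<notin> on S L" by blast
  have "\<not> Y \<subseteq> L" using Y unfolding mem_on by iprover
  have "indep p X Y" unfolding indep_def
  proof (intro conjI notI)
    assume "\<exists>M\<in>pg_lines. p \<subseteq> M \<and> X \<subseteq> M \<and> Y \<subseteq> M"
    then obtain M where M: "M \<in> pg_lines" "p \<subseteq> M" "X \<subseteq> M" "Y \<subseteq> M" by blast
    have "M = L" by (rule join_unique[OF pg X(2)[symmetric] M(1-3) L])
    thus False using M(4) \<open>\<not> Y \<subseteq> L\<close> by iprover
  qed (use p S_E X Y in auto)
  thus ?thesis using that X Y by blast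
qed

lemma ex_point: obtains p where "p \<in> S" using four_le by fastforce

lemma card_U: "card U = CARD('a) ^ 3"
proof -
  obtain p where "p \<in> S" by (rule ex_point)
  hence "p \<in> on pg_points E" by (rule S_E)
  then obtain X Y where "indep p X Y" by (rule indep_S)
  from bij_betw_same_card[OF bij3[OF this]] show ?thesis by (simp add: card_prod power3_eq_cube)
qed

lemma sum_val:
  assumes p: "p \<in> on pg_points E"
  shows "(\<Sum>u\<in>U. of_bool (val u p = c)) = (real (CARD('a)))\<^sup>2"
proof -
  obtain X Y where "indep p X Y" by (rule indep_S[OF p])
  from sum3[OF this, of "\<lambda>a _ _. of_bool (a = c)"] show ?thesis
    by (simp add: sum_distrib_left[symmetric] power2_eq_square of_bool_def cong: if_cong)
qed

lemma card_val:
  assumes p: "p \<in> on pg_points E"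
  shows "card {u\<in>U. val u p = c} = CARD('a)\<^sup>2"
proof -
  have "real (card {u\<in>U. val u p = c}) = (\<Sum>u\<in>U. of_bool (val u p = c))"
    by (simp add: of_bool_def sum.If_cases Int_def)
  thus ?thesis using sum_val[OF p, of c] by (simp only: of_nat_power[symmetric] of_nat_eq_iff)
qed

lemma nuc_tangent:
  assumes "N \<in> nuc" "L \<in> pg_lines" "N \<subseteq> L" "L \<subseteq> E" shows "card (on S L) = 1"
  using assms unfolding nuc_def by simp

lemma nuc_point: "N \<in> nuc \<Longrightarrow> N \<in> pg_points" "N \<in> nuc \<Longrightarrow> N \<subseteq> E" "N \<in> nuc \<Longrightarrow> N \<notin> S" "N \<in> nuc \<Longrightarrow> N \<in> on pg_points E"
  unfolding nuc_def by (simp_all only: mem_Collect_eq mem_on) iprover+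

lemma nuc_even: assumes N: "N \<in> nuc" shows "even (CARD('a))"
proof (rule no_external_arc_point[OF _ E _ nuc_point(1)[OF N] nuc_point(3)[OF N] nuc_point(2)[OF N]])
  show "arc S" by unfold_locales
  show "card (on S E) = CARD('a) + 1" unfolding on_E by (rule card_S)
  show "card (on S L) \<le> 1" if "L \<in> pg_lines" "N \<subseteq> L" "L \<subseteq> E" for L using nuc_tangent[OF N that] by simp
qed

lemma nuc_all_tangents:
  assumes N: "N \<in> nuc" and L: "L \<in> pg_lines" "L \<subseteq> E" "card (on S L) = 1"
  shows "N \<subseteq> L"
proof -
  obtain X where X: "X \<in> S" "X \<subseteq> L" using L(3) by (metis line_pointE L(1))
  have pg: "N \<in> pg_points" "X \<in> pg_points" "N \<noteq> X" using nuc_point[OF N] X(1) points by blast+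
  obtain M where M: "M \<in> pg_lines" "N \<subseteq> M" "X \<subseteq> M" using joinE[OF pg] .
  have ME: "M \<subseteq> E" by (rule line_subset[OF pg M E_subspace nuc_point(2)[OF N] SE[OF X(1)]])
  have "card {L\<in>covers X E. card (on S L) = 1} = 1"
    using card_tangents_plane[OF X(1) SE[OF X(1)] E] unfolding on_E card_S by simp
  then obtain T where T: "{L\<in>covers X E. card (on S L) = 1} = {T}" by (rule card_1_singletonE)
  have "L \<in> {T}" unfolding T[symmetric] using L X(2) pg(2) by (simp add: mem_lines_iff)
  moreover have "M \<in> {T}" unfolding T[symmetric] using M ME nuc_tangent[OF N M(1,2) ME] pg(2) by (simp add: mem_lines_iff)
  ultimately show ?thesis using M(2) by simp
qed

text \<open>All tangents pass through both points, so there is only one tangent, and it would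
  contain the whole oval.\<close>

lemma nuc_unique: assumes N: "N \<in> nuc" and N': "N' \<in> nuc" shows "N = N'"
proof (rule ccontr)
  assume ne: "N \<noteq> N'"
  obtain M where M: "M \<in> pg_lines" "N \<subseteq> M" "N' \<subseteq> M" using joinE[OF nuc_point(1)[OF N] nuc_point(1)[OF N'] ne] .
  have ME: "M \<subseteq> E" by (rule line_subset[OF nuc_point(1)[OF N] nuc_point(1)[OF N'] ne M E_subspace nuc_point(2)[OF N] nuc_point(2)[OF N']])
  have cM: "card (on S M) = 1" by (rule nuc_tangent[OF N M(1,2) ME])
  have "S \<subseteq> on S M"
  proof
    fix X assume X: "X \<in> S"
    have pg: "X \<in> pg_points" "N \<noteq> X" using X points nuc_point(3)[OF N] by blast+
    obtain L where L: "L \<in> pg_lines" "N \<subseteq> L" "X \<subseteq> L" using joinE[OF nuc_point(1)[OF N] pg] .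
    have LE: "L \<subseteq> E" by (rule line_subset[OF nuc_point(1)[OF N] pg L E_subspace nuc_point(2)[OF N] SE[OF X]])
    have "N' \<subseteq> L" by (rule nuc_all_tangents[OF N' L(1) LE nuc_tangent[OF N L(1,2) LE]])
    hence "L = M" using join_unique[OF nuc_point(1)[OF N] nuc_point(1)[OF N'] ne L(1,2) _ M] by blast
    thus "X \<in> on S M" using X L(3) by (simp add: mem_on)
  qed
  hence "card S \<le> card (on S M)" by (intro card_mono) auto
  thus False using cM four_le by simp
qed

text \<open>The oval together with its nucleus, if there is one. These are the points of
  \<open>E\<close> through which no line external to the oval passes.\<close>

definition special :: "('a ^ 4) set set" where "special = S \<union> nuc"

lemma special_E: "p \<in> special \<Longrightarrow> p \<in> on pg_points E"
  unfolding special_def using S_E nuc_point(4) by blast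

lemma special_indep:
  assumes "p1 \<in> special" "p2 \<in> special" "p3 \<in> special" and ne: "p1 \<noteq> p2" "p1 \<noteq> p3" "p2 \<noteq> p3"
  shows "indep p1 p2 p3"
  unfolding indep_def
proof (intro conjI notI)
  assume "\<exists>L\<in>pg_lines. p1 \<subseteq> L \<and> p2 \<subseteq> L \<and> p3 \<subseteq> L"
  then obtain L where L: "L \<in> pg_lines" "p1 \<subseteq> L" "p2 \<subseteq> L" "p3 \<subseteq> L" by blast
  have pg: "p \<in> pg_points" "p \<subseteq> E" if "p \<in> special" for p
    using special_E[OF that] unfolding mem_on by iprover+
  have LE: "L \<subseteq> E"
    by (rule line_subset[OF pg(1)[OF assms(1)] pg(1)[OF assms(2)] ne(1) L(1-3) E_subspace pg(2)[OF assms(1)] pg(2)[OF assms(2)]])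
  have two: False if N: "N \<in> nuc" "N \<subseteq> L" and X: "X \<in> S" "X \<subseteq> L" "Y \<in> S" "Y \<subseteq> L" "X \<noteq> Y" for N X Y
  proof -
    have "{X, Y} \<subseteq> on S L" using X by (simp add: mem_on)
    hence "card {X, Y} \<le> card (on S L)" by (intro card_mono) auto
    thus False using nuc_tangent[OF N(1) L(1) N(2) LE] X(5) by simp
  qed
  have "p1 \<in> S \<or> p1 \<in> nuc" "p2 \<in> S \<or> p2 \<in> nuc" "p3 \<in> S \<or> p3 \<in> nuc" using assms unfolding special_def by blast+
  then consider "p1 \<in> S" "p2 \<in> S" "p3 \<in> S" | "p1 \<in> nuc" "p2 \<in> nuc" | "p1 \<in> nuc" "p3 \<in> nuc" | "p2 \<in> nuc" "p3 \<in> nuc"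
    | "p1 \<in> nuc" "p2 \<in> S" "p3 \<in> S" | "p1 \<in> S" "p2 \<in> nuc" "p3 \<in> S" | "p1 \<in> S" "p2 \<in> S" "p3 \<in> nuc" by argo
  thus False
  proof cases
    case 1 thus ?thesis using no_threeD[OF 1 ne L] by blast
  next
    case 2 thus ?thesis using nuc_unique ne by blast
  next
    case 3 thus ?thesis using nuc_unique ne by blast
  next
    case 4 thus ?thesis using nuc_unique ne by blast
  next
    case 5 thus ?thesis using two[OF 5(1) L(2) 5(2) L(3) 5(3) L(4)] ne by blast
  next
    case 6 thus ?thesis using two[OF 6(2) L(3) 6(1) L(2) 6(3) L(4)] ne by blast
  next
    case 7 thus ?thesis using two[OF 7(3) L(4) 7(1) L(2) 7(2) L(3)] ne by blast
  qed
qed (use assms special_E in blast)+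

lemma third_point:
  obtains p'' where "p'' \<in> S" "p'' \<noteq> p" "p'' \<noteq> p'"
proof -
  have "\<not> S \<subseteq> {p, p'}"
  proof
    assume "S \<subseteq> {p, p'}"
    hence "card S \<le> card {p, p'}" by (intro card_mono) auto
    also have "\<dots> \<le> 2" by (simp add: card_insert_if)
    finally show False using four_le by simp
  qed
  thus ?thesis using that by blast
qed

lemma sum_val2:
  fixes h :: "'a \<Rightarrow> real"
  assumes p: "p \<in> special" "p' \<in> special" "p \<noteq> p'"
  shows "(\<Sum>u\<in>U. of_bool (val u p = c) * h (val u p')) = real (CARD('a)) * (\<Sum>b\<in>UNIV. h b)"
proof -
  obtain p'' where p'': "p'' \<in> S" "p'' \<noteq> p" "p'' \<noteq> p'" by (rule third_point)
  have "indep p p' p''" by (rule special_indep) (use p p'' in \<open>auto simp: special_def\<close>)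
  have "(\<Sum>a\<in>UNIV. \<Sum>b\<in>UNIV. \<Sum>d\<in>(UNIV :: 'a set). of_bool (a = c) * h b)
      = (\<Sum>a\<in>UNIV. of_bool (a = c) * (\<Sum>b\<in>UNIV. \<Sum>d\<in>(UNIV :: 'a set). h b))" by (simp only: sum_distrib_left)
  also have "\<dots> = real (CARD('a)) * (\<Sum>b\<in>UNIV. h b)" unfolding sum_of_bool_eq by (simp add: sum_distrib_left)
  finally show ?thesis using sum3[OF \<open>indep p p' p''\<close>, of "\<lambda>a b _. of_bool (a = c) * h b"] by (rule trans[rotated])
qed

lemma sum_val3:
  fixes h k :: "'a \<Rightarrow> real"
  assumes p: "p \<in> special" "p' \<in> special" "p'' \<in> special" "p \<noteq> p'" "p \<noteq> p''" "p' \<noteq> p''"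
  shows "(\<Sum>u\<in>U. of_bool (val u p = c) * (h (val u p') * k (val u p''))) = (\<Sum>b\<in>UNIV. h b) * (\<Sum>b\<in>UNIV. k b)"
proof -
  have "indep p p' p''" by (rule special_indep[OF p])
  have "(\<Sum>a\<in>UNIV. \<Sum>b\<in>UNIV. \<Sum>d\<in>UNIV. of_bool (a = c) * (h b * k d))
      = (\<Sum>a\<in>UNIV. of_bool (a = c) * (\<Sum>b\<in>UNIV. \<Sum>d\<in>UNIV. h b * k d))" by (simp only: sum_distrib_left)
  also have "\<dots> = (\<Sum>b\<in>UNIV. h b) * (\<Sum>b\<in>UNIV. k b)" unfolding sum_of_bool_eq by (rule sum_product[symmetric])
  finally show ?thesis using sum3[OF \<open>indep p p' p''\<close>, of "\<lambda>a b d. of_bool (a = c) * (h b * k d)"] by (rule trans[rotated])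
qed

text \<open>The plane with equation \<open>f\<close> passes through the vertex and cuts
  \<open>E\<close> in a line external to the oval. Adding a nonzero multiple of \<open>f\<close> to
  an element of \<open>U\<close> changes its value at every point of the oval.\<close>

definition ext :: "'a ^ 4 \<Rightarrow> bool" where
  "ext f \<longleftrightarrow> dot f r = 0 \<and> (\<forall>X\<in>S. val f X \<noteq> 0)"

text \<open>If all \<open>q + 1\<close> lines of \<open>E\<close> through \<open>p\<close> met the
  oval, each would contain exactly one of its \<open>q + 1\<close> points, and \<open>p\<close>
  would be the nucleus.\<close>

lemma ext_through:
  assumes p: "p \<in> on pg_points E" "p \<notin> special"
  obtains f where "ext f" "val f p = 0"
proof -
  have pg: "p \<in> pg_points" "p \<subseteq> E" using p(1) unfolding mem_on by iprover+
  have pS: "p \<notin> S" "p \<notin> nuc" using p(2) unfolding special_def by blast+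
  have "\<exists>L\<in>covers p E. card (on S L) = 0"
  proof (rule ccontr)
    assume a: "\<not> ?thesis"
    have tot: "(\<Sum>L\<in>covers p E. card (on S L)) = (\<Sum>L\<in>covers p E. 1)"
      using sum_lines_out[OF pg(1) pS(1) pg(2) E_subspace] card_lines_plane[OF pg(1) E pg(2)] unfolding on_E card_S by simp
    have ge: "1 \<le> card (on S L)" if L: "L \<in> covers p E" for L
    proof -
      have "card (on S L) \<noteq> 0"
      proof
        assume "card (on S L) = 0"
        hence "\<exists>L\<in>covers p E. card (on S L) = 0" using L by (rule bexI)
        thus False using a by (rule notE[rotated])
      qed
      thus ?thesis by linarith
    qed
    have "card (on S L) = 1" if "L \<in> covers p E" for L
      by (rule sum_mono_inv[OF tot[symmetric] _ that, symmetric]) (use ge in simp_all)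
    hence "p \<in> nuc" unfolding nuc_def using p(1) pS(1) pg(1) by (simp add: mem_lines_iff)
    thus False using pS(2) by blast
  qed
  then obtain L where L: "L \<in> pg_lines" "p \<subseteq> L" "L \<subseteq> E" "card (on S L) = 0" unfolding Bex_def mem_lines_iff[OF pg(1)] by iprover
  have RL: "\<not> R \<subseteq> L" using RE L(3) by (meson subset_trans)
  have "\<exists>F. F \<in> pg_planes \<and> L \<subseteq> F \<and> R \<subseteq> F" using join_plane[OF L(1) R RL] by (rule ex1_implies_ex)
  then obtain F where F: "F \<in> pg_planes" "L \<subseteq> F" "R \<subseteq> F" by iprover
  obtain f where f: "f \<noteq> 0" "F = d.perp f" by (rule d.plane_perp[OF F(1)])
  have fr: "dot f r = 0" using F(3) unfolding f(2) R_perp .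
  have tl: "L = d.perp f \<inter> E" by (rule line_eq_of_subset[OF L(1) trace_line[OF f(1) fr]]) (use F(2) f(2) L(3) in simp)
  have "val f X \<noteq> 0" if X: "X \<in> S" for X
  proof
    assume "val f X = 0"
    hence "X \<subseteq> d.perp f" using val_zero[of X f] points X by blast
    hence "X \<in> on S L" unfolding tl mem_on using X SE[OF X] by simp
    thus False using L(4) by auto
  qed
  moreover have "val f p = 0" unfolding val_zero[OF pg(1)] using L(2) F(2) f(2) by (meson subset_trans)
  ultimately show ?thesis using that fr unfolding ext_def by blast
qed

text \<open>A third point of a secant is not special, so \<open>ext_through\<close> applies to
  it.\<close>

lemma ext_exists: obtains f where "ext f"
proof -
  obtain X where X: "X \<in> S" by (rule ex_point)
  obtain Y where Y: "Y \<in> S" "Y \<noteq> X" by (rule third_point[of X X])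
  have pg: "X \<in> pg_points" "Y \<in> pg_points" "X \<noteq> Y" using X Y points by blast+
  obtain L where L: "L \<in> pg_lines" "X \<subseteq> L" "Y \<subseteq> L" using joinE[OF pg] .
  have LE: "L \<subseteq> E" by (rule line_subset[OF pg L E_subspace SE[OF X] SE[OF Y(1)]])
  have "\<not> on pg_points L \<subseteq> {X, Y}"
  proof
    assume "on pg_points L \<subseteq> {X, Y}"
    hence "card (on pg_points L) \<le> card {X, Y}" by (intro card_mono) auto
    thus False using card_on_line[OF L(1)] q_gt_2 pg(3) by simp
  qed
  then obtain p where p: "p \<in> on pg_points L" "p \<noteq> X" "p \<noteq> Y" by blast
  have pE: "p \<in> on pg_points E" using on_subset(2)[OF LE] p(1) by blast
  have pL: "p \<subseteq> L" using p(1) unfolding mem_on by iprover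
  have "p \<notin> special"
  proof
    assume ps: "p \<in> special"
    have "indep p X Y" by (rule special_indep) (use X Y ps p in \<open>auto simp: special_def\<close>)
    thus False using L pL unfolding indep_def by blast
  qed
  thus ?thesis using ext_through[OF pE] that by blast
qed

end

text \<open>All values of \<open>a\<close> are roots of one quadratic polynomial whose roots have
  sum \<open>1\<close>. If both roots occur, they already exhaust the total, so a third index has
  value \<open>0\<close>; then \<open>K = 0\<close>, and the roots are \<open>0\<close> and
  \<open>1\<close>.\<close>

lemma two_valued_distribution:
  fixes a :: "'a::finite \<Rightarrow> real"
  assumes n: "CARD('a) \<ge> 3" and nn: "\<And>c. a c \<ge> 0" and s: "(\<Sum>c\<in>UNIV. a c) = 1"
    and K: "\<And>c. a c * (1 - a c) = K"
  shows "(\<exists>c. a c = 1) \<or> (\<forall>c. a c = 1 / real (CARD('a)))"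
proof (cases "\<forall>c d. a c = a d")
  case True
  have "a c = 1 / real (CARD('a))" for c
  proof -
    have "(\<Sum>d\<in>UNIV. a d) = (\<Sum>d\<in>(UNIV :: 'a set). a c)" using True by (intro sum.cong) auto
    thus ?thesis using s n by (simp add: field_simps)
  qed
  thus ?thesis by blast
next
  case False
  then obtain c d where ne: "a c \<noteq> a d" by blast
  have "(a c - a d) * (1 - a c - a d) = 0" using K[of c] K[of d] by (simp add: algebra_simps)
  hence sum1: "a c + a d = 1" using ne by simp
  have "card {c, d} < CARD('a)" using n by (simp add: card_insert_if)
  hence "\<not> UNIV \<subseteq> {c, d}" by (metis card_mono finite.emptyI finite_insert not_less)
  then obtain e where e: "e \<notin> {c, d}" by blast
  have "(\<Sum>x\<in>{c, d, e}. a x) \<le> (\<Sum>x\<in>UNIV. a x)" by (rule sum_mono2) (use nn in auto)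
  moreover have "c \<noteq> d" using ne by auto
  hence "(\<Sum>x\<in>{c, d, e}. a x) = a c + a d + a e" using e by auto
  ultimately have "a e = 0" using s sum1 nn[of e] by linarith
  hence "K = 0" using K[of e] by simp
  hence "a c = 0 \<or> a c = 1" "a d = 0 \<or> a d = 1" using K[of c] K[of d] by auto
  thus ?thesis using sum1 by auto
qed

section \<open>Largest families of pairwise agreeing functionals\<close>

locale oval_cone_clique = oval_cone S R E
  for S :: "('a::{field,finite} ^ 4) set set" and R E +
  fixes F :: "('a ^ 4) set"
  assumes F_sub: "F \<subseteq> U" and F_clique: "u \<in> F \<Longrightarrow> v \<in> F \<Longrightarrow> \<exists>X\<in>S. val u X = val v X"
    and card_F_ge: "card F \<ge> CARD('a)\<^sup>2"
begin

interpretation d: bilinear_form "dot :: 'a ^ 4 \<Rightarrow> 'a ^ 4 \<Rightarrow> 'a" by (rule bilinear_dot)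

text \<open>Two elements of \<open>F\<close> agree at some point of the oval, whereas functionals
  differing by a nonzero multiple of \<open>f\<close> agree at none. So \<open>F\<close> meets each
  coset of the multiples of \<open>f\<close> at most once.\<close>

lemma ext_inj:
  assumes f: "ext f" shows "inj_on (\<lambda>(u, t). u + t *s f) (F \<times> UNIV)"
proof (rule inj_onI)
  fix x y assume x: "x \<in> F \<times> UNIV" and y: "y \<in> F \<times> UNIV" and e: "(\<lambda>(u, t). u + t *s f) x = (\<lambda>(u, t). u + t *s f) y"
  obtain u t v s where xy: "x = (u, t)" "y = (v, s)" by (cases x, cases y) blast
  have uv: "u \<in> F" "v \<in> F" "u + t *s f = v + s *s f" using x y e xy by auto
  obtain X where X: "X \<in> S" "val u X = val v X" using F_clique[OF uv(1,2)] by blast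
  have "val (u + t *s f) X = val (v + s *s f) X" unfolding uv(3) ..
  hence "t * val f X = s * val f X" using X(2) by (simp add: dot_add dot_scale)
  hence "t = s" using f X(1) unfolding ext_def by simp
  thus "x = y" using uv(3) xy by simp
qed

lemma ext_image:
  assumes f: "ext f" shows "(\<lambda>(u, t). u + t *s f) ` (F \<times> UNIV) = U" "card F = CARD('a)\<^sup>2"
proof -
  let ?g = "\<lambda>(u, t). u + t *s f"
  have sub: "?g ` (F \<times> UNIV) \<subseteq> U" using F_sub f by (auto simp: U_def ext_def dot_add dot_scale)
  have c: "card (?g ` (F \<times> UNIV)) = card F * CARD('a)" using card_image[OF ext_inj[OF f]] by (simp add: card_cartesian_product)
  have "card (?g ` (F \<times> UNIV)) \<le> card U" by (rule card_mono[OF _ sub]) simp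
  hence "card F * CARD('a) \<le> CARD('a)\<^sup>2 * CARD('a)" unfolding c card_U by (simp add: power2_eq_square power3_eq_cube)
  hence "card F \<le> CARD('a)\<^sup>2" using q_gt_2 by simp
  thus cF: "card F = CARD('a)\<^sup>2" using card_F_ge by simp
  have "card (?g ` (F \<times> UNIV)) = card U" unfolding c cF card_U by (simp add: power2_eq_square power3_eq_cube)
  thus "?g ` (F \<times> UNIV) = U" by (intro card_subset_eq[OF _ sub]) simp
qed

lemma card_F: "card F = CARD('a)\<^sup>2"
  using ext_exists ext_image(2) by metis

definition phi :: "('a ^ 4) set \<Rightarrow> 'a \<Rightarrow> nat" where "phi p c = card {u\<in>F. val u p = c}"

text \<open>Choose \<open>f\<close> with value \<open>0\<close> at \<open>p\<close>. Adding
  multiples of \<open>f\<close> keeps the value at \<open>p\<close>, so the \<open>q\<close>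
  translates of the fibre of \<open>F\<close> over \<open>c\<close> partition the fibre of
  \<open>U\<close> over \<open>c\<close>, which has \<open>q\<^sup>2\<close> elements.\<close>

lemma phi_ordinary:
  assumes p: "p \<in> on pg_points E" "p \<notin> special" shows "phi p c = CARD('a)"
proof -
  obtain f where f: "ext f" "val f p = 0" by (rule ext_through[OF p])
  let ?g = "\<lambda>(u, t). u + t *s f"
  have im: "?g ` ({u\<in>F. val u p = c} \<times> UNIV) = {u\<in>U. val u p = c}"
  proof -
    have "val (?g x) p = val (fst x) p" for x using f(2) by (simp add: split_def dot_add dot_scale)
    hence "?g ` ({u\<in>F. val u p = c} \<times> UNIV) = {u\<in>?g ` (F \<times> UNIV). val u p = c}" by force
    thus ?thesis unfolding ext_image(1)[OF f(1)] .
  qed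
  have inj: "inj_on ?g ({u\<in>F. val u p = c} \<times> UNIV)" by (rule inj_on_subset[OF ext_inj[OF f(1)]]) auto
  have "card ({u\<in>F. val u p = c} \<times> (UNIV :: 'a set)) = CARD('a)\<^sup>2"
    unfolding card_image[OF inj, symmetric] im by (rule card_val[OF p(1)])
  thus ?thesis using q_gt_2 by (simp add: phi_def card_cartesian_product power2_eq_square)
qed

text \<open>Inversion of a Radon transform: two distinct elements of \<open>U\<close> agree on exactly \<open>q + 1\<close> points of \<open>E\<close>.\<close>

lemma sum_phi:
  assumes u: "u \<in> U"
  shows "(\<Sum>p\<in>on pg_points E. phi p (val u p)) = CARD('a)\<^sup>2 * of_bool (u \<in> F) + (CARD('a) + 1) * CARD('a)\<^sup>2"
proof -
  have k: "card {p\<in>on pg_points E. val v p = val u p} = (CARD('a) + 1) + (if v = u then CARD('a)\<^sup>2 else 0)" if v: "v \<in> F" for v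
  proof (cases "v = u")
    case True
    thus ?thesis using card_on_plane[OF E] by simp
  next
    case False
    have z: "v - u \<noteq> 0" "dot (v - u) r = 0" using False u v F_sub by (auto simp: U_def dot_diff)
    have "p \<in> {p\<in>on pg_points E. val v p = val u p} \<longleftrightarrow> p \<in> on pg_points (d.perp (v - u) \<inter> E)" for p
    proof -
      have "p \<in> on pg_points (d.perp (v - u) \<inter> E) \<longleftrightarrow> p \<in> on pg_points E \<and> (p \<in> pg_points \<and> p \<subseteq> d.perp (v - u))"
        unfolding mem_on Int_subset_iff by iprover
      also have "\<dots> \<longleftrightarrow> p \<in> on pg_points E \<and> val (v - u) p = 0"
        using val_zero[of p "v - u"] unfolding mem_on by argo
      finally show ?thesis by (simp add: dot_diff)
    qed
    hence "{p\<in>on pg_points E. val v p = val u p} = on pg_points (d.perp (v - u) \<inter> E)" by (rule set_eqI)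
    thus ?thesis using card_on_line[OF trace_line[OF z]] False by simp
  qed
  have "(\<Sum>p\<in>on pg_points E. phi p (val u p)) = (\<Sum>v\<in>F. (CARD('a) + 1) + (if v = u then CARD('a)\<^sup>2 else 0))"
    unfolding phi_def by (rule sum_multicount_gen) (use k in simp_all)
  also have "\<dots> = (CARD('a) + 1) * card F + (if u \<in> F then CARD('a)\<^sup>2 else 0)"
    unfolding sum.distrib sum.delta[OF finite] by simp
  finally show ?thesis unfolding card_F by simp
qed

text \<open>The deviation of the distribution of \<open>val u p\<close> on \<open>F\<close> from the
  uniform distribution; its sum over all values is zero (\<open>sum_excess\<close>).\<close>

definition excess :: "('a ^ 4) set \<Rightarrow> 'a \<Rightarrow> real" where
  "excess p c = real (phi p c) / (real (CARD('a)))\<^sup>2 - 1 / real (CARD('a))"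

text \<open>This is \<open>sum_phi\<close> solved for the indicator. By \<open>phi_ordinary\<close>
  the points of \<open>E\<close> that are not special contribute constants only.\<close>

lemma indicator_eq:
  assumes u: "u \<in> U"
  shows "of_bool (u \<in> F) = 1 / real (CARD('a)) + (\<Sum>p\<in>special. excess p (val u p))"
proof -
  define q where "q = real (CARD('a))"
  have q0: "q > 0" using q_gt_2 by (simp add: q_def)
  have sub: "special \<subseteq> on pg_points E" using special_E by blast
  have ord: "real (phi p (val u p)) = q" if "p \<in> on pg_points E - special" for p
    using phi_ordinary[of p] that by (simp add: q_def)
  have cs: "card special \<le> card (on pg_points E)" by (rule card_mono[OF _ sub]) simp
  have "real (card (on pg_points E - special)) = q\<^sup>2 + q + 1 - real (card special)"
    using card_Diff_subset[OF _ sub] cs card_on_plane[OF E] by (simp add: of_nat_diff q_def)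
  hence o: "(\<Sum>p\<in>on pg_points E - special. real (phi p (val u p))) = (q\<^sup>2 + q + 1 - real (card special)) * q"
    using ord by simp
  have "(\<Sum>p\<in>on pg_points E. real (phi p (val u p))) = q\<^sup>2 * of_bool (u \<in> F) + (q + 1) * q\<^sup>2"
    using arg_cong[OF sum_phi[OF u], of real] by (simp add: q_def distrib_right)
  moreover have "(\<Sum>p\<in>on pg_points E. real (phi p (val u p))) =
      (\<Sum>p\<in>on pg_points E - special. real (phi p (val u p))) + (\<Sum>p\<in>special. real (phi p (val u p)))"
    by (rule sum.subset_diff[OF sub]) simp
  ultimately have e: "(\<Sum>p\<in>special. real (phi p (val u p))) = q\<^sup>2 * of_bool (u \<in> F) - q + real (card special) * q"
    unfolding o by (simp add: algebra_simps power2_eq_square)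
  have "(\<Sum>p\<in>special. excess p (val u p)) = (\<Sum>p\<in>special. real (phi p (val u p))) / q\<^sup>2 - real (card special) / q"
    by (simp add: excess_def q_def sum_subtractf sum_divide_distrib)
  also have "\<dots> = of_bool (u \<in> F) - 1 / q"
    unfolding e using q0 by (simp add: add_divide_distrib diff_divide_distrib power2_eq_square)
  finally show ?thesis by (simp add: q_def)
qed

lemma sum_phi_values: "(\<Sum>c\<in>UNIV. phi p c) = CARD('a)\<^sup>2"
proof -
  have "(\<Sum>c\<in>UNIV. card {u\<in>F. val u p = c}) = (\<Sum>u\<in>F. 1)"
    by (rule sum_multicount_gen) simp_all
  thus ?thesis unfolding phi_def using card_F by simp
qed

lemma sum_excess: "(\<Sum>c\<in>UNIV. excess p c) = 0"
proof -
  have "(\<Sum>c\<in>UNIV. real (phi p c)) = (real (CARD('a)))\<^sup>2" using arg_cong[OF sum_phi_values[of p], of real] by simp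
  thus ?thesis using q_gt_2 by (simp add: excess_def sum_subtractf sum_divide_distrib[symmetric])
qed

text \<open>On the fibre \<open>val u p = c\<close> the values at two further special points are independent, so squaring
  \<open>indicator_eq\<close> leaves no mixed terms, and what remains besides the mean does not depend on \<open>c\<close>.\<close>

lemma moment:
  assumes p: "p \<in> special"
  defines "a \<equiv> \<lambda>c. real (phi p c) / (real (CARD('a)))\<^sup>2"
  shows "a c * (1 - a c) = (\<Sum>p'\<in>special - {p}. \<Sum>b\<in>UNIV. (excess p' b)\<^sup>2) / real (CARD('a))"
proof -
  define q where "q = real (CARD('a))"
  have q0: "q > 0" using q_gt_2 by (simp add: q_def)
  define T where "T = special - {p}"
  define G where "G u = (\<Sum>p'\<in>T. excess p' (val u p'))" for u
  define e where "e u = (of_bool (val u p = c) :: real)" for u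
  have T: "p' \<in> special" "p \<noteq> p'" if "p' \<in> T" for p' using that by (auto simp: T_def)
  have ind: "e u * of_bool (u \<in> F) = e u * (a c + G u)" if u: "u \<in> U" for u
  proof (cases "val u p = c")
    case True
    have "(\<Sum>p\<in>special. excess p (val u p)) = excess p c + G u"
      unfolding G_def T_def using p True by (subst sum.remove[of _ p]) auto
    thus ?thesis using indicator_eq[OF u] by (simp add: excess_def a_def)
  qed (simp add: e_def)
  have fib: "(\<Sum>u\<in>U. e u * of_bool (u \<in> F)) = q\<^sup>2 * a c"
  proof -
    have "(\<Sum>u\<in>U. e u * of_bool (u \<in> F)) = (\<Sum>u\<in>U. of_bool (u \<in> {u\<in>F. val u p = c}))"
      by (intro sum.cong) (auto simp: e_def)
    also have "\<dots> = real (card (U \<inter> {u\<in>F. val u p = c}))" by (simp add: of_bool_def sum.If_cases)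
    also have "U \<inter> {u\<in>F. val u p = c} = {u\<in>F. val u p = c}" using F_sub by blast
    finally show ?thesis using q0 by (simp add: a_def phi_def q_def)
  qed
  have e2: "e u * e u = e u" for u by (simp add: e_def)
  have s0: "(\<Sum>u\<in>U. e u) = q\<^sup>2" unfolding e_def q_def by (rule sum_val[OF special_E[OF p]])
  have s1: "(\<Sum>u\<in>U. e u * G u) = 0"
  proof -
    have "(\<Sum>u\<in>U. e u * G u) = (\<Sum>p'\<in>T. \<Sum>u\<in>U. e u * excess p' (val u p'))"
      unfolding G_def sum_distrib_left by (rule sum.swap)
    also have "\<dots> = 0" unfolding e_def using sum_val2[OF p T] by (simp add: sum_excess)
    finally show ?thesis .
  qed
  have s2: "(\<Sum>u\<in>U. e u * (G u)\<^sup>2) = q * (\<Sum>p'\<in>T. \<Sum>b\<in>UNIV. (excess p' b)\<^sup>2)"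
  proof -
    have "(\<Sum>u\<in>U. e u * (G u)\<^sup>2) = (\<Sum>u\<in>U. \<Sum>p'\<in>T. \<Sum>p''\<in>T. e u * (excess p' (val u p') * excess p'' (val u p'')))"
      by (simp only: G_def power2_eq_square sum_product) (simp only: sum_distrib_left)
    also have "\<dots> = (\<Sum>p'\<in>T. \<Sum>p''\<in>T. \<Sum>u\<in>U. e u * (excess p' (val u p') * excess p'' (val u p'')))"
      by (subst sum.swap) (intro sum.cong refl sum.swap)
    also have "\<dots> = (\<Sum>p'\<in>T. \<Sum>p''\<in>T. if p' = p'' then q * (\<Sum>b\<in>UNIV. (excess p' b)\<^sup>2) else 0)"
    proof (intro sum.cong refl)
      fix p' p'' assume p': "p' \<in> T" and p'': "p'' \<in> T"
      show "(\<Sum>u\<in>U. e u * (excess p' (val u p') * excess p'' (val u p''))) = (if p' = p'' then q * (\<Sum>b\<in>UNIV. (excess p' b)\<^sup>2) else 0)"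
      proof (cases "p' = p''")
        case True
        thus ?thesis using sum_val2[OF p T[OF p'], of c "\<lambda>b. excess p' b * excess p' b"]
          unfolding e_def q_def by (simp add: power2_eq_square)
      next
        case False
        have "(\<Sum>u\<in>U. e u * (excess p' (val u p') * excess p'' (val u p''))) = (\<Sum>b\<in>UNIV. excess p' b) * (\<Sum>b\<in>UNIV. excess p'' b)"
          unfolding e_def by (rule sum_val3[OF p T(1)[OF p'] T(1)[OF p''] T(2)[OF p'] T(2)[OF p''] False])
        thus ?thesis using False by (simp add: sum_excess)
      qed
    qed
    also have "\<dots> = q * (\<Sum>p'\<in>T. \<Sum>b\<in>UNIV. (excess p' b)\<^sup>2)" by (simp add: sum_distrib_left)
    finally show ?thesis .
  qed
  have "q\<^sup>2 * a c = (\<Sum>u\<in>U. (e u * of_bool (u \<in> F)) * (e u * of_bool (u \<in> F)))"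
    unfolding fib[symmetric] by (intro sum.cong) (auto simp: e_def)
  also have "\<dots> = (\<Sum>u\<in>U. (e u * (a c + G u)) * (e u * (a c + G u)))"
    by (rule sum.cong[OF refl]) (simp only: ind)
  also have "\<dots> = (\<Sum>u\<in>U. (a c)\<^sup>2 * e u + 2 * a c * (e u * G u) + e u * (G u)\<^sup>2)"
  proof (intro sum.cong refl)
    fix u
    have "(e u * (a c + G u)) * (e u * (a c + G u)) = (e u * e u) * (a c + G u)\<^sup>2" by (simp add: power2_eq_square algebra_simps)
    thus "(e u * (a c + G u)) * (e u * (a c + G u)) = (a c)\<^sup>2 * e u + 2 * a c * (e u * G u) + e u * (G u)\<^sup>2"
      unfolding e2 by (simp add: power2_eq_square algebra_simps)
  qed
  also have "\<dots> = (a c)\<^sup>2 * q\<^sup>2 + q * (\<Sum>p'\<in>T. \<Sum>b\<in>UNIV. (excess p' b)\<^sup>2)"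
    by (simp add: sum.distrib sum_distrib_left[symmetric] s0 s1 s2)
  finally have h: "q\<^sup>2 * a c = (a c)\<^sup>2 * q\<^sup>2 + q * (\<Sum>p'\<in>T. \<Sum>b\<in>UNIV. (excess p' b)\<^sup>2)" .
  define K where "K = (\<Sum>p'\<in>T. \<Sum>b\<in>UNIV. (excess p' b)\<^sup>2)"
  have "q * (q * (a c * (1 - a c)) - K) = 0"
    using h unfolding K_def[symmetric] by (simp add: power2_eq_square algebra_simps)
  hence "q * (a c * (1 - a c)) - K = 0" using q0 unfolding mult_eq_0_iff by linarith
  hence "K = q * (a c * (1 - a c))" by linarith
  hence "a c * (1 - a c) = K / q" using q0 by simp
  thus ?thesis unfolding K_def T_def q_def .
qed

text \<open>By \<open>moment\<close> and \<open>two_valued_distribution\<close> the values at a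
  special point are either constant on \<open>F\<close> or uniformly distributed. If they were
  uniformly distributed at all special points, then by \<open>indicator_eq\<close> the indicator
  would have the value \<open>1 / q\<close>.\<close>

theorem clique_pencil: "\<exists>p\<in>special. \<exists>c. F = {u\<in>U. val u p = c}"
proof -
  define q where "q = real (CARD('a))"
  have q0: "q > 2" using q_gt_2 by (simp add: q_def)
  have "\<exists>p\<in>special. \<exists>c. phi p c = CARD('a)\<^sup>2"
  proof (rule ccontr)
    assume no: "\<not> ?thesis"
    have y0: "excess p c = 0" if p: "p \<in> special" for p c
    proof -
      let ?a = "\<lambda>c. real (phi p c) / (real (CARD('a)))\<^sup>2"
      have "(\<exists>c. ?a c = 1) \<or> (\<forall>c. ?a c = 1 / real (CARD('a)))"
      proof (rule two_valued_distribution)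
        show "CARD('a) \<ge> 3" using q_gt_2 by simp
        show "(\<Sum>c\<in>UNIV. ?a c) = 1"
          using arg_cong[OF sum_phi_values[of p], of real] q_gt_2 by (simp add: sum_divide_distrib[symmetric])
        show "?a c * (1 - ?a c) = (\<Sum>p'\<in>special - {p}. \<Sum>b\<in>UNIV. (excess p' b)\<^sup>2) / real (CARD('a))" for c
          by (rule moment[OF p])
      qed simp
      moreover have "?a c \<noteq> 1" for c
      proof
        assume "?a c = 1"
        hence "real (phi p c) = real (CARD('a)\<^sup>2)" using q_gt_2 by (simp add: field_simps)
        hence "phi p c = CARD('a)\<^sup>2" by (simp only: of_nat_eq_iff)
        thus False using no p by blast
      qed
      ultimately show ?thesis unfolding excess_def by simp
    qed
    have "U \<noteq> {}" using card_U q_gt_2 by auto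
    then obtain u where "u \<in> U" by blast
    hence "of_bool (u \<in> F) = 1 / q" using indicator_eq y0 by (simp add: q_def)
    thus False using q0 by (cases "u \<in> F") auto
  qed
  then obtain p c where p: "p \<in> special" "phi p c = CARD('a)\<^sup>2" by blast
  have "{u\<in>F. val u p = c} = F" using p(2) card_F unfolding phi_def by (intro card_subset_eq) auto
  hence sub: "F \<subseteq> {u\<in>U. val u p = c}" using F_sub by blast
  have "F = {u\<in>U. val u p = c}"
    by (rule card_subset_eq[OF _ sub]) (simp_all add: card_F card_val[OF special_E[OF p(1)]])
  thus ?thesis using p(1) by blast
qed

end

section \<open>Translation between circles of the cone and functionals\<close>

context oval_cone begin

interpretation d: bilinear_form "dot :: 'a ^ 4 \<Rightarrow> 'a ^ 4 \<Rightarrow> 'a" by (rule bilinear_dot)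

text \<open>The points of the cone other than its vertex are \<open>pp X c\<close> for \<open>X \<in> S\<close> and \<open>c\<close> in the field, and
  the circle of \<open>u \<in> U\<close> meets the generator through \<open>X\<close> in the point with \<open>c = val u X\<close>.\<close>

definition pp :: "('a ^ 4) set \<Rightarrow> 'a \<Rightarrow> ('a ^ 4) set" where "pp p c = pt (rep p - c *s r)"

definition cone :: "('a ^ 4) set set" where
  "cone = {P\<in>pg_points. \<exists>L\<in>pg_lines. R \<subseteq> L \<and> (\<exists>X\<in>S. X \<subseteq> L) \<and> P \<subseteq> L}"

definition circ :: "'a ^ 4 \<Rightarrow> ('a ^ 4) set set" where "circ u = (\<lambda>X. pp X (val u X)) ` S"

lemma rep_E: assumes "p \<in> on pg_points E" shows "rep p \<in> E" "rep p \<noteq> 0" "p = pt (rep p)"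
proof -
  have p: "p \<in> pg_points" "p \<subseteq> E" using assms unfolding mem_on by iprover+
  show "rep p \<in> E" using rep_subset_iff[OF p(1) E_subspace] p(2) by simp
  show "rep p \<noteq> 0" "p = pt (rep p)" using rep[OF p(1)] by auto
qed

lemma r_indep:
  assumes "x \<in> E" "t *s r = x" shows "t = 0"
proof (rule ccontr)
  assume t: "t \<noteq> 0"
  have "inverse t *s x \<in> E" by (rule vec.subspace_scale[OF E_subspace assms(1)])
  moreover have "inverse t *s x = r" unfolding assms(2)[symmetric] using t by (simp add: vector_smult_assoc)
  ultimately show False using r_notin by simp
qed

lemma pp_nonzero: assumes p: "p \<in> on pg_points E" shows "rep p - c *s r \<noteq> 0"
proof
  assume "rep p - c *s r = 0"
  hence e: "c *s r = rep p" by simp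
  hence "c = 0" by (rule r_indep[OF rep_E(1)[OF p]])
  thus False using e rep_E(2)[OF p] by simp
qed

lemma pp_point: "p \<in> on pg_points E \<Longrightarrow> pp p c \<in> pg_points"
  unfolding pp_def by (intro pt_in_pg_points pp_nonzero)

lemma pp_eqD:
  assumes p: "p \<in> on pg_points E" and p': "p' \<in> on pg_points E" and e: "pp p c = pp p' c'"
  shows "p = p' \<and> c = c'"
proof -
  have "\<exists>k. rep p' - c' *s r = k *s (rep p - c *s r)"
    using e unfolding pp_def pt_eq_iff[OF pp_nonzero[OF p] pp_nonzero[OF p']] .
  then obtain k where k: "rep p' - c' *s r = k *s (rep p - c *s r)" by blast
  hence e: "(c' - k * c) *s r = rep p' - k *s rep p" by (simp add: vec_eq_iff algebra_simps)
  have "rep p' - k *s rep p \<in> E"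
    by (intro vec.subspace_diff vec.subspace_scale E_subspace rep_E p p')
  hence "c' - k * c = 0" using e by (rule r_indep)
  hence k2: "c' = k * c" "rep p' = k *s rep p" using e by simp_all
  have "\<exists>k. rep p' = k *s rep p" using k2(2) by blast
  hence "pt (rep p) = pt (rep p')" by (rule pt_eq_iff[OF rep_E(2)[OF p] rep_E(2)[OF p'], THEN iffD2])
  hence pp': "p = p'" unfolding rep_E(3)[OF p, symmetric] rep_E(3)[OF p', symmetric] .
  have "(1 - k) *s rep p = 0" using k2(2) unfolding pp'[symmetric] by (simp add: vector_sub_rdistrib)
  hence "k = 1" using rep_E(2)[OF p] by simp
  thus ?thesis using pp' k2(1) by simp
qed

lemma pp_perp: "pp p c \<subseteq> d.perp u \<longleftrightarrow> val u p = c * dot u r"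
  unfolding pp_def pt_subset_iff[OF d.perp_subspace] by (simp add: d.perp_def dot_diff dot_scale)

lemma pp_not_R: assumes p: "p \<in> on pg_points E" shows "pp p c \<noteq> R"
proof
  assume "pp p c = R"
  hence "pt (rep p - c *s r) = pt r" unfolding pp_def r(2)[symmetric] .
  hence "\<exists>k. r = k *s (rep p - c *s r)" unfolding pt_eq_iff[OF pp_nonzero[OF p] r(1)] .
  then obtain k where k: "r = k *s (rep p - c *s r)" by blast
  hence e: "(1 + k * c) *s r = k *s rep p" by (simp add: vec_eq_iff algebra_simps)
  hence "1 + k * c = 0" by (rule r_indep[OF vec.subspace_scale[OF E_subspace rep_E(1)[OF p]]])
  hence "k *s rep p = 0" "k \<noteq> 0" using e by auto
  thus False using rep_E(2)[OF p] by simp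
qed

lemma S_not_R: "X \<in> S \<Longrightarrow> X \<noteq> R"
  using SE RE by blast

lemma S_pg: "X \<in> S \<Longrightarrow> X \<in> pg_points"
  using points by blast

lemma pp_in_line:
  assumes X: "X \<in> S" and L: "L \<in> pg_lines" "R \<subseteq> L" "X \<subseteq> L" shows "pp X c \<subseteq> L"
proof -
  have s: "vec.subspace L" by (rule pg_line_subspace(1)[OF L(1)])
  have "rep X \<in> L" "r \<in> L" using rep_subset_iff[OF S_pg[OF X] s] rep_subset_iff[OF R s] L unfolding r_def by blast+
  hence "rep X - c *s r \<in> L" by (intro vec.subspace_diff vec.subspace_scale s)
  thus ?thesis unfolding pp_def pt_subset_iff[OF s] .
qed

lemma coneI: "P \<in> pg_points \<Longrightarrow> L \<in> pg_lines \<Longrightarrow> R \<subseteq> L \<Longrightarrow> X \<in> S \<Longrightarrow> X \<subseteq> L \<Longrightarrow> P \<subseteq> L \<Longrightarrow> P \<in> cone"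
  unfolding cone_def mem_Collect_eq Bex_def by iprover

lemma cone_point: "P \<in> cone \<Longrightarrow> P \<in> pg_points" unfolding cone_def by simp

lemma pp_cone: assumes X: "X \<in> S" shows "pp X c \<in> cone"
proof -
  obtain L where L: "L \<in> pg_lines" "X \<subseteq> L" "R \<subseteq> L" by (rule joinE[OF S_pg[OF X] R S_not_R[OF X]])
  show ?thesis by (rule coneI[OF pp_point[OF S_E[OF X]] L(1,3) X L(2) pp_in_line[OF X L(1,3,2)]])
qed

lemma R_cone: "R \<in> cone"
proof -
  obtain X where X: "X \<in> S" by (rule ex_point)
  obtain L where L: "L \<in> pg_lines" "X \<subseteq> L" "R \<subseteq> L" by (rule joinE[OF S_pg[OF X] R S_not_R[OF X]])
  show ?thesis by (rule coneI[OF R L(1,3) X L(2,3)])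
qed

lemma cone_cases:
  assumes P: "P \<in> cone" "P \<noteq> R" obtains X c where "X \<in> S" "P = pp X c"
proof -
  have Pp: "P \<in> pg_points" by (rule cone_point[OF P(1)])
  obtain L X where L: "L \<in> pg_lines" "R \<subseteq> L" "X \<in> S" "X \<subseteq> L" "P \<subseteq> L" using P(1) unfolding cone_def by blast
  have "rep P \<in> L" using rep_subset_iff[OF Pp pg_line_subspace(1)[OF L(1)]] L(5) by simp
  then obtain a b where ab: "rep P = a *s rep X + b *s rep R"
    by (rule in_line_span[OF S_pg[OF L(3)] R S_not_R[OF L(3)] L(1,4,2)])
  have P0: "rep P \<noteq> 0" "P = pt (rep P)" using rep[OF Pp] by auto
  have a0: "a \<noteq> 0"
  proof
    assume "a = 0"
    hence "\<exists>k. rep P = k *s r" using ab unfolding r_def by auto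
    hence "pt r = pt (rep P)" by (rule pt_eq_iff[OF r(1) P0(1), THEN iffD2])
    thus False using P(2) P0(2) r(2) by simp
  qed
  have "rep X - (- b / a) *s r = (1 / a) *s rep P"
    unfolding ab r_def using a0 by (simp add: vec_eq_iff field_simps)
  hence "\<exists>k. rep X - (- b / a) *s r = k *s rep P" by (rule exI)
  hence "pt (rep P) = pp X (- b / a)" unfolding pp_def by (rule pt_eq_iff[OF P0(1) pp_nonzero[OF S_E[OF L(3)]], THEN iffD2])
  hence "P = pp X (- b / a)" unfolding P0(2)[symmetric] .
  thus ?thesis by (rule that[OF L(3)])
qed

lemma U_r: "u \<in> U \<Longrightarrow> dot u r = 1" by (simp add: U_def)

lemma U_perp: assumes "u \<in> U" shows "d.perp u \<in> pg_planes"
proof (rule d.perp_plane)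
  show "u \<noteq> 0" using assms by (auto simp: U_def dot_def)
qed

lemma pp_mem_circ:
  assumes "X \<in> on pg_points E" shows "pp X c \<in> circ u \<longleftrightarrow> X \<in> S \<and> val u X = c"
proof
  assume "pp X c \<in> circ u"
  then obtain Y where Y: "pp X c = pp Y (val u Y)" "Y \<in> S" unfolding circ_def by (rule imageE)
  thus "X \<in> S \<and> val u X = c" using pp_eqD[OF assms S_E[OF Y(2)] Y(1)] by auto
next
  assume "X \<in> S \<and> val u X = c"
  thus "pp X c \<in> circ u" unfolding circ_def by (intro image_eqI) auto
qed

lemma on_cone_perp: assumes u: "u \<in> U" shows "on cone (d.perp u) = circ u"
proof (rule set_eqI)
  fix P
  have nR: "\<not> R \<subseteq> d.perp u" unfolding R_perp U_r[OF u] by simp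
  have pw: "pp X c \<in> on cone (d.perp u) \<longleftrightarrow> pp X c \<in> circ u" if X: "X \<in> S" for X c
    unfolding mem_on pp_perp U_r[OF u] pp_mem_circ[OF S_E[OF X]] using pp_cone[OF X] X by simp
  show "P \<in> on cone (d.perp u) \<longleftrightarrow> P \<in> circ u"
  proof
    assume P: "P \<in> on cone (d.perp u)"
    hence "P \<in> cone" "P \<noteq> R" using nR unfolding mem_on by auto
    then obtain X c where X: "X \<in> S" "P = pp X c" by (rule cone_cases)
    thus "P \<in> circ u" using pw P by simp
  next
    assume P: "P \<in> circ u"
    then obtain X where X: "P = pp X (val u X)" "X \<in> S" unfolding circ_def by (rule imageE)
    show "P \<in> on cone (d.perp u)" using iffD2[OF pw[OF X(2)], of "val u X"] P unfolding X(1) by iprover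
  qed
qed

lemma card_circ_image: "A \<subseteq> S \<Longrightarrow> card ((\<lambda>X. pp X (val u X)) ` A) = card A"
proof (rule card_image, rule inj_onI)
  fix X Y assume "A \<subseteq> S" "X \<in> A" "Y \<in> A" and e: "pp X (val u X) = pp Y (val u Y)"
  hence "X \<in> on pg_points E" "Y \<in> on pg_points E" using S_E by blast+
  thus "X = Y" using pp_eqD e by iprover
qed

lemma card_circ: "card (circ u) = CARD('a) + 1"
  unfolding circ_def using card_circ_image[of S u] card_S by simp

text \<open>The projection from \<open>R\<close> takes the plane of \<open>u\<close> to
  \<open>E\<close> and \<open>pp p (val u p)\<close> to \<open>p\<close>; the plane joining
  \<open>R\<close> and \<open>L\<close> is the kernel of \<open>f\<close>.\<close>

lemma line_functional:
  assumes u: "u \<in> U" and L: "L \<in> pg_lines" "L \<subseteq> d.perp u"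
  obtains f where "f \<noteq> 0" "dot f r = 0" "\<And>p. p \<in> on pg_points E \<Longrightarrow> pp p (val u p) \<subseteq> L \<longleftrightarrow> val f p = 0"
proof -
  have nR: "\<not> R \<subseteq> d.perp u" unfolding R_perp U_r[OF u] by simp
  hence RL: "\<not> R \<subseteq> L" using L(2) by (meson subset_trans)
  obtain F where F: "F \<in> pg_planes" "L \<subseteq> F" "R \<subseteq> F" using ex1_implies_ex[OF join_plane[OF L(1) R RL]] by iprover
  obtain f where f: "f \<noteq> 0" "F = d.perp f" by (rule d.plane_perp[OF F(1)])
  have fr: "dot f r = 0" using F(3) unfolding f(2) R_perp .
  have ne: "d.perp f \<noteq> d.perp u" using nR F(3) f(2) by metis
  have Le: "L = d.perp f \<inter> d.perp u"
  proof (rule line_eq_of_subset[OF L(1)])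
    show "d.perp f \<inter> d.perp u \<in> pg_lines" by (rule planes_Int[OF d.perp_plane[OF f(1)] U_perp[OF u] ne])
    show "L \<subseteq> d.perp f \<inter> d.perp u" using F(2) L(2) unfolding f(2) by (rule Int_greatest)
  qed
  have "pp p (val u p) \<subseteq> L \<longleftrightarrow> val f p = 0" for p
    unfolding Le Int_subset_iff pp_perp U_r[OF u] fr by simp
  thus ?thesis using that f(1) fr by blast
qed

lemma circ_no_three: assumes u: "u \<in> U" shows "no_three_on_a_line (circ u)"
  unfolding no_three_on_a_line_def
proof (intro ballI impI notI)
  fix P Q Z assume P: "P \<in> circ u" and Q: "Q \<in> circ u" and Z: "Z \<in> circ u" and ne: "P \<noteq> Q \<and> P \<noteq> Z \<and> Q \<noteq> Z"
  assume "\<exists>L\<in>pg_lines. P \<subseteq> L \<and> Q \<subseteq> L \<and> Z \<subseteq> L"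
  then obtain L where L: "L \<in> pg_lines" "P \<subseteq> L" "Q \<subseteq> L" "Z \<subseteq> L" by blast
  have pg: "V \<in> pg_points" "V \<subseteq> d.perp u" if "V \<in> circ u" for V
    using that cone_point unfolding on_cone_perp[OF u, symmetric] mem_on by iprover+
  have Lu: "L \<subseteq> d.perp u"
    by (rule line_subset[OF pg(1)[OF P] pg(1)[OF Q] conjunct1[OF ne] L(1-3) d.perp_subspace pg(2)[OF P] pg(2)[OF Q]])
  obtain f where f: "f \<noteq> 0" "dot f r = 0" "\<And>p. p \<in> on pg_points E \<Longrightarrow> pp p (val u p) \<subseteq> L \<longleftrightarrow> val f p = 0"
    by (rule line_functional[OF u L(1) Lu]) (rule that)
  obtain X1 where X1: "P = pp X1 (val u X1)" "X1 \<in> S" using P unfolding circ_def by (rule imageE)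
  obtain X2 where X2: "Q = pp X2 (val u X2)" "X2 \<in> S" using Q unfolding circ_def by (rule imageE)
  obtain X3 where X3: "Z = pp X3 (val u X3)" "X3 \<in> S" using Z unfolding circ_def by (rule imageE)
  have m: "X \<subseteq> d.perp f \<inter> E" if X: "X \<in> S" "pp X (val u X) \<subseteq> L" for X
    using val_zero[OF S_pg[OF X(1)], of f] f(3)[OF S_E[OF X(1)]] X(2) SE[OF X(1)] by simp
  have "X1 \<noteq> X2" "X1 \<noteq> X3" "X2 \<noteq> X3" using ne X1 X2 X3 by auto
  thus False
    by (rule no_threeD[OF X1(2) X2(2) X3(2) _ _ _ trace_line[OF f(1,2)]])
       (use m X1 X2 X3 L in blast)+
qed

lemma circ_oval_in: assumes u: "u \<in> U" shows "oval_in (d.perp u) (circ u)"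
proof -
  have "circ u \<subseteq> pg_points" "\<forall>P\<in>circ u. P \<subseteq> d.perp u"
    using cone_point unfolding on_cone_perp[OF u, symmetric] by (auto simp only: mem_on)
  thus ?thesis unfolding oval_in_def using U_perp[OF u] card_circ[of u] circ_no_three[OF u] by iprover
qed

lemma section_eq: "section_by Q W = on Q W"
  by (simp only: section_by_def on_def)

lemma oval_planeD:
  assumes o: "oval_plane cone W" obtains u where "u \<in> U" "W = d.perp u"
proof -
  have W: "W \<in> pg_planes" "card (on cone W) = CARD('a) + 1" "no_three_on_a_line (on cone W)"
    using o unfolding oval_plane_def oval_in_def section_eq by iprover+
  obtain v where v: "v \<noteq> 0" "W = d.perp v" by (rule d.plane_perp[OF W(1)])
  show ?thesis
  proof (cases "dot v r = 0")
    case False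
    let ?u = "inverse (dot v r) *s v"
    have "?u \<in> U" using False by (simp add: U_def dot_scale)
    moreover have "W = d.perp ?u" unfolding v(2) using False by (simp add: d.perp_def dot_scale)
    ultimately show ?thesis by (rule that)
  next
    \<comment> \<open>A plane through the vertex that contains another point of the cone contains a
      whole generator and thus three collinear points of the cone.\<close>
    case True
    hence RW: "R \<subseteq> d.perp v" unfolding R_perp .
    have "\<not> on cone W \<subseteq> {R}"
    proof
      assume "on cone W \<subseteq> {R}"
      hence "card (on cone W) \<le> card {R}" by (intro card_mono) auto
      thus False using W(2) q_gt_2 by simp
    qed
    then obtain P where P: "P \<in> on cone W" "P \<noteq> R" by blast
    hence "P \<in> cone" "P \<subseteq> d.perp v" unfolding mem_on v(2) by iprover+
    then obtain X c where X: "X \<in> S" "P = pp X c" using P(2) cone_cases by metis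
    have "val v X = 0" using \<open>P \<subseteq> d.perp v\<close> unfolding X(2) pp_perp True by simp
    hence in_W: "pp X c' \<in> on cone W" for c' unfolding mem_on v(2) pp_perp True using pp_cone[OF X(1)] by simp
    obtain L where L: "L \<in> pg_lines" "X \<subseteq> L" "R \<subseteq> L" by (rule joinE[OF S_pg[OF X(1)] R S_not_R[OF X(1)]])
    have "R \<in> on cone W" unfolding mem_on v(2) using R_cone RW by (rule conjI)
    moreover have "pp X 0 \<noteq> pp X 1" using pp_eqD[OF S_E[OF X(1)] S_E[OF X(1)], of 0 1] by auto
    moreover have "pp X 0 \<noteq> R" "pp X 1 \<noteq> R" using pp_not_R[OF S_E[OF X(1)]] by blast+
    moreover have "\<exists>L\<in>pg_lines. R \<subseteq> L \<and> pp X 0 \<subseteq> L \<and> pp X 1 \<subseteq> L"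
      using L(1) conjI[OF L(3) conjI[OF pp_in_line[OF X(1) L(1,3,2)] pp_in_line[OF X(1) L(1,3,2)]]] by (rule bexI[rotated])
    ultimately show ?thesis using W(3) in_W unfolding no_three_on_a_line_def by metis
  qed
qed

lemma oval_sections_cone: "oval_sections cone = circ ` U"
proof (rule set_eqI)
  fix C
  have "oval_plane cone (d.perp u)" if "u \<in> U" for u
    unfolding oval_plane_def section_eq on_cone_perp[OF that] by (rule circ_oval_in[OF that])
  hence "C \<in> circ ` U \<Longrightarrow> C \<in> oval_sections cone"
    unfolding oval_sections_def section_eq using on_cone_perp by blast
  moreover have "C \<in> circ ` U" if C: "C \<in> oval_sections cone"
  proof -
    obtain W where W: "C = on cone W" "oval_plane cone W" using C unfolding oval_sections_def section_eq by blast
    obtain u where u: "u \<in> U" "W = d.perp u" by (rule oval_planeD[OF W(2)])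
    show ?thesis unfolding W(1) u(2) on_cone_perp[OF u(1)] using u(1) by (rule imageI)
  qed
  ultimately show "C \<in> oval_sections cone \<longleftrightarrow> C \<in> circ ` U" by (rule iffI[rotated])
qed

lemma circ_inj: "inj_on circ U"
proof (rule inj_onI)
  fix u v assume u: "u \<in> U" and v: "v \<in> U" and e: "circ u = circ v"
  have eq: "val u X = val v X" if X: "X \<in> S" for X
    using pp_mem_circ[OF S_E[OF X], of "val u X" u] pp_mem_circ[OF S_E[OF X], of "val u X" v] X e by simp
  obtain p where p: "p \<in> S" by (rule ex_point)
  obtain X Y where XY: "X \<in> S" "Y \<in> S" "indep p X Y" by (rule indep_S[OF S_E[OF p]])
  have "u - v = 0" by (rule indep_zero[OF XY(3)]) (use eq p XY U_r u v in \<open>simp_all add: dot_diff\<close>)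
  thus "u = v" by simp
qed

lemma circ_meet: "circ u \<inter> circ v \<noteq> {} \<Longrightarrow> \<exists>X\<in>S. val u X = val v X"
proof -
  assume "circ u \<inter> circ v \<noteq> {}"
  then obtain P where P: "P \<in> circ u" "P \<in> circ v" by blast
  obtain X where X: "P = pp X (val u X)" "X \<in> S" using P(1) unfolding circ_def by (rule imageE)
  have "val v X = val u X" using pp_mem_circ[OF S_E[OF X(2)]] P(2) X by simp
  thus ?thesis using X(2) by metis
qed

text \<open>The projection from \<open>R\<close> preserves tangency, so the nucleus of
  \<open>circ u\<close> is the point of its plane that projects to \<open>N\<close>, namely
  \<open>pp N (val u N)\<close>. The plane in \<open>circle_nucleus\<close> is unique, since the
  circle has three noncollinear points.\<close>

lemma circ_nucleus:
  assumes N: "N \<in> nuc" and u: "u \<in> U" shows "circle_nucleus (circ u) (pp N c) \<longleftrightarrow> val u N = c"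
proof
  assume "circle_nucleus (circ u) (pp N c)"
  then obtain W where W: "oval_in W (circ u)" "pp N c \<subseteq> W" unfolding circle_nucleus_def nucleus_in_def by blast
  have "W = d.perp u"
  proof (rule ccontr)
    assume "W \<noteq> d.perp u"
    hence L: "W \<inter> d.perp u \<in> pg_lines" using W(1) U_perp[OF u] planes_Int unfolding oval_in_def by blast
    have "3 \<le> card (circ u)" using card_circ[of u] q_gt_2 by simp
    then obtain P Q Z where P: "P \<in> circ u" "Q \<in> circ u" "Z \<in> circ u" "P \<noteq> Q" "P \<noteq> Z" "Q \<noteq> Z" by (rule three_elementsE)
    have "V \<subseteq> W \<inter> d.perp u" if "V \<in> circ u" for V
      using W(1) circ_oval_in[OF u] that unfolding oval_in_def by simp
    hence "\<exists>L\<in>pg_lines. P \<subseteq> L \<and> Q \<subseteq> L \<and> Z \<subseteq> L" using L P by metis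
    thus False using circ_no_three[OF u] P unfolding no_three_on_a_line_def by metis
  qed
  thus "val u N = c" using W(2) unfolding pp_perp[symmetric] by (simp add: pp_perp U_r[OF u])
next
  assume c: "val u N = c"
  have "nucleus_in (d.perp u) (circ u) (pp N c)" unfolding nucleus_in_def
  proof (intro conjI ballI impI)
    show "pp N c \<in> pg_points" by (rule pp_point[OF nuc_point(4)[OF N]])
    show "pp N c \<subseteq> d.perp u" unfolding pp_perp U_r[OF u] c by simp
    fix L assume L: "L \<in> pg_lines" "L \<subseteq> d.perp u"
    obtain f where f: "f \<noteq> 0" "dot f r = 0" "\<And>p. p \<in> on pg_points E \<Longrightarrow> pp p (val u p) \<subseteq> L \<longleftrightarrow> val f p = 0"
      by (rule line_functional[OF u L]) (rule that)
    define M where "M = d.perp f \<inter> E"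
    have M: "M \<in> pg_lines" "M \<subseteq> E" unfolding M_def using trace_line[OF f(1,2)] by auto
    have vM: "val f p = 0 \<longleftrightarrow> p \<subseteq> M" if p: "p \<in> on pg_points E" for p
      unfolding M_def Int_subset_iff using p val_zero[of p f] unfolding mem_on by argo
    have "{P\<in>circ u. P \<subseteq> L} = (\<lambda>X. pp X (val u X)) ` on S M"
    proof (rule set_eqI)
      have "pp X (val u X) \<subseteq> L \<longleftrightarrow> X \<subseteq> M" if "X \<in> S" for X using f(3)[OF S_E[OF that]] vM[OF S_E[OF that]] by simp
      thus "P \<in> {P\<in>circ u. P \<subseteq> L} \<longleftrightarrow> P \<in> (\<lambda>X. pp X (val u X)) ` on S M" for P
        unfolding circ_def image_iff mem_Collect_eq Bex_def mem_on by metis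
    qed
    hence "card {P\<in>circ u. P \<subseteq> L} = card (on S M)" using card_circ_image[of "on S M" u] on_subset(1)[of M M] by simp
    moreover have "card (on S M) = 1 \<longleftrightarrow> N \<subseteq> M" using nuc_tangent[OF N M(1) _ M(2)] nuc_all_tangents[OF N M] by iprover
    moreover have "N \<subseteq> M \<longleftrightarrow> pp N c \<subseteq> L" using f(3)[OF nuc_point(4)[OF N]] vM[OF nuc_point(4)[OF N]] c by simp
    ultimately show "card {P\<in>circ u. P \<subseteq> L} = 1 \<longleftrightarrow> pp N c \<subseteq> L" by simp
  qed
  thus "circle_nucleus (circ u) (pp N c)" unfolding circle_nucleus_def using circ_oval_in[OF u] by blast
qed

end

theorem ovoidal_laguerre_largest:
  fixes G :: "('a::{field,finite} ^ 4) set incidence_structure"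
  assumes G: "ovoidal_laguerre_plane G" and q: "CARD('a) > 2" and F: "largest_intersecting_family G F"
  shows "(\<exists>P\<in>fst G. F = circles_through G P) \<or> even (CARD('a)) \<and> (\<exists>N\<in>nuclei G. F = circles_through_nucleus G N)"
proof -
  obtain R Q where Q: "oval_cone_with_vertex R Q" "G = (Q - {R}, oval_sections Q)" using G by (auto simp: ovoidal_laguerre_plane_def)
  obtain E S where ES: "R \<in> pg_points" "oval_in E S" "\<not> R \<subseteq> E"
    "Q = {P \<in> pg_points. \<exists>L\<in>pg_lines. R \<subseteq> L \<and> (\<exists>X\<in>S. X \<subseteq> L) \<and> P \<subseteq> L}"
    using Q(1) unfolding oval_cone_with_vertex_def by iprover
  have S: "E \<in> pg_planes" "S \<subseteq> pg_points" "\<forall>P\<in>S. P \<subseteq> E" "card S = CARD('a) + 1" "no_three_on_a_line S"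
    using ES(2) unfolding oval_in_def by iprover+
  interpret oval_cone S R E by unfold_locales (use ES S q in simp_all)
  have Qc: "Q = cone" unfolding ES(4) cone_def ..
  have sG: "snd G = circ ` U" unfolding Q(2) snd_conv Qc by (rule oval_sections_cone)
  have ptG: "pp X c \<in> fst G" if "X \<in> S" for X c
    unfolding Q(2) fst_conv Qc using pp_cone[OF that] pp_not_R[OF S_E[OF that]] by simp
  have thr: "circles_through G (pp X c) = circ ` {u\<in>U. val u X = c}" if X: "X \<in> S" for X c
    unfolding circles_through_def sG using pp_mem_circ[OF S_E[OF X]] X by blast
  have FX: "F \<subseteq> circ ` U" and int: "\<And>C D. C \<in> F \<Longrightarrow> D \<in> F \<Longrightarrow> C \<inter> D \<noteq> {}"
    using F unfolding largest_intersecting_family_def intersecting_family_def sG by blast+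
  define F' where "F' = {u\<in>U. circ u \<in> F}"
  have FF: "F = circ ` F'" using FX unfolding F'_def by blast
  have ci: "card (circ ` A) = card A" if "A \<subseteq> U" for A by (rule card_image[OF inj_on_subset[OF circ_inj that]])
  obtain X where X: "X \<in> S" by (rule ex_point)
  have "card {u\<in>U. val u X = 0} \<le> card F" using largest_ge[OF F ptG[OF X, of 0]] unfolding thr[OF X] by (subst (asm) ci) auto
  hence big: "CARD('a)\<^sup>2 \<le> card F'" unfolding card_val[OF S_E[OF X]] FF by (subst (asm) ci) (auto simp: F'_def)
  interpret oval_cone_clique S R E F'
  proof
    show "F' \<subseteq> U" unfolding F'_def by blast
    show "\<exists>X\<in>S. val u X = val v X" if "u \<in> F'" "v \<in> F'" for u v
      by (rule circ_meet) (use int that in \<open>simp add: F'_def\<close>)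
  qed (rule big)
  obtain p c where p: "p \<in> special" "F' = {u\<in>U. val u p = c}" using clique_pencil by blast
  have Fp: "F = circ ` {u\<in>U. val u p = c}" unfolding FF p(2) ..
  consider "p \<in> S" | "p \<in> nuc" using p(1) unfolding special_def by blast
  thus ?thesis
  proof cases
    case 1
    have "F = circles_through G (pp p c)" unfolding thr[OF 1] by (rule Fp)
    thus ?thesis using ptG[OF 1] by blast
  next
    case 2
    have "F = circles_through_nucleus G (pp p c)"
      unfolding circles_through_nucleus_def sG Fp using circ_nucleus[OF 2] by blast
    moreover have "pp p c \<in> nuclei G"
    proof -
      have "F' \<noteq> {}" using big q by auto
      then obtain u where "u \<in> F'" by blast
      hence "u \<in> U" "val u p = c" unfolding p(2) by blast+
      thus ?thesis unfolding nuclei_def sG using circ_nucleus[OF 2] by blast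
    qed
    ultimately show ?thesis using nuc_even[OF 2] by blast
  qed
qed

theorem theorem1p2:
  assumes q_gt_2: "CARD('a::{field,finite}) > 2"
  shows
    "(\<forall>(G :: ('a ^ 4) set incidence_structure) F.
        ovoidal_moebius_plane G \<and> CARD('a) > 3 \<and> largest_intersecting_family G F \<longrightarrow>
        (\<exists>P \<in> fst G. F = circles_through G P)) \<and>
     (\<forall>(G :: ('a ^ 4) set incidence_structure) F.
        ovoidal_laguerre_plane G \<and> largest_intersecting_family G F \<longrightarrow>
        (\<exists>P \<in> fst G. F = circles_through G P) \<or>
        even CARD('a) \<and> (\<exists>N \<in> nuclei G. F = circles_through_nucleus G N)) \<and>
     (\<forall>(G :: ('a ^ 4) set incidence_structure) F.
        ovoidal_minkowski_plane G \<and> largest_intersecting_family G F \<longrightarrow>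
        (\<exists>P \<in> fst G. F = circles_through G P)) \<and>
     (\<forall>(\<phi> :: 'a \<Rightarrow> 'a) F.
        field_automorphism \<phi> \<and> largest_intersecting_family (CM_plane \<phi>) F \<longrightarrow>
        (\<exists>P \<in> fst (CM_plane \<phi>). F = circles_through (CM_plane \<phi>) P))"
proof (intro conjI allI impI)
  fix G :: "('a ^ 4) set incidence_structure" and F
  assume "ovoidal_moebius_plane G \<and> CARD('a) > 3 \<and> largest_intersecting_family G F"
  thus "\<exists>P\<in>fst G. F = circles_through G P" using ovoidal_moebius_largest by iprover
next
  fix G :: "('a ^ 4) set incidence_structure" and F
  assume "ovoidal_laguerre_plane G \<and> largest_intersecting_family G F"
  thus "(\<exists>P\<in>fst G. F = circles_through G P) \<or>
      even (CARD('a)) \<and> (\<exists>N\<in>nuclei G. F = circles_through_nucleus G N)"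
    using ovoidal_laguerre_largest[OF _ q_gt_2] by iprover
next
  fix G :: "('a ^ 4) set incidence_structure" and F
  assume "ovoidal_minkowski_plane G \<and> largest_intersecting_family G F"
  thus "\<exists>P\<in>fst G. F = circles_through G P" using ovoidal_minkowski_largest[OF _ q_gt_2] by iprover
next
  fix \<phi> :: "'a \<Rightarrow> 'a" and F
  assume "field_automorphism \<phi> \<and> largest_intersecting_family (CM_plane \<phi>) F"
  thus "\<exists>P\<in>fst (CM_plane \<phi>). F = circles_through (CM_plane \<phi>) P" using CM_largest[OF _ q_gt_2] by iprover
qed

end
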